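(* Let $B$ be a unital $C^*$-algebra with a norm-dense $*$-invariant complex subspace $V_B\subseteq B$, $1\in V_B$, and a semi-norm $L_B\colon V_B\to[0,\infty)$ with $L_B(1)=0$ and $L_B(\xi)=L_B(\xi^* )$ for all $\xi\in V_B$. Let $|||\cdot|||\colon C_c(\mathbb{Z})\to[0,\infty)$ be an order preserving norm with $|||e_0|||=1$. Let $T$ be a compact Hausdorff space and, for each $t\in T$, let $\beta_t\colon B\to B$ be a $*$-automorphism with $\beta_t(V_B)=V_B=\beta_t^{-1}(V_B)$, such that $t\mapsto\beta_t(b)$ is norm continuous for all $b\in B$. For $t\in T$ define $L_t\colon C_c(\mathbb{Z},V_B)\to[0,\infty)$ by \[ L_t(\eta):=\max\Big\{\Big\|\sum_n n\,\eta(n)U^n\Big\|_{C_r^*(\mathbb{Z},B,\beta_t)},\ |||L_B\circ\eta|||,\ |||L_B\circ\eta^*|||\Big\}. \] Suppose that the following conditions hold: 1. the semi-norm $L_B\colon V_B\to[0,\infty)$ is lower semi-continuous and $(B,L_B)$ is a compact quantum metric space; 2. for each $n\in\mathbb{Z}$ and each $\eta\in V_B$, the map $T\to[0,\infty)$, $t\mapsto L_B(\beta_t^n(\eta))$, is upper semi-continuous; 3. for each $n\in\mathbb{Z}$, $\varepsilon>0$ and $t_0\in T$ there exists an open neighbourhood $U\subseteq T$ of $t_0$ such that $(1-\varepsilon)L_B(\beta_{t_0}^n(\eta))\le L_B(\beta_t^n(\eta))$ for all $t\in U$ and $\eta\in V_B$. Then for every $t_0\in T$, \[ \lim_{t\to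 t_0}\mathrm{dist}_q\big((C_r^*(\mathbb{Z},B,\beta_t),L_t),(C_r^*(\mathbb{Z},B,\beta_{t_0}),L_{t_0})\big)=0. \]
   Context: **Compact quantum metric spaces.** Let $A$ be a unital $C^*$-algebra and $V\subseteq A$ a (not necessarily dense) complex subspace with $1\in V$, $V^*=V$. $V^{\mathrm{sa}}=\{\xi\in V\mid \xi=\xi^*\}$ is an order unit space with the order and unit of $A$; its state space $S(V^{\mathrm{sa}})$ is the set of positive $\mathbb{R}$-linear $\mu\colon V^{\mathrm{sa}}\to\mathbb{R}$ with $\mu(1)=1$, with the weak $*$-topology. For a semi-norm $L^{\mathrm{sa}}$ on $V^{\mathrm{sa}}$ with $L^{\mathrm{sa}}(1)=0$ put $\rho_{L^{\mathrm{sa}}}(\mu,\nu)=\sup\{|\mu(\xi)-\nu(\xi)| \mid \xi\in V^{\mathrm{sa}}, L^{\mathrm{sa}}(\xi)\le 1\}$. $(V^{\mathrm{sa}},L^{\mathrm{sa}})$ is an order unit compact quantum metric space if $\rho_{L^{\mathrm{sa}}}$ metrizes the weak $*$-topology on $S(V^{\mathrm{sa}})$. If $V$ is norm-dense and $L\colon V\to[0,\infty)$ is a semi-norm with $L(1)=0$, $L(\xi^* )=L(\xi)$, then $(A,L)$ is a ($C^*$-algebraic) compact quantum metric space if $\rho_L(\mu,\nu)=\sup\{|\mu(\xi)-\nu(\xi)|\mid \xi\in V, L(\xi)\le1\}$ metrizes the weak $*$-topology on the state space $S(A)$. Lower semi-continuity of $L$ is with respect to the $C^*$-norm topology on $V$.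 Under condition 1 each $(C_r^*(\mathbb{Z},B,\beta_t),L_t)$ is a compact quantum metric space. **Quantum Gromov-Hausdorff distance.** For order unit compact quantum metric spaces $(V_j^{\mathrm{sa}},L_j^{\mathrm{sa}})$, $j=1,2$, a semi-norm $L^{\mathrm{sa}}$ on $V_1^{\mathrm{sa}}\oplus V_2^{\mathrm{sa}}$ vanishing on the unit is admissible if $(V_1^{\mathrm{sa}}\oplus V_2^{\mathrm{sa}},L^{\mathrm{sa}})$ is an order unit compact quantum metric space and $L_j^{\mathrm{sa}}$ is the quotient semi-norm of $L^{\mathrm{sa}}$ under the projection onto $V_j^{\mathrm{sa}}$, $j=1,2$. Then $\mathrm{dist}_q(V_1^{\mathrm{sa}},V_2^{\mathrm{sa}})$ is the infimum over admissible $L^{\mathrm{sa}}$ of the Hausdorff distance, with respect to $\rho_{L^{\mathrm{sa}}}$, between $S(V_1^{\mathrm{sa}})$ and $S(V_2^{\mathrm{sa}})$ viewed (via the projections) as subsets of $S(V_1^{\mathrm{sa}}\oplus V_2^{\mathrm{sa}})$. For $C^*$-algebraic compact quantum metric spaces, $\mathrm{dist}_q((A_1,L_1),(A_2,L_2)):=\mathrm{dist}_q(V_1^{\mathrm{sa}},V_2^{\mathrm{sa}})$, where $V_j$ is the domain of $L_j$. **Crossed products.** $C_r^*(\mathbb{Z},B,\beta)$ is the reduced crossed product of $B$ by the $\mathbb{Z}$-action generated by $\beta$, generated by $B$ and a unitary $U$ with $UbU^*=\beta(b)$. $C_c(\mathbb{Z})$ is the space of finitely supported complex functions on $\mathbb{Z}$,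 and $e_n\in C_c(\mathbb{Z})$ is $1$ at $n$ and $0$ elsewhere. A finitely supported $\eta\colon\mathbb{Z}\to V_B$ is identified with $\sum_n\eta(n)U^n$, and these form $C_c(\mathbb{Z},V_B)$. $\eta^*$ is the adjoint in the crossed product, $\eta^*(n)=\beta^n(\eta(-n)^* )$ (with $\beta=\beta_t$ in $C_r^*(\mathbb{Z},B,\beta_t)$), and $L_B\circ\eta\in C_c(\mathbb{Z})$ is $n\mapsto L_B(\eta(n))$. A norm $|||\cdot|||$ on $C_c(\mathbb{Z})$ is order preserving if $|||h|||\le|||k|||$ whenever $0\le h(n)\le k(n)$ for all $n\in\mathbb{Z}$. *)

theory Defs
  imports "HOL-Analysis.Analysis"
begin

text \<open>
  Unital C*-algebras. The operations are kept apart from the axioms (class \<open>star_ops\<close>), so that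
  a C*-algebra may also be given as a set of elements of a larger ambient type; this is needed for
  crossed products, which depend on the automorphism.
\<close>

class scaleC =
  fixes scaleC :: "complex \<Rightarrow> 'a \<Rightarrow> 'a"  (infixr "*\<^sub>C" 75)

class star =
  fixes star :: "'a \<Rightarrow> 'a"

class star_ops = real_vector + times + one + scaleC + star

class unital_cstar_algebra = star_ops + real_normed_algebra_1 + banach +
  assumes scaleC_add_right: "a *\<^sub>C (x + y) = a *\<^sub>C x + a *\<^sub>C y"
    and scaleC_add_left: "(a + b) *\<^sub>C x = a *\<^sub>C x + b *\<^sub>C x"
    and scaleC_scaleC: "a *\<^sub>C b *\<^sub>C x = (a * b) *\<^sub>C x"
    and scaleC_of_real: "complex_of_real r *\<^sub>C x = r *\<^sub>R x"
    and mult_scaleC_left: "(a *\<^sub>C x) * y = a *\<^sub>C (x * y)"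
    and mult_scaleC_right: "x * (a *\<^sub>C y) = a *\<^sub>C (x * y)"
    and norm_scaleC: "norm (a *\<^sub>C x) = cmod a * norm x"
    and star_add: "star (x + y) = star x + star y"
    and star_scaleC: "star (a *\<^sub>C x) = cnj a *\<^sub>C star x"
    and star_mult: "star (x * y) = star y * star x"
    and star_star: "star (star x) = x"
    and cstar_identity: "norm (star x * x) = (norm x)\<^sup>2"

definition csubspace :: "'a::star_ops set \<Rightarrow> bool" where
  "csubspace V \<longleftrightarrow> 0 \<in> V \<and> (\<forall>x\<in>V. \<forall>y\<in>V. x + y \<in> V) \<and> (\<forall>c. \<forall>x\<in>V. c *\<^sub>C x \<in> V)"

definition cseminorm_on :: "'a::star_ops set \<Rightarrow> ('a \<Rightarrow> real) \<Rightarrow> bool" where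
  "cseminorm_on V L \<longleftrightarrow>
     (\<forall>x\<in>V. 0 \<le> L x) \<and> (\<forall>x\<in>V. \<forall>y\<in>V. L (x + y) \<le> L x + L y) \<and>
     (\<forall>c. \<forall>x\<in>V. L (c *\<^sub>C x) = cmod c * L x)"

definition rseminorm_on :: "'a::real_vector set \<Rightarrow> ('a \<Rightarrow> real) \<Rightarrow> bool" where
  "rseminorm_on V L \<longleftrightarrow>
     (\<forall>x\<in>V. 0 \<le> L x) \<and> (\<forall>x\<in>V. \<forall>y\<in>V. L (x + y) \<le> L x + L y) \<and>
     (\<forall>r. \<forall>x\<in>V. L (r *\<^sub>R x) = \<bar>r\<bar> * L x)"

definition star_automorphism :: "('b::unital_cstar_algebra \<Rightarrow> 'b) \<Rightarrow> bool" where
  "star_automorphism \<beta> \<longleftrightarrow> bij \<beta> \<and>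
     (\<forall>x y. \<beta> (x + y) = \<beta> x + \<beta> y) \<and> (\<forall>c x. \<beta> (c *\<^sub>C x) = c *\<^sub>C \<beta> x) \<and>
     (\<forall>x y. \<beta> (x * y) = \<beta> x * \<beta> y) \<and> (\<forall>x. \<beta> (star x) = star (\<beta> x))"

definition lower_semicontinuous_on :: "'a::topological_space set \<Rightarrow> ('a \<Rightarrow> real) \<Rightarrow> bool" where
  "lower_semicontinuous_on S f \<longleftrightarrow> (\<forall>a. openin (top_of_set S) {x \<in> S. a < f x})"

definition upper_semicontinuous_on :: "'a::topological_space set \<Rightarrow> ('a \<Rightarrow> real) \<Rightarrow> bool" where
  "upper_semicontinuous_on S f \<longleftrightarrow> (\<forall>a. openin (top_of_set S) {x \<in> S. f x < a})"


section \<open>Compact quantum metric spaces\<close>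

text \<open>
  Functionals on \<open>V\<close> are represented by functions that are \<open>undefined\<close> outside \<open>V\<close>, as required
  by the library's product topology (here: pointwise convergence on \<open>V\<close>). Semi-norms are total
  functions of which only the values on their domain matter. Suprema of distances are taken in
  the extended non-negative reals.
\<close>

definition weak_star ::
    "'a set \<Rightarrow> ('a \<Rightarrow> 'k::topological_space) set \<Rightarrow> ('a \<Rightarrow> 'k) topology" where
  "weak_star V S = subtopology (product_topology (\<lambda>_. euclidean) V) S"

definition mk_dist ::
    "'a set \<Rightarrow> ('a \<Rightarrow> real) \<Rightarrow> ('a \<Rightarrow> 'k::real_normed_vector) \<Rightarrow> ('a \<Rightarrow> 'k) \<Rightarrow> ennreal" where
  "mk_dist V L \<mu> \<nu> = (SUP \<xi>\<in>{\<xi> \<in> V. L \<xi> \<le> 1}. ennreal (norm (\<mu> \<xi> - \<nu> \<xi>)))"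

definition metrizes :: "'s set \<Rightarrow> ('s \<Rightarrow> 's \<Rightarrow> ennreal) \<Rightarrow> 's topology \<Rightarrow> bool" where
  "metrizes S \<rho> X \<longleftrightarrow>
     (\<forall>\<mu>\<in>S. \<forall>\<nu>\<in>S. \<rho> \<mu> \<nu> < \<infinity>) \<and>
     Metric_space S (\<lambda>\<mu> \<nu>. enn2real (\<rho> \<mu> \<nu>)) \<and>
     Metric_space.mtopology S (\<lambda>\<mu> \<nu>. enn2real (\<rho> \<mu> \<nu>)) = X"

definition cstar_states :: "('b::unital_cstar_algebra \<Rightarrow> complex) set" where
  "cstar_states = {\<mu>.
     (\<forall>x y. \<mu> (x + y) = \<mu> x + \<mu> y) \<and> (\<forall>c x. \<mu> (c *\<^sub>C x) = c * \<mu> x) \<and>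
     (\<forall>x. Im (\<mu> (star x * x)) = 0 \<and> 0 \<le> Re (\<mu> (star x * x))) \<and> \<mu> 1 = 1}"

definition cstar_cqms :: "'b::unital_cstar_algebra set \<Rightarrow> ('b \<Rightarrow> real) \<Rightarrow> bool" where
  "cstar_cqms V L \<longleftrightarrow>
     csubspace V \<and> closure V = UNIV \<and> 1 \<in> V \<and> (\<forall>\<xi>\<in>V. star \<xi> \<in> V) \<and>
     cseminorm_on V L \<and> L 1 = 0 \<and> (\<forall>\<xi>\<in>V. L (star \<xi>) = L \<xi>) \<and>
     metrizes cstar_states (mk_dist V L) (weak_star UNIV cstar_states)"

record 'a ou_space =
  ou_set :: "'a set"
  ou_pos :: "'a set"
  ou_unit :: 'a

definition ou_states :: "'a::real_vector ou_space \<Rightarrow> ('a \<Rightarrow> real) set" where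
  "ou_states X = {\<mu> \<in> extensional (ou_set X).
     (\<forall>x\<in>ou_set X. \<forall>y\<in>ou_set X. \<mu> (x + y) = \<mu> x + \<mu> y) \<and>
     (\<forall>r. \<forall>x\<in>ou_set X. \<mu> (r *\<^sub>R x) = r * \<mu> x) \<and>
     (\<forall>x\<in>ou_pos X. 0 \<le> \<mu> x) \<and> \<mu> (ou_unit X) = 1}"

definition ou_cqms :: "'a::real_vector ou_space \<Rightarrow> ('a \<Rightarrow> real) \<Rightarrow> bool" where
  "ou_cqms X L \<longleftrightarrow>
     rseminorm_on (ou_set X) L \<and> L (ou_unit X) = 0 \<and>
     metrizes (ou_states X) (mk_dist (ou_set X) L) (weak_star (ou_set X) (ou_states X))"

text \<open>The self-adjoint part of \<open>V\<close> with the order and unit of the C*-algebra \<open>A\<close> containing it.\<close>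

definition sa_space :: "'a::star_ops set \<Rightarrow> 'a set \<Rightarrow> 'a ou_space" where
  "sa_space A V = \<lparr>ou_set = {\<xi> \<in> V. star \<xi> = \<xi>},
                   ou_pos = {\<xi> \<in> V. star \<xi> = \<xi> \<and> (\<exists>c\<in>A. \<xi> = star c * c)},
                   ou_unit = 1\<rparr>"


section \<open>Quantum Gromov-Hausdorff distance\<close>

definition ou_sum :: "'a ou_space \<Rightarrow> 'c ou_space \<Rightarrow> ('a \<times> 'c) ou_space" where
  "ou_sum X Y = \<lparr>ou_set = ou_set X \<times> ou_set Y, ou_pos = ou_pos X \<times> ou_pos Y,
                 ou_unit = (ou_unit X, ou_unit Y)\<rparr>"

definition admissible :: "'a::real_vector ou_space \<Rightarrow> ('a \<Rightarrow> real) \<Rightarrow>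
    'c::real_vector ou_space \<Rightarrow> ('c \<Rightarrow> real) \<Rightarrow> ('a \<times> 'c \<Rightarrow> real) \<Rightarrow> bool" where
  "admissible X L1 Y L2 L \<longleftrightarrow>
     ou_cqms (ou_sum X Y) L \<and>
     (\<forall>x\<in>ou_set X. L1 x = (INF y\<in>ou_set Y. L (x, y))) \<and>
     (\<forall>y\<in>ou_set Y. L2 y = (INF x\<in>ou_set X. L (x, y)))"

definition states_left ::
    "'a::real_vector ou_space \<Rightarrow> 'c::real_vector ou_space \<Rightarrow> ('a \<times> 'c \<Rightarrow> real) set" where
  "states_left X Y = (\<lambda>\<mu>. restrict (\<lambda>p. \<mu> (fst p)) (ou_set (ou_sum X Y))) ` ou_states X"

definition states_right ::
    "'a::real_vector ou_space \<Rightarrow> 'c::real_vector ou_space \<Rightarrow> ('a \<times> 'c \<Rightarrow> real) set" where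
  "states_right X Y = (\<lambda>\<mu>. restrict (\<lambda>p. \<mu> (snd p)) (ou_set (ou_sum X Y))) ` ou_states Y"

definition hausdorff_dist :: "('s \<Rightarrow> 's \<Rightarrow> ennreal) \<Rightarrow> 's set \<Rightarrow> 's set \<Rightarrow> ennreal" where
  "hausdorff_dist \<rho> S T =
     max (SUP \<mu>\<in>S. INF \<nu>\<in>T. \<rho> \<mu> \<nu>) (SUP \<nu>\<in>T. INF \<mu>\<in>S. \<rho> \<mu> \<nu>)"

text \<open>The value is \<open>\<infinity>\<close> if there is no admissible semi-norm.\<close>

definition ou_dist_q :: "'a::real_vector ou_space \<Rightarrow> ('a \<Rightarrow> real) \<Rightarrow>
    'c::real_vector ou_space \<Rightarrow> ('c \<Rightarrow> real) \<Rightarrow> ennreal" where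
  "ou_dist_q X L1 Y L2 =
     (INF L\<in>{L. admissible X L1 Y L2 L}.
        hausdorff_dist (mk_dist (ou_set (ou_sum X Y)) L) (states_left X Y) (states_right X Y))"

definition dist_q :: "'a::star_ops set \<times> 'a set \<times> ('a \<Rightarrow> real) \<Rightarrow>
    'c::star_ops set \<times> 'c set \<times> ('c \<Rightarrow> real) \<Rightarrow> ennreal" where
  "dist_q = (\<lambda>(A1, V1, L1) (A2, V2, L2). ou_dist_q (sa_space A1 V1) L1 (sa_space A2 V2) L2)"


section \<open>Operators on the Hilbert module of square-summable sequences\<close>

definition l2Z :: "(int \<Rightarrow> 'b::unital_cstar_algebra) set" where
  "l2Z = {x. (\<lambda>n. star (x n) * x n) summable_on UNIV}"

definition l2_inner :: "(int \<Rightarrow> 'b) \<Rightarrow> (int \<Rightarrow> 'b) \<Rightarrow> 'b::unital_cstar_algebra" where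
  "l2_inner x y = (\<Sum>\<^sub>\<infinity>n. star (x n) * y n)"

definition l2_norm :: "(int \<Rightarrow> 'b::unital_cstar_algebra) \<Rightarrow> real" where
  "l2_norm x = sqrt (norm (l2_inner x x))"

text \<open>
  The following type only serves as an ambient type with the operator operations (multiplication
  is composition). Operators are represented by functions that vanish outside \<^term>\<open>l2Z\<close>.
  Being adjointable forces an operator to be linear and bounded, and its adjoint is unique.
\<close>

typedef 'b l2_op = "UNIV :: ((int \<Rightarrow> 'b) \<Rightarrow> int \<Rightarrow> 'b) set"
  morphisms op_app L2_op ..

definition mk_op :: "((int \<Rightarrow> 'b::unital_cstar_algebra) \<Rightarrow> int \<Rightarrow> 'b) \<Rightarrow> 'b l2_op" where
  "mk_op T = L2_op (\<lambda>x. if x \<in> l2Z then T x else (\<lambda>_. 0))"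

definition is_adjoint :: "'b::unital_cstar_algebra l2_op \<Rightarrow> 'b l2_op \<Rightarrow> bool" where
  "is_adjoint T S \<longleftrightarrow>
     (\<forall>x\<in>l2Z. op_app T x \<in> l2Z) \<and> (\<forall>x. x \<notin> l2Z \<longrightarrow> op_app T x = (\<lambda>_. 0)) \<and>
     (\<forall>x\<in>l2Z. op_app S x \<in> l2Z) \<and> (\<forall>x. x \<notin> l2Z \<longrightarrow> op_app S x = (\<lambda>_. 0)) \<and>
     (\<forall>x\<in>l2Z. \<forall>y\<in>l2Z. l2_inner (op_app T x) y = l2_inner x (op_app S y))"

definition adjointable :: "'b::unital_cstar_algebra l2_op set" where
  "adjointable = {T. \<exists>S. is_adjoint T S}"

instantiation l2_op :: (unital_cstar_algebra) star_ops
begin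

definition zero_l2_op :: "'a l2_op" where "0 = L2_op (\<lambda>x n. 0)"
definition one_l2_op :: "'a l2_op" where "1 = mk_op (\<lambda>x. x)"
definition plus_l2_op :: "'a l2_op \<Rightarrow> 'a l2_op \<Rightarrow> 'a l2_op" where
  "S + T = L2_op (\<lambda>x n. op_app S x n + op_app T x n)"
definition minus_l2_op :: "'a l2_op \<Rightarrow> 'a l2_op \<Rightarrow> 'a l2_op" where
  "S - T = L2_op (\<lambda>x n. op_app S x n - op_app T x n)"
definition uminus_l2_op :: "'a l2_op \<Rightarrow> 'a l2_op" where
  "- T = L2_op (\<lambda>x n. - op_app T x n)"
definition scaleR_l2_op :: "real \<Rightarrow> 'a l2_op \<Rightarrow> 'a l2_op" where
  "r *\<^sub>R T = L2_op (\<lambda>x n. r *\<^sub>R op_app T x n)"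
definition scaleC_l2_op :: "complex \<Rightarrow> 'a l2_op \<Rightarrow> 'a l2_op" where
  "c *\<^sub>C T = L2_op (\<lambda>x n. c *\<^sub>C op_app T x n)"
definition times_l2_op :: "'a l2_op \<Rightarrow> 'a l2_op \<Rightarrow> 'a l2_op" where
  "S * T = L2_op (\<lambda>x. op_app S (op_app T x))"
definition star_l2_op :: "'a l2_op \<Rightarrow> 'a l2_op" where
  "star T = (THE S. is_adjoint T S)"
instance
  by intro_classes
    (simp_all add: zero_l2_op_def plus_l2_op_def minus_l2_op_def uminus_l2_op_def
      scaleR_l2_op_def L2_op_inverse op_app_inverse scaleR_add_left scaleR_add_right ac_simps)

end

definition l2_op_norm :: "'b::unital_cstar_algebra l2_op \<Rightarrow> real" where
  "l2_op_norm T = (SUP x\<in>{x \<in> l2Z. l2_norm x \<le> 1}. l2_norm (op_app T x))"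


section \<open>Reduced crossed products by the integers\<close>

definition aut_pow :: "('b \<Rightarrow> 'b) \<Rightarrow> int \<Rightarrow> 'b \<Rightarrow> 'b" where
  "aut_pow \<beta> n = (if 0 \<le> n then \<beta> ^^ nat n else inv \<beta> ^^ nat (- n))"

definition Cc :: "'b::zero set \<Rightarrow> (int \<Rightarrow> 'b) set" where
  "Cc V = {\<eta>. finite {n. \<eta> n \<noteq> 0} \<and> (\<forall>n. \<eta> n \<in> V)}"

text \<open>
  The regular representation: \<open>b\<close> acts by \<open>(b x)(m) = \<beta>\<^sup>-\<^sup>m(b) x(m)\<close>, and \<open>U\<close> is the bilateral shift,
  so that \<open>(U\<^sup>n x)(m) = x(m - n)\<close> and \<open>U b U\<^sup>* = \<beta>(b)\<close>.
\<close>

definition cp_coeff ::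
    "('b::unital_cstar_algebra \<Rightarrow> 'b) \<Rightarrow> 'b \<Rightarrow> 'b l2_op" where
  "cp_coeff \<beta> b = mk_op (\<lambda>x m. aut_pow \<beta> (- m) b * x m)"

definition cp_shift :: "int \<Rightarrow> 'b::unital_cstar_algebra l2_op" where
  "cp_shift n = mk_op (\<lambda>x m. x (m - n))"

definition cp_elem ::
    "('b::unital_cstar_algebra \<Rightarrow> 'b) \<Rightarrow> (int \<Rightarrow> 'b) \<Rightarrow> 'b l2_op" where
  "cp_elem \<beta> \<eta> = (\<Sum>n | \<eta> n \<noteq> 0. cp_coeff \<beta> (\<eta> n) * cp_shift n)"

definition crossed_product :: "('b::unital_cstar_algebra \<Rightarrow> 'b) \<Rightarrow> 'b l2_op set" where
  "crossed_product \<beta> =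
     {T \<in> adjointable. \<forall>\<epsilon>>0. \<exists>\<eta>\<in>Cc UNIV. l2_op_norm (T - cp_elem \<beta> \<eta>) < \<epsilon>}"

definition cc_star ::
    "('b::unital_cstar_algebra \<Rightarrow> 'b) \<Rightarrow> (int \<Rightarrow> 'b) \<Rightarrow> int \<Rightarrow> 'b" where
  "cc_star \<beta> \<eta> n = aut_pow \<beta> n (star (\<eta> (- n)))"

definition order_preserving_norm :: "((int \<Rightarrow> complex) \<Rightarrow> real) \<Rightarrow> bool" where
  "order_preserving_norm N \<longleftrightarrow>
     (\<forall>h\<in>Cc UNIV. 0 \<le> N h \<and> (N h = 0 \<longleftrightarrow> (\<forall>n. h n = 0))) \<and>
     (\<forall>c. \<forall>h\<in>Cc UNIV. N (\<lambda>n. c * h n) = cmod c * N h) \<and>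
     (\<forall>h\<in>Cc UNIV. \<forall>k\<in>Cc UNIV. N (\<lambda>n. h n + k n) \<le> N h + N k) \<and>
     (\<forall>h\<in>Cc UNIV. \<forall>k\<in>Cc UNIV. (\<forall>n. 0 \<le> h n \<and> h n \<le> k n) \<longrightarrow>
        N (\<lambda>n. complex_of_real (h n)) \<le> N (\<lambda>n. complex_of_real (k n)))"

definition cc_lip :: "('b::unital_cstar_algebra \<Rightarrow> 'b) \<Rightarrow> ('b \<Rightarrow> real) \<Rightarrow>
    ((int \<Rightarrow> complex) \<Rightarrow> real) \<Rightarrow> (int \<Rightarrow> 'b) \<Rightarrow> real" where
  "cc_lip \<beta> L N \<eta> = Max
     {l2_op_norm (cp_elem \<beta> (\<lambda>n. of_int n *\<^sub>C \<eta> n)),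
      N (\<lambda>n. complex_of_real (L (\<eta> n))),
      N (\<lambda>n. complex_of_real (L (cc_star \<beta> \<eta> n)))}"

text \<open>
  The triple of the crossed product, the image of \<open>C\<^sub>c(\<int>, V)\<close> in it, and the semi-norm on this image;
  \<^term>\<open>cp_elem \<beta>\<close> is injective on \<open>C\<^sub>c(\<int>, V)\<close>.
\<close>

definition cp_cqms :: "('b::unital_cstar_algebra \<Rightarrow> 'b) \<Rightarrow> 'b set \<Rightarrow> ('b \<Rightarrow> real) \<Rightarrow>
    ((int \<Rightarrow> complex) \<Rightarrow> real) \<Rightarrow> 'b l2_op set \<times> 'b l2_op set \<times> ('b l2_op \<Rightarrow> real)" where
  "cp_cqms \<beta> V L N =
     (crossed_product \<beta>, cp_elem \<beta> ` Cc V,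
      \<lambda>a. cc_lip \<beta> L N (inv_into (Cc V) (cp_elem \<beta>) a))"

end

theory Submission imports Defs begin

text \<open>
  Averaging the \<open>k \<times> k\<close> corner of an element of the crossed product for \<open>\<gamma>\<close> gives, for every other
  automorphism \<open>\<beta>\<close>, a unital positive map \<open>\<Theta>\<close> into the crossed product for \<open>\<beta>\<close> which sends
  \<open>\<Sum> y\<^sub>n U\<^sup>n\<close> to \<open>\<Sum> \<theta>\<^sub>n(y\<^sub>n) U\<^sup>n\<close> with \<open>\<theta>\<^sub>n = (1/k) \<Sum> \<beta>\<^sup>m \<gamma>\<^sup>-\<^sup>m\<close>. It commutes with the derivation
  \<open>y\<^sub>n \<mapsto> n y\<^sub>n\<close>, and going back and forth is close to a Fejer multiplier, hence close to the
  identity on Lipschitz balls, uniformly in the action: a bound on the derivation controls the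
  \<open>\<ell>\<^sup>2\<close>-tail of the row \<open>(y\<^sub>n)\<close> by a Cauchy--Schwarz argument. Lipschitz constants are almost
  preserved, by the lower estimate on the Lipschitz ball for \<open>\<beta>\<close> and, for the fixed action, by the
  upper estimate on a finite net. These maps yield an admissible semi-norm ("bridge") on the direct
  sum of the two order unit spaces. Total boundedness of the Lipschitz ball of \<open>B\<close>, which follows
  from the compactness of the state space, supplies the nets.
\<close>

text \<open>The obstacle is that the algebras for different parameters share only their
  coefficients. The identity on C_c(Z, V) need not be positive or bounded from one crossed product
  to another, so it cannot carry states; compression and averaging restore positivity at the price
  of a factor 1 - |n|/k on the n-th coefficient. The first term of L_t pays this price. Since the
  sum of 1/n^2 converges, the norm of a multiplier with symbol c is at most the l^2 norm of c_n/n
  times the norm of the derivation, with a constant that does not see the action. Hence one k and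
  one radius serve all parameters. The two conditions on L_B are of different strength: condition 3
  is uniform on V, condition 2 speaks of one element at a time. A net must therefore exist before
  the neighbourhood is chosen, which is possible only for the action at t0. The order of choice is:
  radius R, loss theta, size k, closeness omega, net, and the neighbourhood last. The distance sees
  self-adjoint elements only, where the third term of L_t equals the second.\<close>

section \<open>Elementary rules for the involution and the scalars\<close>

lemma star_zero [simp]: "star (0::'a::unital_cstar_algebra) = 0"
  using star_add[of "0::'a" 0] by simp

lemma star_minus: "star (- x) = - star (x::'a::unital_cstar_algebra)"
  using star_add[of x "- x"] by (simp add: add_eq_0_iff)

lemma star_diff: "star (x - y) = star x - star (y::'a::unital_cstar_algebra)"
  using star_add[of x "- y"] by (simp add: star_minus)

lemma star_scaleR: "star (r *\<^sub>R x) = r *\<^sub>R star (x::'a::unital_cstar_algebra)"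
  by (metis complex_cnj_complex_of_real scaleC_of_real star_scaleC)

lemma star_one [simp]: "star (1::'a::unital_cstar_algebra) = 1"
  by (metis mult_1_right star_mult star_star)

lemma star_sum: "star (\<Sum>i\<in>A. f i) = (\<Sum>i\<in>A. star (f i :: 'a::unital_cstar_algebra))"
  by (induction A rule: infinite_finite_induct) (auto simp: star_add)

lemma star_power: "star (x ^ n) = star (x::'a::unital_cstar_algebra) ^ n"
  by (induction n) (auto simp: star_mult power_commutes)

lemma norm_star [simp]: "norm (star x) = norm (x::'a::unital_cstar_algebra)"
proof -
  have le: "norm y \<le> norm (star y)" for y :: 'a
  proof (cases "y = 0")
    case False
    have "norm y * norm y \<le> norm (star y) * norm y"
      using cstar_identity[of y] norm_mult_ineq[of "star y" y] by (simp add: power2_eq_square)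
    then show ?thesis using False by simp
  qed simp
  show ?thesis using le[of x] le[of "star x"] by (simp add: star_star)
qed

lemma bounded_linear_star: "bounded_linear (star :: 'a::unital_cstar_algebra \<Rightarrow> 'a)"
  by (rule bounded_linear_intro[where K=1]) (auto simp: star_add star_scaleR)

lemma norm_sa_square: "star h = h \<Longrightarrow> norm (h * h) = (norm (h::'a::unital_cstar_algebra))\<^sup>2"
  using cstar_identity[of h] by simp

lemma norm_sa_power:
  assumes "star h = (h::'a::unital_cstar_algebra)" shows "norm (h ^ n) = norm h ^ n"
proof -
  have p2: "norm (h ^ (2 ^ k)) = norm h ^ (2 ^ k)" for k
  proof (induction k)
    case (Suc k)
    have "h ^ (2 ^ Suc k) = h ^ (2 ^ k) * h ^ (2 ^ k)" by (simp add: power_add[symmetric] mult_2)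
    moreover have "star (h ^ (2 ^ k)) = h ^ (2 ^ k)" by (simp add: star_power assms)
    ultimately show ?case using Suc norm_sa_square[of "h ^ (2 ^ k)"]
      by (simp add: power_mult[symmetric] mult.commute[of _ 2] del: power_mult)
  qed simp
  show ?thesis
  proof (cases "h = 0")
    case True then show ?thesis by (cases n) auto
  next
    case False
    have le: "n \<le> 2 ^ n" by (simp add: less_imp_le)
    have "norm h ^ (2 ^ n) = norm (h ^ n * h ^ (2 ^ n - n))"
      using p2[of n] le by (simp add: power_add[symmetric])
    also have "\<dots> \<le> norm (h ^ n) * norm h ^ (2 ^ n - n)"
      by (meson mult_left_mono norm_ge_zero norm_mult_ineq norm_power_ineq order_trans)
    finally have "norm h ^ n * norm h ^ (2 ^ n - n) \<le> norm (h ^ n) * norm h ^ (2 ^ n - n)"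
      using le by (simp add: power_add[symmetric])
    then have "norm h ^ n \<le> norm (h ^ n)" using False by simp
    then show ?thesis using norm_power_ineq[of h n] by simp
  qed
qed

lemma scaleC_zero_right [simp]: "c *\<^sub>C (0::'a::unital_cstar_algebra) = 0"
  using scaleC_add_right[of c "0::'a" 0] by simp

lemma scaleC_zero_left [simp]: "0 *\<^sub>C (x::'a::unital_cstar_algebra) = 0"
  using scaleC_add_left[of 0 0 x] by simp

lemma scaleC_one [simp]: "1 *\<^sub>C (x::'a::unital_cstar_algebra) = x"
  using scaleC_of_real[of 1 x] by simp

lemma scaleC_minus_right: "c *\<^sub>C (- x) = - (c *\<^sub>C (x::'a::unital_cstar_algebra))"
  using scaleC_add_right[of c x "- x"] by (simp add: add_eq_0_iff)

lemma scaleC_minus_left: "(- c) *\<^sub>C x = - (c *\<^sub>C (x::'a::unital_cstar_algebra))"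
  using scaleC_add_left[of c "- c" x] by (simp add: add_eq_0_iff)

lemma scaleC_diff_right: "c *\<^sub>C (x - y) = c *\<^sub>C x - c *\<^sub>C (y::'a::unital_cstar_algebra)"
  using scaleC_add_right[of c x "- y"] by (simp add: scaleC_minus_right)

lemma scaleC_sum_right: "c *\<^sub>C (\<Sum>i\<in>A. f i) = (\<Sum>i\<in>A. c *\<^sub>C (f i :: 'a::unital_cstar_algebra))"
  by (induction A rule: infinite_finite_induct) (auto simp: scaleC_add_right)

lemma scaleC_scaleR: "c *\<^sub>C r *\<^sub>R x = r *\<^sub>R c *\<^sub>C (x::'a::unital_cstar_algebra)"
  by (metis mult.commute scaleC_of_real scaleC_scaleC)

lemma bounded_linear_scaleC: "bounded_linear (\<lambda>x. c *\<^sub>C (x::'a::unital_cstar_algebra))"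
  by (rule bounded_linear_intro[where K="cmod c"])
    (auto simp: scaleC_add_right scaleC_scaleR norm_scaleC mult.commute)

section \<open>Positive elements of a C*-algebra\<close>

text \<open>The coefficients of the binomial series of sqrt (1 - x). From n = 1 on they are at most
  0 and their absolute values sum to at most 1, so the series converges absolutely on the closed
  unit ball, boundary included.\<close>

definition sqrt_coeff :: "nat \<Rightarrow> real" where
  "sqrt_coeff n = ((1 / 2) gchoose n) * (- 1) ^ n"

lemma sqrt_coeff_0 [simp]: "sqrt_coeff 0 = 1"
  by (simp add: sqrt_coeff_def)

lemma sqrt_coeff_Suc: "real (Suc n) * sqrt_coeff (Suc n) = (real n - 1 / 2) * sqrt_coeff n"
proof -
  have "real (Suc n) * ((1 / 2) gchoose Suc n) = (1 / 2 - real n) * ((1 / 2) gchoose n)"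
    using gbinomial_mult_1[of "1 / 2 :: real" n] by (simp add: algebra_simps)
  then have "real (Suc n) * ((1 / 2) gchoose Suc n) * (- 1) ^ n = (1 / 2 - real n) * ((1 / 2) gchoose n) * (- 1) ^ n"
    by simp
  then show ?thesis by (simp add: sqrt_coeff_def algebra_simps)
qed

lemma sqrt_coeff_neg: "sqrt_coeff (Suc n) \<le> 0"
proof (induction n)
  case 0
  then show ?case using sqrt_coeff_Suc[of 0] by simp
next
  case (Suc n)
  have "real (Suc (Suc n)) * sqrt_coeff (Suc (Suc n)) \<le> 0"
    unfolding sqrt_coeff_Suc[of "Suc n"] using Suc by (intro mult_nonneg_nonpos) auto
  then show ?case by (simp add: mult_le_0_iff del: of_nat_Suc)
qed

text \<open>The identity \<open>n c\<^sub>n - (n + 1) c\<^sub>n\<^sub>+\<^sub>1 = c\<^sub>n / 2\<close> telescopes.\<close>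

lemma sum_sqrt_coeff:
  "(\<Sum>n<m. \<bar>sqrt_coeff (Suc n)\<bar>) = 1 + 2 * real (Suc m) * sqrt_coeff (Suc m)"
proof (induction m)
  case 0
  then show ?case using sqrt_coeff_Suc[of 0] by simp
next
  case (Suc m)
  have "\<bar>sqrt_coeff (Suc m)\<bar> = - sqrt_coeff (Suc m)" using sqrt_coeff_neg[of m] by simp
  then show ?case using Suc sqrt_coeff_Suc[of "Suc m"] by (simp add: algebra_simps)
qed

lemma sum_sqrt_coeff_le: "(\<Sum>n<m. \<bar>sqrt_coeff (Suc n)\<bar>) \<le> 1"
  unfolding sum_sqrt_coeff using sqrt_coeff_neg[of m] by (simp add: mult_nonneg_nonpos)

lemma summable_sqrt_coeff_Suc: "summable (\<lambda>n. \<bar>sqrt_coeff (Suc n)\<bar>)"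
  by (rule summableI_nonneg_bounded[where x=1]) (auto intro: sum_sqrt_coeff_le)

lemma suminf_sqrt_coeff_le: "(\<Sum>n. \<bar>sqrt_coeff (Suc n)\<bar>) \<le> 1"
  by (rule suminf_le_const[OF summable_sqrt_coeff_Suc sum_sqrt_coeff_le])

text \<open>Vandermonde's identity for 1/2 + 1/2 = 1: the Cauchy square of the series is the
  binomial series of 1 - x, which stops after two terms.\<close>

lemma sqrt_coeff_Cauchy:
  "(\<Sum>i\<le>n. sqrt_coeff i * sqrt_coeff (n - i)) = (if n = 0 then 1 else if n = 1 then -1 else 0)"
proof -
  have "(\<Sum>i\<le>n. sqrt_coeff i * sqrt_coeff (n - i))
      = (\<Sum>i\<le>n. ((1/2) gchoose i) * ((1/2) gchoose (n - i)) * (-1) ^ n)"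
    by (rule sum.cong) (auto simp: sqrt_coeff_def power_add[symmetric])
  also have "\<dots> = (1 gchoose n) * (-1::real) ^ n"
    unfolding sum_distrib_right[symmetric] atMost_atLeast0 gbinomial_Vandermonde by simp
  also have "(1 gchoose n) = real (1 choose n)"
    by (metis binomial_gbinomial of_nat_1)
  finally show ?thesis by (auto simp: binomial_eq_0)
qed

definition sqrt_ser :: "'a::unital_cstar_algebra \<Rightarrow> 'a" where
  "sqrt_ser w = (\<Sum>n. sqrt_coeff n *\<^sub>R w ^ n)"

lemma summable_sqrt_ser:
  assumes "norm w \<le> 1"
  shows "summable (\<lambda>n. norm (sqrt_coeff n *\<^sub>R (w::'a::unital_cstar_algebra) ^ n))"
proof (rule summable_comparison_test'[where N=0])
  show "summable (\<lambda>n. \<bar>sqrt_coeff n\<bar>)"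
    using summable_sqrt_coeff_Suc by (subst (asm) summable_Suc_iff)
  show "norm (norm (sqrt_coeff n *\<^sub>R w ^ n)) \<le> \<bar>sqrt_coeff n\<bar>" for n
    using norm_power_ineq[of w n] power_le_one[OF norm_ge_zero assms, of n]
    by (simp add: mult_left_le)
qed

lemma sqrt_ser_sums:
  "norm w \<le> 1 \<Longrightarrow> (\<lambda>n. sqrt_coeff n *\<^sub>R (w::'a::unital_cstar_algebra) ^ n) sums sqrt_ser w"
  unfolding sqrt_ser_def by (rule summable_sums[OF summable_norm_cancel[OF summable_sqrt_ser]])

lemma sqrt_ser_square:
  assumes "norm w \<le> 1" shows "sqrt_ser w * sqrt_ser w = 1 - (w::'a::unital_cstar_algebra)"
proof -
  let ?a = "\<lambda>n. sqrt_coeff n *\<^sub>R w ^ n"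
  have "(\<lambda>n. \<Sum>i\<le>n. ?a i * ?a (n - i)) sums (sqrt_ser w * sqrt_ser w)"
    unfolding sqrt_ser_def
    by (rule Cauchy_product_sums) (use summable_sqrt_ser[OF assms] in auto)
  moreover have "(\<Sum>i\<le>n. ?a i * ?a (n - i)) =
      (if n = 0 then 1 else if n = 1 then -1 else 0) *\<^sub>R w ^ n" for n
  proof -
    have "(\<Sum>i\<le>n. ?a i * ?a (n - i)) = (\<Sum>i\<le>n. (sqrt_coeff i * sqrt_coeff (n - i)) *\<^sub>R w ^ n)"
      by (rule sum.cong) (auto simp: power_add[symmetric])
    then show ?thesis by (simp only: scaleR_sum_left[symmetric] sqrt_coeff_Cauchy)
  qed
  ultimately have "(\<lambda>n. (if n = 0 then 1 else if n = 1 then -1 else 0) *\<^sub>R w ^ n)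
      sums (sqrt_ser w * sqrt_ser w)" by simp
  moreover have "(\<lambda>n. (if n = 0 then 1 else if n = 1 then -1 else 0) *\<^sub>R w ^ n) sums
      (\<Sum>n\<in>{0,1}. (if n = 0 then 1 else if n = 1 then -1 else 0) *\<^sub>R w ^ n)"
    by (rule sums_finite) auto
  ultimately show ?thesis using sums_unique2 by fastforce
qed

lemma star_sqrt_ser:
  assumes "norm w \<le> 1" "star w = (w::'a::unital_cstar_algebra)"
  shows "star (sqrt_ser w) = sqrt_ser w"
proof -
  have "(\<lambda>n. star (sqrt_coeff n *\<^sub>R w ^ n)) sums star (sqrt_ser w)"
    by (rule bounded_linear.sums[OF bounded_linear_star sqrt_ser_sums[OF assms(1)]])
  then have "(\<lambda>n. sqrt_coeff n *\<^sub>R w ^ n) sums star (sqrt_ser w)"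
    by (simp add: star_scaleR star_power assms)
  then show ?thesis using sqrt_ser_sums[OF assms(1)] sums_unique2 by blast
qed

lemma sqrt_ser_commute:
  assumes "norm w \<le> 1" "w * x = x * (w::'a::unital_cstar_algebra)"
  shows "sqrt_ser w * x = x * sqrt_ser w"
proof -
  have c: "w ^ n * x = x * w ^ n" for n
    by (induction n) (auto simp: mult.assoc assms(2), metis assms(2) mult.assoc)
  have "(\<lambda>n. (sqrt_coeff n *\<^sub>R w ^ n) * x) sums (sqrt_ser w * x)"
    by (rule sums_mult2[OF sqrt_ser_sums[OF assms(1)]])
  moreover have "(\<lambda>n. x * (sqrt_coeff n *\<^sub>R w ^ n)) sums (x * sqrt_ser w)"
    by (rule sums_mult[OF sqrt_ser_sums[OF assms(1)]])
  ultimately show ?thesis using c sums_unique2 by fastforce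
qed

text \<open>This is the witness, with radius 1, that the square root is again positive in the sense
  of \<open>cpos\<close>.\<close>

lemma norm_one_minus_sqrt_ser:
  assumes "norm w \<le> 1" shows "norm (1 - sqrt_ser (w::'a::unital_cstar_algebra)) \<le> 1"
proof -
  let ?a = "\<lambda>n. sqrt_coeff n *\<^sub>R w ^ n"
  have sm: "summable (\<lambda>n. norm (?a (Suc n)))"
    using summable_sqrt_ser[OF assms] by (subst summable_Suc_iff)
  have "sqrt_ser w = (\<Sum>n. ?a (Suc n)) + ?a 0"
    unfolding sqrt_ser_def
    by (subst suminf_split_head[OF summable_norm_cancel[OF summable_sqrt_ser[OF assms]]]) simp
  then have "1 - sqrt_ser w = - (\<Sum>n. ?a (Suc n))" by simp
  then have "norm (1 - sqrt_ser w) \<le> (\<Sum>n. norm (?a (Suc n)))"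
    by (simp only: norm_minus_cancel summable_norm[OF sm])
  also have "\<dots> \<le> (\<Sum>n. \<bar>sqrt_coeff (Suc n)\<bar>)"
  proof (rule suminf_le[OF _ sm summable_sqrt_coeff_Suc])
    show "norm (?a (Suc n)) \<le> \<bar>sqrt_coeff (Suc n)\<bar>" for n
      using norm_power_ineq[of w "Suc n"] power_le_one[OF norm_ge_zero assms, of "Suc n"]
      by (simp only: norm_scaleR) (meson abs_ge_zero mult_left_le order_trans)
  qed
  also have "\<dots> \<le> 1" by (rule suminf_sqrt_coeff_le)
  finally show ?thesis .
qed

text \<open>The partial sums are polynomials in w. This keeps square roots inside a crossed product,
  where positivity asks for a factor c from the algebra itself.\<close>

lemma sqrt_ser_in_closed:
  assumes w: "norm w \<le> 1" "(w::'a::unital_cstar_algebra) \<in> A" and "closed A" "1 \<in> A"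
    and add: "\<And>x y. x \<in> A \<Longrightarrow> y \<in> A \<Longrightarrow> x + y \<in> A"
    and scale: "\<And>r x. x \<in> A \<Longrightarrow> r *\<^sub>R x \<in> A"
    and mult: "\<And>x y. x \<in> A \<Longrightarrow> y \<in> A \<Longrightarrow> x * y \<in> A"
  shows "sqrt_ser w \<in> A"
proof -
  have pow: "w ^ n \<in> A" for n by (induction n) (auto simp: assms)
  have zero: "0 \<in> A" using scale[OF \<open>1 \<in> A\<close>, of 0] by simp
  have "(\<Sum>n<m. sqrt_coeff n *\<^sub>R w ^ n) \<in> A" for m
    by (induction m) (auto simp: zero add scale pow)
  then show ?thesis
    by (rule closed_sequentially[OF \<open>closed A\<close> _ sqrt_ser_sums[OF w(1), unfolded sums_def]])
qed

text \<open>Equivalent to a non-negative spectrum, but stated without spectral theory.\<close>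

definition cpos :: "'a::unital_cstar_algebra \<Rightarrow> bool" where
  "cpos a \<longleftrightarrow> star a = a \<and> (\<exists>r. norm (r *\<^sub>R 1 - a) \<le> r)"

lemma cpos_sa: "cpos a \<Longrightarrow> star a = a"
  by (simp add: cpos_def)

lemma cposI: "star a = a \<Longrightarrow> norm (r *\<^sub>R 1 - a) \<le> r \<Longrightarrow> cpos a"
  by (auto simp: cpos_def)

lemma norm_shift_mono:
  assumes "norm (r *\<^sub>R 1 - (a::'a::unital_cstar_algebra)) \<le> s" "r \<le> R"
  shows "norm (R *\<^sub>R 1 - a) \<le> s + (R - r)"
proof -
  have "R *\<^sub>R 1 - a = (r *\<^sub>R 1 - a) + (R - r) *\<^sub>R 1" by (simp add: algebra_simps)
  then have "norm (R *\<^sub>R 1 - a) \<le> norm (r *\<^sub>R 1 - a) + norm ((R - r) *\<^sub>R (1::'a))"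
    by (simp only: norm_triangle_ineq)
  then show ?thesis using assms by simp
qed

lemma cpos_add: "cpos a \<Longrightarrow> cpos b \<Longrightarrow> cpos (a + b)"
proof -
  assume "cpos a" "cpos b"
  then obtain r s where rs: "norm (r *\<^sub>R 1 - a) \<le> r" "norm (s *\<^sub>R 1 - b) \<le> s"
    by (auto simp: cpos_def)
  have eq: "(r + s) *\<^sub>R 1 - (a + b) = (r *\<^sub>R 1 - a) + (s *\<^sub>R 1 - b)" by (simp add: algebra_simps)
  have "norm ((r + s) *\<^sub>R 1 - (a + b)) \<le> r + s"
    unfolding eq using rs by (intro norm_triangle_le) simp
  then show ?thesis
    using \<open>cpos a\<close> \<open>cpos b\<close> by (intro cposI) (auto simp: star_add cpos_sa)
qed

lemma cpos_scaleR: "cpos a \<Longrightarrow> 0 \<le> c \<Longrightarrow> cpos (c *\<^sub>R a)"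
proof -
  assume a: "cpos a" "0 \<le> c"
  then obtain r where r: "norm (r *\<^sub>R 1 - a) \<le> r" by (auto simp: cpos_def)
  have "norm ((c * r) *\<^sub>R 1 - c *\<^sub>R a) = c * norm (r *\<^sub>R 1 - a)"
    using a by (simp add: scaleR_diff_right[symmetric] flip: scaleR_scaleR)
  also have "\<dots> \<le> c * r" using r a by (simp add: mult_left_mono)
  finally show ?thesis using a by (intro cposI) (auto simp: star_scaleR cpos_sa)
qed

lemma cpos_zero [simp]: "cpos 0"
  by (rule cposI[where r=0]) auto

lemma cpos_one [simp]: "cpos 1"
  by (rule cposI[where r=1]) auto

lemma cpos_sum: "(\<And>i. i \<in> A \<Longrightarrow> cpos (f i)) \<Longrightarrow> cpos (\<Sum>i\<in>A. f i)"
  by (induction A rule: infinite_finite_induct) (auto simp: cpos_add)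

lemma cpos_norm_minus:
  assumes "star h = h" "norm h \<le> r" shows "cpos (r *\<^sub>R 1 - h)"
  by (rule cposI[where r=r]) (use assms in \<open>auto simp: star_diff star_scaleR\<close>)

lemma cpos_norm_plus:
  assumes "star h = h" "norm h \<le> r" shows "cpos (r *\<^sub>R 1 + h)"
  using cpos_norm_minus[of "- h" r] assms by (simp add: star_minus)

text \<open>Solve a = r (1 - w) with \<open>norm w \<le> 1\<close> and take sqrt r times the series
  at w. The last two clauses record that the root is a limit of polynomials in a: it commutes with
  what commutes with a, and lies in every closed unital algebra containing a.\<close>

lemma cpos_sqrt:
  assumes "cpos (a::'a::unital_cstar_algebra)"
  obtains d where "cpos d" "d * d = a" "\<And>x. a * x = x * a \<Longrightarrow> d * x = x * d"
    "\<And>A. a \<in> A \<Longrightarrow> closed A \<Longrightarrow> 1 \<in> A \<Longrightarrow> (\<And>x y. x \<in> A \<Longrightarrow> y \<in> A \<Longrightarrow> x + y \<in> A) \<Longrightarrow>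
      (\<And>r x. x \<in> A \<Longrightarrow> r *\<^sub>R x \<in> A) \<Longrightarrow> (\<And>x y. x \<in> A \<Longrightarrow> y \<in> A \<Longrightarrow> x * y \<in> A) \<Longrightarrow> d \<in> A"
proof -
  obtain r0 where r0: "norm (r0 *\<^sub>R 1 - a) \<le> r0" using assms by (auto simp: cpos_def)
  \<comment> \<open>The given radius may be 0, namely when a = 0; adding 1 makes the division by r
    legitimate.\<close>
  define r where "r = r0 + 1"
  have r: "norm (r *\<^sub>R 1 - a) \<le> r" using norm_shift_mono[OF r0, of r] by (simp add: r_def)
  have "r > 0" using order_trans[OF norm_ge_zero r0] by (simp add: r_def)
  define w where "w = 1 - (1 / r) *\<^sub>R a"
  have weq: "w = (1 / r) *\<^sub>R (r *\<^sub>R 1 - a)" using \<open>r > 0\<close> by (simp add: w_def algebra_simps)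
  have w: "norm w \<le> 1" unfolding weq using r \<open>r > 0\<close> by simp
  have wsa: "star w = w" using assms by (simp add: w_def star_diff star_scaleR cpos_sa)
  define d where "d = sqrt r *\<^sub>R sqrt_ser w"
  show ?thesis
  proof (rule that[of d])
    have "cpos (sqrt_ser w)"
      by (rule cposI[where r=1]) (use norm_one_minus_sqrt_ser[OF w] star_sqrt_ser[OF w wsa] in auto)
    then show "cpos d" unfolding d_def using \<open>r > 0\<close> by (intro cpos_scaleR) auto
    show "d * d = a" using \<open>r > 0\<close> by (simp add: d_def sqrt_ser_square[OF w]) (simp add: w_def)
    show "d * x = x * d" if "a * x = x * a" for x
      using sqrt_ser_commute[OF w, of x] that by (simp add: d_def w_def algebra_simps)
    show "d \<in> A" if A: "a \<in> A" "closed A" "1 \<in> A" "\<And>x y. x \<in> A \<Longrightarrow> y \<in> A \<Longrightarrow> x + y \<in> A"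
      "\<And>r x. x \<in> A \<Longrightarrow> r *\<^sub>R x \<in> A" "\<And>x y. x \<in> A \<Longrightarrow> y \<in> A \<Longrightarrow> x * y \<in> A" for A
    proof -
      have "1 + (- (1 / r)) *\<^sub>R a \<in> A" by (intro A)
      then have wA: "w \<in> A" by (simp add: w_def)
      have "sqrt_ser w \<in> A"
        by (rule sqrt_ser_in_closed[OF w wA A(2,3)]) (blast intro: A)+
      then show ?thesis unfolding d_def by (rule A(5))
    qed
  qed
qed

text \<open>For self-adjoint \<open>y\<close> of norm at most one, \<open>y\<close> is the real part of the unitary
  \<open>u = y + i sqrt (1 - y\<^sup>2)\<close>, and \<open>y\<^sup>2 - 1/2 = (u\<^sup>2 + (u\<^sup>*)\<^sup>2) / 4\<close>.\<close>

lemma norm_half_minus_square_aux: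
  assumes "star y = (y::'a::unital_cstar_algebra)" "norm y \<le> 1"
  shows "norm ((1 / 2) *\<^sub>R 1 - y * y) \<le> 1 / 2"
proof -
  define s where "s = sqrt_ser (y * y)"
  have w: "norm (y * y) \<le> 1" using assms by (simp add: norm_sa_square power_le_one)
  have ssa: "star s = s" unfolding s_def using star_sqrt_ser[OF w] assms by (simp add: star_mult)
  have ss: "s * s = 1 - y * y" unfolding s_def by (rule sqrt_ser_square[OF w])
  have sy: "s * y = y * s" unfolding s_def by (rule sqrt_ser_commute[OF w]) (simp add: mult.assoc)
  define u where "u = y + \<i> *\<^sub>C s"
  have su: "star u = y - \<i> *\<^sub>C s"
    by (simp add: u_def star_add star_scaleC assms ssa scaleC_minus_left)
  have ii: "\<i> *\<^sub>C \<i> *\<^sub>C x = - x" for x :: 'a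
    by (simp add: scaleC_scaleC scaleC_minus_left)
  have uu: "star u * u = 1"
    unfolding su unfolding u_def
    by (simp add: algebra_simps mult_scaleC_left mult_scaleC_right scaleC_add_right scaleC_diff_right ii ss sy)
  have "norm u = 1" using cstar_identity[of u] uu by (simp add: power2_eq_1_iff)
    (metis abs_norm_cancel one_neq_neg_one abs_1 abs_minus_cancel)
  have "u * u + star u * star u = (y * y + y * y + (y * y + y * y)) - (1 + 1)"
    unfolding su unfolding u_def
    by (simp add: algebra_simps mult_scaleC_left mult_scaleC_right scaleC_add_right scaleC_diff_right ii ss sy)
  also have "\<dots> = 4 *\<^sub>R (y * y) - 2 *\<^sub>R 1"
    using scaleR_left_distrib[of 2 2 "y * y"] by (simp only: scaleR_2) (simp add: scaleR_2)
  finally have "u * u + star u * star u = 4 *\<^sub>R (y * y) - 2 *\<^sub>R 1" .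
  then have "(1 / 2) *\<^sub>R 1 - y * y = - (1 / 4) *\<^sub>R (u * u + star u * star u)"
    by (simp add: scaleR_diff_right)
  then have "norm ((1 / 2) *\<^sub>R 1 - y * y) = (1 / 4) * norm (u * u + star u * star u)"
    by simp
  also have "norm (u * u + star u * star u) \<le> norm u * norm u + norm (star u) * norm (star u)"
    by (meson add_mono norm_mult_ineq norm_triangle_le)
  finally show ?thesis using \<open>norm u = 1\<close> by simp
qed

lemma norm_half_minus_square:
  assumes "star y = (y::'a::unital_cstar_algebra)"
  shows "norm (((norm y)\<^sup>2 / 2) *\<^sub>R 1 - y * y) \<le> (norm y)\<^sup>2 / 2"
proof (cases "y = 0")
  case False
  define z where "z = (1 / norm y) *\<^sub>R y"
  have z: "star z = z" "norm z \<le> 1" using assms False by (auto simp: z_def star_scaleR)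
  have yy: "y * y = (norm y)\<^sup>2 *\<^sub>R (z * z)" using False by (simp add: z_def power2_eq_square)
  have "((norm y)\<^sup>2 / 2) *\<^sub>R 1 - y * y = (norm y)\<^sup>2 *\<^sub>R ((1 / 2) *\<^sub>R 1 - z * z)"
    by (simp add: yy scaleR_diff_right)
  then have "norm (((norm y)\<^sup>2 / 2) *\<^sub>R 1 - y * y) = (norm y)\<^sup>2 * norm ((1 / 2) *\<^sub>R 1 - z * z)"
    by simp
  also have "\<dots> \<le> (norm y)\<^sup>2 * (1 / 2)"
    using norm_half_minus_square_aux[OF z] by (intro mult_left_mono) auto
  finally show ?thesis by simp
qed simp

lemma cpos_square: "star y = y \<Longrightarrow> cpos (y * (y::'a::unital_cstar_algebra))"
  by (rule cposI[OF _ norm_half_minus_square]) (simp_all add: star_mult)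

text \<open>Removes the existential quantifier from \<open>cpos\<close>: writing a as a square shows
  that the radius \<open>norm a / 2\<close> works, and then so does every larger one. Norm estimates
  for positive elements can thus use a radius of choice.\<close>

lemma cpos_norm_half:
  assumes "cpos (a::'a::unital_cstar_algebra)"
  shows "norm ((norm a / 2) *\<^sub>R 1 - a) \<le> norm a / 2"
proof -
  obtain d where "cpos d" "d * d = a" using cpos_sqrt[OF assms] by metis
  then show ?thesis
    using norm_half_minus_square[of d] norm_sa_square[of d] by (simp add: cpos_sa)
qed

lemma cpos_norm_shift:
  assumes "cpos (a::'a::unital_cstar_algebra)" "norm a / 2 \<le> r"
  shows "norm (r *\<^sub>R 1 - a) \<le> r"
  using norm_shift_mono[OF cpos_norm_half[OF assms(1)] assms(2)] by simp

text \<open>\<open>p\<close> is a combination of \<open>S + p\<close> and \<open>\<parallel>p\<parallel>/2 - p\<close>, whose norms are controlled for large \<open>S\<close>.\<close>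

lemma cpos_le_scalar_norm:
  assumes "cpos p" "cpos (r *\<^sub>R 1 - p)"
  shows "norm (p::'a::unital_cstar_algebra) \<le> r"
proof (cases "p = 0")
  case True
  obtain s where "norm (s *\<^sub>R 1 - (r *\<^sub>R (1::'a))) \<le> s" using assms(2) True by (auto simp: cpos_def)
  then have "\<bar>s - r\<bar> \<le> s" by (simp add: scaleR_diff_left[symmetric])
  then show ?thesis using True by simp
next
  case False
  define q t where "q = r *\<^sub>R 1 - p" and "t = norm p"
  \<comment> \<open>Large enough for \<open>S + r\<close> to exceed half the norm of q, so that
    \<open>S + r\<close> is an admissible radius for q, and positive.\<close>
  define S where "S = norm q + \<bar>r\<bar> + 1"
  have "t > 0" using False by (simp add: t_def)
  have S: "S > 0" by (simp add: S_def add_nonneg_pos)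
  have "norm ((S + r) *\<^sub>R 1 - q) \<le> S + r"
    by (rule cpos_norm_shift) (use assms in \<open>auto simp: q_def S_def\<close>)
  then have b1: "norm (S *\<^sub>R 1 + p) \<le> S + r" by (simp add: q_def algebra_simps)
  have b2: "norm ((t / 2) *\<^sub>R 1 - p) \<le> t / 2"
    unfolding t_def by (rule cpos_norm_half[OF assms(1)])
  have "(S + t / 2) *\<^sub>R p = (t / 2) *\<^sub>R (S *\<^sub>R 1 + p) - S *\<^sub>R ((t / 2) *\<^sub>R 1 - p)"
    by (simp add: algebra_simps)
  then have "(S + t / 2) * norm p \<le> (t / 2) * norm (S *\<^sub>R 1 + p) + S * norm ((t / 2) *\<^sub>R 1 - p)"
    using norm_triangle_ineq4[of "(t / 2) *\<^sub>R (S *\<^sub>R 1 + p)" "S *\<^sub>R ((t / 2) *\<^sub>R 1 - p)"] S \<open>t > 0\<close>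
    by (metis abs_of_pos add_pos_pos half_gt_zero norm_scaleR)
  also have "\<dots> \<le> (t / 2) * (S + r) + S * (t / 2)"
    using b1 b2 S \<open>t > 0\<close> by (intro add_mono mult_left_mono) auto
  finally have "(S + t / 2) * t \<le> (t / 2) * (S + r) + S * (t / 2)" by (simp only: t_def)
  moreover have "(S + t / 2) * t = S * t + (t * t) / 2" "(t / 2) * (S + r) + S * (t / 2) = S * t + (t * r) / 2"
    by (simp_all add: field_simps)
  ultimately have "t * t \<le> t * r" by linarith
  then show ?thesis using \<open>t > 0\<close> by (simp add: t_def)
qed

text \<open>The element r + h lies between 0 and 2 r, so its norm is at most 2 r and the radius r is
  admissible for it; the distance of r + h from r is the norm of h.\<close>

lemma norm_le_if_cpos:
  assumes "cpos (r *\<^sub>R 1 - h)" "cpos (r *\<^sub>R 1 + h)"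
  shows "norm (h::'a::unital_cstar_algebra) \<le> r"
proof -
  have "(2 * r) *\<^sub>R 1 - (r *\<^sub>R 1 + h) = r *\<^sub>R 1 - h"
    by (simp only: scaleR_scaleR[symmetric] scaleR_2) simp
  with assms(1) have "cpos ((2 * r) *\<^sub>R 1 - (r *\<^sub>R 1 + h))" by (simp only:)
  then have "norm (r *\<^sub>R 1 + h) \<le> 2 * r" by (rule cpos_le_scalar_norm[OF assms(2)])
  then have "norm (r *\<^sub>R 1 - (r *\<^sub>R 1 + h)) \<le> r"
    by (intro cpos_norm_shift[OF assms(2)]) simp
  then show ?thesis by simp
qed

lemma cpos_norm_mono:
  assumes "cpos p" "cpos (q - p)" "cpos q"
  shows "norm (p::'a::unital_cstar_algebra) \<le> norm q"
proof (rule cpos_le_scalar_norm[OF assms(1)])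
  show "cpos (norm q *\<^sub>R 1 - p)"
    using cpos_add[OF cpos_norm_minus[of q "norm q"] assms(2)] assms(3) by (simp add: cpos_sa)
qed

lemma cpos_antisym: "cpos p \<Longrightarrow> cpos (- p) \<Longrightarrow> p = (0::'a::unital_cstar_algebra)"
  using cpos_le_scalar_norm[of p 0] by simp

text \<open>The roots d and e of a and b commute as well, so a b is the square of the self-adjoint
  element d e.\<close>

lemma cpos_mult_commute:
  assumes "cpos a" "cpos b" "a * b = b * (a::'a::unital_cstar_algebra)" shows "cpos (a * b)"
proof -
  obtain d where d: "cpos d" "d * d = a" "\<And>x. a * x = x * a \<Longrightarrow> d * x = x * d"
    using cpos_sqrt[OF assms(1)] by metis
  obtain e where e: "cpos e" "e * e = b" "\<And>x. b * x = x * b \<Longrightarrow> e * x = x * e"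
    using cpos_sqrt[OF assms(2)] by metis
  have "d * b = b * d" using d(3)[of b] assms(3) by simp
  then have de: "e * d = d * e" using e(3)[of d] by simp
  then have "star (d * e) = d * e" using d(1) e(1) by (simp add: star_mult cpos_sa)
  moreover have "d * e * (d * e) = d * d * (e * e)" by (metis de mult.assoc)
  ultimately show ?thesis using cpos_square[of "d * e"] d(2) e(2) by simp
qed

text \<open>With \<open>g = r + z z\<^sup>*\<close> one has \<open>g\<^sup>n (g - r) = z (r + z\<^sup>* z)\<^sup>n z\<^sup>*\<close>; if \<open>\<parallel>g\<parallel> > r\<close>, the left side grows
  faster than the right side.\<close>

lemma cpos_minus_flip:
  assumes "cpos (- (star z * z))" shows "cpos (- (z * star (z::'a::unital_cstar_algebra)))"
proof -
  let ?f = "star z * z" and ?e = "z * star z"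
  obtain r0 where r0: "norm (r0 *\<^sub>R 1 + ?f) \<le> r0" using assms by (auto simp: cpos_def)
  define r where "r = r0 + 1"
  have r: "norm (r *\<^sub>R 1 + ?f) \<le> r"
    using norm_shift_mono[of r0 "- ?f" r0 r] r0 by (simp add: r_def)
  have "r > 0" using order_trans[OF norm_ge_zero r0] by (simp add: r_def)
  define g where "g = r *\<^sub>R 1 + ?e"
  have gsa: "star g = g" by (simp add: g_def star_add star_scaleR star_mult star_star)
  have key: "g ^ n * ?e = z * (r *\<^sub>R 1 + ?f) ^ n * star z" for n
  proof (induction n)
    case (Suc n)
    have gz: "g * z = z * (r *\<^sub>R 1 + ?f)" by (simp add: g_def algebra_simps)
    have "g ^ Suc n * ?e = g * (g ^ n * ?e)" by (simp only: power_Suc mult.assoc)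
    also have "\<dots> = (g * z) * (r *\<^sub>R 1 + ?f) ^ n * star z"
      unfolding Suc by (simp only: mult.assoc)
    also have "\<dots> = z * (r *\<^sub>R 1 + ?f) ^ Suc n * star z"
      unfolding gz by (simp only: power_Suc mult.assoc)
    finally show ?case .
  qed simp
  have "norm g \<le> r"
  proof (rule ccontr)
    assume "\<not> norm g \<le> r"
    then have gr: "norm g > r" by simp
    have le: "norm g ^ n * (norm g - r) \<le> (norm z)\<^sup>2 * r ^ n" for n
    proof -
      have "norm g ^ n * (norm g - r) = norm (g ^ Suc n) - r * norm (g ^ n)"
        by (simp only: norm_sa_power[OF gsa]) (simp add: algebra_simps)
      also have "\<dots> \<le> norm (g ^ Suc n - r *\<^sub>R g ^ n)"
        using norm_triangle_ineq2[of "g ^ Suc n" "r *\<^sub>R g ^ n"] \<open>r > 0\<close> by simp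
      also have "g ^ Suc n - r *\<^sub>R g ^ n = g ^ n * ?e"
        by (simp add: g_def power_commutes[symmetric] algebra_simps)
      also have "norm (g ^ n * ?e) \<le> norm z * norm (r *\<^sub>R 1 + ?f) ^ n * norm z"
        unfolding key
        by (intro norm_mult_ineq[THEN order_trans] mult_mono norm_power_ineq) auto
      also have "\<dots> \<le> norm z * r ^ n * norm z"
        using power_mono[OF r norm_ge_zero, of n] by (intro mult_right_mono mult_left_mono) auto
      finally show ?thesis by (simp add: power2_eq_square algebra_simps)
    qed
    have "(norm g / r) ^ n \<le> (norm z)\<^sup>2 / (norm g - r)" for n
      using le[of n] gr \<open>r > 0\<close> by (simp add: power_divide field_simps)
    moreover obtain n where "(norm z)\<^sup>2 / (norm g - r) < (norm g / r) ^ n"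
      using real_arch_pow[of "norm g / r" "(norm z)\<^sup>2 / (norm g - r)"] gr \<open>r > 0\<close> by auto
    ultimately show False by (meson linorder_not_less)
  qed
  then have "norm (r *\<^sub>R 1 - (- ?e)) \<le> r" by (simp add: g_def)
  then show ?thesis by (intro cposI) (auto simp: star_minus star_mult star_star)
qed

lemma real_imag_parts:
  fixes z :: "'a::unital_cstar_algebra"
  obtains u v where "star u = u" "star v = v" "z = u + \<i> *\<^sub>C v"
    "u = (1 / 2) *\<^sub>R (z + star z)" "v = (1 / 2) *\<^sub>R ((- \<i>) *\<^sub>C (z - star z))"
proof
  let ?u = "(1 / 2) *\<^sub>R (z + star z)" and ?v = "(1 / 2) *\<^sub>R ((- \<i>) *\<^sub>C (z - star z))"
  show "star ?u = ?u" by (simp add: star_scaleR star_add star_star add.commute)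
  show "star ?v = ?v"
    by (simp add: star_scaleR star_scaleC star_diff star_star scaleC_minus_left star_minus scaleC_diff_right)
  have "\<i> *\<^sub>C ?v = (1 / 2) *\<^sub>R (z - star z)"
    by (simp add: scaleC_scaleR scaleC_scaleC)
  moreover have "?u + (1 / 2) *\<^sub>R (z - star z) = (1 / 2) *\<^sub>R (2 *\<^sub>R z)"
    by (simp only: scaleR_right_distrib[symmetric]) (simp add: scaleR_2)
  ultimately show "z = ?u + \<i> *\<^sub>C ?v" by simp
qed (rule refl)+

text \<open>The Fukamiya--Kelley--Vaught argument: for the negative part \<open>m\<close> of \<open>y = x\<^sup>* x\<close> and \<open>z = x m\<close>
  one has \<open>z\<^sup>* z = - m\<^sup>3\<close>, while \<open>z\<^sup>* z + z z\<^sup>*\<close> is always positive.\<close>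

theorem cpos_star_mult: "cpos (star x * (x::'a::unital_cstar_algebra))"
proof -
  have neg_zero: "star z * z = 0" if neg: "cpos (- (star z * z))" for z :: 'a
  proof -
    obtain u v where uv: "star u = u" "star v = v" "z = u + \<i> *\<^sub>C v" using real_imag_parts by metis
    have ii: "\<i> *\<^sub>C \<i> *\<^sub>C x = - x" for x :: 'a
      by (simp add: scaleC_scaleC scaleC_minus_left)
    have sz: "star z = u - \<i> *\<^sub>C v" by (simp add: uv star_add star_scaleC scaleC_minus_left)
    have "star z * z + z * star z = 2 *\<^sub>R (u * u + v * v)"
      unfolding sz unfolding uv(3)
      by (simp add: algebra_simps mult_scaleC_left mult_scaleC_right scaleC_add_right scaleC_diff_right ii scaleR_2)
    moreover have "cpos (2 *\<^sub>R (u * u + v * v))"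
      by (intro cpos_scaleR cpos_add cpos_square uv) simp
    ultimately have "cpos (star z * z + z * star z + - (z * star z))"
      by (intro cpos_add[OF _ cpos_minus_flip[OF neg]]) simp
    then have "cpos (star z * z)" by simp
    then show ?thesis using neg cpos_antisym by blast
  qed
  define y where "y = star x * x"
  have ysa: "star y = y" by (simp add: y_def star_mult star_star)
  obtain d where d: "cpos d" "d * d = y * y" "\<And>x. y * y * x = x * (y * y) \<Longrightarrow> d * x = x * d"
    using cpos_sqrt[OF cpos_square[OF ysa]] by metis
  have dy: "d * y = y * d" by (rule d(3)) (simp add: mult.assoc)
  define m where "m = (1 / 2) *\<^sub>R (d - y)"
  have msa: "star m = m" using d(1) ysa by (simp add: m_def star_scaleR star_diff cpos_sa)
  have quarter: "(1 / 4) *\<^sub>R (x + x) = (1 / 2) *\<^sub>R x" for x :: 'a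
    by (simp add: scaleR_2[symmetric])
  have my: "m * y = - (m * m)"
    using d(2) dy by (simp add: m_def algebra_simps)
      (simp add: scaleR_add_right[symmetric] quarter)
  have md: "m * d = m * m"
    using d(2) dy by (simp add: m_def algebra_simps)
      (simp add: scaleR_add_right[symmetric] quarter)
  have dm: "d * m = m * d" using dy by (simp add: m_def algebra_simps)
  have "star (x * m) * (x * m) = m * y * m" by (simp add: star_mult msa y_def mult.assoc)
  then have zz: "star (x * m) * (x * m) = - (m * m * m)" by (simp add: my)
  have "m * m * d = d * (m * m)"
    by (simp only: mult.assoc md[symmetric] dm) (simp only: mult.assoc[symmetric] dm)
  then have "cpos (m * m * d)" by (intro cpos_mult_commute cpos_square msa d(1))
  then have "cpos (m * m * m)" by (simp add: mult.assoc md)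
  then have "m * m * m = 0" using neg_zero[of "x * m"] zz by simp
  then have "norm m ^ 3 = 0" using norm_sa_power[OF msa, of 3] by (simp add: power3_eq_cube mult.assoc)
  then have "d = y" by (simp add: m_def)
  then show ?thesis using d(1) y_def by simp
qed

lemma cpos_conj:
  assumes "cpos a" shows "cpos (star x * a * (x::'a::unital_cstar_algebra))"
proof -
  obtain d where d: "cpos d" "d * d = a" using cpos_sqrt[OF assms] by metis
  have "star (d * x) * (d * x) = star x * a * x"
    using d by (simp add: star_mult cpos_sa mult.assoc[symmetric])
      (metis mult.assoc)
  then show ?thesis using cpos_star_mult[of "d * x"] by simp
qed

text \<open>With the radius fixed to \<open>norm a\<close>, which depends continuously on a,
  positivity becomes an inequality between continuous functions.\<close>

lemma closed_cpos: "closed {a::'a::unital_cstar_algebra. cpos a}"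
proof -
  have "{a::'a. cpos a} = {a. star a = a} \<inter> {a. norm (norm a *\<^sub>R 1 - a) \<le> norm a}"
    by (auto simp: cpos_def intro: cpos_norm_shift cposI)
  moreover have "closed {a::'a. star a = a}"
    by (intro closed_Collect_eq continuous_on_id linear_continuous_on bounded_linear_star)
  moreover have "closed {a::'a. norm (norm a *\<^sub>R 1 - a) \<le> norm a}"
    by (intro closed_Collect_le continuous_intros)
  ultimately show ?thesis by auto
qed

lemma cpos_infsum:
  assumes "f summable_on A" "\<And>i. i \<in> A \<Longrightarrow> cpos (f i :: 'a::unital_cstar_algebra)"
  shows "cpos (infsum f A)"
proof -
  have "(sum f \<longlongrightarrow> infsum f A) (finite_subsets_at_top A)"
    using assms(1) by (rule infsum_tendsto)
  moreover have "\<forall>\<^sub>F F in finite_subsets_at_top A. sum f F \<in> {a. cpos a}"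
    using assms(2) by (intro eventually_finite_subsets_at_top_weakI) (auto intro!: cpos_sum)
  ultimately have "infsum f A \<in> {a. cpos a}"
    using Lim_in_closed_set[OF closed_cpos] finite_subsets_at_top_neq_bot by blast
  then show ?thesis by simp
qed

lemma cpos_norm_minus_star_mult:
  "cpos ((norm x)\<^sup>2 *\<^sub>R 1 - star x * (x::'a::unital_cstar_algebra))"
  by (rule cpos_norm_minus) (auto simp: star_mult star_star cstar_identity)

lemma cpos_conj_le:
  "cpos ((norm b)\<^sup>2 *\<^sub>R (star x * x) - star (b * x) * (b * (x::'a::unital_cstar_algebra)))"
  using cpos_conj[OF cpos_norm_minus_star_mult[of b], of x]
  by (simp add: algebra_simps star_mult)

section \<open>Sums of squares and the algebra-valued Cauchy-Schwarz inequality\<close>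

lemma sum_star_mult_mono:
  assumes "finite F" "E \<subseteq> F"
  shows "norm (\<Sum>i\<in>E. star (f i) * f i) \<le> norm (\<Sum>i\<in>F. star (f i) * (f i :: 'a::unital_cstar_algebra))"
proof (rule cpos_norm_mono)
  have "(\<Sum>i\<in>F. star (f i) * f i) - (\<Sum>i\<in>E. star (f i) * f i) = (\<Sum>i\<in>F - E. star (f i) * f i)"
    using sum_diff[OF assms, of "\<lambda>i. star (f i) * f i"] by simp
  then show "cpos ((\<Sum>i\<in>F. star (f i) * f i) - (\<Sum>i\<in>E. star (f i) * f i))"
    by (simp add: cpos_sum cpos_star_mult)
qed (auto intro: cpos_sum cpos_star_mult)

lemma norm_le_sum_star_mult:
  assumes "finite F" "i \<in> F"
  shows "(norm (f i))\<^sup>2 \<le> norm (\<Sum>i\<in>F. star (f i) * (f i :: 'a::unital_cstar_algebra))"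
  using sum_star_mult_mono[OF assms(1), of "{i}" f] assms(2) by (simp add: cstar_identity)

text \<open>With s the norm of P, expand the sum of the squares of
  \<open>p i * a - s *\<^sub>R q i\<close>, which is positive, and estimate a* P a from above by s
  a* a. What remains is a* a \<le> s Q, and norms are monotone on positive elements.\<close>

lemma cstar_Cauchy_Schwarz_sum:
  fixes p q :: "'i \<Rightarrow> 'a::unital_cstar_algebra"
  assumes "finite F"
  shows "(norm (\<Sum>i\<in>F. star (p i) * q i))\<^sup>2
    \<le> norm (\<Sum>i\<in>F. star (p i) * p i) * norm (\<Sum>i\<in>F. star (q i) * q i)"
proof -
  define P Q a s where "P = (\<Sum>i\<in>F. star (p i) * p i)" and "Q = (\<Sum>i\<in>F. star (q i) * q i)"
    and "a = (\<Sum>i\<in>F. star (p i) * q i)" and "s = norm P"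
  show ?thesis
  proof (cases "s = 0")
    case True
    have "p i = 0" if "i \<in> F" for i
      using norm_le_sum_star_mult[OF assms that, of p] True by (simp add: s_def P_def)
    then show ?thesis by simp
  next
    case False
    then have "s > 0" by (simp add: s_def)
    have stara: "star a = (\<Sum>i\<in>F. star (q i) * p i)"
      by (simp add: a_def star_sum star_mult star_star)
    let ?v = "\<lambda>i. p i * a - s *\<^sub>R q i"
    have "star (?v i) * ?v i = star a * (star (p i) * p i) * a - s *\<^sub>R (star a * (star (p i) * q i))
        - s *\<^sub>R (star (q i) * p i * a) + (s * s) *\<^sub>R (star (q i) * q i)" for i
      by (simp add: star_diff star_mult star_scaleR algebra_simps)
    then have "(\<Sum>i\<in>F. star (?v i) * ?v i) = star a * P * a - s *\<^sub>R (star a * a)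
        - s *\<^sub>R (star a * a) + (s * s) *\<^sub>R Q"
      by (simp only: sum.distrib sum_subtractf scaleR_sum_right[symmetric]
          sum_distrib_left[symmetric] sum_distrib_right[symmetric] P_def[symmetric] Q_def[symmetric]
          a_def[symmetric] stara[symmetric])
    moreover have "cpos (\<Sum>i\<in>F. star (?v i) * ?v i)" by (intro cpos_sum cpos_star_mult)
    moreover have "cpos (star a * (s *\<^sub>R 1 - P) * a)"
      unfolding s_def by (intro cpos_conj cpos_norm_minus)
        (simp_all add: P_def star_sum star_mult star_star)
    ultimately have "cpos ((star a * P * a - s *\<^sub>R (star a * a)
        - s *\<^sub>R (star a * a) + (s * s) *\<^sub>R Q) + star a * (s *\<^sub>R 1 - P) * a)"
      by (metis cpos_add)
    then have "cpos ((s * s) *\<^sub>R Q - s *\<^sub>R (star a * a))" by (simp add: algebra_simps)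
    then have "cpos ((1 / s) *\<^sub>R ((s * s) *\<^sub>R Q - s *\<^sub>R (star a * a)))"
      using \<open>s > 0\<close> by (intro cpos_scaleR) auto
    then have le: "cpos (s *\<^sub>R Q - star a * a)" using \<open>s > 0\<close> by (simp add: scaleR_diff_right)
    have "norm (star a * a) \<le> norm (s *\<^sub>R Q)"
      by (rule cpos_norm_mono[OF _ le]) (use \<open>s > 0\<close> in
        \<open>auto simp: Q_def intro!: cpos_scaleR cpos_sum cpos_star_mult\<close>)
    then show ?thesis using \<open>s > 0\<close> by (simp add: cstar_identity a_def Q_def s_def P_def)
  qed
qed

section \<open>Square-summable sequences\<close>

text \<open>The norm of a finite section. Membership in \<open>l2Z\<close> means norm convergence of
  a series in the algebra, which is more than bounded finite sections, so estimates are proved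
  section by section and then passed to tails and limits.\<close>

definition l2_fin :: "int set \<Rightarrow> (int \<Rightarrow> 'a::unital_cstar_algebra) \<Rightarrow> real" where
  "l2_fin F x = sqrt (norm (\<Sum>n\<in>F. star (x n) * x n))"

lemma l2_fin_nonneg [simp]: "0 \<le> l2_fin F x"
  by (simp add: l2_fin_def)

lemma l2_fin_Cauchy_Schwarz:
  assumes "finite F"
  shows "norm (\<Sum>n\<in>F. star (x n) * (y n :: 'a::unital_cstar_algebra)) \<le> l2_fin F x * l2_fin F y"
proof -
  have "(norm (\<Sum>n\<in>F. star (x n) * y n))\<^sup>2 \<le> (l2_fin F x * l2_fin F y)\<^sup>2"
    using cstar_Cauchy_Schwarz_sum[OF assms, of x y] by (simp add: l2_fin_def power_mult_distrib)
  then show ?thesis by (rule power2_le_imp_le) simp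
qed

lemma l2_fin_triangle:
  assumes "finite F"
  shows "l2_fin F (\<lambda>n. x n + (y n :: 'a::unital_cstar_algebra)) \<le> l2_fin F x + l2_fin F y"
proof -
  have "(\<Sum>n\<in>F. star (x n + y n) * (x n + y n)) = (\<Sum>n\<in>F. star (x n) * x n) +
      (\<Sum>n\<in>F. star (x n) * y n) + (\<Sum>n\<in>F. star (y n) * x n) + (\<Sum>n\<in>F. star (y n) * y n)"
    by (simp add: star_add algebra_simps sum.distrib)
  then have "(l2_fin F (\<lambda>n. x n + y n))\<^sup>2 \<le> (l2_fin F x)\<^sup>2 + l2_fin F x * l2_fin F y
      + l2_fin F y * l2_fin F x + (l2_fin F y)\<^sup>2"
    unfolding l2_fin_def[of F "\<lambda>n. x n + y n"]
    using l2_fin_Cauchy_Schwarz[OF assms, of x y] l2_fin_Cauchy_Schwarz[OF assms, of y x]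
    by (simp only: real_sqrt_pow2 norm_ge_zero) (intro norm_triangle_mono; simp add: l2_fin_def)
  then have "(l2_fin F (\<lambda>n. x n + y n))\<^sup>2 \<le> (l2_fin F x + l2_fin F y)\<^sup>2"
    by (simp add: power2_eq_square algebra_simps)
  then show ?thesis by (rule power2_le_imp_le) simp
qed

lemma l2_fin_uminus: "l2_fin F (\<lambda>n. - x n) = l2_fin F x"
  by (simp add: l2_fin_def star_minus)

lemma l2_fin_diff_commute: "l2_fin F (\<lambda>n. x n - y n) = l2_fin F (\<lambda>n. y n - x n)"
  using l2_fin_uminus[of F "\<lambda>n. x n - y n"] by simp

text \<open>The Cauchy criterion in terms of finite sets away from F0, the form in which
  Cauchy-Schwarz estimates tails.\<close>

lemma summable_on_Cauchy_iff:
  fixes f :: "'i \<Rightarrow> 'b::banach"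
  shows "f summable_on UNIV \<longleftrightarrow>
    (\<forall>e>0. \<exists>F0. finite F0 \<and> (\<forall>F. finite F \<longrightarrow> F \<inter> F0 = {} \<longrightarrow> norm (sum f F) < e))"
    (is "_ \<longleftrightarrow> ?C")
proof
  assume "f summable_on UNIV"
  then obtain L where lim: "(sum f \<longlongrightarrow> L) (finite_subsets_at_top UNIV)"
    by (auto simp: summable_on_def has_sum_def)
  show ?C
  proof (intro allI impI)
    fix e :: real assume "e > 0"
    then have "\<forall>\<^sub>F F in finite_subsets_at_top UNIV. dist (sum f F) L < e / 2"
      using lim by (intro tendstoD) auto
    then obtain F0 where F0: "finite F0" "\<And>F. finite F \<Longrightarrow> F0 \<subseteq> F \<Longrightarrow> dist (sum f F) L < e / 2"
      by (auto simp: eventually_finite_subsets_at_top)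
    show "\<exists>F0. finite F0 \<and> (\<forall>F. finite F \<longrightarrow> F \<inter> F0 = {} \<longrightarrow> norm (sum f F) < e)"
    proof (intro exI[of _ F0] conjI allI impI F0(1))
      fix F assume F: "finite F" "F \<inter> F0 = {}"
      then have "sum f (F \<union> F0) = sum f F + sum f F0" using F0(1) by (intro sum.union_disjoint) auto
      then have "norm (sum f F) = dist (sum f (F \<union> F0)) (sum f F0)" by (simp add: dist_norm)
      also have "\<dots> \<le> dist (sum f (F \<union> F0)) L + dist (sum f F0) L" by (rule dist_triangle2)
      also have "\<dots> < e / 2 + e / 2" using F F0 by (intro add_strict_mono F0(2)) auto
      finally show "norm (sum f F) < e" by simp
    qed
  qed
next
  assume C: ?C
  have "\<exists>P. eventually P (finite_subsets_at_top UNIV) \<and>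
      (\<forall>F F'. P F \<and> P F' \<longrightarrow> dist (sum f F) (sum f F') < e)" if "e > 0" for e
  proof -
    obtain F0 where F0: "finite F0" "\<And>F. finite F \<Longrightarrow> F \<inter> F0 = {} \<Longrightarrow> norm (sum f F) < e / 2"
      using C half_gt_zero[OF \<open>e > 0\<close>] by meson
    define P where "P F \<longleftrightarrow> finite F \<and> F0 \<subseteq> F" for F
    have close: "dist (sum f F) (sum f F0) < e / 2" if "P F" for F
      using that F0(2)[of "F - F0"] sum_diff[of F F0 f] by (auto simp: P_def dist_norm)
    have "eventually P (finite_subsets_at_top UNIV)"
      using F0(1) by (auto simp: P_def eventually_finite_subsets_at_top)
    moreover have "dist (sum f F) (sum f F') < e" if "P F" "P F'" for F F'
      using dist_triangle2[of "sum f F" "sum f F'" "sum f F0"] close[OF that(1)] close[OF that(2)]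
      by linarith
    ultimately show ?thesis by blast
  qed
  then have "cauchy_filter (filtermap (sum f) (finite_subsets_at_top UNIV))"
    by (simp add: cauchy_filter_metric_filtermap)
  moreover have "complete (UNIV::'b set)"
    by (meson Cauchy_convergent UNIV_I complete_def convergent_def)
  ultimately obtain L where "(sum f \<longlongrightarrow> L) (finite_subsets_at_top UNIV)"
    using complete_uniform[where S=UNIV] by (force simp add: filterlim_def)
  then show "f summable_on UNIV" by (auto simp: summable_on_def has_sum_def)
qed

lemma l2Z_iff:
  "x \<in> l2Z \<longleftrightarrow> (\<forall>e>0. \<exists>F0. finite F0 \<and> (\<forall>F. finite F \<longrightarrow> F \<inter> F0 = {} \<longrightarrow> l2_fin F x < e))"
proof -
  have "(\<forall>e>0. \<exists>F0. finite F0 \<and> (\<forall>F. finite F \<longrightarrow> F \<inter> F0 = {} \<longrightarrow> norm (\<Sum>n\<in>F. star (x n) * x n) < e))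
    \<longleftrightarrow> (\<forall>e>0. \<exists>F0. finite F0 \<and> (\<forall>F. finite F \<longrightarrow> F \<inter> F0 = {} \<longrightarrow> l2_fin F x < e))" (is "?L \<longleftrightarrow> ?R")
  proof
    assume L: ?L
    show ?R
    proof (intro allI impI)
      fix e :: real assume "e > 0"
      then obtain F0 where "finite F0" "\<And>F. finite F \<Longrightarrow> F \<inter> F0 = {} \<Longrightarrow> norm (\<Sum>n\<in>F. star (x n) * x n) < e\<^sup>2"
        using L[rule_format, of "e\<^sup>2"] by auto
      then show "\<exists>F0. finite F0 \<and> (\<forall>F. finite F \<longrightarrow> F \<inter> F0 = {} \<longrightarrow> l2_fin F x < e)"
        unfolding l2_fin_def using \<open>e > 0\<close>
        by (intro exI[of _ F0]) (metis real_less_lsqrt norm_ge_zero less_imp_le)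
    qed
  next
    assume R: ?R
    show ?L
    proof (intro allI impI)
      fix e :: real assume "e > 0"
      then obtain F0 where F0: "finite F0" "\<And>F. finite F \<Longrightarrow> F \<inter> F0 = {} \<Longrightarrow> l2_fin F x < sqrt e"
        using R[rule_format, of "sqrt e"] by auto
      then show "\<exists>F0. finite F0 \<and> (\<forall>F. finite F \<longrightarrow> F \<inter> F0 = {} \<longrightarrow> norm (\<Sum>n\<in>F. star (x n) * x n) < e)"
        unfolding l2_fin_def by (intro exI[of _ F0]) (auto simp: real_sqrt_less_iff)
    qed
  qed
  then show ?thesis by (simp add: l2Z_def summable_on_Cauchy_iff)
qed

lemma l2Z_add:
  assumes "x \<in> l2Z" "y \<in> l2Z" shows "(\<lambda>n. x n + y n) \<in> l2Z"
  unfolding l2Z_iff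
proof (intro allI impI)
  fix e :: real assume "e > 0"
  obtain F1 where F1: "finite F1" "\<And>F. finite F \<Longrightarrow> F \<inter> F1 = {} \<Longrightarrow> l2_fin F x < e / 2"
    using assms(1) half_gt_zero[OF \<open>e > 0\<close>] unfolding l2Z_iff by meson
  obtain F2 where F2: "finite F2" "\<And>F. finite F \<Longrightarrow> F \<inter> F2 = {} \<Longrightarrow> l2_fin F y < e / 2"
    using assms(2) half_gt_zero[OF \<open>e > 0\<close>] unfolding l2Z_iff by meson
  show "\<exists>F0. finite F0 \<and> (\<forall>F. finite F \<longrightarrow> F \<inter> F0 = {} \<longrightarrow> l2_fin F (\<lambda>n. x n + y n) < e)"
  proof (intro exI[of _ "F1 \<union> F2"] conjI allI impI)
    fix F assume F: "finite F" "F \<inter> (F1 \<union> F2) = {}"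
    have "l2_fin F x < e / 2" "l2_fin F y < e / 2" using F by (intro F1(2) F2(2); blast)+
    then show "l2_fin F (\<lambda>n. x n + y n) < e" using l2_fin_triangle[OF F(1), of x y] by linarith
  qed (use F1 F2 in auto)
qed

text \<open>Each summand is dominated in the order: (b x)* (b x) \<le> K^2 x* x. Norms of the
  individual terms would not suffice, because the norm is taken after summation.\<close>

lemma l2_fin_left_mult:
  assumes "finite F" "\<And>n. norm (b n) \<le> K"
  shows "l2_fin F (\<lambda>n. b n * x n) \<le> K * l2_fin F (x :: int \<Rightarrow> 'a::unital_cstar_algebra)"
proof -
  have K: "0 \<le> K" using order_trans[OF norm_ge_zero assms(2)] .
  have "norm (\<Sum>n\<in>F. star (b n * x n) * (b n * x n)) \<le> norm (K\<^sup>2 *\<^sub>R (\<Sum>n\<in>F. star (x n) * x n))"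
  proof (rule cpos_norm_mono)
    have c: "cpos (K\<^sup>2 *\<^sub>R (star (x n) * x n) - star (b n * x n) * (b n * x n))" for n
    proof -
      have "cpos ((K\<^sup>2 - (norm (b n))\<^sup>2) *\<^sub>R (star (x n) * x n))"
        using assms(2)[of n] by (intro cpos_scaleR cpos_star_mult) (simp add: power_mono)
      from cpos_add[OF this cpos_conj_le[of "b n" "x n"]] show ?thesis
        by (simp add: algebra_simps)
    qed
    show "cpos (K\<^sup>2 *\<^sub>R (\<Sum>n\<in>F. star (x n) * x n) - (\<Sum>n\<in>F. star (b n * x n) * (b n * x n)))"
      unfolding scaleR_sum_right sum_subtractf[symmetric] by (intro cpos_sum c)
  qed (auto intro!: cpos_sum cpos_star_mult cpos_scaleR)
  then have "l2_fin F (\<lambda>n. b n * x n) \<le> sqrt (K\<^sup>2 * norm (\<Sum>n\<in>F. star (x n) * x n))"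
    unfolding l2_fin_def by (intro real_sqrt_le_mono) simp
  then show ?thesis using K by (simp add: real_sqrt_mult l2_fin_def)
qed

text \<open>The bound holds for the same finite set on both sides, so it also compares tails, and
  tails decide membership.\<close>

lemma l2Z_bounded_transform:
  assumes x: "x \<in> l2Z" and K: "\<And>F. finite F \<Longrightarrow> l2_fin F y \<le> K * l2_fin F x"
  shows "y \<in> l2Z"
  unfolding l2Z_iff
proof (intro allI impI)
  fix e :: real assume "e > 0"
  then have "e / (\<bar>K\<bar> + 1) > 0" by simp
  then obtain F1 where F1: "finite F1" "\<And>F. finite F \<Longrightarrow> F \<inter> F1 = {} \<Longrightarrow> l2_fin F x < e / (\<bar>K\<bar> + 1)"
    using x unfolding l2Z_iff by meson
  show "\<exists>F0. finite F0 \<and> (\<forall>F. finite F \<longrightarrow> F \<inter> F0 = {} \<longrightarrow> l2_fin F y < e)"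
  proof (intro exI[of _ F1] conjI allI impI F1(1))
    fix F assume F: "finite F" "F \<inter> F1 = {}"
    have "l2_fin F y \<le> (\<bar>K\<bar> + 1) * l2_fin F x"
      by (rule order_trans[OF K[OF F(1)]]) (auto intro: mult_right_mono)
    also have "\<dots> < (\<bar>K\<bar> + 1) * (e / (\<bar>K\<bar> + 1))"
      using F1(2)[OF F] by (intro mult_strict_left_mono) auto
    finally show "l2_fin F y < e" by simp
  qed
qed

lemma l2Z_left_mult:
  assumes "x \<in> l2Z" "\<And>n. norm (b n) \<le> K" shows "(\<lambda>n. b n * x n) \<in> l2Z"
  using l2_fin_left_mult[OF _ assms(2)] by (rule l2Z_bounded_transform[OF assms(1)])

lemma l2Z_scaleC: "x \<in> l2Z \<Longrightarrow> (\<lambda>n. c *\<^sub>C x n) \<in> l2Z"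
  using l2Z_left_mult[of x "\<lambda>_. c *\<^sub>C 1" "cmod c"]
  by (simp add: norm_scaleC mult_scaleC_left)

lemma l2Z_scaleR: "x \<in> l2Z \<Longrightarrow> (\<lambda>n. r *\<^sub>R x n) \<in> l2Z"
  using l2Z_scaleC[of x "complex_of_real r"] by (simp add: scaleC_of_real)

lemma l2Z_uminus: "x \<in> l2Z \<Longrightarrow> (\<lambda>n. - x n) \<in> l2Z"
  using l2Z_scaleR[of x "-1"] by simp

lemma l2Z_diff: "x \<in> l2Z \<Longrightarrow> y \<in> l2Z \<Longrightarrow> (\<lambda>n. x n - y n) \<in> l2Z"
  using l2Z_add[of x "\<lambda>n. - y n"] l2Z_uminus[of y] by simp

lemma l2Z_finite_support:
  assumes "finite {n. x n \<noteq> 0}" shows "x \<in> l2Z"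
proof -
  have "(\<lambda>n. star (x n) * x n) summable_on {n. x n \<noteq> 0}" using assms by simp
  then show ?thesis unfolding l2Z_def
    by (simp, subst summable_on_cong_neutral[where T="{n. x n \<noteq> 0}" and g="\<lambda>n. star (x n) * x n"]) auto
qed

lemma l2Z_zero [simp]: "(\<lambda>_. 0) \<in> l2Z"
  by (rule l2Z_finite_support) simp

lemma l2Z_summable_mult:
  assumes "x \<in> l2Z" "y \<in> l2Z" shows "(\<lambda>n. star (x n) * y n) summable_on UNIV"
  unfolding summable_on_Cauchy_iff
proof (intro allI impI)
  fix e :: real assume "e > 0"
  then have "min e 1 > 0" by simp
  obtain F1 where F1: "finite F1" "\<And>F. finite F \<Longrightarrow> F \<inter> F1 = {} \<Longrightarrow> l2_fin F x < min e 1"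
    using assms(1) \<open>min e 1 > 0\<close> unfolding l2Z_iff by meson
  obtain F2 where F2: "finite F2" "\<And>F. finite F \<Longrightarrow> F \<inter> F2 = {} \<Longrightarrow> l2_fin F y < 1"
    using assms(2) zero_less_one unfolding l2Z_iff by meson
  show "\<exists>F0. finite F0 \<and> (\<forall>F. finite F \<longrightarrow> F \<inter> F0 = {} \<longrightarrow> norm (\<Sum>n\<in>F. star (x n) * y n) < e)"
  proof (intro exI[of _ "F1 \<union> F2"] conjI allI impI)
    fix F assume F: "finite F" "F \<inter> (F1 \<union> F2) = {}"
    have le: "l2_fin F x < min e 1" "l2_fin F y < 1" using F by (intro F1(2) F2(2); blast)+
    have "norm (\<Sum>n\<in>F. star (x n) * y n) \<le> l2_fin F x * l2_fin F y"
      by (rule l2_fin_Cauchy_Schwarz[OF F(1)])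
    also have "\<dots> \<le> l2_fin F x * 1" using le by (intro mult_left_mono) auto
    finally show "norm (\<Sum>n\<in>F. star (x n) * y n) < e" using le by simp
  qed (use F1 F2 in auto)
qed

lemma l2_inner_add_right:
  "x \<in> l2Z \<Longrightarrow> y \<in> l2Z \<Longrightarrow> z \<in> l2Z \<Longrightarrow> l2_inner x (\<lambda>n. y n + z n) = l2_inner x y + l2_inner x z"
  unfolding l2_inner_def distrib_left by (intro infsum_add l2Z_summable_mult)

lemma star_l2_inner:
  assumes "x \<in> l2Z" "y \<in> l2Z" shows "star (l2_inner x y) = l2_inner y x"
proof -
  have "star (l2_inner x y) = (\<Sum>\<^sub>\<infinity>n. star (star (x n) * y n))"
    unfolding l2_inner_def
    by (rule infsumI[symmetric, OF has_sum_bounded_linear[OF bounded_linear_star has_sum_infsum[OF l2Z_summable_mult[OF assms]]]])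
  then show ?thesis by (simp add: star_mult star_star l2_inner_def)
qed

lemma l2_inner_scaleC_right:
  assumes "x \<in> l2Z" "y \<in> l2Z" shows "l2_inner x (\<lambda>n. c *\<^sub>C y n) = c *\<^sub>C l2_inner x y"
  unfolding l2_inner_def mult_scaleC_right
  by (rule infsumI[OF has_sum_bounded_linear[OF bounded_linear_scaleC has_sum_infsum[OF l2Z_summable_mult[OF assms]]]])

lemma l2_fin_tendsto:
  assumes "x \<in> l2Z"
  shows "((\<lambda>F. l2_fin F x) \<longlongrightarrow> l2_norm x) (finite_subsets_at_top UNIV)"
  unfolding l2_fin_def l2_norm_def l2_inner_def
  by (intro tendsto_intros infsum_tendsto l2Z_summable_mult assms)

lemma l2_norm_le_if_fin:
  assumes "x \<in> l2Z" "\<And>F. finite F \<Longrightarrow> l2_fin F x \<le> K" shows "l2_norm x \<le> K"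
  by (rule tendsto_upperbound[OF l2_fin_tendsto[OF assms(1)]])
    (auto intro: eventually_finite_subsets_at_top_weakI assms(2))

lemma l2_fin_le_l2_norm:
  assumes "x \<in> l2Z" "finite F" shows "l2_fin F x \<le> l2_norm x"
proof (rule tendsto_lowerbound[OF l2_fin_tendsto[OF assms(1)]])
  have "l2_fin F x \<le> l2_fin F' x" if "finite F'" "F \<subseteq> F'" for F'
    unfolding l2_fin_def using sum_star_mult_mono[OF that, of x] by simp
  then show "\<forall>\<^sub>F F' in finite_subsets_at_top UNIV. l2_fin F x \<le> l2_fin F' x"
    using assms(2) by (auto simp: eventually_finite_subsets_at_top)
qed simp

lemma norm_le_l2_norm: "x \<in> l2Z \<Longrightarrow> norm (x n) \<le> l2_norm x"
  using l2_fin_le_l2_norm[of x "{n}"] by (simp add: l2_fin_def cstar_identity)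

lemma l2_Cauchy_Schwarz:
  assumes "x \<in> l2Z" "y \<in> l2Z" shows "norm (l2_inner x y) \<le> l2_norm x * l2_norm y"
proof (rule tendsto_le)
  show "((\<lambda>F. l2_fin F x * l2_fin F y) \<longlongrightarrow> l2_norm x * l2_norm y) (finite_subsets_at_top UNIV)"
    by (intro tendsto_intros l2_fin_tendsto assms)
  show "((\<lambda>F. norm (\<Sum>n\<in>F. star (x n) * y n)) \<longlongrightarrow> norm (l2_inner x y)) (finite_subsets_at_top UNIV)"
    unfolding l2_inner_def by (intro tendsto_intros infsum_tendsto l2Z_summable_mult assms)
qed (auto intro: eventually_finite_subsets_at_top_weakI l2_fin_Cauchy_Schwarz)

lemma l2_norm_triangle:
  assumes "x \<in> l2Z" "y \<in> l2Z" shows "l2_norm (\<lambda>n. x n + y n) \<le> l2_norm x + l2_norm y"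
  by (rule l2_norm_le_if_fin[OF l2Z_add[OF assms]])
    (intro order_trans[OF l2_fin_triangle] add_mono l2_fin_le_l2_norm assms)

lemma l2_norm_scaleC:
  assumes "x \<in> l2Z" shows "l2_norm (\<lambda>n. c *\<^sub>C x n) = cmod c * l2_norm x"
proof -
  have "l2_inner (\<lambda>n. c *\<^sub>C x n) (\<lambda>n. c *\<^sub>C x n) = (c * cnj c) *\<^sub>C l2_inner x x"
    using l2_inner_scaleC_right[OF assms assms, of "c * cnj c"]
    by (simp add: l2_inner_def star_scaleC mult_scaleC_left mult_scaleC_right scaleC_scaleC mult.commute)
  then show ?thesis
    by (simp add: l2_norm_def norm_scaleC norm_mult real_sqrt_mult)
qed

text \<open>The limit is formed coordinatewise. The Cauchy estimate passes to it on every finite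
  section with a bound independent of the section, which gives both membership and convergence in
  norm.\<close>

lemma l2Z_complete:
  fixes X :: "nat \<Rightarrow> int \<Rightarrow> 'b::unital_cstar_algebra"
  assumes X: "\<And>k. X k \<in> l2Z"
    and Cauchy: "\<And>e. e > 0 \<Longrightarrow> \<exists>M. \<forall>k\<ge>M. \<forall>l\<ge>M. l2_norm (\<lambda>n. X k n - X l n) < e"
  shows "\<exists>x\<in>l2Z. \<forall>e>0. \<exists>M. \<forall>k\<ge>M. l2_norm (\<lambda>n. X k n - x n) \<le> e"
proof -
  have "convergent (\<lambda>k. X k n)" for n
  proof (rule Cauchy_convergent, rule metric_CauchyI)
    fix e :: real assume "e > 0"
    then obtain M where M: "\<forall>k\<ge>M. \<forall>l\<ge>M. l2_norm (\<lambda>n. X k n - X l n) < e" using Cauchy by blast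
    have "dist (X k n) (X l n) < e" if "k \<ge> M" "l \<ge> M" for k l
      using norm_le_l2_norm[OF l2Z_diff[OF X[of k] X[of l]], of n] M that by (fastforce simp: dist_norm)
    then show "\<exists>M. \<forall>m\<ge>M. \<forall>l\<ge>M. dist (X m n) (X l n) < e" by blast
  qed
  then obtain x where x: "\<And>n. (\<lambda>k. X k n) \<longlonglongrightarrow> x n"
    unfolding convergent_def by metis
  have fin: "\<exists>M. \<forall>k\<ge>M. \<forall>F. finite F \<longrightarrow> l2_fin F (\<lambda>n. X k n - x n) \<le> e" if "e > 0" for e
  proof -
    obtain M where M: "\<forall>k\<ge>M. \<forall>l\<ge>M. l2_norm (\<lambda>n. X k n - X l n) < e" using Cauchy[OF \<open>e > 0\<close>] by blast
    have "l2_fin F (\<lambda>n. X k n - x n) \<le> e" if "k \<ge> M" "finite F" for k F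
    proof (rule tendsto_upperbound)
      show "(\<lambda>l. l2_fin F (\<lambda>n. X k n - X l n)) \<longlonglongrightarrow> l2_fin F (\<lambda>n. X k n - x n)"
        unfolding l2_fin_def
        by (intro tendsto_intros bounded_linear.tendsto[OF bounded_linear_star] x)
      show "\<forall>\<^sub>F l in sequentially. l2_fin F (\<lambda>n. X k n - X l n) \<le> e"
        unfolding eventually_sequentially
        using l2_fin_le_l2_norm[OF l2Z_diff[OF X X] that(2)] M that(1) by (meson less_imp_le order_trans)
    qed simp
    then show ?thesis by blast
  qed
  have xl2: "x \<in> l2Z"
    unfolding l2Z_iff
  proof (intro allI impI)
    fix e :: real assume "e > 0"
    obtain k where k: "\<And>F. finite F \<Longrightarrow> l2_fin F (\<lambda>n. X k n - x n) \<le> e / 2"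
      using fin[OF half_gt_zero[OF \<open>e > 0\<close>]] by blast
    obtain F0 where F0: "finite F0" "\<And>F. finite F \<Longrightarrow> F \<inter> F0 = {} \<Longrightarrow> l2_fin F (X k) < e / 2"
      using X[of k] half_gt_zero[OF \<open>e > 0\<close>] unfolding l2Z_iff by meson
    have "l2_fin F x < e" if F: "finite F" "F \<inter> F0 = {}" for F
      using l2_fin_triangle[OF F(1), of "X k" "\<lambda>n. x n - X k n"] F0(2)[OF F] k[OF F(1)]
        l2_fin_diff_commute[of F "X k" x] by simp
    then show "\<exists>F0. finite F0 \<and> (\<forall>F. finite F \<longrightarrow> F \<inter> F0 = {} \<longrightarrow> l2_fin F x < e)"
      using F0(1) by blast
  qed
  show ?thesis
  proof (intro bexI[OF _ xl2] allI impI)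
    fix e :: real assume "e > 0"
    then obtain M where "\<forall>k\<ge>M. \<forall>F. finite F \<longrightarrow> l2_fin F (\<lambda>n. X k n - x n) \<le> e"
      using fin by blast
    then have "l2_norm (\<lambda>n. X k n - x n) \<le> e" if "k \<ge> M" for k
      using that by (intro l2_norm_le_if_fin[OF l2Z_diff[OF X xl2]]) simp
    then show "\<exists>M. \<forall>k\<ge>M. l2_norm (\<lambda>n. X k n - x n) \<le> e" by blast
  qed
qed

section \<open>The C*-algebra of adjointable operators\<close>

text \<open>As a type of its own the Hilbert module becomes a Banach space, so that bounded
  operators and Baire's theorem apply to it.\<close>

typedef (overloaded) 'b l2 = "l2Z :: (int \<Rightarrow> 'b::unital_cstar_algebra) set"
  morphisms l2_seq Abs_l2
  using l2Z_zero by blast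

setup_lifting type_definition_l2

lemma l2_seq_l2Z [simp]: "l2_seq x \<in> l2Z"
  by (rule l2_seq)

lemma l2_norm_scaleR: "x \<in> l2Z \<Longrightarrow> l2_norm (\<lambda>n. r *\<^sub>R x n) = \<bar>r\<bar> * l2_norm x"
  using l2_norm_scaleC[of x "complex_of_real r"] by (simp add: scaleC_of_real)

instantiation l2 :: (unital_cstar_algebra) real_normed_vector
begin

lift_definition zero_l2 :: "'a l2" is "\<lambda>_. 0" by simp
lift_definition plus_l2 :: "'a l2 \<Rightarrow> 'a l2 \<Rightarrow> 'a l2" is "\<lambda>x y n. x n + y n" by (rule l2Z_add)
lift_definition minus_l2 :: "'a l2 \<Rightarrow> 'a l2 \<Rightarrow> 'a l2" is "\<lambda>x y n. x n - y n" by (rule l2Z_diff)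
lift_definition uminus_l2 :: "'a l2 \<Rightarrow> 'a l2" is "\<lambda>x n. - x n" by (rule l2Z_uminus)
lift_definition scaleR_l2 :: "real \<Rightarrow> 'a l2 \<Rightarrow> 'a l2" is "\<lambda>r x n. r *\<^sub>R x n" by (rule l2Z_scaleR)
lift_definition norm_l2 :: "'a l2 \<Rightarrow> real" is l2_norm .
definition dist_l2 :: "'a l2 \<Rightarrow> 'a l2 \<Rightarrow> real" where "dist_l2 x y = norm (x - y)"
definition sgn_l2 :: "'a l2 \<Rightarrow> 'a l2" where "sgn_l2 x = inverse (norm x) *\<^sub>R x"
definition uniformity_l2 :: "('a l2 \<times> 'a l2) filter" where
  "uniformity_l2 = (INF e\<in>{0 <..}. principal {(x, y). dist x y < e})"
definition open_l2 :: "'a l2 set \<Rightarrow> bool" where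
  "open_l2 U = (\<forall>x\<in>U. \<forall>\<^sub>F (x', y) in uniformity. x' = x \<longrightarrow> y \<in> U)"

instance
proof
  fix x y z :: "'a l2" and a b :: real
  show "x + y + z = x + (y + z)" "x + y = y + x" "0 + x = x" "- x + x = 0" "x - y = x + - y"
    by (transfer; simp add: ac_simps)+
  show "a *\<^sub>R (x + y) = a *\<^sub>R x + a *\<^sub>R y" "(a + b) *\<^sub>R x = a *\<^sub>R x + b *\<^sub>R x"
    "a *\<^sub>R b *\<^sub>R x = (a * b) *\<^sub>R x" "1 *\<^sub>R x = x"
    by (transfer; simp add: scaleR_add_right scaleR_add_left)+
  show "norm (x + y) \<le> norm x + norm y" by transfer (rule l2_norm_triangle)
  show "norm (a *\<^sub>R x) = \<bar>a\<bar> * norm x"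
    by transfer (rule l2_norm_scaleR)
  show "norm x = 0 \<longleftrightarrow> x = 0"
  proof
    show "norm x = 0 \<Longrightarrow> x = 0"
    proof (transfer, rule ext)
      fix x :: "int \<Rightarrow> 'a" and n assume "x \<in> l2Z" "l2_norm x = 0"
      then show "x n = 0" using norm_le_l2_norm[of x n] by simp
    qed
    show "x = 0 \<Longrightarrow> norm x = 0"
      by (simp, transfer) (simp add: l2_norm_def l2_inner_def)
  qed
qed (rule dist_l2_def sgn_l2_def uniformity_l2_def open_l2_def)+

end

instantiation l2 :: (unital_cstar_algebra) scaleC
begin
lift_definition scaleC_l2 :: "complex \<Rightarrow> 'a l2 \<Rightarrow> 'a l2" is "\<lambda>c x n. c *\<^sub>C x n" by (rule l2Z_scaleC)
instance ..
end

instance l2 :: (unital_cstar_algebra) banach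
proof
  fix X :: "nat \<Rightarrow> 'a l2" assume C: "Cauchy X"
  have C': "\<exists>M. \<forall>k\<ge>M. \<forall>l\<ge>M. l2_norm (\<lambda>n. l2_seq (X k) n - l2_seq (X l) n) < e" if "e > 0" for e
    using CauchyD[OF C that] by (simp add: norm_l2.rep_eq minus_l2.rep_eq)
  obtain x where x: "x \<in> l2Z"
    "\<And>e. e > 0 \<Longrightarrow> \<exists>M. \<forall>k\<ge>M. l2_norm (\<lambda>n. l2_seq (X k) n - x n) \<le> e"
    using l2Z_complete[where X="\<lambda>k. l2_seq (X k)", OF l2_seq_l2Z C'] by blast
  have "X \<longlonglongrightarrow> Abs_l2 x"
  proof (rule LIMSEQ_I)
    fix e :: real assume "e > 0"
    then obtain M where M: "\<forall>k\<ge>M. l2_norm (\<lambda>n. l2_seq (X k) n - x n) \<le> e / 2"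
      using x(2)[of "e / 2"] by auto
    show "\<exists>no. \<forall>n\<ge>no. norm (X n - Abs_l2 x) < e"
      using M \<open>e > 0\<close> by (intro exI[of _ M])
        (fastforce simp: norm_l2.rep_eq minus_l2.rep_eq Abs_l2_inverse[OF x(1)])
  qed
  then show "convergent X" by (auto simp: convergent_def)
qed

lift_definition l2i :: "'b::unital_cstar_algebra l2 \<Rightarrow> 'b l2 \<Rightarrow> 'b" is l2_inner .

lemma star_l2i: "star (l2i x y) = l2i y x"
  by transfer (rule star_l2_inner)

lemma l2i_add_right: "l2i x (y + z) = l2i x y + l2i x z"
  by transfer (rule l2_inner_add_right)

lemma l2i_scaleC_right: "l2i x (c *\<^sub>C y) = c *\<^sub>C l2i x y"
  by transfer (rule l2_inner_scaleC_right)

lemma scaleC_of_real_l2: "complex_of_real r *\<^sub>C x = r *\<^sub>R (x::'b::unital_cstar_algebra l2)"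
  by transfer (simp add: scaleC_of_real)

lemma scaleC_one_l2: "1 *\<^sub>C (x::'b::unital_cstar_algebra l2) = x"
  by transfer simp

lemma norm_scaleC_l2: "norm (c *\<^sub>C (x::'b::unital_cstar_algebra l2)) = cmod c * norm x"
  by transfer (rule l2_norm_scaleC)

lemma scaleC_add_right_l2: "c *\<^sub>C (x + y) = c *\<^sub>C x + c *\<^sub>C (y::'b::unital_cstar_algebra l2)"
  by transfer (simp add: scaleC_add_right)

lemma scaleC_add_left_l2: "(c + d) *\<^sub>C x = c *\<^sub>C x + d *\<^sub>C (x::'b::unital_cstar_algebra l2)"
  by transfer (simp add: scaleC_add_left)

lemma scaleC_scaleC_l2: "c *\<^sub>C d *\<^sub>C x = (c * d) *\<^sub>C (x::'b::unital_cstar_algebra l2)"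
  by transfer (simp add: scaleC_scaleC)

lemma l2i_scaleR_right: "l2i x (r *\<^sub>R y) = r *\<^sub>R l2i x y"
  using l2i_scaleC_right[of x "complex_of_real r" y] by (simp add: scaleC_of_real_l2 scaleC_of_real)

lemma l2i_add_left: "l2i (x + y) z = l2i x z + l2i y z"
  by (metis l2i_add_right star_add star_l2i)

lemma l2i_scaleR_left: "l2i (r *\<^sub>R x) y = r *\<^sub>R l2i x y"
  by (metis l2i_scaleR_right star_scaleR star_l2i)

lemma l2i_scaleC_left: "l2i (c *\<^sub>C x) y = cnj c *\<^sub>C l2i x y"
  by (metis l2i_scaleC_right star_scaleC star_l2i)

lemma norm_l2i_le: "norm (l2i x y) \<le> norm x * norm y"
  by transfer (rule l2_Cauchy_Schwarz)

lemma norm_l2_square: "(norm x)\<^sup>2 = norm (l2i x x)"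
  by transfer (simp add: l2_norm_def)

lemma bounded_bilinear_l2i: "bounded_bilinear (l2i :: 'b::unital_cstar_algebra l2 \<Rightarrow> _)"
  by unfold_locales
    (auto intro!: exI[of _ 1] simp: l2i_add_left l2i_add_right l2i_scaleR_left l2i_scaleR_right norm_l2i_le)

lemma l2i_diff_right: "l2i x (y - z) = l2i x y - l2i x z"
  by (rule bounded_bilinear.diff_right[OF bounded_bilinear_l2i])

lemma l2i_zero_iff: "(\<forall>y. l2i y x = 0) \<longleftrightarrow> x = 0"
proof
  assume "\<forall>y. l2i y x = 0"
  then have "(norm x)\<^sup>2 = 0" by (simp add: norm_l2_square)
  then show "x = 0" by simp
qed (simp add: bounded_bilinear.zero_right[OF bounded_bilinear_l2i])

lemma l2i_eqI: "(\<And>z. l2i z x = l2i z y) \<Longrightarrow> x = y"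
  using l2i_zero_iff[of "x - y"] by (simp add: l2i_diff_right)

section \<open>Adjoint pairs and their automatic boundedness\<close>

text \<open>Nothing but the adjoint relation is asked of the two maps; linearity follows by testing
  against vectors, boundedness from Baire's theorem.\<close>

definition adj_pair :: "('b l2 \<Rightarrow> 'b l2) \<Rightarrow> ('b l2 \<Rightarrow> 'b::unital_cstar_algebra l2) \<Rightarrow> bool" where
  "adj_pair T S \<longleftrightarrow> (\<forall>x y. l2i (T x) y = l2i x (S y))"

lemma adj_pair_sym: "adj_pair T S \<Longrightarrow> adj_pair S T"
  unfolding adj_pair_def by (metis star_l2i)

lemma adj_pair_unique: "adj_pair T S \<Longrightarrow> adj_pair T S' \<Longrightarrow> S = S'"
  unfolding adj_pair_def by (intro ext l2i_eqI) metis

lemma adj_pair_linear: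
  assumes "adj_pair T S"
  shows "T (x + y) = T x + T y" "T (r *\<^sub>R x) = r *\<^sub>R T x" "T (c *\<^sub>C x) = c *\<^sub>C T x"
proof -
  have *: "l2i z (T x) = l2i (S z) x" for z x
    using adj_pair_sym[OF assms] by (simp add: adj_pair_def)
  show "T (x + y) = T x + T y" "T (r *\<^sub>R x) = r *\<^sub>R T x" "T (c *\<^sub>C x) = c *\<^sub>C T x"
    by (rule l2i_eqI, simp add: * l2i_add_right l2i_scaleR_right l2i_scaleC_right)+
qed

lemma adj_pair_norm_le:
  assumes "adj_pair T S" "\<And>x. norm (T x) \<le> K * norm x"
  shows "norm (S y) \<le> K * norm y"
proof (cases "S y = 0")
  case True
  have "0 \<le> norm (T y)" by simp
  then have "0 \<le> K * norm y" using assms(2)[of y] by linarith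
  then show ?thesis using True by simp
next
  case False
  have "norm (S y) * norm (S y) = norm (l2i (T (S y)) y)"
    using assms(1) norm_l2_square[of "S y"] by (simp add: adj_pair_def power2_eq_square)
  also have "\<dots> \<le> norm (T (S y)) * norm y" by (rule norm_l2i_le)
  also have "\<dots> \<le> K * norm (S y) * norm y" by (intro mult_right_mono assms) simp
  finally have "norm (S y) * norm (S y) \<le> (K * norm y) * norm (S y)" by (simp add: ac_simps)
  then show ?thesis using False by simp
qed

text \<open>The functionals \<open>\<langle>y, T x\<rangle>\<close> are continuous in \<open>x\<close> because \<open>T\<close> has an adjoint, so Baire's theorem applies.\<close>

lemma adj_pair_bounded:
  fixes T :: "'b::unital_cstar_algebra l2 \<Rightarrow> 'b l2"
  assumes "adj_pair T S"
  obtains K where "\<And>x. norm (T x) \<le> K * norm x"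
proof -
  note lin = adj_pair_linear[OF assms]
  define f where "f y x = l2i y (T x)" for y x
  have fS: "f y x = l2i (S y) x" for y x
    using adj_pair_sym[OF assms] by (simp add: f_def adj_pair_def)
  \<comment> \<open>These are the sublevel sets of \<open>norm (T x)\<close>, written through the
    functionals \<open>f y\<close>: their closedness needs only the continuity of each
    \<open>f y\<close>, while that of T is still to be shown.\<close>
  define E where "E k = {x. \<forall>y. norm y \<le> 1 \<longrightarrow> norm (f y x) \<le> real k}" for k :: nat
  have closedE: "closed (E k)" for k
  proof -
    have eq: "E k = (\<Inter>y\<in>{y. norm y \<le> 1}. {x. norm (l2i (S y) x) \<le> real k})"
      by (auto simp: E_def fS)
    have "continuous_on UNIV (\<lambda>x. l2i (S y) x)" for y
      by (rule linear_continuous_on[OF bounded_bilinear.bounded_linear_right[OF bounded_bilinear_l2i]])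
    then show ?thesis unfolding eq by (intro closed_INT ballI closed_Collect_le continuous_intros)
  qed
  have cover: "(\<Union>k. E k) = UNIV"
  proof -
    have "\<exists>k. x \<in> E k" for x
    proof -
      obtain k :: nat where k: "norm (T x) \<le> real k" using real_arch_simple by blast
      have "norm (f y x) \<le> real k" if "norm y \<le> 1" for y
        using norm_l2i_le[of y "T x"] that k mult_right_mono[OF that norm_ge_zero[of "T x"]]
        by (simp add: f_def)
      then show ?thesis by (auto simp: E_def)
    qed
    then show ?thesis by blast
  qed
  have "\<exists>k. interior (E k) \<noteq> {}"
  proof (rule ccontr)
    assume "\<not> ?thesis"
    then have "euclidean interior_of (\<Union>(range E)) = {}"
      using completely_metrizable_space_euclidean
      by (intro Baire_category_alt) (auto simp: closedE)
    then show False using cover by simp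
  qed
  then obtain k x0 where "x0 \<in> interior (E k)" by blast
  then obtain e where e: "e > 0" "cball x0 e \<subseteq> E k"
    using mem_interior_cball by metis
  have bound: "norm (T x) \<le> (2 * real k / e) * norm x" for x
  proof (cases "x = 0")
    case True
    have "T 0 = 0" using lin(2)[of 0 0] by simp
    then show ?thesis using True by simp
  next
    case False
    define w where "w = (e / norm x) *\<^sub>R x"
    have "norm w = e" using False e(1) by (simp add: w_def)
    have mem: "x0 \<in> E k" "x0 + w \<in> E k" using e \<open>norm w = e\<close> by (auto simp: dist_norm)
    have fw: "norm (f y w) \<le> 2 * real k" if "norm y \<le> 1" for y
    proof -
      have "f y w = f y (x0 + w) - f y x0" by (simp add: f_def lin l2i_add_right)
      then have "norm (f y w) \<le> norm (f y (x0 + w)) + norm (f y x0)"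
        by (simp only: norm_triangle_ineq4)
      then show ?thesis using mem that by (auto simp: E_def intro: order_trans)
        (smt (verit, best) mem(1) mem(2) that E_def mem_Collect_eq)
    qed
    have "norm (T w) \<le> 2 * real k"
    proof (cases "T w = 0")
      case False
      have "norm (f ((1 / norm (T w)) *\<^sub>R T w) w) = norm (T w)"
        using False norm_l2_square[of "T w", symmetric]
        by (simp add: f_def l2i_scaleR_left power2_eq_square)
      then show ?thesis using fw[of "(1 / norm (T w)) *\<^sub>R T w"] False by simp
    qed simp
    then have "(e / norm x) * norm (T x) \<le> 2 * real k" using e(1) by (simp add: w_def lin)
    then show ?thesis using e(1) False by (simp add: field_simps)
  qed
  then show ?thesis by (rule that)
qed

lemma adj_pair_bounded_linear:
  assumes "adj_pair T S" shows "bounded_linear T"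
proof -
  obtain K where "\<And>x. norm (T x) \<le> K * norm x" using adj_pair_bounded[OF assms] by blast
  then show ?thesis
    by (intro bounded_linear_intro[where K=K]) (auto simp: adj_pair_linear[OF assms] mult.commute)
qed

text \<open>The ambient type \<open>l2_op\<close> contains arbitrary maps and is no C*-algebra. This
  type is made an instance of the class, so that the theory of positive elements applies to
  operators as well as to B.\<close>

typedef (overloaded) 'b adj = "{T :: 'b l2 \<Rightarrow>\<^sub>L 'b::unital_cstar_algebra l2. \<exists>S. adj_pair (blinfun_apply T) S}"
  morphisms adj_blinfun Abs_adj
  by (rule exI[of _ id_blinfun]) (auto simp: adj_pair_def intro!: exI[of _ "\<lambda>x. x"])

definition adj_app :: "'b::unital_cstar_algebra adj \<Rightarrow> 'b l2 \<Rightarrow> 'b l2" where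
  "adj_app T = blinfun_apply (adj_blinfun T)"

lemma adj_app_cong: "(\<And>x. adj_app S x = adj_app T x) \<Longrightarrow> S = T"
  by (metis adj_app_def adj_blinfun_inject blinfun_eqI)

lemma ex_adj_pair: "\<exists>S. adj_pair (adj_app T) S"
  using adj_blinfun[of T] by (simp add: adj_app_def)

definition mk_adj :: "('b l2 \<Rightarrow> 'b::unital_cstar_algebra l2) \<Rightarrow> 'b adj" where
  "mk_adj f = Abs_adj (Blinfun f)"

lemma adj_app_mk_adj: "adj_pair f g \<Longrightarrow> adj_app (mk_adj f) = f"
  unfolding mk_adj_def adj_app_def
  using adj_pair_bounded_linear[of f g] bounded_linear_Blinfun_apply[of f]
  by (subst Abs_adj_inverse) auto

definition adj_star :: "'b::unital_cstar_algebra adj \<Rightarrow> 'b l2 \<Rightarrow> 'b l2" where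
  "adj_star T = (SOME S. adj_pair (adj_app T) S)"

lemma adj_pair_adj_star: "adj_pair (adj_app T) (adj_star T)"
  unfolding adj_star_def by (rule someI_ex[OF ex_adj_pair])

lemmas adj_app_linear = adj_pair_linear[OF adj_pair_adj_star]

lemma adj_star_eqI: "adj_pair (adj_app T) S \<Longrightarrow> adj_star T = S"
  using adj_pair_adj_star adj_pair_unique by blast

lemma adj_pair_add:
  "adj_pair f g \<Longrightarrow> adj_pair f' g' \<Longrightarrow> adj_pair (\<lambda>x. f x + f' x) (\<lambda>x. g x + g' x)"
  by (simp add: adj_pair_def l2i_add_left l2i_add_right)

lemma adj_pair_scaleC: "adj_pair f g \<Longrightarrow> adj_pair (\<lambda>x. c *\<^sub>C f x) (\<lambda>x. cnj c *\<^sub>C g x)"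
  by (simp add: adj_pair_def l2i_scaleC_left l2i_scaleC_right)

lemma adj_pair_scaleR: "adj_pair f g \<Longrightarrow> adj_pair (\<lambda>x. r *\<^sub>R f x) (\<lambda>x. r *\<^sub>R g x)"
  by (simp add: adj_pair_def l2i_scaleR_left l2i_scaleR_right)

lemma adj_pair_minus: "adj_pair f g \<Longrightarrow> adj_pair (\<lambda>x. - f x) (\<lambda>x. - g x)"
  using adj_pair_scaleR[of f g "-1"] by simp

lemma adj_pair_diff:
  "adj_pair f g \<Longrightarrow> adj_pair f' g' \<Longrightarrow> adj_pair (\<lambda>x. f x - f' x) (\<lambda>x. g x - g' x)"
  using adj_pair_add[of f g "\<lambda>x. - f' x" "\<lambda>x. - g' x"] adj_pair_minus[of f' g'] by simp

lemma adj_pair_comp: "adj_pair f g \<Longrightarrow> adj_pair f' g' \<Longrightarrow> adj_pair (\<lambda>x. f (f' x)) (\<lambda>x. g' (g x))"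
  by (simp add: adj_pair_def)

lemma adj_pair_id: "adj_pair (\<lambda>x. x) (\<lambda>x. x)"
  by (simp add: adj_pair_def)

lemma adj_pair_zero: "adj_pair (\<lambda>x. 0) (\<lambda>x. 0)"
  using adj_pair_scaleR[OF adj_pair_id, of 0] by simp

instantiation adj :: (unital_cstar_algebra) real_normed_vector
begin

definition "0 = mk_adj (\<lambda>x. 0)"
definition "S + T = mk_adj (\<lambda>x. adj_app S x + adj_app T x)"
definition "S - T = mk_adj (\<lambda>x. adj_app S x - adj_app T x)"
definition "- T = mk_adj (\<lambda>x. - adj_app T x)"
definition "r *\<^sub>R T = mk_adj (\<lambda>x. r *\<^sub>R adj_app T x)"
definition norm_adj :: "'a adj \<Rightarrow> real" where "norm_adj T = norm (adj_blinfun T)"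
definition dist_adj :: "'a adj \<Rightarrow> 'a adj \<Rightarrow> real" where "dist_adj x y = norm (x - y)"
definition sgn_adj :: "'a adj \<Rightarrow> 'a adj" where "sgn_adj x = inverse (norm x) *\<^sub>R x"
definition uniformity_adj :: "('a adj \<times> 'a adj) filter" where
  "uniformity_adj = (INF e\<in>{0 <..}. principal {(x, y). dist x y < e})"
definition open_adj :: "'a adj set \<Rightarrow> bool" where
  "open_adj U = (\<forall>x\<in>U. \<forall>\<^sub>F (x', y) in uniformity. x' = x \<longrightarrow> y \<in> U)"

lemma adj_app_vector_simps:
  "adj_app 0 x = 0" "adj_app (S + T) x = adj_app S x + adj_app T x"
  "adj_app (S - T) x = adj_app S x - adj_app T x" "adj_app (- T) x = - adj_app T x"
  "adj_app (r *\<^sub>R T) x = r *\<^sub>R adj_app T x"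
  unfolding zero_adj_def plus_adj_def minus_adj_def uminus_adj_def scaleR_adj_def
  by (subst adj_app_mk_adj; (rule adj_pair_zero adj_pair_add adj_pair_diff adj_pair_minus
        adj_pair_scaleR adj_pair_adj_star refl)+)+

lemma adj_blinfun_vector_simps:
  "adj_blinfun (S + T) = adj_blinfun S + adj_blinfun T"
  "adj_blinfun (S - T) = adj_blinfun S - adj_blinfun T"
  "adj_blinfun (r *\<^sub>R T) = r *\<^sub>R adj_blinfun T"
  "adj_blinfun 0 = 0"
  using adj_app_vector_simps by (intro blinfun_eqI; simp add: adj_app_def blinfun.bilinear_simps)+

instance
proof
  fix x y z :: "'a adj" and a b :: real
  show "x + y + z = x + (y + z)" "x + y = y + x" "0 + x = x" "- x + x = 0" "x - y = x + - y"
    "a *\<^sub>R (x + y) = a *\<^sub>R x + a *\<^sub>R y" "(a + b) *\<^sub>R x = a *\<^sub>R x + b *\<^sub>R x"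
    "a *\<^sub>R b *\<^sub>R x = (a * b) *\<^sub>R x" "1 *\<^sub>R x = x"
    by (rule adj_app_cong; simp add: algebra_simps adj_app_vector_simps)+
  show "norm (x + y) \<le> norm x + norm y" "norm (a *\<^sub>R x) = \<bar>a\<bar> * norm x"
    by (simp_all add: norm_adj_def adj_blinfun_vector_simps norm_triangle_ineq)
  show "norm x = 0 \<longleftrightarrow> x = 0"
    by (simp add: norm_adj_def) (metis adj_blinfun_inject adj_blinfun_vector_simps(4))
qed (rule dist_adj_def sgn_adj_def uniformity_adj_def open_adj_def)+

end

instantiation adj :: (unital_cstar_algebra) "{one,times,scaleC,star}"
begin
definition "1 = mk_adj (\<lambda>x. x)"
definition "S * T = mk_adj (\<lambda>x. adj_app S (adj_app T x))"
definition "c *\<^sub>C T = mk_adj (\<lambda>x. c *\<^sub>C adj_app T x)"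
definition "star T = mk_adj (adj_star T)"
instance ..
end

lemma adj_app_algebra_simps:
  "adj_app 1 x = x" "adj_app (S * T) x = adj_app S (adj_app T x)"
  "adj_app (c *\<^sub>C T) x = c *\<^sub>C adj_app T x" "adj_app (star T) x = adj_star T x"
  unfolding one_adj_def times_adj_def scaleC_adj_def star_adj_def
  by (subst adj_app_mk_adj; (rule adj_pair_id adj_pair_scaleC[OF adj_pair_adj_star]
        adj_pair_comp[OF adj_pair_adj_star adj_pair_adj_star] adj_pair_sym[OF adj_pair_adj_star] refl)+)+

lemmas adj_app_simps [simp] = adj_app_vector_simps adj_app_algebra_simps

lemma adj_blinfun_mult: "adj_blinfun (S * T) = adj_blinfun S o\<^sub>L adj_blinfun T"
  using adj_app_simps by (intro blinfun_eqI; simp add: adj_app_def)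

lemma norm_adj_app_le: "norm (adj_app T x) \<le> norm T * norm x"
  by (simp add: adj_app_def norm_adj_def norm_blinfun)

lemma norm_adj_le:
  assumes "\<And>x. norm (adj_app T x) \<le> K * norm x" "0 \<le> K" shows "norm T \<le> K"
  unfolding norm_adj_def by (rule norm_blinfun_bound) (use assms in \<open>auto simp: adj_app_def mult.commute\<close>)

lemma l2i_adj_star: "l2i (adj_app T x) y = l2i x (adj_star T y)"
  using adj_pair_adj_star by (auto simp: adj_pair_def)

lemma l2i_adj_star': "l2i (adj_star T x) y = l2i x (adj_app T y)"
  using adj_pair_sym[OF adj_pair_adj_star] by (auto simp: adj_pair_def)

lemma adj_app_star_star: "adj_star (star T) x = adj_app T x"
  by (rule l2i_eqI) (simp flip: l2i_adj_star add: l2i_adj_star')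

lemma norm_star_adj_le: "norm (star T) \<le> norm (T::'b::unital_cstar_algebra adj)"
  by (rule norm_adj_le) (simp_all add: adj_pair_norm_le[OF adj_pair_adj_star norm_adj_app_le])

definition l2_unit :: "int \<Rightarrow> 'b::unital_cstar_algebra \<Rightarrow> 'b l2" where
  "l2_unit n b = Abs_l2 (\<lambda>m. if m = n then b else 0)"

lemma l2_seq_l2_unit: "l2_seq (l2_unit n b) = (\<lambda>m. if m = n then b else 0)"
proof -
  have "finite {m. (if m = n then b else 0) \<noteq> 0}" by (rule finite_subset[of _ "{n}"]) auto
  then show ?thesis unfolding l2_unit_def by (intro Abs_l2_inverse l2Z_finite_support)
qed

lemma l2i_l2_unit: "l2i (l2_unit n b) x = star b * l2_seq x n"
proof -
  have "l2i (l2_unit n b) x = (\<Sum>\<^sub>\<infinity>m. if m = n then star b * l2_seq x n else 0)"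
    by (simp add: l2i.rep_eq l2_inner_def l2_seq_l2_unit if_distrib[of star] cong: if_cong)
      (rule infsum_cong, auto)
  also have "\<dots> = (\<Sum>\<^sub>\<infinity>m\<in>{n}. star b * l2_seq x n)"
    by (rule infsum_cong_neutral) auto
  finally show ?thesis by simp
qed

lemma norm_l2_unit: "norm (l2_unit n b) = norm b"
proof -
  have "(norm (l2_unit n b))\<^sup>2 = (norm b)\<^sup>2"
    by (simp add: norm_l2_square l2i_l2_unit l2_seq_l2_unit cstar_identity)
  then show ?thesis by simp
qed

text \<open>The square of \<open>norm (adj_app T x)\<close> is the norm of the inner product of x
  with T* T x, hence at most the norm of T* T times that of x squared.\<close>

lemma adj_cstar_identity: "norm (star T * T) = (norm (T::'b::unital_cstar_algebra adj))\<^sup>2"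
proof (rule antisym)
  have mult: "norm (S * T) \<le> norm S * norm T" for S :: "'b adj"
    unfolding norm_adj_def adj_blinfun_mult by (rule norm_blinfun_compose)
  have n0: "0 \<le> norm S" for S :: "'b adj" by (simp add: norm_adj_def)
  show "norm (star T * T) \<le> (norm T)\<^sup>2"
    using mult[of "star T"] mult_right_mono[OF norm_star_adj_le[of T] n0[of T]]
    by (simp add: power2_eq_square)
  have "norm (adj_app T x) \<le> sqrt (norm (star T * T)) * norm x" for x
  proof (rule power2_le_imp_le)
    have "(norm (adj_app T x))\<^sup>2 = norm (l2i x (adj_app (star T * T) x))"
      by (simp add: norm_l2_square l2i_adj_star)
    also have "\<dots> \<le> norm x * (norm (star T * T) * norm x)"
      by (rule order_trans[OF norm_l2i_le]) (intro mult_left_mono norm_adj_app_le norm_ge_zero)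
    finally show "(norm (adj_app T x))\<^sup>2 \<le> (sqrt (norm (star T * T)) * norm x)\<^sup>2"
      by (simp add: power_mult_distrib power2_eq_square[of "norm x"] ac_simps n0)
  qed (simp add: n0)
  then have "norm T \<le> sqrt (norm (star T * T))" by (intro norm_adj_le) (auto simp: n0)
  then show "(norm T)\<^sup>2 \<le> norm (star T * T)" by (simp add: n0 real_le_rsqrt sqrt_ge_absD)
qed

instance adj :: (unital_cstar_algebra) unital_cstar_algebra
proof
  fix x y z :: "'a adj" and a b :: real and c d :: complex
  show "x * y * z = x * (y * z)" "(x + y) * z = x * z + y * z" "x * (y + z) = x * y + x * z"
    "a *\<^sub>R x * y = a *\<^sub>R (x * y)" "x * a *\<^sub>R y = a *\<^sub>R (x * y)" "1 * x = x" "x * 1 = x"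
    by (rule adj_app_cong; simp add: adj_app_linear)+
  show "c *\<^sub>C (x + y) = c *\<^sub>C x + c *\<^sub>C y" "c *\<^sub>C d *\<^sub>C x = (c * d) *\<^sub>C x"
    "complex_of_real a *\<^sub>C x = a *\<^sub>R x" "c *\<^sub>C x * y = c *\<^sub>C (x * y)" "x * c *\<^sub>C y = c *\<^sub>C (x * y)"
    by (rule adj_app_cong; simp add: scaleC_add_right_l2 scaleC_scaleC_l2 scaleC_of_real_l2 adj_app_linear)+
  show scaleC_add: "(c + d) *\<^sub>C x = c *\<^sub>C x + d *\<^sub>C x"
    by (rule adj_app_cong) (simp add: scaleC_add_left_l2)
  show "norm (x * y) \<le> norm x * norm y"
    unfolding norm_adj_def adj_blinfun_mult by (rule norm_blinfun_compose)
  have e0: "norm (l2_unit 0 1 :: 'a l2) = 1" by (simp add: norm_l2_unit)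
  show "norm (1::'a adj) = 1"
  proof (rule antisym)
    show "norm (1::'a adj) \<le> 1" by (rule norm_adj_le) auto
    show "1 \<le> norm (1::'a adj)" using norm_adj_app_le[of 1 "l2_unit 0 1 :: 'a l2"] e0 by simp
  qed
  then show "(0::'a adj) \<noteq> 1" by (metis norm_zero zero_neq_one)
  show "star (x + y) = star x + star y" "star (c *\<^sub>C x) = cnj c *\<^sub>C star x" "star (x * y) = star y * star x"
    "star (star x) = x"
    by (rule adj_app_cong, rule l2i_eqI, simp only: l2i_adj_star[symmetric] adj_app_simps l2i_adj_star'
        l2i_add_left l2i_add_right l2i_scaleC_left l2i_scaleC_right adj_app_star_star; simp)+
  have le: "norm (c *\<^sub>C x) \<le> cmod c * norm x" for c and x :: "'a adj"
    by (rule norm_adj_le)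
      (auto simp: norm_scaleC_l2 mult.assoc intro!: mult_left_mono norm_adj_app_le)
  show "norm (c *\<^sub>C x) = cmod c * norm x"
  proof (cases "c = 0")
    case True
    then show ?thesis using le[of c x] by simp
  next
    case False
    have "x = inverse c *\<^sub>C c *\<^sub>C x"
      by (rule adj_app_cong) (simp add: False scaleC_scaleC_l2 scaleC_one_l2)
    then have "norm x \<le> cmod (inverse c) * norm (c *\<^sub>C x)" using le by metis
    then have "cmod c * norm x \<le> norm (c *\<^sub>C x)" using False by (simp add: norm_divide inverse_eq_divide field_simps)
    then show ?thesis using le[of c x] by simp
  qed
  show "norm (star x * x) = (norm x)\<^sup>2" by (rule adj_cstar_identity)
  show "convergent X" if C: "Cauchy X" for X :: "nat \<Rightarrow> 'a adj"
  proof -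
    have star_diff': "star (u - v) = star u - star v" for u v :: "'a adj"
      by (rule adj_app_cong, rule l2i_eqI)
        (simp add: l2i_adj_star[symmetric] l2i_diff_right bounded_bilinear.diff_left[OF bounded_bilinear_l2i])
    have conv: "\<exists>T. (\<lambda>k. adj_blinfun (Y k)) \<longlonglongrightarrow> T" if "Cauchy Y" for Y :: "nat \<Rightarrow> 'a adj"
    proof -
      have "Cauchy (\<lambda>k. adj_blinfun (Y k))"
        using that by (simp add: Cauchy_iff norm_adj_def adj_blinfun_vector_simps)
      then show ?thesis using Cauchy_convergent convergent_def by blast
    qed
    obtain T where T: "(\<lambda>k. adj_blinfun (X k)) \<longlonglongrightarrow> T" using conv[OF C] by blast
    \<comment> \<open>The limit operator must again have an adjoint; since the involution does not
      increase norms, the adjoints converge too, and their limit is that adjoint.\<close>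
    have "Cauchy (\<lambda>k. star (X k))"
      using C unfolding Cauchy_iff star_diff'[symmetric] by (meson norm_star_adj_le le_less_trans)
    then obtain S where S: "(\<lambda>k. adj_blinfun (star (X k))) \<longlonglongrightarrow> S" using conv by blast
    have "l2i (T u) v = l2i u (S v)" for u v
    proof (rule LIMSEQ_unique)
      have "(\<lambda>k. adj_blinfun (X k) u) \<longlonglongrightarrow> T u" "(\<lambda>k. adj_blinfun (star (X k)) v) \<longlonglongrightarrow> S v"
        by (intro tendsto_intros S T)+
      then have T': "(\<lambda>k. adj_app (X k) u) \<longlonglongrightarrow> T u" and S': "(\<lambda>k. adj_app (star (X k)) v) \<longlonglongrightarrow> S v"
        by (simp_all only: adj_app_def)
      show "(\<lambda>k. l2i (adj_app (X k) u) v) \<longlonglongrightarrow> l2i (T u) v"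
        by (rule bounded_bilinear.tendsto[OF bounded_bilinear_l2i T' tendsto_const])
      show "(\<lambda>k. l2i (adj_app (X k) u) v) \<longlonglongrightarrow> l2i u (S v)"
        using bounded_bilinear.tendsto[OF bounded_bilinear_l2i tendsto_const S', of u]
        by (simp add: l2i_adj_star)
    qed
    then have "adj_pair (blinfun_apply T) S" by (auto simp: adj_pair_def)
    then have T': "adj_blinfun (Abs_adj T) = T" by (intro Abs_adj_inverse) auto
    have "X \<longlonglongrightarrow> Abs_adj T"
      using T by (simp add: LIMSEQ_iff norm_adj_def adj_blinfun_vector_simps T')
    then show ?thesis by (auto simp: convergent_def)
  qed
qed

section \<open>Translation to the operator type of the statement\<close>

text \<open>Identifies \<open>adj\<close> with the set \<open>adjointable\<close>, compatibly with
  the algebraic operations, the involution and the norm. All analysis is done in \<open>adj\<close>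
  and carried over by this map.\<close>

definition op_of :: "'b::unital_cstar_algebra adj \<Rightarrow> 'b l2_op" where
  "op_of T = mk_op (\<lambda>x. l2_seq (adj_app T (Abs_l2 x)))"

lemma op_app_mk_op: "op_app (mk_op f) x = (if x \<in> l2Z then f x else (\<lambda>_. 0))"
  by (simp add: mk_op_def L2_op_inverse)

lemma op_app_op_of: "op_app (op_of T) (l2_seq u) = l2_seq (adj_app T u)"
  by (simp add: op_of_def op_app_mk_op l2_seq_inverse)

lemma op_app_op_of_outside: "x \<notin> l2Z \<Longrightarrow> op_app (op_of T) x = (\<lambda>_. 0)"
  by (simp add: op_of_def op_app_mk_op)

lemma l2Z_cases: obtains u where "x = l2_seq u" | "x \<notin> l2Z"
  by (metis Abs_l2_inverse)

lemma l2_op_eqI: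
  assumes "\<And>u. op_app S (l2_seq u) = op_app T (l2_seq u)"
    "\<And>x. x \<notin> l2Z \<Longrightarrow> op_app S x = (\<lambda>_. 0)" "\<And>x. x \<notin> l2Z \<Longrightarrow> op_app T x = (\<lambda>_. 0)"
  shows "S = T"
proof -
  have "op_app S x = op_app T x" for x
    by (rule l2Z_cases[of x]) (simp_all add: assms)
  then have "op_app S = op_app T" by blast
  then show ?thesis by (simp add: op_app_inject)
qed

lemma op_of_inject: "op_of S = op_of T \<longleftrightarrow> S = T"
proof
  assume "op_of S = op_of T"
  then have "l2_seq (adj_app S u) = l2_seq (adj_app T u)" for u by (metis op_app_op_of)
  then show "S = T" by (intro adj_app_cong) (simp add: l2_seq_inject)
qed simp

lemma l2_op_app_simps:
  "op_app (0::'b::unital_cstar_algebra l2_op) x = (\<lambda>_. 0)"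
  "op_app (S + T) x = (\<lambda>n. op_app S x n + op_app T x n)"
  "op_app (S - T) x = (\<lambda>n. op_app S x n - op_app T x n)"
  "op_app (r *\<^sub>R T) x = (\<lambda>n. r *\<^sub>R op_app T x n)"
  "op_app (c *\<^sub>C T) x = (\<lambda>n. c *\<^sub>C op_app T x n)"
  "op_app (S * T) x = op_app S (op_app T x)"
  by (simp_all add: zero_l2_op_def plus_l2_op_def minus_l2_op_def scaleR_l2_op_def scaleC_l2_op_def
      times_l2_op_def L2_op_inverse)

lemma op_app_op_of_zero: "op_app (op_of T) (\<lambda>_. 0) = (\<lambda>_. 0)"
  using op_app_op_of[of T 0] adj_app_linear(2)[of T 0 0] by (simp add: zero_l2.rep_eq)

lemma op_of_simps:
  "op_of 0 = 0" "op_of 1 = 1" "op_of (S + T) = op_of S + op_of T" "op_of (S - T) = op_of S - op_of T"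
  "op_of (r *\<^sub>R T) = r *\<^sub>R op_of T" "op_of (c *\<^sub>C T) = c *\<^sub>C op_of T" "op_of (S * T) = op_of S * op_of T"
  by (rule l2_op_eqI;
      simp add: op_app_op_of op_app_op_of_outside op_app_op_of_zero l2_op_app_simps one_l2_op_def
        op_app_mk_op zero_l2.rep_eq plus_l2.rep_eq minus_l2.rep_eq scaleR_l2.rep_eq scaleC_l2.rep_eq)+

lemma op_of_sum: "op_of (\<Sum>i\<in>A. f i) = (\<Sum>i\<in>A. op_of (f i))"
  by (induction A rule: infinite_finite_induct) (auto simp: op_of_simps)

lemma is_adjoint_op_of: "is_adjoint (op_of T) (op_of (star T))"
  unfolding is_adjoint_def
proof (intro conjI ballI allI impI)
  show "op_app (op_of T) x \<in> l2Z" "op_app (op_of (star T)) x \<in> l2Z" if "x \<in> l2Z" for x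
    using that by (metis Abs_l2_inverse l2_seq_l2Z op_app_op_of)+
  show "l2_inner (op_app (op_of T) x) y = l2_inner x (op_app (op_of (star T)) y)"
    if "x \<in> l2Z" "y \<in> l2Z" for x y
    using l2i_adj_star[of T "Abs_l2 x" "Abs_l2 y"] that
    by (simp add: op_of_def op_app_mk_op l2i.rep_eq Abs_l2_inverse)
qed (simp_all add: op_app_op_of_outside)

lemma is_adjoint_imp_op_of:
  assumes "is_adjoint T S" obtains A where "T = op_of A" "S = op_of (star A)"
proof
  define f g where "f u = Abs_l2 (op_app T (l2_seq u))" and "g u = Abs_l2 (op_app S (l2_seq u))" for u
  have rep: "l2_seq (f u) = op_app T (l2_seq u)" "l2_seq (g u) = op_app S (l2_seq u)" for u
    using assms by (auto simp: is_adjoint_def f_def g_def intro!: Abs_l2_inverse)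
  have "adj_pair f g"
    using assms by (simp add: adj_pair_def l2i.rep_eq rep is_adjoint_def)
  then have fA: "adj_app (mk_adj f) = f" and gA: "adj_star (mk_adj f) = g"
    using adj_star_eqI[of "mk_adj f" g] by (auto simp: adj_app_mk_adj)
  show "T = op_of (mk_adj f)"
    by (rule l2_op_eqI) (use assms in \<open>auto simp: op_app_op_of fA rep is_adjoint_def op_app_op_of_outside\<close>)
  show "S = op_of (star (mk_adj f))"
    by (rule l2_op_eqI) (use assms in \<open>auto simp: op_app_op_of gA rep is_adjoint_def op_app_op_of_outside\<close>)
qed

lemma star_op_of: "star (op_of T) = op_of (star T)"
  unfolding star_l2_op_def
proof (rule the_equality, rule is_adjoint_op_of)
  fix S assume "is_adjoint (op_of T) S"
  then show "S = op_of (star T)" by (metis is_adjoint_imp_op_of op_of_inject)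
qed

lemma adjointable_eq: "adjointable = range (op_of :: 'b::unital_cstar_algebra adj \<Rightarrow> 'b l2_op)"
  unfolding adjointable_def using is_adjoint_op_of is_adjoint_imp_op_of by blast

lemma l2_op_norm_op_of: "l2_op_norm (op_of T) = norm T"
proof -
  have eq: "(\<lambda>x. l2_norm (op_app (op_of T) x)) ` {x \<in> l2Z. l2_norm x \<le> 1} = (\<lambda>u. norm (adj_app T u)) ` {u. norm u \<le> 1}"
  proof (intro equalityI subsetI; elim imageE CollectE)
    fix y x assume "y = l2_norm (op_app (op_of T) x)" "x \<in> l2Z \<and> l2_norm x \<le> 1"
    then show "y \<in> (\<lambda>u. norm (adj_app T u)) ` {u. norm u \<le> 1}"
      by (intro image_eqI[of _ _ "Abs_l2 x"])
        (auto simp: op_of_def op_app_mk_op norm_l2.rep_eq Abs_l2_inverse)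
  next
    fix y u assume "y = norm (adj_app T u)" "norm u \<le> 1"
    then show "y \<in> (\<lambda>x. l2_norm (op_app (op_of T) x)) ` {x \<in> l2Z. l2_norm x \<le> 1}"
      by (intro image_eqI[of _ _ "l2_seq u"]) (auto simp: op_app_op_of norm_l2.rep_eq)
  qed
  let ?S = "SUP u\<in>{u. norm u \<le> 1}. norm (adj_app T u)"
  have le: "norm (adj_app T u) \<le> norm T" if "norm u \<le> 1" for u
    using norm_adj_app_le[of T u] mult_left_mono[OF that norm_ge_zero[of T]] by simp
  have bdd: "bdd_above ((\<lambda>u. norm (adj_app T u)) ` {u. norm u \<le> 1})"
    using le by (intro bdd_aboveI2[of _ _ "norm T"]) auto
  have S: "norm (adj_app T u) \<le> ?S" if "norm u \<le> 1" for u
    by (rule cSUP_upper[OF _ bdd]) (use that in auto)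
  have "?S \<le> norm T" by (rule cSUP_least) (auto simp: le intro: exI[of _ 0])
  moreover have "norm T \<le> ?S"
  proof (rule norm_adj_le)
    show "0 \<le> ?S" by (rule order_trans[OF norm_ge_zero S[of 0]]) simp
    show "norm (adj_app T u) \<le> ?S * norm u" for u
    proof (cases "u = 0")
      case True
      then show ?thesis using adj_app_linear(2)[of T 0 0] by simp
    next
      case False
      then have "norm (adj_app T ((1 / norm u) *\<^sub>R u)) \<le> ?S" by (intro S) simp
      then show ?thesis using False by (simp add: adj_app_linear field_simps)
    qed
  qed
  ultimately show ?thesis by (simp add: l2_op_norm_def eq)
qed

section \<open>Automorphisms\<close>

lemma star_automorphism_scaleR:
  "star_automorphism \<beta> \<Longrightarrow> \<beta> (r *\<^sub>R x) = r *\<^sub>R \<beta> x"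
  by (metis scaleC_of_real star_automorphism_def)

lemma star_automorphism_zero: "star_automorphism \<beta> \<Longrightarrow> \<beta> 0 = 0"
  using star_automorphism_scaleR[of \<beta> 0 0] by simp

lemma star_automorphism_diff: "star_automorphism \<beta> \<Longrightarrow> \<beta> (x - y) = \<beta> x - \<beta> y"
proof -
  assume "star_automorphism \<beta>"
  then have "\<beta> (x - y + y) = \<beta> (x - y) + \<beta> y" unfolding star_automorphism_def by blast
  then show ?thesis by simp
qed

lemma star_automorphism_one:
  assumes "star_automorphism \<beta>" shows "\<beta> 1 = 1"
proof -
  obtain x where "\<beta> x = 1" using assms by (metis bij_pointE star_automorphism_def)
  then show ?thesis using assms by (metis mult_1_left mult_1_right star_automorphism_def)
qed

lemma star_automorphism_inv:
  assumes "star_automorphism \<beta>" shows "star_automorphism (inv \<beta>)"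
proof -
  have b: "bij \<beta>" and i: "\<And>x. \<beta> (inv \<beta> x) = x" "\<And>x. inv \<beta> (\<beta> x) = x"
    using assms by (auto simp: star_automorphism_def bij_is_surj surj_f_inv_f bij_is_inj)
  have eqI: "inv \<beta> y = x" if "\<beta> x = y" for x y using that i by auto
  show ?thesis
    unfolding star_automorphism_def using assms
    by (intro conjI allI bij_imp_bij_inv b eqI) (auto simp: star_automorphism_def i)
qed

lemma star_automorphism_comp:
  "star_automorphism \<beta> \<Longrightarrow> star_automorphism \<gamma> \<Longrightarrow> star_automorphism (\<lambda>x. \<beta> (\<gamma> x))"
  unfolding star_automorphism_def using bij_comp[of \<gamma> \<beta>] by (auto simp: o_def)

lemma star_automorphism_id: "star_automorphism (\<lambda>x. x)"
  using bij_id by (simp add: star_automorphism_def id_def)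

lemma star_automorphism_funpow: "star_automorphism \<beta> \<Longrightarrow> star_automorphism (\<beta> ^^ n)"
proof (induction n)
  case 0
  then show ?case using star_automorphism_id by (simp add: id_def)
next
  case (Suc n)
  then show ?case using star_automorphism_comp[of \<beta> "\<beta> ^^ n"] by (simp add: o_def)
qed

lemma star_automorphism_aut_pow: "star_automorphism \<beta> \<Longrightarrow> star_automorphism (aut_pow \<beta> n)"
  unfolding aut_pow_def by (auto intro: star_automorphism_funpow star_automorphism_inv)

text \<open>Square roots show that an automorphism preserves \<open>cpos\<close>; apply this to the
  positive element \<open>(norm x)\<^sup>2 *\<^sub>R 1 - star x * x\<close>.\<close>

lemma star_automorphism_norm_le:
  assumes "star_automorphism \<beta>" shows "norm (\<beta> x) \<le> norm x"
proof -
  have pos: "cpos (\<beta> a)" if "cpos a" for a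
  proof -
    obtain d where d: "cpos d" "d * d = a" using cpos_sqrt[OF \<open>cpos a\<close>] by metis
    then have "\<beta> a = \<beta> d * \<beta> d" "star (\<beta> d) = \<beta> d"
      using assms by (auto simp: star_automorphism_def) (metis cpos_sa)
    then show ?thesis by (simp add: cpos_square)
  qed
  have "\<beta> ((norm x)\<^sup>2 *\<^sub>R 1 - star x * x) = (norm x)\<^sup>2 *\<^sub>R 1 - star (\<beta> x) * \<beta> x"
    using assms by (simp add: star_automorphism_diff star_automorphism_scaleR star_automorphism_one)
      (simp add: star_automorphism_def)
  then have "cpos ((norm x)\<^sup>2 *\<^sub>R 1 - star (\<beta> x) * \<beta> x)"
    using pos[OF cpos_norm_minus_star_mult[of x]] by simp
  then have "norm (star (\<beta> x) * \<beta> x) \<le> (norm x)\<^sup>2"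
    by (intro cpos_le_scalar_norm cpos_star_mult)
  then show ?thesis by (simp add: cstar_identity power2_le_iff_abs_le)
qed

lemma star_automorphism_norm:
  assumes "star_automorphism \<beta>" shows "norm (\<beta> x) = norm x"
proof (rule antisym[OF star_automorphism_norm_le[OF assms]])
  have "inv \<beta> (\<beta> x) = x" using assms by (simp add: star_automorphism_def bij_is_inj)
  then show "norm x \<le> norm (\<beta> x)"
    using star_automorphism_norm_le[OF star_automorphism_inv[OF assms], of "\<beta> x"] by simp
qed

lemma aut_pow_Suc:
  assumes "bij \<beta>" shows "aut_pow \<beta> (n + 1) x = \<beta> (aut_pow \<beta> n x)"
proof (cases "0 \<le> n")
  case True
  then show ?thesis by (simp add: aut_pow_def nat_add_distrib)
next
  case False
  define k where "k = nat (- (n + 1))"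
  have k: "nat (- n) = Suc k" using False by (simp add: k_def)
  have "aut_pow \<beta> (n + 1) x = (inv \<beta> ^^ k) x"
    using False by (cases "n + 1 = 0") (auto simp: aut_pow_def k_def)
  moreover have "aut_pow \<beta> n x = inv \<beta> ((inv \<beta> ^^ k) x)"
    using False k by (simp add: aut_pow_def)
  ultimately show ?thesis using assms by (simp add: bij_is_surj surj_f_inv_f)
qed

lemma aut_pow_0 [simp]: "aut_pow \<beta> 0 x = x"
  by (simp add: aut_pow_def)

lemma aut_pow_add:
  assumes "bij \<beta>" shows "aut_pow \<beta> (m + n) x = aut_pow \<beta> m (aut_pow \<beta> n x)"
proof (induction m rule: int_induct[where k=0])
  case (step1 i)
  then show ?case using aut_pow_Suc[OF assms, of "i + n"] aut_pow_Suc[OF assms, of i] by (simp add: ac_simps)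
next
  case (step2 i)
  have "\<beta> (aut_pow \<beta> (i - 1 + n) x) = \<beta> (aut_pow \<beta> (i - 1) (aut_pow \<beta> n x))"
    using step2 aut_pow_Suc[OF assms, of "i - 1 + n"] aut_pow_Suc[OF assms, of "i - 1"] by (simp add: ac_simps)
  then show ?case using assms by (meson bij_is_inj injD)
qed simp

lemma star_automorphism_bij: "star_automorphism \<beta> \<Longrightarrow> bij \<beta>"
  by (simp add: star_automorphism_def)

lemma aut_pow_cancel [simp]:
  assumes "bij \<beta>"
  shows "aut_pow \<beta> n (aut_pow \<beta> (- n) x) = x" "aut_pow \<beta> (- n) (aut_pow \<beta> n x) = x"
  using aut_pow_add[OF assms, of n "- n" x] aut_pow_add[OF assms, of "- n" n x] by simp_all

lemma aut_pow_image:
  assumes "bij \<beta>" "\<beta> ` V = V" "x \<in> V" shows "aut_pow \<beta> n x \<in> V"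
proof -
  have inv: "inv \<beta> y \<in> V" if "y \<in> V" for y
    using that assms(1,2) by (metis bij_inv_eq_iff image_iff)
  have "(\<beta> ^^ k) x \<in> V" "(inv \<beta> ^^ k) x \<in> V" for k
    by (induction k) (use assms inv in auto)
  then show ?thesis by (simp add: aut_pow_def)
qed

section \<open>Crossed products\<close>

lemma bij_shift: "bij_betw (\<lambda>m. m - n) (UNIV::int set) UNIV"
  by (rule bij_betwI[where g="\<lambda>m. m + n"]) auto

lemma l2Z_shift:
  assumes "x \<in> l2Z" shows "(\<lambda>m. x (m - n)) \<in> l2Z"
proof -
  have "(\<lambda>m. star (x m) * x m) summable_on UNIV" using assms by (simp add: l2Z_def)
  then have "(\<lambda>m. star (x (m - n)) * x (m - n)) summable_on UNIV"
    using summable_on_reindex_bij_betw[OF bij_shift[of n], of "\<lambda>m. star (x m) * x m"] by simp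
  then show ?thesis by (simp add: l2Z_def)
qed

lift_definition shift_l2 :: "int \<Rightarrow> 'b::unital_cstar_algebra l2 \<Rightarrow> 'b l2" is "\<lambda>n x m. x (m - n)"
  by (rule l2Z_shift)

lemma adj_pair_shift: "adj_pair (shift_l2 n) (shift_l2 (- n))"
  unfolding adj_pair_def
proof (intro allI, transfer)
  fix n :: int and x y :: "int \<Rightarrow> 'a"
  show "l2_inner (\<lambda>m. x (m - n)) y = l2_inner x (\<lambda>m. y (m - - n))"
    using infsum_reindex_bij_betw[OF bij_shift[of n], of "\<lambda>m. star (x m) * y (m + n)"]
    by (simp add: l2_inner_def)
qed

text \<open>The test for boundedness makes the operator total in the sequence b. It is applied to
  orbits of automorphisms, which are bounded because powers are isometric.\<close>

lift_definition diag_l2 :: "(int \<Rightarrow> 'b::unital_cstar_algebra) \<Rightarrow> 'b l2 \<Rightarrow> 'b l2"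
  is "\<lambda>b x. if bounded (range b) then (\<lambda>m. b m * x m) else (\<lambda>_. 0)"
  by (auto simp: bounded_iff intro: l2Z_left_mult)

lemma adj_pair_diag:
  assumes "bounded (range b)" shows "adj_pair (diag_l2 b) (diag_l2 (\<lambda>m. star (b m)))"
proof -
  have "bounded (range (\<lambda>m. star (b m)))" using assms by (auto simp: bounded_iff)
  then show ?thesis unfolding adj_pair_def using assms
    by (auto, transfer) (simp add: l2_inner_def star_mult mult.assoc)
qed

definition cp_u :: "int \<Rightarrow> 'b::unital_cstar_algebra adj" where
  "cp_u n = mk_adj (shift_l2 n)"

definition cp_p :: "('b::unital_cstar_algebra \<Rightarrow> 'b) \<Rightarrow> 'b \<Rightarrow> 'b adj" where
  "cp_p \<beta> b = mk_adj (diag_l2 (\<lambda>m. aut_pow \<beta> (- m) b))"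

lemma bounded_orbit: "star_automorphism \<beta> \<Longrightarrow> bounded (range (\<lambda>m. aut_pow \<beta> (- m) b))"
  by (auto simp: bounded_iff star_automorphism_norm star_automorphism_aut_pow)

lemma adj_app_cp_u: "l2_seq (adj_app (cp_u n) x) m = l2_seq x (m - n)"
  unfolding cp_u_def adj_app_mk_adj[OF adj_pair_shift] by transfer simp

lemma adj_app_cp_p:
  "star_automorphism \<beta> \<Longrightarrow> l2_seq (adj_app (cp_p \<beta> b) x) m = aut_pow \<beta> (- m) b * l2_seq x m"
  unfolding cp_p_def adj_app_mk_adj[OF adj_pair_diag[OF bounded_orbit]]
  using bounded_orbit[of \<beta> b] by (simp add: diag_l2.rep_eq)

lemma adj_eqI: "(\<And>x m. l2_seq (adj_app S x) m = l2_seq (adj_app T x) m) \<Longrightarrow> S = T"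
  by (intro adj_app_cong) (metis ext l2_seq_inject)

lemma op_of_cp_u: "op_of (cp_u n) = cp_shift n"
  by (rule l2_op_eqI) (auto simp: op_app_op_of op_app_op_of_outside cp_shift_def op_app_mk_op adj_app_cp_u)

lemma op_of_cp_p: "star_automorphism \<beta> \<Longrightarrow> op_of (cp_p \<beta> b) = cp_coeff \<beta> b"
  by (rule l2_op_eqI) (auto simp: op_app_op_of op_app_op_of_outside cp_coeff_def op_app_mk_op adj_app_cp_p)

lemma cp_u_add: "cp_u (m + n) = cp_u m * cp_u n"
  by (rule adj_eqI) (simp add: adj_app_cp_u algebra_simps)

lemma cp_u_0: "cp_u 0 = 1"
  by (rule adj_eqI) (simp add: adj_app_cp_u)

lemma star_cp_u: "star (cp_u n) = (cp_u (- n) :: 'a::unital_cstar_algebra adj)"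
proof (rule adj_app_cong)
  have *: "adj_pair (adj_app (cp_u n :: 'a adj)) (shift_l2 (- n))"
    using adj_pair_shift[of n] by (simp add: cp_u_def adj_app_mk_adj[OF adj_pair_shift])
  show "adj_app (star (cp_u n :: 'a adj)) x = adj_app (cp_u (- n)) x" for x
    using adj_star_eqI[OF *] by (simp add: cp_u_def[of "- n"] adj_app_mk_adj[OF adj_pair_shift])
qed

lemma aut_simps:
  assumes "star_automorphism \<beta>"
  shows "aut_pow \<beta> n (x + y) = aut_pow \<beta> n x + aut_pow \<beta> n y" "aut_pow \<beta> n (c *\<^sub>C x) = c *\<^sub>C aut_pow \<beta> n x"
    "aut_pow \<beta> n (x * y) = aut_pow \<beta> n x * aut_pow \<beta> n y" "aut_pow \<beta> n (star x) = star (aut_pow \<beta> n x)"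
    "aut_pow \<beta> n (r *\<^sub>R x) = r *\<^sub>R aut_pow \<beta> n x" "aut_pow \<beta> n 0 = 0" "aut_pow \<beta> n 1 = 1"
    "aut_pow \<beta> n (x - y) = aut_pow \<beta> n x - aut_pow \<beta> n y" "norm (aut_pow \<beta> n x) = norm x"
  using star_automorphism_aut_pow[OF assms, of n]
  by (simp_all add: star_automorphism_scaleR star_automorphism_zero star_automorphism_one
      star_automorphism_diff star_automorphism_norm) (simp_all add: star_automorphism_def)

lemma cp_p_add: "star_automorphism \<beta> \<Longrightarrow> cp_p \<beta> (a + b) = cp_p \<beta> a + cp_p \<beta> b"
  by (rule adj_eqI) (simp add: adj_app_cp_p plus_l2.rep_eq aut_simps distrib_right)

lemma cp_p_scaleC: "star_automorphism \<beta> \<Longrightarrow> cp_p \<beta> (c *\<^sub>C b) = c *\<^sub>C cp_p \<beta> b"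
  by (rule adj_eqI) (simp add: adj_app_cp_p scaleC_l2.rep_eq aut_simps mult_scaleC_left)

lemma cp_p_scaleR: "star_automorphism \<beta> \<Longrightarrow> cp_p \<beta> (r *\<^sub>R b) = r *\<^sub>R cp_p \<beta> b"
  using cp_p_scaleC[of \<beta> "complex_of_real r" b] by (simp add: scaleC_of_real)

lemma cp_p_mult: "star_automorphism \<beta> \<Longrightarrow> cp_p \<beta> (a * b) = cp_p \<beta> a * cp_p \<beta> b"
  by (rule adj_eqI) (simp add: adj_app_cp_p aut_simps mult.assoc)

lemma cp_p_one: "star_automorphism \<beta> \<Longrightarrow> cp_p \<beta> 1 = 1"
  by (rule adj_eqI) (simp add: adj_app_cp_p star_automorphism_one star_automorphism_aut_pow)

lemma cp_p_zero: "star_automorphism \<beta> \<Longrightarrow> cp_p \<beta> 0 = 0"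
  using cp_p_scaleR[of \<beta> 0 0] by simp

lemma star_cp_p:
  assumes "star_automorphism \<beta>" shows "star (cp_p \<beta> b) = cp_p \<beta> (star b)"
proof (rule adj_app_cong)
  have "adj_pair (adj_app (cp_p \<beta> b)) (diag_l2 (\<lambda>m. star (aut_pow \<beta> (- m) b)))"
    using adj_pair_diag[OF bounded_orbit[OF assms]]
    by (simp add: cp_p_def adj_app_mk_adj[OF adj_pair_diag[OF bounded_orbit[OF assms]]])
  moreover have "adj_app (cp_p \<beta> (star b)) = diag_l2 (\<lambda>m. aut_pow \<beta> (- m) (star b))"
    unfolding cp_p_def by (rule adj_app_mk_adj[OF adj_pair_diag[OF bounded_orbit[OF assms]]])
  then have "diag_l2 (\<lambda>m. star (aut_pow \<beta> (- m) b)) = adj_app (cp_p \<beta> (star b))"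
    by (simp add: aut_simps assms)
  ultimately show "adj_app (star (cp_p \<beta> b)) x = adj_app (cp_p \<beta> (star b)) x" for x
    using adj_star_eqI by fastforce
qed

lemma norm_cp_p_le:
  assumes "star_automorphism \<beta>" shows "norm (cp_p \<beta> b) \<le> norm b"
proof (rule norm_adj_le)
  fix x :: "'a l2"
  have eq: "l2_seq (adj_app (cp_p \<beta> b) x) = (\<lambda>m. aut_pow \<beta> (- m) b * l2_seq x m)"
    using adj_app_cp_p[OF assms] by blast
  have b: "norm (aut_pow \<beta> (- m) b) \<le> norm b" for m
    using assms by (simp add: star_automorphism_norm star_automorphism_aut_pow)
  show "norm (adj_app (cp_p \<beta> b) x) \<le> norm b * norm x"
    unfolding norm_l2.rep_eq
  proof (rule l2_norm_le_if_fin)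
    fix F :: "int set" assume "finite F"
    then have "l2_fin F (l2_seq (adj_app (cp_p \<beta> b) x)) \<le> norm b * l2_fin F (l2_seq x)"
      unfolding eq by (rule l2_fin_left_mult[OF _ b])
    also have "\<dots> \<le> norm b * l2_norm (l2_seq x)"
      using \<open>finite F\<close> by (intro mult_left_mono l2_fin_le_l2_norm) auto
    finally show "l2_fin F (l2_seq (adj_app (cp_p \<beta> b) x)) \<le> norm b * l2_norm (l2_seq x)" .
  qed simp
qed simp

lemma bounded_linear_cp_p: "star_automorphism \<beta> \<Longrightarrow> bounded_linear (cp_p \<beta>)"
  by (rule bounded_linear_intro[where K=1]) (auto simp: cp_p_add cp_p_scaleR norm_cp_p_le)

lemma norm_cp_u: "norm (cp_u n) = 1"
proof -
  have "star (cp_u n) * cp_u n = (1 :: 'a adj)" by (simp add: star_cp_u cp_u_0 flip: cp_u_add)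
  then have "(norm (cp_u n :: 'a adj))\<^sup>2 = 1" using cstar_identity[of "cp_u n :: 'a adj"] by simp
  then show ?thesis by (metis norm_ge_zero power2_eq_1_iff zero_le_one neg_0_le_iff_le not_one_le_zero)
qed

lemma cp_u_cp_p:
  assumes "star_automorphism \<beta>" shows "cp_u n * cp_p \<beta> b = cp_p \<beta> (aut_pow \<beta> n b) * cp_u n"
proof (rule adj_eqI)
  fix x :: "'a l2" and m
  have "aut_pow \<beta> (- (m - n)) b = aut_pow \<beta> (- m) (aut_pow \<beta> n b)"
    using aut_pow_add[of \<beta> "- m" n b] assms by (simp add: star_automorphism_bij)
  then show "l2_seq (adj_app (cp_u n * cp_p \<beta> b) x) m = l2_seq (adj_app (cp_p \<beta> (aut_pow \<beta> n b) * cp_u n) x) m"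
    using assms by (simp add: adj_app_cp_u adj_app_cp_p)
qed

section \<open>Finitely supported elements and their closure\<close>

definition cp_el :: "('b::unital_cstar_algebra \<Rightarrow> 'b) \<Rightarrow> (int \<Rightarrow> 'b) \<Rightarrow> 'b adj" where
  "cp_el \<beta> \<eta> = (\<Sum>n | \<eta> n \<noteq> 0. cp_p \<beta> (\<eta> n) * cp_u n)"

lemma op_of_cp_el: "star_automorphism \<beta> \<Longrightarrow> op_of (cp_el \<beta> \<eta>) = cp_elem \<beta> \<eta>"
  by (simp add: cp_el_def cp_elem_def op_of_sum op_of_simps op_of_cp_p op_of_cp_u)

lemma cp_el_eq_sum:
  assumes "star_automorphism \<beta>" "finite F" "{n. \<eta> n \<noteq> 0} \<subseteq> F"
  shows "cp_el \<beta> \<eta> = (\<Sum>n\<in>F. cp_p \<beta> (\<eta> n) * cp_u n)"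
  unfolding cp_el_def using assms by (intro sum.mono_neutral_left) (auto simp: cp_p_zero)

lemma Cc_UNIV_iff: "\<eta> \<in> Cc UNIV \<longleftrightarrow> finite {n. \<eta> n \<noteq> 0}"
  by (simp add: Cc_def)

lemma cp_el_add:
  assumes "star_automorphism \<beta>" "\<eta> \<in> Cc UNIV" "\<zeta> \<in> Cc UNIV"
  shows "cp_el \<beta> (\<lambda>n. \<eta> n + \<zeta> n) = cp_el \<beta> \<eta> + cp_el \<beta> \<zeta>"
proof -
  let ?F = "{n. \<eta> n \<noteq> 0} \<union> {n. \<zeta> n \<noteq> 0}"
  have F: "finite ?F" using assms by (simp add: Cc_UNIV_iff)
  show ?thesis
    by (subst (1 2 3) cp_el_eq_sum[OF assms(1) F]) (auto simp: cp_p_add assms(1) distrib_right sum.distrib)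
qed

lemma cp_el_scaleC:
  assumes "star_automorphism \<beta>" "\<eta> \<in> Cc UNIV"
  shows "cp_el \<beta> (\<lambda>n. c *\<^sub>C \<eta> n) = c *\<^sub>C cp_el \<beta> \<eta>"
proof -
  have F: "finite {n. \<eta> n \<noteq> 0}" using assms by (simp add: Cc_UNIV_iff)
  show ?thesis
    by (subst (1 2) cp_el_eq_sum[OF assms(1) F]) (auto simp: cp_p_scaleC assms(1) scaleC_sum_right mult_scaleC_left)
qed

lemma cp_el_scaleR:
  assumes "star_automorphism \<beta>" "\<eta> \<in> Cc UNIV"
  shows "cp_el \<beta> (\<lambda>n. r *\<^sub>R \<eta> n) = r *\<^sub>R cp_el \<beta> \<eta>"
  using cp_el_scaleC[OF assms, of "complex_of_real r"] by (simp add: scaleC_of_real)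

lemma cp_el_single: "star_automorphism \<beta> \<Longrightarrow> cp_el \<beta> (\<lambda>m. if m = n then b else 0) = cp_p \<beta> b * cp_u n"
  by (subst cp_el_eq_sum[where F="{n}"]) auto

lemma Cc_single: "0 \<in> V \<Longrightarrow> b \<in> V \<Longrightarrow> (\<lambda>m. if m = n then b else 0) \<in> Cc V"
  by (auto simp: Cc_def intro: finite_subset[of _ "{n}"])

lemma cp_el_one: "star_automorphism \<beta> \<Longrightarrow> cp_el \<beta> (\<lambda>m. if m = 0 then 1 else 0) = 1"
  by (simp add: cp_el_single cp_p_one cp_u_0)

lemma star_cp_el:
  assumes "star_automorphism \<beta>" "\<eta> \<in> Cc UNIV"
  shows "star (cp_el \<beta> \<eta>) = cp_el \<beta> (cc_star \<beta> \<eta>)"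
proof -
  let ?F = "{n. \<eta> n \<noteq> 0}"
  have F: "finite ?F" using assms by (simp add: Cc_UNIV_iff)
  have "star (cp_el \<beta> \<eta>) = (\<Sum>n\<in>?F. cp_p \<beta> (aut_pow \<beta> (- n) (star (\<eta> n))) * cp_u (- n))"
    by (simp add: cp_el_def star_sum star_mult star_cp_p star_cp_u assms(1) cp_u_cp_p)
  also have "\<dots> = (\<Sum>n\<in>uminus ` ?F. cp_p \<beta> (cc_star \<beta> \<eta> n) * cp_u n)"
    by (subst sum.reindex) (auto simp: cc_star_def)
  also have "\<dots> = cp_el \<beta> (cc_star \<beta> \<eta>)"
  proof (rule cp_el_eq_sum[symmetric, OF assms(1)])
    show "finite (uminus ` ?F)" using F by simp
    have "cc_star \<beta> \<eta> n = 0" if "\<eta> (- n) = 0" for n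
      using that by (simp add: cc_star_def aut_simps assms(1))
    then show "{n. cc_star \<beta> \<eta> n \<noteq> 0} \<subseteq> uminus ` ?F" by force
  qed
  finally show ?thesis .
qed

lemma adj_app_sum: "adj_app (\<Sum>i\<in>A. f i) x = (\<Sum>i\<in>A. adj_app (f i) x)"
  by (induction A rule: infinite_finite_induct) auto

lemma l2_seq_sum: "l2_seq (\<Sum>i\<in>A. f i) m = (\<Sum>i\<in>A. l2_seq (f i) m)"
  by (induction A rule: infinite_finite_induct) (auto simp: zero_l2.rep_eq plus_l2.rep_eq)

text \<open>In the regular representation a coefficient sequence is a matrix that is constant along
  diagonals up to the twist by \<open>aut_pow \<beta> (- i)\<close>. Reading entries gives
  injectivity, and the transfer between two actions is defined through them.\<close>

lemma cp_el_entry: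
  assumes "star_automorphism \<beta>" "\<eta> \<in> Cc UNIV"
  shows "l2_seq (adj_app (cp_el \<beta> \<eta>) (l2_unit j 1)) i = aut_pow \<beta> (- i) (\<eta> (i - j))"
proof -
  have F: "finite (insert (i - j) {n. \<eta> n \<noteq> 0})" using assms by (simp add: Cc_UNIV_iff)
  have "l2_seq (adj_app (cp_el \<beta> \<eta>) (l2_unit j 1)) i
      = (\<Sum>n\<in>insert (i - j) {n. \<eta> n \<noteq> 0}. if n = i - j then aut_pow \<beta> (- i) (\<eta> n) else 0)"
    by (subst cp_el_eq_sum[OF assms(1) F], blast, simp add: adj_app_sum l2_seq_sum adj_app_cp_p adj_app_cp_u assms(1) l2_seq_l2_unit)
      (intro sum.cong; auto)
  then show ?thesis using F by simp
qed

lemma cp_el_inj: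
  assumes "star_automorphism \<beta>" "\<eta> \<in> Cc UNIV" "\<zeta> \<in> Cc UNIV" "cp_el \<beta> \<eta> = cp_el \<beta> \<zeta>"
  shows "\<eta> = \<zeta>"
proof
  fix n
  have "aut_pow \<beta> (- n) (\<eta> n) = aut_pow \<beta> (- n) (\<zeta> n)"
    using cp_el_entry[OF assms(1,2), of 0 n] cp_el_entry[OF assms(1,3), of 0 n] assms(4) by simp
  then show "\<eta> n = \<zeta> n" by (metis assms(1) aut_pow_cancel(1) star_automorphism_bij)
qed

definition cp_alg :: "('b::unital_cstar_algebra \<Rightarrow> 'b) \<Rightarrow> 'b adj set" where
  "cp_alg \<beta> = closure (cp_el \<beta> ` Cc UNIV)"

lemma crossed_product_eq:
  assumes "star_automorphism \<beta>" shows "crossed_product \<beta> = op_of ` cp_alg \<beta>"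
proof -
  have "op_of T \<in> crossed_product \<beta> \<longleftrightarrow> T \<in> cp_alg \<beta>" for T
    by (simp add: crossed_product_def adjointable_eq cp_alg_def closure_approachable
        op_of_simps(4)[symmetric] op_of_cp_el[OF assms, symmetric] l2_op_norm_op_of dist_norm norm_minus_commute)
  moreover have "crossed_product \<beta> \<subseteq> range op_of" by (auto simp: crossed_product_def adjointable_eq)
  ultimately show ?thesis by blast
qed

lemma Cc_UNIV_add: "\<eta> \<in> Cc UNIV \<Longrightarrow> \<zeta> \<in> Cc UNIV \<Longrightarrow> (\<lambda>n. \<eta> n + \<zeta> n :: 'b::unital_cstar_algebra) \<in> Cc UNIV"
  unfolding Cc_UNIV_iff by (rule finite_subset[of _ "{n. \<eta> n \<noteq> 0} \<union> {n. \<zeta> n \<noteq> 0}"]) auto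

lemma cp_el_add_mem:
  assumes "star_automorphism \<beta>" "x \<in> cp_el \<beta> ` Cc UNIV" "y \<in> cp_el \<beta> ` Cc UNIV"
  shows "x + y \<in> cp_el \<beta> ` Cc UNIV"
proof -
  obtain \<eta> \<zeta> where \<eta>: "\<eta> \<in> Cc UNIV" "x = cp_el \<beta> \<eta>" "\<zeta> \<in> Cc UNIV" "y = cp_el \<beta> \<zeta>"
    using assms(2,3) by blast
  then have "x + y = cp_el \<beta> (\<lambda>n. \<eta> n + \<zeta> n)" using cp_el_add[OF assms(1)] by simp
  then show ?thesis using Cc_UNIV_add[OF \<eta>(1,3)] by blast
qed

lemma cp_el_mult_mem:
  assumes "star_automorphism \<beta>" "\<eta> \<in> Cc UNIV" "\<zeta> \<in> Cc UNIV"
  shows "cp_el \<beta> \<eta> * cp_el \<beta> \<zeta> \<in> cp_el \<beta> ` Cc UNIV"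
proof -
  let ?E = "cp_el \<beta> ` Cc UNIV"
  have zero: "0 \<in> ?E"
    by (rule image_eqI[of _ _ "\<lambda>_. 0"]) (auto simp: cp_el_def Cc_UNIV_iff)
  have add: "x + y \<in> ?E" if "x \<in> ?E" "y \<in> ?E" for x y
    using that cp_el_add_mem[OF assms(1)] by blast
  have sum: "(\<Sum>i\<in>A. f i) \<in> ?E" if "\<And>i. i \<in> A \<Longrightarrow> f i \<in> ?E" for A :: "int set" and f
    using that by (induction A rule: infinite_finite_induct) (auto simp: zero add)
  have single: "(cp_p \<beta> a * cp_u m) * (cp_p \<beta> b * cp_u n) \<in> ?E" for a b m n
  proof -
    have "(cp_p \<beta> a * cp_u m) * (cp_p \<beta> b * cp_u n) = cp_p \<beta> a * (cp_u m * cp_p \<beta> b) * cp_u n"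
      by (simp only: mult.assoc)
    also have "\<dots> = cp_p \<beta> (a * aut_pow \<beta> m b) * cp_u (m + n)"
      by (simp only: cp_u_cp_p[OF assms(1)] cp_p_mult[OF assms(1)] cp_u_add mult.assoc)
    also have "\<dots> = cp_el \<beta> (\<lambda>l. if l = m + n then a * aut_pow \<beta> m b else 0)"
      by (rule cp_el_single[OF assms(1), symmetric])
    also have "\<dots> \<in> ?E" by (rule imageI) (rule Cc_single; simp)
    finally show ?thesis .
  qed
  show ?thesis
    unfolding cp_el_def[of \<beta> \<eta>] cp_el_def[of \<beta> \<zeta>] sum_product by (intro sum single)
qed

lemma closure_closed_under:
  assumes "\<And>x y. x \<in> A \<Longrightarrow> y \<in> A \<Longrightarrow> f x y \<in> A"
    and "\<And>X Y x y. X \<longlonglongrightarrow> x \<Longrightarrow> Y \<longlonglongrightarrow> y \<Longrightarrow> (\<lambda>k. f (X k) (Y k)) \<longlonglongrightarrow> f x (y :: 'b::metric_space)"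
    and "x \<in> closure A" "y \<in> closure A"
  shows "f x y \<in> closure A"
proof -
  obtain X Y where "\<And>k. X k \<in> A" "X \<longlonglongrightarrow> x" "\<And>k. Y k \<in> A" "Y \<longlonglongrightarrow> y"
    using assms(3,4) unfolding closure_sequential by blast
  then show ?thesis using assms(1,2) unfolding closure_sequential
    by (intro exI[of _ "\<lambda>k. f (X k) (Y k)"]) simp
qed

lemma cp_alg_algebra:
  assumes "star_automorphism \<beta>"
  shows "closed (cp_alg \<beta>)" "1 \<in> cp_alg \<beta>"
    "\<And>x y. x \<in> cp_alg \<beta> \<Longrightarrow> y \<in> cp_alg \<beta> \<Longrightarrow> x + y \<in> cp_alg \<beta>"
    "\<And>r x. x \<in> cp_alg \<beta> \<Longrightarrow> r *\<^sub>R x \<in> cp_alg \<beta>"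
    "\<And>x y. x \<in> cp_alg \<beta> \<Longrightarrow> y \<in> cp_alg \<beta> \<Longrightarrow> x * y \<in> cp_alg \<beta>"
proof -
  let ?E = "cp_el \<beta> ` Cc UNIV"
  show "closed (cp_alg \<beta>)" by (simp add: cp_alg_def)
  have "cp_el \<beta> (\<lambda>m. if m = 0 then 1 else 0) \<in> ?E" by (rule imageI) (rule Cc_single; simp)
  then have "1 \<in> ?E" by (simp add: cp_el_one[OF assms])
  then show "1 \<in> cp_alg \<beta>" using closure_subset[of ?E] by (auto simp: cp_alg_def)
  have add: "x + y \<in> ?E" if "x \<in> ?E" "y \<in> ?E" for x y
    using that cp_el_add_mem[OF assms(1)] by blast
  show "x + y \<in> cp_alg \<beta>" if "x \<in> cp_alg \<beta>" "y \<in> cp_alg \<beta>" for x y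
    using closure_closed_under[of ?E "\<lambda>x y. x + y" x y] add that by (auto simp: cp_alg_def intro: tendsto_add)
  have mult: "x * y \<in> ?E" if "x \<in> ?E" "y \<in> ?E" for x y
    using that cp_el_mult_mem[OF assms(1)] by auto
  show "x * y \<in> cp_alg \<beta>" if "x \<in> cp_alg \<beta>" "y \<in> cp_alg \<beta>" for x y
    using closure_closed_under[of ?E "\<lambda>x y. x * y" x y] mult that by (auto simp: cp_alg_def intro: tendsto_mult)
  have scale: "r *\<^sub>R x \<in> ?E" if "x \<in> ?E" for x r
  proof -
    obtain \<eta> where \<eta>: "\<eta> \<in> Cc UNIV" "x = cp_el \<beta> \<eta>" using \<open>x \<in> ?E\<close> by blast
    have "(\<lambda>n. r *\<^sub>R \<eta> n) \<in> Cc UNIV"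
      using \<eta>(1) unfolding Cc_UNIV_iff by (rule rev_finite_subset) auto
    then show ?thesis using cp_el_scaleR[OF assms \<eta>(1), of r] \<eta>(2) by (metis imageI)
  qed
  show "r *\<^sub>R x \<in> cp_alg \<beta>" if "x \<in> cp_alg \<beta>" for r x
    using closure_closed_under[of ?E "\<lambda>x y. r *\<^sub>R x" x x] scale that
    by (auto simp: cp_alg_def intro: tendsto_scaleR[OF tendsto_const])
qed

text \<open>The order of the crossed product asks for a factor inside it; the root of a positive
  element stays there because the crossed product is a closed unital algebra.\<close>

lemma cpos_cp_alg_sqrt:
  assumes "star_automorphism \<beta>" "cpos a" "a \<in> cp_alg \<beta>"
  obtains d where "d \<in> cp_alg \<beta>" "star d * d = a"
proof -
  obtain d where d: "cpos d" "d * d = a" "d \<in> cp_alg \<beta>"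
    using cpos_sqrt[OF assms(2)] cp_alg_algebra[OF assms(1)] assms(3) by (smt (verit, ccfv_threshold))
  then show ?thesis using that[of d] by (simp add: cpos_sa)
qed

text \<open>\<open>\<Sum> a\<^sub>n \<zeta>\<^sub>n U\<^sup>n\<close> is the product of the row \<open>(\<zeta>\<^sub>n)\<close> and the column \<open>(a\<^sub>n U\<^sup>n)\<close>.\<close>

lemma norm_sum_mult_star_le:
  assumes "star_automorphism \<beta>" "\<zeta> \<in> Cc UNIV" "finite F" "{n. \<zeta> n \<noteq> 0} \<subseteq> F"
  shows "norm (\<Sum>n\<in>F. \<zeta> n * star (\<zeta> n)) \<le> (norm (cp_el \<beta> \<zeta>))\<^sup>2"
proof -
  let ?T = "cp_el \<beta> \<zeta>"
  have fin: "cc_star \<beta> \<zeta> \<in> Cc UNIV"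
  proof -
    have "{n. cc_star \<beta> \<zeta> n \<noteq> 0} \<subseteq> uminus ` F"
    proof
      fix n assume "n \<in> {n. cc_star \<beta> \<zeta> n \<noteq> 0}"
      then have "\<zeta> (- n) \<noteq> 0" by (auto simp: cc_star_def aut_simps assms(1))
      then show "n \<in> uminus ` F" using assms(4) by (intro image_eqI[of _ _ "- n"]) auto
    qed
    then show ?thesis using assms(3) by (simp add: Cc_UNIV_iff finite_subset)
  qed
  \<comment> \<open>The adjoint turns the row of coefficients into a column: applied to the unit
    vector at 0 it yields a vector whose square is the sum to be bounded.\<close>
  have entry: "l2_seq (adj_app (star ?T) (l2_unit 0 1)) m = star (\<zeta> (- m))" for m
    unfolding star_cp_el[OF assms(1,2)] cp_el_entry[OF assms(1) fin]
    by (simp add: cc_star_def assms(1) star_automorphism_bij)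
  have z: "\<zeta> (- m) = 0" if "m \<in> UNIV - uminus ` F" for m
  proof (rule ccontr)
    assume "\<zeta> (- m) \<noteq> 0"
    then have "m \<in> uminus ` F" using assms(4) by (intro image_eqI[of _ _ "- m"]) auto
    then show False using that by simp
  qed
  let ?v = "adj_app (star ?T) (l2_unit 0 1)"
  have "l2i ?v ?v = (\<Sum>\<^sub>\<infinity>m. \<zeta> (- m) * star (\<zeta> (- m)))"
    by (simp add: l2i.rep_eq l2_inner_def entry[simplified] star_star)
  also have "\<dots> = (\<Sum>\<^sub>\<infinity>m\<in>uminus ` F. \<zeta> (- m) * star (\<zeta> (- m)))"
    by (rule infsum_cong_neutral) (simp_all add: z)
  also have "\<dots> = (\<Sum>n\<in>F. \<zeta> n * star (\<zeta> n))"
    using assms(3) by (simp add: sum.reindex)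
  finally have "norm (\<Sum>n\<in>F. \<zeta> n * star (\<zeta> n)) = (norm ?v)\<^sup>2" by (simp add: norm_l2_square)
  also have "\<dots> \<le> (norm ?T)\<^sup>2"
    using norm_adj_app_le[of "star ?T" "l2_unit 0 1"] by (intro power_mono) (simp_all add: norm_l2_unit)
  finally show ?thesis .
qed

lemma norm_coeff_le_norm_cp_el:
  assumes "star_automorphism \<beta>" "\<zeta> \<in> Cc UNIV" shows "norm (\<zeta> n) \<le> norm (cp_el \<beta> \<zeta>)"
proof -
  let ?F = "insert n {n. \<zeta> n \<noteq> 0}"
  have F: "finite ?F" using assms by (simp add: Cc_UNIV_iff)
  have "(norm (\<zeta> n))\<^sup>2 \<le> norm (\<Sum>n\<in>?F. \<zeta> n * star (\<zeta> n))"
    using norm_le_sum_star_mult[OF F, of n "\<lambda>n. star (\<zeta> n)"] by (simp add: star_star)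
  also have "\<dots> \<le> (norm (cp_el \<beta> \<zeta>))\<^sup>2" by (rule norm_sum_mult_star_le[OF assms F]) blast
  finally show ?thesis by (rule power2_le_imp_le) simp
qed

text \<open>Cauchy-Schwarz with \<open>q n\<close> a multiple of a unitary: the column contributes
  exactly the sum of the squares of a, the row at most the norm of the element. The constant does
  not involve the action, which makes all later tail estimates uniform in it.\<close>

lemma norm_cp_el_multiplier_le:
  assumes aut: "star_automorphism \<beta>" and \<zeta>: "\<zeta> \<in> Cc UNIV" and F: "finite F" "{n. \<zeta> n \<noteq> 0} \<subseteq> F"
  shows "norm (cp_el \<beta> (\<lambda>n. a n *\<^sub>R \<zeta> n)) \<le> sqrt (\<Sum>n\<in>F. (a n)\<^sup>2) * norm (cp_el \<beta> \<zeta>)"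
proof -
  let ?p = "\<lambda>n. star (cp_p \<beta> (\<zeta> n))" and ?q = "\<lambda>n. a n *\<^sub>R (cp_u n :: 'a adj)"
  have eq: "cp_el \<beta> (\<lambda>n. a n *\<^sub>R \<zeta> n) = (\<Sum>n\<in>F. star (?p n) * ?q n)"
    using F(2) by (subst cp_el_eq_sum[OF aut F(1)]) (auto simp: star_star cp_p_scaleR aut)
  have "(\<Sum>n\<in>F. star (?p n) * ?p n) = cp_p \<beta> (\<Sum>n\<in>F. \<zeta> n * star (\<zeta> n))"
    by (simp add: star_star star_cp_p aut linear_sum[OF bounded_linear.linear[OF bounded_linear_cp_p[OF aut]]] flip: cp_p_mult)
  then have p: "norm (\<Sum>n\<in>F. star (?p n) * ?p n) \<le> (norm (cp_el \<beta> \<zeta>))\<^sup>2"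
    using norm_cp_p_le[OF aut] norm_sum_mult_star_le[OF aut \<zeta> F] by (metis order_trans)
  have "star (?q n) * ?q n = (a n)\<^sup>2 *\<^sub>R 1" for n
    by (simp add: star_scaleR star_cp_u power2_eq_square cp_u_0 flip: cp_u_add)
  then have "(\<Sum>n\<in>F. star (?q n) * ?q n) = (\<Sum>n\<in>F. (a n)\<^sup>2) *\<^sub>R (1 :: 'a adj)"
    by (simp add: scaleR_sum_left)
  then have q: "norm (\<Sum>n\<in>F. star (?q n) * ?q n) = (\<Sum>n\<in>F. (a n)\<^sup>2)"
    by (simp add: sum_nonneg)
  have "(norm (cp_el \<beta> (\<lambda>n. a n *\<^sub>R \<zeta> n)))\<^sup>2 \<le> (norm (cp_el \<beta> \<zeta>))\<^sup>2 * (\<Sum>n\<in>F. (a n)\<^sup>2)"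
    unfolding eq using cstar_Cauchy_Schwarz_sum[OF F(1), of ?p ?q] mult_right_mono[OF p]
    unfolding q by (meson order_trans sum_nonneg zero_le_power2)
  then have "norm (cp_el \<beta> (\<lambda>n. a n *\<^sub>R \<zeta> n)) \<le> sqrt ((norm (cp_el \<beta> \<zeta>))\<^sup>2 * (\<Sum>n\<in>F. (a n)\<^sup>2))"
    by (rule real_le_rsqrt)
  then show ?thesis by (simp add: real_sqrt_mult mult.commute)
qed

lemma norm_cp_el_le_sum:
  assumes "star_automorphism \<beta>" "finite F" "{n. \<zeta> n \<noteq> 0} \<subseteq> F"
  shows "norm (cp_el \<beta> \<zeta>) \<le> (\<Sum>n\<in>F. norm (\<zeta> n))"
proof -
  have "norm (cp_p \<beta> (\<zeta> n) * cp_u n) \<le> norm (\<zeta> n)" for n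
    using norm_mult_ineq[of "cp_p \<beta> (\<zeta> n)" "cp_u n"] norm_cp_p_le[OF assms(1), of "\<zeta> n"]
    by (simp add: norm_cp_u)
  then show ?thesis
    unfolding cp_el_eq_sum[OF assms] by (intro order_trans[OF norm_sum] sum_mono)
qed

text \<open>Averaging of the \<open>k \<times> k\<close> compression: the matrix entries \<open>\<gamma>\<^sup>-\<^sup>m(y\<^sub>n)\<close> at \<open>(m, m - n)\<close> of an
  element of the crossed product for \<open>\<gamma>\<close> are sent to the average of \<open>U\<^sup>i \<gamma>\<^sup>-\<^sup>i(y\<^sub>i\<^sub>-\<^sub>j) U\<^sup>-\<^sup>j\<close> in the
  crossed product for \<open>\<beta>\<close>. For \<open>\<beta> = \<gamma>\<close> this is the Fejer multiplier.\<close>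

definition window :: "nat \<Rightarrow> int \<Rightarrow> int set" where
  "window k n = {m. 0 \<le> m \<and> m < int k \<and> 0 \<le> m - n \<and> m - n < int k}"

definition cp_transfer :: "nat \<Rightarrow> ('b::unital_cstar_algebra \<Rightarrow> 'b) \<Rightarrow> ('b \<Rightarrow> 'b) \<Rightarrow> (int \<Rightarrow> 'b) \<Rightarrow> int \<Rightarrow> 'b" where
  "cp_transfer k \<beta> \<gamma> y n = (1 / real k) *\<^sub>R (\<Sum>m\<in>window k n. aut_pow \<beta> m (aut_pow \<gamma> (- m) (y n)))"

lemma finite_window [simp]: "finite (window k n)"
  by (rule finite_subset[of _ "{0..<int k}"]) (auto simp: window_def)

lemma window_empty: "\<bar>n\<bar> \<ge> int k \<Longrightarrow> window k n = {}"
  by (auto simp: window_def)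

lemma card_window: "card (window k n) = nat (int k - \<bar>n\<bar>)"
proof (cases "0 \<le> n")
  case True
  then have "window k n = {n..<int k}" by (auto simp: window_def)
  then show ?thesis using True by simp
next
  case False
  then have "window k n = {0..<int k + n}" by (auto simp: window_def)
  then show ?thesis using False by simp
qed

lemma cp_transfer_support: "{n. cp_transfer k \<beta> \<gamma> y n \<noteq> 0} \<subseteq> {- int k..int k}"
proof
  fix n assume "n \<in> {n. cp_transfer k \<beta> \<gamma> y n \<noteq> 0}"
  then have "\<not> \<bar>n\<bar> \<ge> int k" using window_empty[of k n] by (auto simp: cp_transfer_def)
  then show "n \<in> {- int k..int k}" by auto
qed

lemma cp_transfer_Cc_UNIV: "cp_transfer k \<beta> \<gamma> y \<in> Cc UNIV"
  using finite_subset[OF cp_transfer_support] by (simp add: Cc_UNIV_iff)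

text \<open>Summation of a k by k square along its diagonals; \<open>window k n\<close> is the set
  of rows met by the n-th diagonal.\<close>

lemma sum_square_diff:
  fixes f :: "int \<Rightarrow> int \<Rightarrow> 'a::comm_monoid_add"
  shows "(\<Sum>i\<in>{0..<int k}. \<Sum>j\<in>{0..<int k}. f i (i - j)) = (\<Sum>n\<in>{- int k..int k}. \<Sum>i\<in>window k n. f i n)"
proof -
  have "(\<Sum>j\<in>{0..<int k}. f i (i - j)) = (\<Sum>n\<in>{- int k..int k}. if i \<in> window k n then f i n else 0)"
    if "i \<in> {0..<int k}" for i
  proof -
    have "(\<Sum>j\<in>{0..<int k}. f i (i - j)) = (\<Sum>n\<in>{n\<in>{- int k..int k}. i \<in> window k n}. f i n)"
      using that by (intro sum.reindex_bij_witness[of _ "\<lambda>n. i - n" "\<lambda>j. i - j"]) (auto simp: window_def)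
    also have "\<dots> = (\<Sum>n\<in>{- int k..int k}. if i \<in> window k n then f i n else 0)"
      by (rule sum.inter_filter) simp
    finally show ?thesis .
  qed
  then have "(\<Sum>i\<in>{0..<int k}. \<Sum>j\<in>{0..<int k}. f i (i - j))
      = (\<Sum>i\<in>{0..<int k}. \<Sum>n\<in>{- int k..int k}. if i \<in> window k n then f i n else 0)"
    by (rule sum.cong[OF refl])
  also have "\<dots> = (\<Sum>n\<in>{- int k..int k}. \<Sum>i\<in>{0..<int k}. if i \<in> window k n then f i n else 0)"
    by (rule sum.swap)
  also have "\<dots> = (\<Sum>n\<in>{- int k..int k}. \<Sum>i\<in>window k n. f i n)"
    by (intro sum.cong refl sum.mono_neutral_cong_right) (auto simp: window_def)
  finally show ?thesis .
qed

lemma has_sum_finite_sum: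
  fixes f :: "'i \<Rightarrow> 'a \<Rightarrow> 'b::{topological_comm_monoid_add}"
  assumes "finite A" "\<And>i. i \<in> A \<Longrightarrow> (f i has_sum s i) B"
  shows "((\<lambda>x. \<Sum>i\<in>A. f i x) has_sum (\<Sum>i\<in>A. s i)) B"
  using assms by (induction A rule: finite_induct) (auto intro: has_sum_add)

text \<open>The entries of c* c are inner products of columns of c. Placing powers of U around them,
  the whole square becomes a sum of squares over the rows l of c; this is complete positivity of the
  compression made explicit.\<close>

lemma cpos_cp_transfer:
  assumes \<beta>: "star_automorphism \<beta>" and \<gamma>: "star_automorphism \<gamma>" and y: "y \<in> Cc UNIV"
    and c: "star c * c = cp_el \<gamma> y"
  shows "cpos (cp_el \<beta> (cp_transfer k \<beta> \<gamma> y))"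
proof -
  let ?K = "{0..<int k}"
  define e where "e j l = l2_seq (adj_app c (l2_unit j 1)) l" for j l
  define G where "G i j b = cp_u i * cp_p \<beta> b * cp_u (- j)" for i j b
  have blG: "bounded_linear (G i j)" for i j
    unfolding G_def by (intro bounded_linear_intros bounded_linear_compose[OF bounded_linear_mult_left]
        bounded_linear_compose[OF bounded_linear_mult_right] bounded_linear_cp_p \<beta>)
  have hs: "((\<lambda>l. star (e i l) * e j l) has_sum aut_pow \<gamma> (- i) (y (i - j))) UNIV" for i j
  proof -
    have sm: "(\<lambda>l. star (e i l) * e j l) summable_on UNIV"
      unfolding e_def by (intro l2Z_summable_mult l2_seq_l2Z)
    have "(\<Sum>\<^sub>\<infinity>l. star (e i l) * e j l) = l2i (adj_app c (l2_unit i 1)) (adj_app c (l2_unit j 1))"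
      by (simp add: e_def l2i.rep_eq l2_inner_def)
    also have "\<dots> = l2i (l2_unit i 1) (adj_app (star c * c) (l2_unit j 1))"
      by (simp add: l2i_adj_star)
    also have "\<dots> = aut_pow \<gamma> (- i) (y (i - j))"
      unfolding c by (simp add: l2i_l2_unit cp_el_entry[OF \<gamma> y])
    finally show ?thesis using sm by (simp add: has_sum_iff)
  qed
  \<comment> \<open>The l-th row of c, cut to k columns, with its entries moved into the crossed
    product for \<open>\<beta>\<close>. Its square consists of the terms U^i (e_il* e_jl) U^-j, so
    summation over l assembles the entries of c* c.\<close>
  define d where "d l = (\<Sum>j\<in>?K. cp_p \<beta> (e j l) * cp_u (- j))" for l
  have dd: "star (d l) * d l = (\<Sum>i\<in>?K. \<Sum>j\<in>?K. G i j (star (e i l) * e j l))" for l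
    by (simp add: d_def star_sum star_mult star_cp_p star_cp_u \<beta> sum_product G_def cp_p_mult mult.assoc)
  have "((\<lambda>l. star (d l) * d l) has_sum (\<Sum>i\<in>?K. \<Sum>j\<in>?K. G i j (aut_pow \<gamma> (- i) (y (i - j))))) UNIV"
    unfolding dd by (intro has_sum_finite_sum finite_atLeastLessThan_int has_sum_bounded_linear[OF blG hs])
  then have "cpos (\<Sum>i\<in>?K. \<Sum>j\<in>?K. G i j (aut_pow \<gamma> (- i) (y (i - j))))"
    using cpos_infsum[of "\<lambda>l. star (d l) * d l" UNIV] by (auto simp: has_sum_iff cpos_star_mult)
  then have "cpos ((1 / real k) *\<^sub>R (\<Sum>i\<in>?K. \<Sum>j\<in>?K. G i j (aut_pow \<gamma> (- i) (y (i - j)))))"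
    by (rule cpos_scaleR) simp
  also have "(\<Sum>i\<in>?K. \<Sum>j\<in>?K. G i j (aut_pow \<gamma> (- i) (y (i - j))))
      = (\<Sum>i\<in>?K. \<Sum>j\<in>?K. cp_p \<beta> (aut_pow \<beta> i (aut_pow \<gamma> (- i) (y (i - j)))) * cp_u (i - j))"
    by (simp add: G_def cp_u_cp_p[OF \<beta>] mult.assoc flip: cp_u_add)
  also have "\<dots> = (\<Sum>n\<in>{- int k..int k}. \<Sum>i\<in>window k n. cp_p \<beta> (aut_pow \<beta> i (aut_pow \<gamma> (- i) (y n))) * cp_u n)"
    by (rule sum_square_diff)
  also have "(1 / real k) *\<^sub>R \<dots> = cp_el \<beta> (cp_transfer k \<beta> \<gamma> y)"
    by (simp add: cp_el_eq_sum[OF \<beta> _ cp_transfer_support] cp_transfer_def cp_p_scaleR \<beta> scaleR_sum_right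
        linear_sum[OF bounded_linear.linear[OF bounded_linear_cp_p[OF \<beta>]]] sum_distrib_right)
  finally show ?thesis .
qed

lemma cp_transfer_add:
  "star_automorphism \<beta> \<Longrightarrow> star_automorphism \<gamma> \<Longrightarrow>
    cp_transfer k \<beta> \<gamma> (\<lambda>n. x n + y n) = (\<lambda>n. cp_transfer k \<beta> \<gamma> x n + cp_transfer k \<beta> \<gamma> y n)"
  by (auto simp: cp_transfer_def aut_simps sum.distrib scaleR_add_right)

lemma cp_transfer_scaleC:
  "star_automorphism \<beta> \<Longrightarrow> star_automorphism \<gamma> \<Longrightarrow>
    cp_transfer k \<beta> \<gamma> (\<lambda>n. c n *\<^sub>C x n) = (\<lambda>n. c n *\<^sub>C cp_transfer k \<beta> \<gamma> x n)"
  by (auto simp: cp_transfer_def aut_simps scaleC_sum_right scaleC_scaleR)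

lemma cp_transfer_scaleR:
  "star_automorphism \<beta> \<Longrightarrow> star_automorphism \<gamma> \<Longrightarrow>
    cp_transfer k \<beta> \<gamma> (\<lambda>n. r *\<^sub>R x n) = (\<lambda>n. r *\<^sub>R cp_transfer k \<beta> \<gamma> x n)"
  using cp_transfer_scaleC[of \<beta> \<gamma> k "\<lambda>_. complex_of_real r" x] by (simp add: scaleC_of_real)

definition cc_one :: "int \<Rightarrow> 'b::unital_cstar_algebra" where
  "cc_one m = (if m = 0 then 1 else 0)"

lemma cp_transfer_one:
  assumes "star_automorphism \<beta>" "star_automorphism \<gamma>" "k > 0"
  shows "cp_transfer k \<beta> \<gamma> cc_one = cc_one"
proof
  fix n
  have "of_nat k = real k *\<^sub>R (1 :: 'a)" by (simp add: scaleR_conv_of_real)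
  then show "cp_transfer k \<beta> \<gamma> cc_one n = cc_one n"
    using assms by (cases "n = 0") (simp_all add: cp_transfer_def cc_one_def aut_simps card_window)
qed

lemma cc_one_Cc_UNIV: "cc_one \<in> Cc UNIV"
  unfolding cc_one_def[abs_def] by (rule Cc_single) simp_all

lemma cp_el_cc_one: "star_automorphism \<beta> \<Longrightarrow> cp_el \<beta> cc_one = 1"
  unfolding cc_one_def[abs_def] by (rule cp_el_one)

lemma Cc_UNIV_scaleR: "\<eta> \<in> Cc UNIV \<Longrightarrow> (\<lambda>n. r *\<^sub>R \<eta> n :: 'b::unital_cstar_algebra) \<in> Cc UNIV"
  unfolding Cc_UNIV_iff by (erule rev_finite_subset) auto

text \<open>A unital positive map sends the positive elements r + y and r - y to r plus and minus
  the image of y, where r is the norm of y. Self-adjointness of the image is read off from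
  positivity as well.\<close>

lemma cp_transfer_contractive:
  assumes \<beta>: "star_automorphism \<beta>" and \<gamma>: "star_automorphism \<gamma>" and y: "y \<in> Cc UNIV"
    and sa: "star (cp_el \<gamma> y) = cp_el \<gamma> y" and k: "k > 0"
  shows "star (cp_el \<beta> (cp_transfer k \<beta> \<gamma> y)) = cp_el \<beta> (cp_transfer k \<beta> \<gamma> y)"
    "norm (cp_el \<beta> (cp_transfer k \<beta> \<gamma> y)) \<le> norm (cp_el \<gamma> y)"
proof -
  define r where "r = norm (cp_el \<gamma> y)"
  have pos: "cpos (r *\<^sub>R 1 + s *\<^sub>R cp_el \<beta> (cp_transfer k \<beta> \<gamma> y))" if "\<bar>s\<bar> = 1" for s
  proof -
    have "cpos (r *\<^sub>R 1 + s *\<^sub>R cp_el \<gamma> y)"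
      using that by (intro cpos_norm_plus) (simp_all add: star_scaleR sa r_def)
    then obtain d where d: "cpos d" "d * d = r *\<^sub>R 1 + s *\<^sub>R cp_el \<gamma> y" by (metis cpos_sqrt)
    let ?z = "\<lambda>n. r *\<^sub>R cc_one n + s *\<^sub>R y n"
    have z: "?z \<in> Cc UNIV" by (intro Cc_UNIV_add Cc_UNIV_scaleR cc_one_Cc_UNIV y)
    have ez: "cp_el \<alpha> (\<lambda>n. r *\<^sub>R cc_one n + s *\<^sub>R x n) = r *\<^sub>R 1 + s *\<^sub>R cp_el \<alpha> x"
      if "star_automorphism \<alpha>" "x \<in> Cc UNIV" for \<alpha> x
      using that by (simp add: cp_el_add Cc_UNIV_scaleR cc_one_Cc_UNIV cp_el_scaleR cp_el_cc_one)
    have "star d * d = cp_el \<gamma> ?z" using d by (simp add: cpos_sa ez[OF \<gamma> y])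
    then have "cpos (cp_el \<beta> (cp_transfer k \<beta> \<gamma> ?z))" by (rule cpos_cp_transfer[OF \<beta> \<gamma> z])
    then show ?thesis
      by (simp add: cp_transfer_add cp_transfer_scaleR cp_transfer_one \<beta> \<gamma> k ez[OF \<beta> cp_transfer_Cc_UNIV])
  qed
  have "star (r *\<^sub>R 1 + 1 *\<^sub>R cp_el \<beta> (cp_transfer k \<beta> \<gamma> y)) = r *\<^sub>R 1 + 1 *\<^sub>R cp_el \<beta> (cp_transfer k \<beta> \<gamma> y)"
    by (rule cpos_sa[OF pos]) simp
  then show "star (cp_el \<beta> (cp_transfer k \<beta> \<gamma> y)) = cp_el \<beta> (cp_transfer k \<beta> \<gamma> y)"
    by (simp add: star_add star_scaleR)
  show "norm (cp_el \<beta> (cp_transfer k \<beta> \<gamma> y)) \<le> norm (cp_el \<gamma> y)"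
    using pos[of 1] pos[of "-1"] by (intro norm_le_if_cpos) (simp_all add: r_def)
qed

section \<open>States and total boundedness\<close>

definition sublinear :: "('a::real_vector \<Rightarrow> real) \<Rightarrow> bool" where
  "sublinear p \<longleftrightarrow> (\<forall>x y. p (x + y) \<le> p x + p y) \<and> (\<forall>t\<ge>0. \<forall>x. p (t *\<^sub>R x) \<le> t * p x)"

lemma sublinear_zero: "sublinear p \<Longrightarrow> p 0 = 0"
proof -
  assume p: "sublinear p"
  have "p (0 *\<^sub>R 0) \<le> 0 * p 0" using p unfolding sublinear_def by blast
  moreover have "p (0 + 0) \<le> p 0 + p 0" using p unfolding sublinear_def by blast
  ultimately show ?thesis by simp
qed

lemma sublinear_minus: "sublinear p \<Longrightarrow> - p (- x) \<le> p x"
proof -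
  assume p: "sublinear p"
  then have "p (x + - x) \<le> p x + p (- x)" unfolding sublinear_def by blast
  then show ?thesis using sublinear_zero[OF p] by simp
qed

text \<open>The infimum of \<open>p (x + t *\<^sub>R h) - t * p h\<close> over t \<ge> 0 is again
  sublinear, and t = 1 gives the bound at - h. It serves twice: to prescribe the value at h, and to
  show that a minimal functional is odd.\<close>

lemma sublinear_lower:
  assumes p: "sublinear p"
  obtains q where "sublinear q" "\<And>x. q x \<le> p x" "q (- h) \<le> - p h"
proof -
  define q where "q x = (INF t\<in>{0..}. p (x + t *\<^sub>R h) - t * p h)" for x
  have add: "p (x + y) \<le> p x + p y" for x y using p by (simp add: sublinear_def)
  have scale: "t \<ge> 0 \<Longrightarrow> p (t *\<^sub>R x) \<le> t * p x" for t x using p by (simp add: sublinear_def)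
  have lb: "- p (- x) \<le> p (x + t *\<^sub>R h) - t * p h" if "t \<ge> 0" for x t
  proof (cases "t = 0")
    case True
    then show ?thesis using sublinear_minus[OF p, of x] by simp
  next
    case False
    have "p (t *\<^sub>R h) \<le> p (x + t *\<^sub>R h) + p (- x)" using add[of "x + t *\<^sub>R h" "- x"] by simp
    moreover have "t * p h \<le> p (t *\<^sub>R h)"
      using scale[of "1 / t" "t *\<^sub>R h"] that False by (simp add: field_simps)
    ultimately show ?thesis by linarith
  qed
  have bdd: "bdd_below ((\<lambda>t. p (x + t *\<^sub>R h) - t * p h) ` {0..})" for x
    by (rule bdd_belowI2[of _ "- p (- x)"]) (auto intro: lb)
  have q_le: "q x \<le> p (x + t *\<^sub>R h) - t * p h" if "t \<ge> 0" for x t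
    unfolding q_def by (rule cINF_lower[OF bdd]) (use that in auto)
  have q_ge: "c \<le> q x" if "\<And>t. t \<ge> 0 \<Longrightarrow> c \<le> p (x + t *\<^sub>R h) - t * p h" for c x
    unfolding q_def by (rule cINF_greatest) (use that in auto)
  have qadd: "q (x + y) \<le> q x + q y" for x y
  proof -
    have "q (x + y) - (p (x + s *\<^sub>R h) - s * p h) \<le> q y" if "s \<ge> 0" for s
    proof (rule q_ge)
      fix t :: real assume "t \<ge> 0"
      have "q (x + y) \<le> p (x + y + (s + t) *\<^sub>R h) - (s + t) * p h"
        using that \<open>t \<ge> 0\<close> by (intro q_le) simp
      also have "p (x + y + (s + t) *\<^sub>R h) \<le> p (x + s *\<^sub>R h) + p (y + t *\<^sub>R h)"
        using add[of "x + s *\<^sub>R h" "y + t *\<^sub>R h"] by (simp add: algebra_simps)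
      finally show "q (x + y) - (p (x + s *\<^sub>R h) - s * p h) \<le> p (y + t *\<^sub>R h) - t * p h"
        by (simp add: algebra_simps)
    qed
    then have "q (x + y) - q y \<le> q x" by (intro q_ge) (simp add: algebra_simps)
    then show ?thesis by simp
  qed
  have qscale: "q (c *\<^sub>R x) \<le> c * q x" if "c \<ge> 0" for c x
  proof (cases "c = 0")
    case True
    then show ?thesis using q_le[of 0 0] sublinear_zero[OF p] by simp
  next
    case False
    have "q (c *\<^sub>R x) / c \<le> q x"
    proof (rule q_ge)
      fix t :: real assume "t \<ge> 0"
      have "q (c *\<^sub>R x) \<le> p (c *\<^sub>R x + (c * t) *\<^sub>R h) - (c * t) * p h"
        using that \<open>t \<ge> 0\<close> by (intro q_le) simp
      also have "p (c *\<^sub>R x + (c * t) *\<^sub>R h) \<le> c * p (x + t *\<^sub>R h)"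
        using scale[OF that, of "x + t *\<^sub>R h"] by (simp add: algebra_simps)
      finally show "q (c *\<^sub>R x) / c \<le> p (x + t *\<^sub>R h) - t * p h"
        using False that by (simp add: field_simps)
    qed
    then show ?thesis using False that by (simp add: field_simps)
  qed
  show ?thesis
  proof (rule that)
    show "sublinear q" using qadd qscale by (simp add: sublinear_def)
    show "q x \<le> p x" for x using q_le[of 0 x] by simp
    show "q (- h) \<le> - p h" using q_le[of 1 "- h"] sublinear_zero[OF p] by simp
  qed
qed

text \<open>The Hahn--Banach theorem in the form that minimal sublinear functionals are linear.\<close>

lemma sublinear_minimal:
  assumes p: "sublinear p"
  obtains f where "sublinear f" "\<And>x. f x \<le> p x" "\<And>q. sublinear q \<Longrightarrow> (\<And>x. q x \<le> f x) \<Longrightarrow> q = f"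
proof -
  define A where "A = {q. sublinear q \<and> (\<forall>x. q x \<le> p x)}"
  define P where "P q q' \<longleftrightarrow> (\<forall>x. q' x \<le> q x)" for q q' :: "'a \<Rightarrow> real"
  have lower: "- p (- x) \<le> q x" if "q \<in> A" for q x
    using sublinear_minus[of q x] that by (auto simp: A_def) (meson neg_le_iff_le order_trans)
  have "\<exists>m\<in>A. \<forall>a\<in>A. P m a \<longrightarrow> a = m"
  proof (rule predicate_Zorn)
    show "partial_order_on A (relation_of P A)"
      by (rule partial_order_on_relation_ofI) (auto simp: P_def fun_eq_iff intro: order_trans antisym)
    fix C assume C: "C \<in> Chains (relation_of P A)"
    show "\<exists>u\<in>A. \<forall>a\<in>C. P a u"
    proof (cases "C = {}")
      case True
      then show ?thesis using p by (intro bexI[of _ p]) (auto simp: A_def)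
    next
      case False
      have CA: "C \<subseteq> A" using C by (auto simp: Chains_def relation_of_def)
      have chain: "P q q' \<or> P q' q" if "q \<in> C" "q' \<in> C" for q q'
        using C that by (auto simp: Chains_def relation_of_def)
      define u where "u x = (INF q\<in>C. q x)" for x
      have bdd: "bdd_below ((\<lambda>q. q x) ` C)" for x
        by (rule bdd_belowI2[of _ "- p (- x)"]) (use CA lower in auto)
      have u_le: "u x \<le> q x" if "q \<in> C" for q x
        unfolding u_def by (rule cINF_lower[OF bdd that])
      have u_ge: "c \<le> u x" if "\<And>q. q \<in> C \<Longrightarrow> c \<le> q x" for c x
        unfolding u_def by (rule cINF_greatest[OF False that])
      have uadd: "u (x + y) \<le> u x + u y" for x y
      proof -
        have "u (x + y) - q x \<le> u y" if "q \<in> C" for q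
        proof (rule u_ge)
          fix q' assume "q' \<in> C"
          \<comment> \<open>Of two members of a chain the smaller one is below both, hence usable at
            x and at y simultaneously.\<close>
          then obtain r where r: "r \<in> C" "r x \<le> q x" "r y \<le> q' y"
            using chain[OF \<open>q \<in> C\<close> \<open>q' \<in> C\<close>] \<open>q \<in> C\<close> by (auto simp: P_def)
          have "u (x + y) \<le> r (x + y)" by (rule u_le[OF r(1)])
          also have "\<dots> \<le> r x + r y" using r(1) CA by (auto simp: A_def sublinear_def)
          finally show "u (x + y) - q x \<le> q' y" using r by simp
        qed
        then have "u (x + y) - u y \<le> u x" by (intro u_ge) (simp add: algebra_simps)
        then show ?thesis by simp
      qed
      have uscale: "u (t *\<^sub>R x) \<le> t * u x" if "t \<ge> 0" for t x
      proof (cases "t = 0")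
        case True
        obtain q where "q \<in> C" using False by blast
        then have "q 0 = 0" using CA sublinear_zero by (auto simp: A_def)
        then show ?thesis using u_le[OF \<open>q \<in> C\<close>, of 0] True by simp
      next
        case False
        have "u (t *\<^sub>R x) / t \<le> u x"
        proof (rule u_ge)
          fix q assume "q \<in> C"
          then have "q (t *\<^sub>R x) \<le> t * q x" using CA \<open>t \<ge> 0\<close> by (auto simp: A_def sublinear_def)
          then show "u (t *\<^sub>R x) / t \<le> q x"
            using u_le[OF \<open>q \<in> C\<close>, of "t *\<^sub>R x"] False \<open>t \<ge> 0\<close> by (simp add: field_simps)
        qed
        then show ?thesis using False that by (simp add: field_simps)
      qed
      obtain q where "q \<in> C" using False by blast
      then have "u x \<le> p x" for x using u_le[of q x] CA by (auto simp: A_def intro: order_trans)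
      then have "u \<in> A" using uadd uscale by (simp add: A_def sublinear_def)
      then show ?thesis using u_le by (auto simp: P_def)
    qed
  qed
  then obtain f where f: "f \<in> A" "\<And>a. a \<in> A \<Longrightarrow> P f a \<Longrightarrow> a = f" by blast
  show ?thesis
  proof (rule that)
    show "sublinear f" "f x \<le> p x" for x using f(1) by (auto simp: A_def)
    fix q assume q: "sublinear q" "\<And>x. q x \<le> f x"
    then have "q \<in> A" using f(1) by (auto simp: A_def intro: order_trans)
    then show "q = f" using f(2) q(2) by (simp add: P_def)
  qed
qed

text \<open>Minimality is taken below the lowered functional q, which forces the value at h.
  Lowering once more in an arbitrary direction cannot change a minimal f, so f is odd, and an odd
  sublinear functional is linear.\<close>

theorem Hahn_Banach_sublinear:
  assumes p: "sublinear p"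
  obtains f where "linear f" "\<And>x. f x \<le> p x" "f h = p h"
proof -
  obtain q where q: "sublinear q" "\<And>x. q x \<le> p x" "q (- h) \<le> - p h" using sublinear_lower[OF p] by metis
  obtain f where f: "sublinear f" "\<And>x. f x \<le> q x" "\<And>q. sublinear q \<Longrightarrow> (\<And>x. q x \<le> f x) \<Longrightarrow> q = f"
    using sublinear_minimal[OF q(1)] by metis
  have neg: "f (- k) = - f k" for k
  proof -
    obtain g where g: "sublinear g" "\<And>x. g x \<le> f x" "g (- k) \<le> - f k" using sublinear_lower[OF f(1)] by metis
    then have "g = f" using f(3) by blast
    then show ?thesis using g(3) sublinear_minus[OF f(1), of k] by simp
  qed
  have add_le: "f (x + y) \<le> f x + f y" and scale_le: "t \<ge> 0 \<Longrightarrow> f (t *\<^sub>R x) \<le> t * f x" for x y t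
    using f(1) by (auto simp: sublinear_def)
  have add: "f (x + y) = f x + f y" for x y
    using add_le[of x y] add_le[of "x + y" "- y"] by (simp add: neg)
  have pos: "f (t *\<^sub>R x) = t * f x" if "t \<ge> 0" for t x
    using scale_le[OF that, of x] scale_le[OF that, of "- x"] by (simp add: neg)
  have scale: "f (t *\<^sub>R x) = t * f x" for t x
    using pos[of t x] pos[of "- t" x] neg[of "t *\<^sub>R x"] by (cases "t \<ge> 0") auto
  show ?thesis
  proof (rule that[of f])
    show "linear f" by (rule linearI) (simp_all add: add scale)
    show fp: "f x \<le> p x" for x using f(2) q(2) order_trans by blast
    show "f h = p h" using fp[of h] f(2)[of "- h"] q(3) neg[of h] by linarith
  qed
qed

section \<open>States of a C*-algebra and their weak-star compactness\<close>

lemma cpos_scaleR_one: "cpos (c *\<^sub>R (1::'a::unital_cstar_algebra)) \<Longrightarrow> 0 \<le> c"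
proof -
  assume "cpos (c *\<^sub>R (1::'a))"
  then obtain s where "norm (s *\<^sub>R 1 - c *\<^sub>R (1::'a)) \<le> s" by (auto simp: cpos_def)
  then have "\<bar>s - c\<bar> \<le> s" by (simp add: scaleR_diff_left[symmetric])
  then show ?thesis by simp
qed

text \<open>The sublinear functional p is the least scalar above the real part of x. For
  self-adjoint h the norm is at most the larger of p(h) and p(-h), so a real functional below p that
  attains the larger value norms h; domination by p makes it positive and unital.\<close>

lemma ex_cstar_state:
  assumes sa: "star h = (h :: 'a::unital_cstar_algebra)"
  obtains \<mu> where "\<mu> \<in> cstar_states" "norm h \<le> cmod (\<mu> h)"
proof -
  define R :: "'a \<Rightarrow> 'a" where "R x = (1 / 2) *\<^sub>R (x + star x)" for x
  have Rsa: "star (R x) = R x" for x by (simp add: R_def star_scaleR star_add star_star add.commute)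
  have Radd: "R (x + y) = R x + R y" for x y by (simp add: R_def star_add algebra_simps)
  have Rscale: "R (t *\<^sub>R x) = t *\<^sub>R R x" for t x by (simp add: R_def star_scaleR algebra_simps)
  have Rid: "R x = x" if "star x = x" for x using that by (simp add: R_def scaleR_2[symmetric])
  have RI: "R (\<i> *\<^sub>C x) = 0" if "star x = x" for x
    using that by (simp add: R_def star_scaleC scaleC_minus_left)
  define p where "p x = Inf {r. cpos (r *\<^sub>R 1 - R x)}" for x
  have ne: "norm (R x) \<in> {r. cpos (r *\<^sub>R 1 - R x)}" for x by (simp add: cpos_norm_minus Rsa)
  have lb: "- norm (R x) \<le> r" if "cpos (r *\<^sub>R 1 - R x)" for r x
  proof -
    have "cpos ((r *\<^sub>R 1 - R x) + (norm (R x) *\<^sub>R 1 + R x))"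
      by (intro cpos_add that cpos_norm_plus Rsa order_refl)
    then have "cpos ((r + norm (R x)) *\<^sub>R (1::'a))" by (simp add: scaleR_add_left)
    then show ?thesis using cpos_scaleR_one by fastforce
  qed
  have p_le: "p x \<le> r" if "cpos (r *\<^sub>R 1 - R x)" for r x
    unfolding p_def by (rule cInf_lower) (use that lb in \<open>auto intro: bdd_belowI[of _ "- norm (R x)"]\<close>)
  have p_approx: "\<exists>r<c. cpos (r *\<^sub>R 1 - R x)" if "p x < c" for c x
    using cInf_lessD[of "{r. cpos (r *\<^sub>R 1 - R x)}" c] ne that by (auto simp: p_def)
  have p_approx_le: "cpos (c *\<^sub>R 1 - R x)" if c: "p x < c" for c x
  proof -
    obtain r where r: "r < c" "cpos (r *\<^sub>R 1 - R x)" using p_approx[OF c] by blast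
    have "cpos ((r *\<^sub>R 1 - R x) + (c - r) *\<^sub>R 1)" using r by (intro cpos_add cpos_scaleR) auto
    then show ?thesis by (simp add: algebra_simps)
  qed
  have "sublinear p"
    unfolding sublinear_def
  proof (intro conjI allI impI)
    fix x y
    show "p (x + y) \<le> p x + p y"
    proof (rule field_le_epsilon)
      fix e :: real assume "e > 0"
      have "cpos (((p x + e / 2) *\<^sub>R 1 - R x) + ((p y + e / 2) *\<^sub>R 1 - R y))"
        using \<open>e > 0\<close> by (intro cpos_add p_approx_le) auto
      also have "((p x + e / 2) *\<^sub>R 1 - R x) + ((p y + e / 2) *\<^sub>R 1 - R y)
          = ((p x + e / 2) + (p y + e / 2)) *\<^sub>R 1 - R (x + y)"
        by (simp only: Radd scaleR_add_left diff_conv_add_uminus minus_add_distrib ac_simps)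
      finally have "p (x + y) \<le> (p x + e / 2) + (p y + e / 2)" by (rule p_le)
      then show "p (x + y) \<le> p x + p y + e" by simp
    qed
  next
    fix t :: real and x assume "t \<ge> 0"
    show "p (t *\<^sub>R x) \<le> t * p x"
    proof (rule field_le_epsilon)
      fix e :: real assume "e > 0"
      define s where "s = p x + e / (t + 1)"
      have "cpos (t *\<^sub>R (s *\<^sub>R 1 - R x))"
        unfolding s_def using \<open>e > 0\<close> \<open>t \<ge> 0\<close> by (intro cpos_scaleR p_approx_le) auto
      then have "cpos ((t * s) *\<^sub>R 1 - R (t *\<^sub>R x))" by (simp add: Rscale scaleR_diff_right)
      then have "p (t *\<^sub>R x) \<le> t * s" by (rule p_le)
      also have "t * s \<le> t * p x + e"
        using \<open>t \<ge> 0\<close> \<open>e > 0\<close> by (simp add: s_def field_simps)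
      finally show "p (t *\<^sub>R x) \<le> t * p x + e" .
    qed
  qed
  have big: "norm h \<le> max (p h) (p (- h))"
  proof (rule field_le_epsilon)
    fix e :: real assume "e > 0"
    let ?c = "max (p h) (p (- h)) + e"
    have "cpos (?c *\<^sub>R 1 - R h)" "cpos (?c *\<^sub>R 1 - R (- h))"
      using \<open>e > 0\<close> by (intro p_approx_le; simp)+
    then show "norm h \<le> ?c"
      using sa by (intro norm_le_if_cpos) (simp_all add: Rid star_minus)
  qed
  then obtain g where g: "g = h \<or> g = - h" "norm h \<le> p g" by (metis max_def)
  obtain f where f: "linear f" "\<And>x. f x \<le> p x" "f g = p g"
    using Hahn_Banach_sublinear[OF \<open>sublinear p\<close>] by metis
  \<comment> \<open>A real functional below p vanishes on elements without real part, so its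
    complexification is real on self-adjoint elements.\<close>
  have f0: "f x = 0" if "R x = 0" for x
  proof -
    have "f x \<le> 0" using f(2)[of x] p_le[of 0 x] that by simp
    moreover have "R (- x) = 0" using that Rscale[of "-1" x] by simp
    then have "f (- x) \<le> 0" using f(2)[of "- x"] p_le[of 0 "- x"] by simp
    ultimately show ?thesis using linear_neg[OF f(1), of x] by simp
  qed
  have fpos: "0 \<le> f a" if "cpos a" for a
  proof -
    have "R (- a) = - a" using that by (intro Rid) (simp add: star_minus cpos_sa)
    then have "p (- a) \<le> 0" using that by (intro p_le) simp
    then show ?thesis using f(2)[of "- a"] linear_neg[OF f(1), of a] by simp
  qed
  have f1: "f 1 = 1"
  proof -
    have "p 1 \<le> 1" "p (- 1) \<le> - 1" by (rule p_le; simp add: Rid star_minus)+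
    then show ?thesis using f(2)[of 1] f(2)[of "- 1"] linear_neg[OF f(1), of 1] by linarith
  qed
  \<comment> \<open>The standard complexification f(x) - i f(i x) of a real functional.\<close>
  define \<mu> where "\<mu> x = Complex (f x) (- f (\<i> *\<^sub>C x))" for x
  have \<mu>sa: "\<mu> x = complex_of_real (f x)" if "star x = x" for x
    using f0[OF RI[OF that]] by (simp add: \<mu>_def complex_eq_iff)
  show ?thesis
  proof (rule that[of \<mu>])
    have "\<mu> (c *\<^sub>C x) = c * \<mu> x" for c x
    proof -
      have c: "c *\<^sub>C z = Re c *\<^sub>R z + Im c *\<^sub>R (\<i> *\<^sub>C z)" for z :: 'a
      proof -
        have "c *\<^sub>C z = (complex_of_real (Re c) + complex_of_real (Im c) * \<i>) *\<^sub>C z"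
          by (metis complex_eq mult.commute)
        then show ?thesis by (simp add: scaleC_add_left scaleC_of_real flip: scaleC_scaleC)
      qed
      have "\<i> *\<^sub>C c *\<^sub>C x = Re c *\<^sub>R (\<i> *\<^sub>C x) - Im c *\<^sub>R x"
        by (subst c) (simp add: scaleC_add_right scaleC_scaleR scaleC_scaleC scaleC_minus_left)
      then show ?thesis
        using c[of x] by (simp add: \<mu>_def complex_eq_iff linear_add[OF f(1)] linear_diff[OF f(1)]
            linear_scale[OF f(1)])
    qed
    moreover have "\<mu> (x + y) = \<mu> x + \<mu> y" for x y
      by (simp add: \<mu>_def complex_eq_iff scaleC_add_right linear_add[OF f(1)])
    ultimately show "\<mu> \<in> cstar_states"
      using fpos[OF cpos_star_mult] by (simp add: cstar_states_def \<mu>sa star_mult star_star f1)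
    have "norm h \<le> \<bar>f h\<bar>" using g f(3) linear_neg[OF f(1), of h] by auto
    then show "norm h \<le> cmod (\<mu> h)" by (simp add: \<mu>sa sa)
  qed
qed

lemma cstar_state_sa:
  assumes "\<mu> \<in> cstar_states" "star h = h"
  shows "Im (\<mu> h) = 0" "\<bar>Re (\<mu> h)\<bar> \<le> norm h"
proof -
  have add: "\<mu> (x + y) = \<mu> x + \<mu> y" and scale: "\<mu> (c *\<^sub>C x) = c * \<mu> x" and one: "\<mu> 1 = 1" for x y c
    using assms(1) by (auto simp: cstar_states_def)
  have scaleR: "\<mu> (r *\<^sub>R x) = of_real r * \<mu> x" for r x using scale[of "of_real r" x] by (simp add: scaleC_of_real)
  have pos: "Im (\<mu> a) = 0 \<and> 0 \<le> Re (\<mu> a)" if a: "cpos a" for a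
  proof -
    obtain d where "cpos d" "d * d = a" using cpos_sqrt[OF a] by metis
    then have "a = star d * d" by (simp add: cpos_sa)
    then show ?thesis using assms(1) by (simp add: cstar_states_def)
  qed
  have eq: "\<mu> (norm h *\<^sub>R 1 + s *\<^sub>R h) = norm h + s * \<mu> h" for s :: real
    by (simp only: add scaleR one) simp
  have "\<mu> (norm h *\<^sub>R 1 + h) = norm h + \<mu> h" "\<mu> (norm h *\<^sub>R 1 - h) = norm h - \<mu> h"
    using eq[of 1] eq[of "- 1"] by simp_all
  then show "Im (\<mu> h) = 0" "\<bar>Re (\<mu> h)\<bar> \<le> norm h"
    using pos[OF cpos_norm_plus[OF assms(2) order_refl]] pos[OF cpos_norm_minus[OF assms(2) order_refl]]
    by (simp_all add: abs_le_iff)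
qed

lemma cstar_state_real_imag:
  assumes "\<mu> \<in> cstar_states" "star u = u" "star v = v"
  shows "\<mu> (u + \<i> *\<^sub>C v) = Complex (Re (\<mu> u)) (Re (\<mu> v))"
proof -
  have "\<mu> (u + \<i> *\<^sub>C v) = \<mu> u + \<i> * \<mu> v" using assms(1) by (simp add: cstar_states_def)
  then show ?thesis
    using cstar_state_sa(1)[OF assms(1,2)] cstar_state_sa(1)[OF assms(1,3)] by (simp add: complex_eq_iff)
qed

text \<open>The factor 2 comes from treating real and imaginary parts separately; any bound linear
  in the norm serves for compactness.\<close>

lemma cstar_state_norm_le:
  assumes "\<mu> \<in> cstar_states" shows "cmod (\<mu> x) \<le> 2 * norm x"
proof -
  obtain u v where uv: "star u = u" "star v = v" "x = u + \<i> *\<^sub>C v"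
    "u = (1 / 2) *\<^sub>R (x + star x)" "v = (1 / 2) *\<^sub>R ((- \<i>) *\<^sub>C (x - star x))" using real_imag_parts by metis
  have "norm u \<le> norm x" using norm_triangle_ineq[of x "star x"] by (simp add: uv(4))
  moreover have "norm v \<le> norm x" using norm_triangle_ineq4[of x "star x"] by (simp add: uv(5) norm_scaleC)
  moreover have "cmod (\<mu> x) \<le> \<bar>Re (\<mu> u)\<bar> + \<bar>Re (\<mu> v)\<bar>"
    using cmod_le[of "\<mu> x"] cstar_state_real_imag[OF assms uv(1,2)] uv(3) by simp
  ultimately show ?thesis
    using cstar_state_sa(2)[OF assms uv(1)] cstar_state_sa(2)[OF assms uv(2)] by linarith
qed

text \<open>The Banach-Alaoglu argument: a set cut out by closed conditions on evaluations inside a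
  product of discs.\<close>

lemma compact_cstar_states: "compact (cstar_states :: ('a::unital_cstar_algebra \<Rightarrow> complex) set)"
proof -
  have cont: "continuous_on UNIV (\<lambda>\<mu>::'a \<Rightarrow> complex. \<mu> x)" for x by simp
  have eq: "cstar_states = (\<Inter>x. \<Inter>y. {\<mu>::'a \<Rightarrow> complex. \<mu> (x + y) = \<mu> x + \<mu> y}) \<inter>
      (\<Inter>c. \<Inter>x. {\<mu>. \<mu> (c *\<^sub>C x) = c * \<mu> x}) \<inter>
      (\<Inter>x. {\<mu>. Im (\<mu> (star x * x)) = 0} \<inter> {\<mu>. 0 \<le> Re (\<mu> (star x * x))}) \<inter> {\<mu>. \<mu> 1 = 1}"
    by (auto simp: cstar_states_def)
  have cl: "closed (cstar_states :: ('a \<Rightarrow> complex) set)"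
    unfolding eq
    by (intro closed_Int closed_INT ballI closed_Collect_eq closed_Collect_le continuous_intros cont)
  have "compactin (product_topology (\<lambda>_. euclidean) UNIV) (PiE UNIV (\<lambda>x::'a. cball (0::complex) (2 * norm x)))"
    unfolding compactin_PiE by simp
  then have "compact (PiE UNIV (\<lambda>x::'a. cball (0::complex) (2 * norm x)))"
    by (simp add: euclidean_product_topology)
  moreover have "cstar_states \<subseteq> PiE UNIV (\<lambda>x::'a. cball (0::complex) (2 * norm x))"
    using cstar_state_norm_le by (auto simp: dist_norm)
  ultimately show ?thesis using cl by (metis closed_Int_compact inf.absorb_iff1 inf.orderE)
qed

section \<open>Total boundedness of the Lipschitz ball of the coefficient algebra\<close>

text \<open>A pigeonhole argument over the finitely many patterns of approximating points. The net
  has to consist of members of S, since its elements must later satisfy the Lipschitz bounds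
  themselves; this costs half of e.\<close>

lemma finite_net_multi:
  fixes g :: "'i \<Rightarrow> 's \<Rightarrow> 'm::metric_space"
  assumes "finite I" "e > 0"
    and net: "\<And>i d. i \<in> I \<Longrightarrow> d > 0 \<Longrightarrow> \<exists>C. finite C \<and> (\<forall>x\<in>S. \<exists>c\<in>C. dist (g i x) c < d)"
  shows "\<exists>F. finite F \<and> F \<subseteq> S \<and> (\<forall>x\<in>S. \<exists>f\<in>F. \<forall>i\<in>I. dist (g i x) (g i f) < e)"
proof -
  have "\<exists>C. finite C \<and> (\<forall>x\<in>S. \<exists>c\<in>C. dist (g i x) c < e / 2)" if "i \<in> I" for i
    by (rule net[OF that half_gt_zero[OF \<open>e > 0\<close>]])
  then obtain C where C: "\<And>i. i \<in> I \<Longrightarrow> finite (C i)" "\<And>i x. i \<in> I \<Longrightarrow> x \<in> S \<Longrightarrow> \<exists>c\<in>C i. dist (g i x) c < e / 2"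
    by metis
  then obtain c where c: "\<And>i x. i \<in> I \<Longrightarrow> x \<in> S \<Longrightarrow> c i x \<in> C i \<and> dist (g i x) (c i x) < e / 2"
    by metis
  define \<phi> where "\<phi> x = restrict (\<lambda>i. c i x) I" for x
  have "\<phi> ` S \<subseteq> PiE I C" using c by (auto simp: \<phi>_def)
  then have fin: "finite (\<phi> ` S)" using finite_PiE[OF assms(1)] C(1) finite_subset by blast
  \<comment> \<open>One representative in S for every pattern that occurs.\<close>
  define r where "r p = (SOME x. x \<in> S \<and> \<phi> x = p)" for p
  have r: "r (\<phi> x) \<in> S \<and> \<phi> (r (\<phi> x)) = \<phi> x" if "x \<in> S" for x
    unfolding r_def by (rule someI_ex) (use that in blast)
  show ?thesis
  proof (intro exI[of _ "r ` \<phi> ` S"] conjI ballI)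
    show "finite (r ` \<phi> ` S)" using fin by simp
    show "r ` \<phi> ` S \<subseteq> S" using r by blast
    fix x assume x: "x \<in> S"
    have "dist (g i x) (g i (r (\<phi> x))) < e" if "i \<in> I" for i
    proof -
      have "c i (r (\<phi> x)) = c i x" using r[OF x] that by (auto simp: \<phi>_def dest: fun_cong[of _ _ i])
      then show ?thesis
        using c[OF that x] c[OF that, of "r (\<phi> x)"] r[OF x] dist_triangle_half_l[of "g i x" "c i x" e "g i (r (\<phi> x))"]
        by metis
    qed
    then show "\<exists>f\<in>r ` \<phi> ` S. \<forall>i\<in>I. dist (g i x) (g i f) < e" using x by blast
  qed
qed

lemma mk_dist_upper:
  assumes "mk_dist V L \<mu> \<nu> < \<infinity>" "\<xi> \<in> V" "L \<xi> \<le> 1"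
  shows "norm (\<mu> \<xi> - \<nu> \<xi>) \<le> enn2real (mk_dist V L \<mu> \<nu>)"
proof -
  have "ennreal (norm (\<mu> \<xi> - \<nu> \<xi>)) \<le> mk_dist V L \<mu> \<nu>"
    unfolding mk_dist_def by (rule SUP_upper) (use assms in auto)
  then have "enn2real (ennreal (norm (\<mu> \<xi> - \<nu> \<xi>))) \<le> enn2real (mk_dist V L \<mu> \<nu>)"
    using assms(1) by (intro enn2real_mono) (auto simp: top_unique)
  then show ?thesis by simp
qed

lemma mk_dist_least:
  assumes "\<And>\<xi>. \<xi> \<in> V \<Longrightarrow> L \<xi> \<le> 1 \<Longrightarrow> norm (\<mu> \<xi> - \<nu> \<xi>) \<le> c"
  shows "mk_dist V L \<mu> \<nu> \<le> ennreal c"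
  unfolding mk_dist_def by (rule SUP_least) (use assms in \<open>auto intro: ennreal_leI\<close>)

text \<open>The metric topology is the weak-star topology, in which the state space is compact; a
  finite net for the metric approximates every state uniformly on the Lipschitz ball.\<close>

lemma cstar_cqms_net:
  fixes V :: "'a::unital_cstar_algebra set"
  assumes "cstar_cqms V L" "e > 0"
  obtains F where "finite F" "F \<subseteq> cstar_states"
    "\<And>\<mu>. \<mu> \<in> cstar_states \<Longrightarrow> \<exists>\<nu>\<in>F. \<forall>\<xi>\<in>V. L \<xi> \<le> 1 \<longrightarrow> cmod (\<mu> \<xi> - \<nu> \<xi>) < e"
proof -
  let ?S = "cstar_states :: ('a \<Rightarrow> complex) set"
  let ?d = "\<lambda>\<mu> \<nu>. enn2real (mk_dist V L \<mu> \<nu>)"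
  have m: "metrizes cstar_states (mk_dist V L) (weak_star UNIV ?S)"
    using assms(1) by (simp add: cstar_cqms_def)
  then interpret M: Metric_space ?S ?d by (simp add: metrizes_def)
  have top: "M.mtopology = weak_star UNIV ?S"
    and fin: "\<And>\<mu> \<nu>. \<mu> \<in> cstar_states \<Longrightarrow> \<nu> \<in> ?S \<Longrightarrow> mk_dist V L \<mu> \<nu> < \<infinity>"
    using m by (auto simp: metrizes_def)
  have "compactin M.mtopology ?S"
    unfolding top weak_star_def euclidean_product_topology using compact_cstar_states
    by (simp add: compactin_subtopology)
  then have "M.mtotally_bounded ?S" by (rule M.compactin_imp_mtotally_bounded)
  then have "\<exists>F. finite F \<and> F \<subseteq> ?S \<and> ?S \<subseteq> (\<Union>x\<in>F. M.mball x e)"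
    using assms(2) by (simp only: M.mtotally_bounded_def)
  then obtain F where F: "finite F" "F \<subseteq> ?S" "?S \<subseteq> (\<Union>x\<in>F. M.mball x e)" by metis
  show ?thesis
  proof (rule that[OF F(1,2)])
    fix \<mu> :: "'a \<Rightarrow> complex" assume "\<mu> \<in> cstar_states"
    then obtain \<nu> where \<nu>: "\<nu> \<in> F" "\<nu> \<in> cstar_states" "?d \<nu> \<mu> < e" using F(3) by (auto simp: M.mball_def)
    have "cmod (\<mu> \<xi> - \<nu> \<xi>) < e" if "\<xi> \<in> V" "L \<xi> \<le> 1" for \<xi>
      using mk_dist_upper[OF fin[OF \<nu>(2) \<open>\<mu> \<in> cstar_states\<close>] that] \<nu>(3) by (simp add: norm_minus_commute)
    then show "\<exists>\<nu>\<in>F. \<forall>\<xi>\<in>V. L \<xi> \<le> 1 \<longrightarrow> cmod (\<mu> \<xi> - \<nu> \<xi>) < e" using \<nu>(1) by blast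
  qed
qed

text \<open>The state space has finite diameter. Subtracting the value of a base state
  \<open>\<mu>0\<close> from b leaves a self-adjoint element on which every state is bounded by D,
  and some state attains at least the norm.\<close>

lemma cstar_cqms_radius:
  assumes "cstar_cqms V L"
  obtains D where "D \<ge> 0" "\<And>b. b \<in> V \<Longrightarrow> star b = b \<Longrightarrow> L b \<le> 1 \<Longrightarrow> \<exists>r. norm (b - r *\<^sub>R 1) \<le> D"
proof -
  let ?d = "\<lambda>\<mu> \<nu>. enn2real (mk_dist V L \<mu> \<nu>)"
  have m: "metrizes cstar_states (mk_dist V L) (weak_star UNIV cstar_states)"
    using assms(1) by (simp add: cstar_cqms_def)
  then have fin: "\<And>\<mu> \<nu>. \<mu> \<in> cstar_states \<Longrightarrow> \<nu> \<in> cstar_states \<Longrightarrow> mk_dist V L \<mu> \<nu> < \<infinity>"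
    by (auto simp: metrizes_def)
  obtain F where F: "finite F" "F \<subseteq> cstar_states"
    "\<And>\<mu>. \<mu> \<in> cstar_states \<Longrightarrow> \<exists>\<nu>\<in>F. \<forall>\<xi>\<in>V. L \<xi> \<le> 1 \<longrightarrow> cmod (\<mu> \<xi> - \<nu> \<xi>) < 1"
    using cstar_cqms_net[OF assms zero_less_one] by metis
  obtain \<mu>0 where \<mu>0: "\<mu>0 \<in> (cstar_states :: ('a \<Rightarrow> complex) set)" using ex_cstar_state[OF star_one] by metis
  define D where "D = 1 + (\<Sum>\<nu>\<in>F. ?d \<nu> \<mu>0)"
  show ?thesis
  proof (rule that[of D])
    show "D \<ge> 0" by (simp add: D_def sum_nonneg add_nonneg_nonneg)
    fix b assume b: "b \<in> V" "star b = b" "L b \<le> 1"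
    let ?r = "Re (\<mu>0 b)"
    have sa: "star (b - ?r *\<^sub>R 1) = b - ?r *\<^sub>R 1" by (simp add: star_diff star_scaleR b)
    obtain \<mu> where \<mu>: "\<mu> \<in> cstar_states" "norm (b - ?r *\<^sub>R 1) \<le> cmod (\<mu> (b - ?r *\<^sub>R 1))"
      using ex_cstar_state[OF sa] by metis
    have "\<mu> ((b - ?r *\<^sub>R 1) + complex_of_real ?r *\<^sub>C 1) = \<mu> (b - ?r *\<^sub>R 1) + complex_of_real ?r * \<mu> 1"
      using \<mu>(1) by (simp add: cstar_states_def)
    then have "\<mu> (b - ?r *\<^sub>R 1) = \<mu> b - complex_of_real ?r"
      using \<mu>(1) by (simp add: scaleC_of_real cstar_states_def)
    also have "complex_of_real ?r = \<mu>0 b" using cstar_state_sa(1)[OF \<mu>0 b(2)] by (simp add: complex_eq_iff)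
    finally have eq: "cmod (\<mu> (b - ?r *\<^sub>R 1)) = cmod (\<mu> b - \<mu>0 b)" by simp
    obtain \<nu> where \<nu>: "\<nu> \<in> F" "cmod (\<mu> b - \<nu> b) < 1" using F(3)[OF \<mu>(1)] b by blast
    have "cmod (\<nu> b - \<mu>0 b) \<le> ?d \<nu> \<mu>0" using mk_dist_upper[OF fin b(1,3)] \<nu>(1) F(2) \<mu>0 by blast
    also have "\<dots> \<le> (\<Sum>\<nu>\<in>F. ?d \<nu> \<mu>0)" by (rule member_le_sum[OF \<nu>(1)]) (simp_all add: F(1))
    finally have "cmod (\<mu> b - \<mu>0 b) \<le> D"
      using norm_triangle_ineq[of "\<mu> b - \<nu> b" "\<nu> b - \<mu>0 b"] \<nu>(2) by (simp add: D_def)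
    then show "\<exists>r. norm (b - r *\<^sub>R 1) \<le> D" using \<mu>(2) eq by (intro exI[of _ ?r]) simp
  qed
qed

text \<open>Finitely many states determine elements of the Lipschitz ball up to a small error in
  norm, because they approximate all states uniformly there. The norm bound confines their values to
  a compact disc.\<close>

lemma cstar_cqms_totally_bounded_unit:
  assumes "cstar_cqms V L" "e > 0"
  shows "\<exists>F. finite F \<and> F \<subseteq> {b\<in>V. L b \<le> 1 \<and> norm b \<le> r} \<and>
    (\<forall>b\<in>{b\<in>V. L b \<le> 1 \<and> norm b \<le> r}. \<exists>f\<in>F. norm (b - f) < e)"
proof -
  let ?S = "{b\<in>V. L b \<le> 1 \<and> norm b \<le> r}"
  \<comment> \<open>Every state is within 3 d on a difference, so the real and the imaginary part
    have norm at most 3 d each; the total 6 d is below e.\<close>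
  define d where "d = e / 8"
  have "d > 0" using assms(2) by (simp add: d_def)
  obtain I where I: "finite I" "I \<subseteq> cstar_states"
    "\<And>\<mu>. \<mu> \<in> cstar_states \<Longrightarrow> \<exists>\<nu>\<in>I. \<forall>\<xi>\<in>V. L \<xi> \<le> 1 \<longrightarrow> cmod (\<mu> \<xi> - \<nu> \<xi>) < d"
    using cstar_cqms_net[OF assms(1) \<open>d > 0\<close>] by metis
  have net: "\<exists>C. finite C \<and> (\<forall>x\<in>?S. \<exists>c\<in>C. dist (\<mu> x) c < s)" if "\<mu> \<in> I" "s > 0" for \<mu> s
  proof -
    have "compact (cball (0::complex) (2 * r))" by simp
    then have "\<exists>C. finite C \<and> cball (0::complex) (2 * r) \<subseteq> (\<Union>c\<in>C. ball c s)"
      using \<open>s > 0\<close> by (simp only: compact_eq_totally_bounded)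
    then obtain C where C: "finite C" "cball (0::complex) (2 * r) \<subseteq> (\<Union>c\<in>C. ball c s)" by metis
    have "\<mu> x \<in> cball 0 (2 * r)" if "x \<in> ?S" for x
      using cstar_state_norm_le[of \<mu> x] I(2) \<open>\<mu> \<in> I\<close> that by (auto simp: dist_norm)
    then show ?thesis using C by (intro exI[of _ C]) (force simp: dist_commute)
  qed
  have "\<exists>F. finite F \<and> F \<subseteq> ?S \<and> (\<forall>x\<in>?S. \<exists>f\<in>F. \<forall>\<mu>\<in>I. dist (\<mu> x) (\<mu> f) < d)"
    by (rule finite_net_multi[OF I(1) \<open>d > 0\<close>]) (rule net)
  then obtain F where F: "finite F" "F \<subseteq> ?S" "\<forall>x\<in>?S. \<exists>f\<in>F. \<forall>\<mu>\<in>I. dist (\<mu> x) (\<mu> f) < d"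
    by (elim exE conjE)
  have "\<exists>f\<in>F. norm (b - f) < e" if b: "b \<in> ?S" for b
  proof -
    obtain f where f: "f \<in> F" "\<forall>\<mu>\<in>I. dist (\<mu> b) (\<mu> f) < d" using bspec[OF F(3) b] by blast
    have fS: "f \<in> ?S" using f(1) F(2) by blast
    have close: "cmod (\<mu> (b - f)) \<le> 3 * d" if \<mu>: "\<mu> \<in> cstar_states" for \<mu>
    proof -
      obtain \<nu> where \<nu>: "\<nu> \<in> I" "\<forall>\<xi>\<in>V. L \<xi> \<le> 1 \<longrightarrow> cmod (\<mu> \<xi> - \<nu> \<xi>) < d" using I(3)[OF \<mu>] by blast
      have "\<mu> ((b - f) + f) = \<mu> (b - f) + \<mu> f"
        using \<mu> by (simp only: cstar_states_def mem_Collect_eq)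
      then have "\<mu> (b - f) = (\<mu> b - \<nu> b) + (\<nu> b - \<nu> f) - (\<mu> f - \<nu> f)" by simp
      then have "cmod (\<mu> (b - f)) \<le> cmod (\<mu> b - \<nu> b) + cmod (\<nu> b - \<nu> f) + cmod (\<mu> f - \<nu> f)"
        using norm_triangle_ineq4[of "(\<mu> b - \<nu> b) + (\<nu> b - \<nu> f)" "\<mu> f - \<nu> f"]
          norm_triangle_ineq[of "\<mu> b - \<nu> b" "\<nu> b - \<nu> f"] by simp
      moreover have "cmod (\<mu> b - \<nu> b) < d" "cmod (\<mu> f - \<nu> f) < d" "cmod (\<nu> b - \<nu> f) < d"
        using \<nu> b fS f(2) by (auto simp: dist_norm)
      ultimately show ?thesis by linarith
    qed
    obtain u v where uv: "star u = u" "star v = v" "b - f = u + \<i> *\<^sub>C v" using real_imag_parts by metis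
    obtain \<mu> where \<mu>: "\<mu> \<in> cstar_states" "norm u \<le> cmod (\<mu> u)" using ex_cstar_state[OF uv(1)] by metis
    obtain \<nu> where \<nu>: "\<nu> \<in> cstar_states" "norm v \<le> cmod (\<nu> v)" using ex_cstar_state[OF uv(2)] by metis
    have "norm u \<le> 3 * d"
    proof -
      have "cmod (\<mu> u) = \<bar>Re (\<mu> (b - f))\<bar>"
        using cstar_state_real_imag[OF \<mu>(1) uv(1,2)] cstar_state_sa(1)[OF \<mu>(1) uv(1)] uv(3)
        by (simp add: cmod_def)
      then show ?thesis using \<mu>(2) abs_Re_le_cmod[of "\<mu> (b - f)"] close[OF \<mu>(1)] by linarith
    qed
    moreover have "norm v \<le> 3 * d"
    proof -
      have "cmod (\<nu> v) = \<bar>Im (\<nu> (b - f))\<bar>"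
        using cstar_state_real_imag[OF \<nu>(1) uv(1,2)] cstar_state_sa(1)[OF \<nu>(1) uv(2)] uv(3)
        by (simp add: cmod_def)
      then show ?thesis using \<nu>(2) abs_Im_le_cmod[of "\<nu> (b - f)"] close[OF \<nu>(1)] by linarith
    qed
    ultimately have "norm (b - f) \<le> 6 * d"
      using norm_triangle_ineq[of u "\<i> *\<^sub>C v"] uv(3) by (simp add: norm_scaleC)
    then show ?thesis using f(1) assms(2) by (intro bexI[of _ f]) (auto simp: d_def)
  qed
  then show ?thesis using F(1,2) by (intro exI[of _ F]) blast
qed

lemma cstar_cqms_totally_bounded:
  assumes "cstar_cqms V L" "e > 0" "K > 0"
  shows "\<exists>F. finite F \<and> F \<subseteq> {b\<in>V. L b \<le> K \<and> norm b \<le> r} \<and>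
    (\<forall>b\<in>{b\<in>V. L b \<le> K \<and> norm b \<le> r}. \<exists>f\<in>F. norm (b - f) < e)"
proof -
  have V: "(c *\<^sub>R b \<in> V)" "L (c *\<^sub>R b) = \<bar>c\<bar> * L b" if "b \<in> V" for b c
    using assms(1) that unfolding cstar_cqms_def csubspace_def cseminorm_on_def
    by (metis scaleC_of_real norm_of_real)+
  obtain F where F: "finite F" "F \<subseteq> {b\<in>V. L b \<le> 1 \<and> norm b \<le> r / K}"
    "\<forall>b\<in>{b\<in>V. L b \<le> 1 \<and> norm b \<le> r / K}. \<exists>f\<in>F. norm (b - f) < e / K"
    using cstar_cqms_totally_bounded_unit[OF assms(1), of "e / K" "r / K"] assms(2,3) by auto
  show ?thesis
  proof (intro exI[of _ "(\<lambda>b. K *\<^sub>R b) ` F"] conjI ballI)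
    show "finite ((\<lambda>b. K *\<^sub>R b) ` F)" using F(1) by simp
    show "(\<lambda>b. K *\<^sub>R b) ` F \<subseteq> {b\<in>V. L b \<le> K \<and> norm b \<le> r}"
      using F(2) assms(3) V by (auto simp: field_simps mult_left_le)
    fix b assume b: "b \<in> {b\<in>V. L b \<le> K \<and> norm b \<le> r}"
    then have "(1 / K) *\<^sub>R b \<in> {b\<in>V. L b \<le> 1 \<and> norm b \<le> r / K}"
      using assms(3) V by (auto simp: field_simps)
    then obtain f where f: "f \<in> F" "norm ((1 / K) *\<^sub>R b - f) < e / K" using F(3) by blast
    have "norm (b - K *\<^sub>R f) = K * norm ((1 / K) *\<^sub>R b - f)"
    proof -
      have "b - K *\<^sub>R f = K *\<^sub>R ((1 / K) *\<^sub>R b - f)" using assms(3) by (simp add: scaleR_diff_right)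
      then show ?thesis using assms(3) by simp
    qed
    also have "\<dots> < e" using f(2) assms(3) by (simp add: field_simps)
    finally show "\<exists>f\<in>(\<lambda>b. K *\<^sub>R b) ` F. norm (b - f) < e" using f(1) by blast
  qed
qed

section \<open>Bridges between order unit spaces\<close>

text \<open>An interface to the order unit norm: an element of norm at most r lies below r times the
  unit, which makes states contractive for n.\<close>

definition ou_norm :: "'a::real_vector ou_space \<Rightarrow> ('a \<Rightarrow> real) \<Rightarrow> bool" where
  "ou_norm X n \<longleftrightarrow> (\<forall>x\<in>ou_set X. \<forall>y\<in>ou_set X. x + y \<in> ou_set X) \<and>
     (\<forall>r. \<forall>x\<in>ou_set X. r *\<^sub>R x \<in> ou_set X) \<and> ou_unit X \<in> ou_set X \<and> ou_pos X \<subseteq> ou_set X \<and>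
     rseminorm_on (ou_set X) n \<and> n (ou_unit X) = 1 \<and>
     (\<forall>r. \<forall>x\<in>ou_set X. n x \<le> r \<longrightarrow> r *\<^sub>R ou_unit X - x \<in> ou_pos X)"

lemma ou_norm_subspace:
  assumes "ou_norm X n"
  shows "x \<in> ou_set X \<Longrightarrow> y \<in> ou_set X \<Longrightarrow> x + y \<in> ou_set X" "x \<in> ou_set X \<Longrightarrow> r *\<^sub>R x \<in> ou_set X"
    "ou_unit X \<in> ou_set X" "x \<in> ou_set X \<Longrightarrow> y \<in> ou_set X \<Longrightarrow> x - y \<in> ou_set X"
    "x \<in> ou_set X \<Longrightarrow> - x \<in> ou_set X" "0 \<in> ou_set X"
proof -
  show *: "x \<in> ou_set X \<Longrightarrow> y \<in> ou_set X \<Longrightarrow> x + y \<in> ou_set X" "x \<in> ou_set X \<Longrightarrow> r *\<^sub>R x \<in> ou_set X"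
    "ou_unit X \<in> ou_set X" for x y r
    using assms by (auto simp: ou_norm_def)
  show neg: "x \<in> ou_set X \<Longrightarrow> - x \<in> ou_set X" for x using *(2)[of x "-1"] by simp
  show "x \<in> ou_set X \<Longrightarrow> y \<in> ou_set X \<Longrightarrow> x - y \<in> ou_set X" using *(1)[of x "- y"] neg[of y] by simp
  show "0 \<in> ou_set X" using *(2)[of "ou_unit X" 0] *(3) by simp
qed

lemma rseminorm_onD:
  assumes "rseminorm_on V n"
  shows "x \<in> V \<Longrightarrow> 0 \<le> n x" "x \<in> V \<Longrightarrow> y \<in> V \<Longrightarrow> n (x + y) \<le> n x + n y" "x \<in> V \<Longrightarrow> n (r *\<^sub>R x) = \<bar>r\<bar> * n x"
    "x \<in> V \<Longrightarrow> n (- x) = n x"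
proof -
  show *: "x \<in> V \<Longrightarrow> 0 \<le> n x" "x \<in> V \<Longrightarrow> y \<in> V \<Longrightarrow> n (x + y) \<le> n x + n y"
    "x \<in> V \<Longrightarrow> n (r *\<^sub>R x) = \<bar>r\<bar> * n x" for x y r
    using assms by (auto simp: rseminorm_on_def)
  show "x \<in> V \<Longrightarrow> n (- x) = n x" using *(3)[of x "-1"] by simp
qed

lemma ou_norm_rseminorm: "ou_norm X n \<Longrightarrow> rseminorm_on (ou_set X) n"
  by (simp add: ou_norm_def)

lemma ou_state_linear:
  assumes "ou_norm X n" "\<mu> \<in> ou_states X"
  shows "x \<in> ou_set X \<Longrightarrow> y \<in> ou_set X \<Longrightarrow> \<mu> (x + y) = \<mu> x + \<mu> y"
    "x \<in> ou_set X \<Longrightarrow> \<mu> (r *\<^sub>R x) = r * \<mu> x" "\<mu> (ou_unit X) = 1" "x \<in> ou_pos X \<Longrightarrow> 0 \<le> \<mu> x"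
    "x \<in> ou_set X \<Longrightarrow> y \<in> ou_set X \<Longrightarrow> \<mu> (x - y) = \<mu> x - \<mu> y"
proof -
  show *: "x \<in> ou_set X \<Longrightarrow> y \<in> ou_set X \<Longrightarrow> \<mu> (x + y) = \<mu> x + \<mu> y"
    "x \<in> ou_set X \<Longrightarrow> \<mu> (r *\<^sub>R x) = r * \<mu> x" "\<mu> (ou_unit X) = 1" "x \<in> ou_pos X \<Longrightarrow> 0 \<le> \<mu> x" for x y r
    using assms(2) by (auto simp: ou_states_def)
  show "x \<in> ou_set X \<Longrightarrow> y \<in> ou_set X \<Longrightarrow> \<mu> (x - y) = \<mu> x - \<mu> y"
    using *(1)[of x "- y"] *(2)[of y "-1"] ou_norm_subspace(5)[OF assms(1), of y] by simp
qed

lemma ou_state_bound: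
  assumes n: "ou_norm X n" and \<mu>: "\<mu> \<in> ou_states X" and x: "x \<in> ou_set X"
  shows "\<bar>\<mu> x\<bar> \<le> n x"
proof -
  note lin = ou_state_linear[OF n \<mu>] and sub = ou_norm_subspace[OF n]
  have le: "\<mu> y \<le> n y" if "y \<in> ou_set X" for y
  proof -
    have "n y *\<^sub>R ou_unit X - y \<in> ou_pos X" using n that by (auto simp: ou_norm_def)
    then have "0 \<le> \<mu> (n y *\<^sub>R ou_unit X - y)" by (rule lin(4))
    also have "\<dots> = n y - \<mu> y" using that by (simp add: lin sub)
    finally show ?thesis by simp
  qed
  have "\<mu> (- x) = - \<mu> x" using lin(2)[OF x, of "-1"] by simp
  moreover have "n (- x) = n x" using rseminorm_onD(4)[OF ou_norm_rseminorm[OF n] x] .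
  ultimately show ?thesis using le[OF x] le[OF sub(5)[OF x]] by simp
qed

text \<open>Rieffel's criterion: the Lipschitz ball is totally bounded modulo scalars. States agree
  on scalars, so up to 2 e the metric is controlled by finitely many evaluations and is weak-star
  continuous; conversely every evaluation is Lipschitz for the metric.\<close>

lemma ou_cqms_criterion:
  fixes X :: "'a::real_vector ou_space"
  assumes n: "ou_norm X n" and L: "rseminorm_on (ou_set X) L" "L (ou_unit X) = 0"
    and tb: "\<And>e. e > 0 \<Longrightarrow> \<exists>F. finite F \<and> F \<subseteq> ou_set X \<and>
      (\<forall>x\<in>ou_set X. L x \<le> 1 \<longrightarrow> (\<exists>f\<in>F. \<exists>r. n (x - f - r *\<^sub>R ou_unit X) \<le> e))"
  shows "ou_cqms X L"
proof -
  let ?E = "ou_set X" and ?S = "ou_states X" and ?\<rho> = "mk_dist (ou_set X) L"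
  let ?d = "\<lambda>\<mu> \<nu>. enn2real (?\<rho> \<mu> \<nu>)"
  note sub = ou_norm_subspace[OF n] and lin = ou_state_linear[OF n] and Ls = rseminorm_onD[OF L(1)]
  have approx: "\<exists>F. finite F \<and> F \<subseteq> ?E \<and> (\<forall>\<mu>\<in>?S. \<forall>\<nu>\<in>?S. \<forall>x\<in>?E. L x \<le> 1 \<longrightarrow>
      \<bar>\<mu> x - \<nu> x\<bar> \<le> (\<Sum>f\<in>F. \<bar>\<mu> f - \<nu> f\<bar>) + 2 * e)" if e: "e > 0" for e
  proof -
    obtain F where F: "finite F" "F \<subseteq> ?E"
      "\<forall>x\<in>?E. L x \<le> 1 \<longrightarrow> (\<exists>f\<in>F. \<exists>r. n (x - f - r *\<^sub>R ou_unit X) \<le> e)" using tb[OF e] by (elim exE conjE)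
    have "\<bar>\<mu> x - \<nu> x\<bar> \<le> (\<Sum>f\<in>F. \<bar>\<mu> f - \<nu> f\<bar>) + 2 * e"
      if \<mu>: "\<mu> \<in> ?S" and \<nu>: "\<nu> \<in> ?S" and x: "x \<in> ?E" "L x \<le> 1" for \<mu> \<nu> x
    proof -
      obtain f r where f: "f \<in> F" "n (x - f - r *\<^sub>R ou_unit X) \<le> e" using F(3) x by blast
      have fE: "f \<in> ?E" using f(1) F(2) by blast
      have dE: "x - f - r *\<^sub>R ou_unit X \<in> ?E" by (intro sub x fE)
      have eq: "\<sigma> (x - f - r *\<^sub>R ou_unit X) = \<sigma> x - \<sigma> f - r" if "\<sigma> \<in> ?S" for \<sigma>
        using x fE by (simp add: lin[OF that] sub)
      have "\<bar>\<mu> x - \<mu> f - r\<bar> \<le> e" "\<bar>\<nu> x - \<nu> f - r\<bar> \<le> e"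
        using ou_state_bound[OF n \<mu> dE] ou_state_bound[OF n \<nu> dE] f(2) by (simp_all add: eq \<mu> \<nu>)
      moreover have "\<bar>\<mu> f - \<nu> f\<bar> \<le> (\<Sum>f\<in>F. \<bar>\<mu> f - \<nu> f\<bar>)"
        using member_le_sum[OF f(1), of "\<lambda>f. \<bar>\<mu> f - \<nu> f\<bar>"] F(1) by simp
      ultimately show ?thesis by linarith
    qed
    then show ?thesis using F(1,2) by blast
  qed
  have fin: "?\<rho> \<mu> \<nu> < \<infinity>" if "\<mu> \<in> ?S" "\<nu> \<in> ?S" for \<mu> \<nu>
  proof -
    obtain F where "\<forall>\<mu>\<in>?S. \<forall>\<nu>\<in>?S. \<forall>x\<in>?E. L x \<le> 1 \<longrightarrow> \<bar>\<mu> x - \<nu> x\<bar> \<le> (\<Sum>f\<in>F. \<bar>\<mu> f - \<nu> f\<bar>) + 2 * 1"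
      using approx[OF zero_less_one] by (elim exE conjE)
    then have "?\<rho> \<mu> \<nu> \<le> ennreal ((\<Sum>f\<in>F. \<bar>\<mu> f - \<nu> f\<bar>) + 2 * 1)"
      using that by (intro mk_dist_least) (simp only: real_norm_def)
    then show ?thesis using ennreal_less_top le_less_trans by (metis infinity_ennreal_def)
  qed
  have le_d: "\<bar>\<mu> x - \<nu> x\<bar> \<le> ?d \<mu> \<nu>" if "\<mu> \<in> ?S" "\<nu> \<in> ?S" "x \<in> ?E" "L x \<le> 1" for \<mu> \<nu> x
    using mk_dist_upper[OF fin[OF that(1,2)] that(3,4)] by simp
  have d_le: "?d \<mu> \<nu> \<le> c" if "c \<ge> 0" "\<And>x. x \<in> ?E \<Longrightarrow> L x \<le> 1 \<Longrightarrow> \<bar>\<mu> x - \<nu> x\<bar> \<le> c" for \<mu> \<nu> c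
  proof -
    have "?\<rho> \<mu> \<nu> \<le> ennreal c" using that(2) by (intro mk_dist_least) simp
    then show ?thesis using enn2real_mono[of "?\<rho> \<mu> \<nu>" "ennreal c"] that(1) by simp
  qed
  \<comment> \<open>Adding 1 allows scaling into the Lipschitz ball even when
    \<open>L x = 0\<close>.\<close>
  have le_Ld: "\<bar>\<mu> x - \<nu> x\<bar> \<le> (L x + 1) * ?d \<mu> \<nu>" if \<mu>: "\<mu> \<in> ?S" and \<nu>: "\<nu> \<in> ?S" and x: "x \<in> ?E" for \<mu> \<nu> x
  proof -
    have "L x + 1 > 0" using Ls(1)[OF x] by simp
    let ?y = "(1 / (L x + 1)) *\<^sub>R x"
    have "\<bar>\<mu> ?y - \<nu> ?y\<bar> \<le> ?d \<mu> \<nu>"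
      by (intro le_d \<mu> \<nu> sub x) (use \<open>L x + 1 > 0\<close> in \<open>simp add: Ls(3)[OF x]\<close>)
    moreover have "\<mu> ?y - \<nu> ?y = (\<mu> x - \<nu> x) / (L x + 1)"
      by (simp add: lin(2)[OF \<mu> x] lin(2)[OF \<nu> x] diff_divide_distrib)
    ultimately have "\<bar>\<mu> x - \<nu> x\<bar> / (L x + 1) \<le> ?d \<mu> \<nu>" using \<open>L x + 1 > 0\<close> by (simp add: abs_divide)
    then show ?thesis using \<open>L x + 1 > 0\<close> by (simp only: pos_divide_le_eq mult.commute)
  qed
  have metric: "Metric_space ?S ?d"
  proof
    show "0 \<le> ?d \<mu> \<nu>" for \<mu> \<nu> by simp
    show "?d \<mu> \<nu> = ?d \<nu> \<mu>" for \<mu> \<nu> by (simp add: mk_dist_def norm_minus_commute)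
    fix \<mu> \<nu> assume \<mu>: "\<mu> \<in> ?S" and \<nu>: "\<nu> \<in> ?S"
    show "?d \<mu> \<nu> = 0 \<longleftrightarrow> \<mu> = \<nu>"
    proof
      assume "?d \<mu> \<nu> = 0"
      then have eq: "\<mu> x = \<nu> x" if "x \<in> ?E" for x using le_Ld[OF \<mu> \<nu> that] by simp
      show "\<mu> = \<nu>"
        by (rule extensionalityI[of _ ?E]) (use \<mu> \<nu> eq in \<open>auto simp: ou_states_def\<close>)
    next
      assume "\<mu> = \<nu>"
      then have "?d \<mu> \<nu> \<le> 0" by (intro d_le) auto
      then show "?d \<mu> \<nu> = 0" by (simp add: antisym)
    qed
    fix \<sigma> assume \<sigma>: "\<sigma> \<in> ?S"
    show "?d \<mu> \<sigma> \<le> ?d \<mu> \<nu> + ?d \<nu> \<sigma>"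
    proof (rule d_le)
      fix x assume "x \<in> ?E" "L x \<le> 1"
      then show "\<bar>\<mu> x - \<sigma> x\<bar> \<le> ?d \<mu> \<nu> + ?d \<nu> \<sigma>" using le_d[OF \<mu> \<nu>] le_d[OF \<nu> \<sigma>] by fastforce
    qed simp
  qed
  interpret M: Metric_space ?S ?d by (rule metric)
  have topspaceW: "topspace (weak_star ?E ?S) = ?S"
    by (auto simp: weak_star_def ou_states_def PiE_def)
  have "M.mtopology = weak_star ?E ?S"
    unfolding topology_eq
  proof (intro allI iffI)
    fix U assume U: "openin M.mtopology U"
    show "openin (weak_star ?E ?S) U"
    proof (subst openin_subopen, intro ballI)
      fix \<mu> assume "\<mu> \<in> U"
      then obtain r where r: "r > 0" "M.mball \<mu> r \<subseteq> U" and \<mu>: "\<mu> \<in> ?S"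
        using U unfolding M.openin_mtopology by blast
      \<comment> \<open>The approximation error is 2 (r / 8) and the evaluations contribute less
        than r / 4, so the distance stays below r / 2.\<close>
      have "r / 8 > 0" using r(1) by simp
      then obtain F where F: "finite F" "F \<subseteq> ?E" "\<forall>\<mu>\<in>?S. \<forall>\<nu>\<in>?S. \<forall>x\<in>?E. L x \<le> 1 \<longrightarrow>
        \<bar>\<mu> x - \<nu> x\<bar> \<le> (\<Sum>f\<in>F. \<bar>\<mu> f - \<nu> f\<bar>) + 2 * (r / 8)"
        using approx[OF \<open>r / 8 > 0\<close>] by (elim exE conjE)
      let ?g = "\<lambda>\<nu>. \<Sum>f\<in>F. \<bar>\<mu> f - \<nu> f\<bar>"
      have "continuous_map (weak_star ?E ?S) euclidean (\<lambda>\<nu>. \<nu> f)" if "f \<in> F" for f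
        unfolding weak_star_def using F(2) that
        by (intro continuous_map_from_subtopology continuous_map_product_projection) blast
      then have cont: "continuous_map (weak_star ?E ?S) euclidean ?g"
        by (intro continuous_map_sum F(1) continuous_map_real_abs continuous_map_diff) auto
      let ?T = "{\<nu> \<in> topspace (weak_star ?E ?S). ?g \<nu> \<in> {..<r / 4}}"
      have "openin (weak_star ?E ?S) ?T"
        by (rule openin_continuous_map_preimage[OF cont]) simp
      moreover have "\<mu> \<in> ?T" using \<mu> r(1) by (simp add: topspaceW)
      moreover have "?T \<subseteq> U"
      proof
        fix \<nu> assume "\<nu> \<in> ?T"
        then have \<nu>: "\<nu> \<in> ?S" "?g \<nu> < r / 4" by (auto simp: topspaceW)
        have "?d \<mu> \<nu> \<le> ?g \<nu> + 2 * (r / 8)"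
          using F(3) \<mu> \<nu>(1) r(1) by (intro d_le) (auto intro!: add_nonneg_nonneg sum_nonneg)
        then have "\<nu> \<in> M.mball \<mu> r" using \<mu> \<nu> r(1) by simp
        then show "\<nu> \<in> U" using r(2) by blast
      qed
      ultimately show "\<exists>T. openin (weak_star ?E ?S) T \<and> \<mu> \<in> T \<and> T \<subseteq> U" by blast
    qed
  next
    fix U assume U: "openin (weak_star ?E ?S) U"
    have "continuous_map M.mtopology euclidean (\<lambda>\<mu>. \<mu> x)" if x: "x \<in> ?E" for x
      unfolding continuous_map_def
    proof (intro conjI allI impI)
      fix G :: "real set" assume "openin euclidean G"
      then have "open G" by simp
      show "openin M.mtopology {\<mu> \<in> topspace M.mtopology. \<mu> x \<in> G}"
        unfolding M.openin_mtopology
      proof (intro conjI allI impI)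
        fix \<mu> assume "\<mu> \<in> {\<mu> \<in> topspace M.mtopology. \<mu> x \<in> G}"
        then have \<mu>: "\<mu> \<in> ?S" "\<mu> x \<in> G" by auto
        then obtain e where e: "e > 0" "\<And>z. dist z (\<mu> x) < e \<Longrightarrow> z \<in> G"
          using \<open>open G\<close> unfolding open_dist by blast
        have pos: "L x + 1 > 0" using Ls(1)[OF x] by simp
        show "\<exists>r>0. M.mball \<mu> r \<subseteq> {\<mu> \<in> topspace M.mtopology. \<mu> x \<in> G}"
        proof (intro exI[of _ "e / (L x + 1)"] conjI subsetI)
          fix \<nu> assume "\<nu> \<in> M.mball \<mu> (e / (L x + 1))"
          then have \<nu>: "\<nu> \<in> ?S" "?d \<mu> \<nu> < e / (L x + 1)" by auto
          have "\<bar>\<mu> x - \<nu> x\<bar> < e"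
            using le_Ld[OF \<mu>(1) \<nu>(1) x] \<nu>(2) pos by (simp add: field_simps)
          then show "\<nu> \<in> {\<mu> \<in> topspace M.mtopology. \<mu> x \<in> G}"
            using e(2) \<nu>(1) by (simp add: dist_real_def abs_minus_commute)
        qed (use e(1) pos in simp)
      qed auto
    qed simp
    moreover have "?S \<subseteq> extensional ?E" by (auto simp: ou_states_def)
    ultimately have "continuous_map M.mtopology (weak_star ?E ?S) (\<lambda>\<mu>. \<mu>)"
      unfolding weak_star_def continuous_map_in_subtopology continuous_map_componentwise by simp
    from openin_continuous_map_preimage[OF this U]
    have "openin M.mtopology {\<mu> \<in> ?S. \<mu> \<in> U}" by simp
    moreover have "{\<mu> \<in> ?S. \<mu> \<in> U} = U" using openin_subset[OF U] topspaceW by blast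
    ultimately show "openin M.mtopology U" by simp
  qed
  then show ?thesis using L fin metric by (simp add: ou_cqms_def metrizes_def)
qed

lemma real_INF_eqI:
  fixes c :: real
  assumes "W \<noteq> {}" "\<And>w. w \<in> W \<Longrightarrow> c \<le> \<Lambda> w" "\<And>s. s > c \<Longrightarrow> \<exists>w\<in>W. \<Lambda> w \<le> s"
  shows "c = (INF w\<in>W. \<Lambda> w)"
proof (rule antisym)
    show "c \<le> (INF w\<in>W. \<Lambda> w)" using assms(1,2) by (rule cINF_greatest)
    have bdd: "bdd_below (\<Lambda> ` W)" using assms(2) by (rule bdd_belowI2)
    show "(INF w\<in>W. \<Lambda> w) \<le> c"
    proof (rule dense_ge)
      fix s assume "c < s"
      then obtain w where "w \<in> W" "\<Lambda> w \<le> s" using assms(3) by blast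
      then show "(INF w\<in>W. \<Lambda> w) \<le> s" using cINF_lower[OF bdd] order_trans by blast
    qed
qed

section \<open>Positive maps and direct sums of order unit spaces\<close>

definition ou_hom :: "'a::real_vector ou_space \<Rightarrow> 'c::real_vector ou_space \<Rightarrow> ('a \<Rightarrow> 'c) \<Rightarrow> bool" where
  "ou_hom X Y P \<longleftrightarrow> (\<forall>x\<in>ou_set X. P x \<in> ou_set Y) \<and>
     (\<forall>x\<in>ou_set X. \<forall>y\<in>ou_set X. P (x + y) = P x + P y) \<and>
     (\<forall>r. \<forall>x\<in>ou_set X. P (r *\<^sub>R x) = r *\<^sub>R P x) \<and>
     P (ou_unit X) = ou_unit Y \<and> (\<forall>x\<in>ou_pos X. P x \<in> ou_pos Y)"

lemma ou_hom_state:
  assumes "ou_norm X n" "ou_hom X Y P" "\<nu> \<in> ou_states Y"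
  shows "restrict (\<lambda>x. \<nu> (P x)) (ou_set X) \<in> ou_states X"
proof -
  have "ou_pos X \<subseteq> ou_set X" using assms(1) by (simp add: ou_norm_def)
  then show ?thesis
    using assms(2,3) ou_norm_subspace[OF assms(1)] by (auto simp: ou_states_def ou_hom_def)
qed

lemma ou_sum_simps:
  "ou_set (ou_sum X Y) = ou_set X \<times> ou_set Y" "ou_pos (ou_sum X Y) = ou_pos X \<times> ou_pos Y"
  "ou_unit (ou_sum X Y) = (ou_unit X, ou_unit Y)"
  by (simp_all add: ou_sum_def)

lemma rseminorm_on_max:
  assumes "rseminorm_on A n" "rseminorm_on A m" shows "rseminorm_on A (\<lambda>z. max (n z) (m z))"
  unfolding rseminorm_on_def
proof (intro conjI ballI allI)
  note 1 = rseminorm_onD[OF assms(1)] and 2 = rseminorm_onD[OF assms(2)]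
  fix x assume x: "x \<in> A"
  show "0 \<le> max (n x) (m x)" using 1(1)[OF x] by simp
  show "max (n (r *\<^sub>R x)) (m (r *\<^sub>R x)) = \<bar>r\<bar> * max (n x) (m x)" for r
    using x by (simp add: 1 2 max_mult_distrib_left)
  fix y assume y: "y \<in> A"
  show "max (n (x + y)) (m (x + y)) \<le> max (n x) (m x) + max (n y) (m y)"
    using 1(2)[OF x y] 2(2)[OF x y] by linarith
qed

lemma rseminorm_on_comp:
  assumes "rseminorm_on A n" "\<And>z. z \<in> B \<Longrightarrow> f z \<in> A"
    "\<And>w z. w \<in> B \<Longrightarrow> z \<in> B \<Longrightarrow> f (w + z) = f w + f z" "\<And>r z. z \<in> B \<Longrightarrow> f (r *\<^sub>R z) = r *\<^sub>R f z"
  shows "rseminorm_on B (\<lambda>z. n (f z))"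
  using assms rseminorm_onD[OF assms(1)] by (simp add: rseminorm_on_def)

lemma ou_norm_sum:
  assumes "ou_norm X n" "ou_norm Y m"
  shows "ou_norm (ou_sum X Y) (\<lambda>z. max (n (fst z)) (m (snd z)))"
proof -
  have "rseminorm_on (ou_set X \<times> ou_set Y) (\<lambda>z. max (n (fst z)) (m (snd z)))"
  proof (rule rseminorm_on_max)
    show "rseminorm_on (ou_set X \<times> ou_set Y) (\<lambda>z. n (fst z))"
      by (rule rseminorm_on_comp[OF ou_norm_rseminorm[OF assms(1)]]) auto
    show "rseminorm_on (ou_set X \<times> ou_set Y) (\<lambda>z. m (snd z))"
      by (rule rseminorm_on_comp[OF ou_norm_rseminorm[OF assms(2)]]) auto
  qed
  then show ?thesis
    using assms unfolding ou_norm_def ou_sum_simps by auto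
qed

text \<open>The bridge between \<open>X\<close> and \<open>Y\<close> is built from almost inverse positive maps \<open>P\<close> and \<open>Q\<close>:
  pairs \<open>(x, y)\<close> with \<open>x\<close> close to \<open>Q y\<close> and \<open>y\<close> close to \<open>P x\<close> are close. A state \<open>\<mu>\<close> of \<open>X\<close> is then
  close to the state \<open>\<mu> \<circ> Q\<close> of \<open>Y\<close>.\<close>

locale ou_bridge =
  fixes X :: "'a::real_vector ou_space" and Y :: "'c::real_vector ou_space"
    and nX LX nY LY P Q and \<epsilon> :: real
  assumes nX: "ou_norm X nX" and nY: "ou_norm Y nY"
    and LX: "rseminorm_on (ou_set X) LX" "LX (ou_unit X) = 0"
    and LY: "rseminorm_on (ou_set Y) LY" "LY (ou_unit Y) = 0"
    and tbX: "\<And>e. e > 0 \<Longrightarrow> \<exists>F. finite F \<and> F \<subseteq> ou_set X \<and>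
      (\<forall>x\<in>ou_set X. LX x \<le> 1 \<longrightarrow> (\<exists>f\<in>F. \<exists>r. nX (x - f - r *\<^sub>R ou_unit X) \<le> e))"
    and tbY: "\<And>e. e > 0 \<Longrightarrow> \<exists>F. finite F \<and> F \<subseteq> ou_set Y \<and>
      (\<forall>y\<in>ou_set Y. LY y \<le> 1 \<longrightarrow> (\<exists>f\<in>F. \<exists>r. nY (y - f - r *\<^sub>R ou_unit Y) \<le> e))"
    and P: "ou_hom X Y P" and Q: "ou_hom Y X Q"
    and Q_contractive: "\<And>y. y \<in> ou_set Y \<Longrightarrow> nX (Q y) \<le> nY y"
    and \<epsilon>: "\<epsilon> > 0"
    and lift_X: "\<And>x. x \<in> ou_set X \<Longrightarrow> LX x \<le> 1 \<Longrightarrow>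
      \<exists>y\<in>ou_set Y. LY y \<le> 1 \<and> nX (x - Q y) \<le> \<epsilon> \<and> nY (y - P x) \<le> \<epsilon>"
    and lift_Y: "\<And>y. y \<in> ou_set Y \<Longrightarrow> LY y \<le> 1 \<Longrightarrow>
      \<exists>x\<in>ou_set X. LX x \<le> 1 \<and> nX (x - Q y) \<le> \<epsilon> \<and> nY (y - P x) \<le> \<epsilon>"
begin

lemmas subX = ou_norm_subspace[OF nX] and subY = ou_norm_subspace[OF nY]
  and semX = rseminorm_onD[OF ou_norm_rseminorm[OF nX]] and semY = rseminorm_onD[OF ou_norm_rseminorm[OF nY]]

lemma hom:
  "x \<in> ou_set X \<Longrightarrow> P x \<in> ou_set Y" "y \<in> ou_set Y \<Longrightarrow> Q y \<in> ou_set X"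
  "x \<in> ou_set X \<Longrightarrow> x' \<in> ou_set X \<Longrightarrow> P (x + x') = P x + P x'"
  "y \<in> ou_set Y \<Longrightarrow> y' \<in> ou_set Y \<Longrightarrow> Q (y + y') = Q y + Q y'"
  "x \<in> ou_set X \<Longrightarrow> P (r *\<^sub>R x) = r *\<^sub>R P x" "y \<in> ou_set Y \<Longrightarrow> Q (r *\<^sub>R y) = r *\<^sub>R Q y"
  "P (ou_unit X) = ou_unit Y" "Q (ou_unit Y) = ou_unit X"
  using P Q by (auto simp: ou_hom_def)

definition bridge :: "'a \<times> 'c \<Rightarrow> real" where
  "bridge z = max (nX (fst z - Q (snd z))) (nY (snd z - P (fst z)))"

text \<open>The scale 1/\<epsilon> turns \<open>lip z \<le> 1\<close> into closeness within
  \<open>\<epsilon>\<close>, which becomes the bound on the Hausdorff distance.\<close>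

definition lip :: "'a \<times> 'c \<Rightarrow> real" where
  "lip z = max (max (LX (fst z)) (LY (snd z))) ((1 / \<epsilon>) * bridge z)"

lemma bridge_seminorm: "rseminorm_on (ou_set X \<times> ou_set Y) bridge"
  unfolding bridge_def
proof (rule rseminorm_on_max)
  show "rseminorm_on (ou_set X \<times> ou_set Y) (\<lambda>z. nX (fst z - Q (snd z)))"
    by (rule rseminorm_on_comp[OF ou_norm_rseminorm[OF nX]])
      (auto simp: hom subX algebra_simps)
  show "rseminorm_on (ou_set X \<times> ou_set Y) (\<lambda>z. nY (snd z - P (fst z)))"
    by (rule rseminorm_on_comp[OF ou_norm_rseminorm[OF nY]])
      (auto simp: hom subY algebra_simps)
qed

lemma lip_seminorm: "rseminorm_on (ou_set X \<times> ou_set Y) lip"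
  unfolding lip_def
proof (intro rseminorm_on_max)
  show "rseminorm_on (ou_set X \<times> ou_set Y) (\<lambda>z. LX (fst z))"
    by (rule rseminorm_on_comp[OF LX(1)]) auto
  show "rseminorm_on (ou_set X \<times> ou_set Y) (\<lambda>z. LY (snd z))"
    by (rule rseminorm_on_comp[OF LY(1)]) auto
  have "\<And>a b c :: real. 0 < c \<Longrightarrow> a \<le> b \<Longrightarrow> a / c \<le> b / c" by (simp add: divide_right_mono)
  then show "rseminorm_on (ou_set X \<times> ou_set Y) (\<lambda>z. (1 / \<epsilon>) * bridge z)"
    using bridge_seminorm \<epsilon> unfolding rseminorm_on_def
    by (auto simp: add_divide_distrib[symmetric])
qed

lemma bridge_le: "z \<in> ou_set X \<times> ou_set Y \<Longrightarrow> lip z \<le> 1 \<Longrightarrow> bridge z \<le> \<epsilon>"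
  using \<epsilon> by (simp add: lip_def)

lemma lip_unit: "lip (ou_unit X, ou_unit Y) = 0"
proof -
  have "nX 0 = 0" "nY 0 = 0" using semX(3)[OF subX(6), of 0] semY(3)[OF subY(6), of 0] by simp_all
  then show ?thesis by (simp add: lip_def bridge_def hom LX LY)
qed

text \<open>For the quotient semi-norms a lift of an element of Lipschitz constant at most 1 is
  rescaled. For compactness the nets F and G fix x and y each up to its own scalar r and s; the
  bridge bounds r - s, so a finite net of an interval for the difference suffices.\<close>

lemma admissible_lip: "admissible X LX Y LY lip"
  unfolding admissible_def
proof (intro conjI ballI)
  show "ou_cqms (ou_sum X Y) lip"
  proof (rule ou_cqms_criterion[OF ou_norm_sum[OF nX nY]])
    fix e :: real assume "e > 0"
    define d where "d = e / 2"
    have "d > 0" using \<open>e > 0\<close> by (simp add: d_def)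
    obtain F where F: "finite F" "F \<subseteq> ou_set X"
      "\<forall>x\<in>ou_set X. LX x \<le> 1 \<longrightarrow> (\<exists>f\<in>F. \<exists>r. nX (x - f - r *\<^sub>R ou_unit X) \<le> d)"
      using tbX[OF \<open>d > 0\<close>] by (elim exE conjE)
    obtain G where G: "finite G" "G \<subseteq> ou_set Y"
      "\<forall>y\<in>ou_set Y. LY y \<le> 1 \<longrightarrow> (\<exists>g\<in>G. \<exists>r. nY (y - g - r *\<^sub>R ou_unit Y) \<le> d)"
      using tbY[OF \<open>d > 0\<close>] by (elim exE conjE)
    \<comment> \<open>Bound for the difference of the two scalars: the bridge gives
      \<open>\<epsilon>\<close>, the finitely many pairs of net points give the sum, and the two
      approximation errors give 2 d.\<close>
    define M where "M = \<epsilon> + (\<Sum>z\<in>F \<times> G. nX (fst z - Q (snd z))) + 2 * d"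
    have "compact (cball (0::real) M)" by simp
    then have "\<exists>H. finite H \<and> cball (0::real) M \<subseteq> (\<Union>h\<in>H. ball h d)"
      using \<open>d > 0\<close> by (simp only: compact_eq_totally_bounded)
    then obtain H where H: "finite H" "cball (0::real) M \<subseteq> (\<Union>h\<in>H. ball h d)" by (elim exE conjE)
    let ?J = "(\<lambda>(f, g, h). (f, g + h *\<^sub>R ou_unit Y)) ` (F \<times> G \<times> H)"
    show "\<exists>J. finite J \<and> J \<subseteq> ou_set (ou_sum X Y) \<and> (\<forall>z\<in>ou_set (ou_sum X Y). lip z \<le> 1 \<longrightarrow>
        (\<exists>j\<in>J. \<exists>r. max (nX (fst (z - j - r *\<^sub>R ou_unit (ou_sum X Y))))
          (nY (snd (z - j - r *\<^sub>R ou_unit (ou_sum X Y)))) \<le> e))"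
    proof (intro exI[of _ ?J] conjI ballI impI)
      show "finite ?J" using F(1) G(1) H(1) by simp
      show "?J \<subseteq> ou_set (ou_sum X Y)" using F(2) G(2) subY by (auto simp: ou_sum_simps)
      fix z assume z: "z \<in> ou_set (ou_sum X Y)" "lip z \<le> 1"
      obtain x y where xy: "z = (x, y)" "x \<in> ou_set X" "y \<in> ou_set Y" using z(1) by (auto simp: ou_sum_simps)
      have L1: "LX x \<le> 1" "LY y \<le> 1" using z(2) by (simp_all add: lip_def xy(1))
      obtain f r where f: "f \<in> F" "nX (x - f - r *\<^sub>R ou_unit X) \<le> d" using F(3) xy(2) L1(1) by blast
      obtain g s where g: "g \<in> G" "nY (y - g - s *\<^sub>R ou_unit Y) \<le> d" using G(3) xy(3) L1(2) by blast
      have fX: "f \<in> ou_set X" and gY: "g \<in> ou_set Y" using f(1) F(2) g(1) G(2) by auto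
      define a b where "a = x - f - r *\<^sub>R ou_unit X" and "b = y - g - s *\<^sub>R ou_unit Y"
      have ab: "a \<in> ou_set X" "b \<in> ou_set Y"
        unfolding a_def b_def by (intro subX subY xy fX gY)+
      have "x = f + r *\<^sub>R ou_unit X + a" "y = g + s *\<^sub>R ou_unit Y + b" by (simp_all add: a_def b_def)
      then have "x - Q y = (f + r *\<^sub>R ou_unit X + a) - (Q g + s *\<^sub>R ou_unit X + Q b)"
        using gY ab subY by (simp add: hom)
      then have eq: "(r - s) *\<^sub>R ou_unit X = (x - Q y) + - (f - Q g) + (- a) + Q b"
        by (simp add: algebra_simps)
      have "\<bar>r - s\<bar> = nX ((r - s) *\<^sub>R ou_unit X)" using nX subX by (simp add: semX(3)) (simp add: ou_norm_def)
      also have "\<dots> \<le> nX ((x - Q y) + - (f - Q g) + (- a)) + nX (Q b)"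
        unfolding eq by (intro semX(2) subX hom xy fX gY ab)
      also have "nX ((x - Q y) + - (f - Q g) + (- a)) \<le> nX ((x - Q y) + - (f - Q g)) + nX (- a)"
        by (intro semX(2) subX hom xy fX gY ab)
      also have "nX ((x - Q y) + - (f - Q g)) \<le> nX (x - Q y) + nX (- (f - Q g))"
        by (intro semX(2) subX hom xy fX gY ab)
      also have "nX (- a) = nX a" by (rule semX(4)[OF ab(1)])
      also have "nX (- (f - Q g)) = nX (f - Q g)" by (intro semX(4) subX hom fX gY)
      finally have "\<bar>r - s\<bar> \<le> nX (x - Q y) + nX (f - Q g) + nX a + nX (Q b)" by linarith
      moreover have "nX (x - Q y) \<le> \<epsilon>"
        using bridge_le[of z] z by (simp add: ou_sum_simps xy(1) bridge_def)
      moreover have "nX (f - Q g) \<le> (\<Sum>z\<in>F \<times> G. nX (fst z - Q (snd z)))"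
      proof -
        have "0 \<le> nX (fst z - Q (snd z))" if "z \<in> F \<times> G" for z
          using that F(2) G(2) by (intro semX(1) subX hom) auto
        then show ?thesis
          using member_le_sum[of "(f, g)" "F \<times> G" "\<lambda>z. nX (fst z - Q (snd z))"] f(1) g(1) F(1) G(1) by simp
      qed
      moreover have "nX a \<le> d" "nX (Q b) \<le> d"
        using f(2) g(2) Q_contractive[OF ab(2)] by (simp_all add: a_def b_def)
      ultimately have "s - r \<in> cball 0 M" by (simp add: M_def abs_minus_commute)
      then obtain h where "h \<in> H" "s - r \<in> ball h d" using H(2) by blast
      then have h: "h \<in> H" "\<bar>s - r - h\<bar> < d" by (simp_all add: dist_real_def abs_minus_commute)
      have "y - (g + h *\<^sub>R ou_unit Y) - r *\<^sub>R ou_unit Y = b + (s - r - h) *\<^sub>R ou_unit Y"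
        by (simp add: b_def algebra_simps)
      then have "nY (y - (g + h *\<^sub>R ou_unit Y) - r *\<^sub>R ou_unit Y) \<le> nY b + nY ((s - r - h) *\<^sub>R ou_unit Y)"
        using ab(2) subY by (simp add: semY(2))
      also have "nY ((s - r - h) *\<^sub>R ou_unit Y) = \<bar>s - r - h\<bar>"
        using nY subY by (simp add: semY(3)) (simp add: ou_norm_def)
      finally have "nY (y - (g + h *\<^sub>R ou_unit Y) - r *\<^sub>R ou_unit Y) \<le> e"
        using g(2) h(2) by (simp add: b_def d_def)
      moreover have "nX (x - f - r *\<^sub>R ou_unit X) \<le> e" using f(2) \<open>e > 0\<close> by (simp add: d_def)
      moreover have J: "(f, g + h *\<^sub>R ou_unit Y) \<in> ?J"
        by (rule image_eqI[of _ _ "(f, g, h)"]) (use f(1) g(1) h(1) in auto)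
      ultimately show "\<exists>j\<in>?J. \<exists>r. max (nX (fst (z - j - r *\<^sub>R ou_unit (ou_sum X Y))))
          (nY (snd (z - j - r *\<^sub>R ou_unit (ou_sum X Y)))) \<le> e"
        by (intro bexI[OF _ J] exI[of _ r]) (auto simp: xy(1) ou_sum_simps)
    qed
  qed (simp_all add: ou_sum_simps lip_seminorm lip_unit)
next
  fix x assume x: "x \<in> ou_set X"
  show "LX x = (INF y\<in>ou_set Y. lip (x, y))"
  proof (rule real_INF_eqI)
    show "ou_set Y \<noteq> {}" using subY(3) by blast
    show "LX x \<le> lip (x, y)" for y by (simp add: lip_def)
    fix s assume s: "s > LX x"
    then have "s > 0" using rseminorm_onD(1)[OF LX(1) x] by simp
    \<comment> \<open>Dividing by some s above \<open>LX x\<close> avoids a zero divisor and is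
      enough for an infimum.\<close>
    have "LX ((1 / s) *\<^sub>R x) \<le> 1" using s \<open>s > 0\<close> by (simp add: rseminorm_onD(3)[OF LX(1) x])
    then obtain y where y: "y \<in> ou_set Y" "LY y \<le> 1" "nX ((1 / s) *\<^sub>R x - Q y) \<le> \<epsilon>" "nY (y - P ((1 / s) *\<^sub>R x)) \<le> \<epsilon>"
      using lift_X[of "(1 / s) *\<^sub>R x"] x subX by blast
    then have "lip ((1 / s) *\<^sub>R x, y) \<le> 1" using \<epsilon> \<open>LX ((1 / s) *\<^sub>R x) \<le> 1\<close> by (simp add: lip_def bridge_def)
    then have "lip (s *\<^sub>R ((1 / s) *\<^sub>R x, y)) \<le> s"
      using rseminorm_onD(3)[OF lip_seminorm, of "((1 / s) *\<^sub>R x, y)" s] x y(1) subX \<open>s > 0\<close>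
      by (simp add: mult_left_le)
    then have "lip (x, s *\<^sub>R y) \<le> s" using \<open>s > 0\<close> by simp
    then show "\<exists>y\<in>ou_set Y. lip (x, y) \<le> s" using subY(2)[OF y(1)] by blast
  qed
next
  fix y assume y: "y \<in> ou_set Y"
  show "LY y = (INF x\<in>ou_set X. lip (x, y))"
  proof (rule real_INF_eqI)
    show "ou_set X \<noteq> {}" using subX(3) by blast
    show "LY y \<le> lip (x, y)" for x by (simp add: lip_def)
    fix s assume s: "s > LY y"
    then have "s > 0" using rseminorm_onD(1)[OF LY(1) y] by simp
    have "LY ((1 / s) *\<^sub>R y) \<le> 1" using s \<open>s > 0\<close> by (simp add: rseminorm_onD(3)[OF LY(1) y])
    then obtain x where x: "x \<in> ou_set X" "LX x \<le> 1" "nX (x - Q ((1 / s) *\<^sub>R y)) \<le> \<epsilon>" "nY ((1 / s) *\<^sub>R y - P x) \<le> \<epsilon>"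
      using lift_Y[of "(1 / s) *\<^sub>R y"] y subY by blast
    then have "lip (x, (1 / s) *\<^sub>R y) \<le> 1" using \<epsilon> \<open>LY ((1 / s) *\<^sub>R y) \<le> 1\<close> by (simp add: lip_def bridge_def)
    then have "lip (s *\<^sub>R (x, (1 / s) *\<^sub>R y)) \<le> s"
      using rseminorm_onD(3)[OF lip_seminorm, of "(x, (1 / s) *\<^sub>R y)" s] y x(1) subY \<open>s > 0\<close>
      by (simp add: mult_left_le)
    then have "lip (s *\<^sub>R x, y) \<le> s" using \<open>s > 0\<close> by simp
    then show "\<exists>x\<in>ou_set X. lip (x, y) \<le> s" using subX(2)[OF x(1)] by blast
  qed
qed

theorem ou_dist_q_le: "ou_dist_q X LX Y LY \<le> ennreal \<epsilon>"
proof -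
  let ?E = "ou_set (ou_sum X Y)"
  let ?left = "\<lambda>\<mu>. restrict (\<lambda>p. \<mu> (fst p)) ?E" and ?right = "\<lambda>\<nu>. restrict (\<lambda>p. \<nu> (snd p)) ?E"
  let ?\<rho> = "mk_dist ?E lip"
  have left: "(INF \<nu>\<in>states_right X Y. ?\<rho> (?left \<mu>) \<nu>) \<le> ennreal \<epsilon>" if \<mu>: "\<mu> \<in> ou_states X" for \<mu>
  proof -
    let ?\<nu> = "restrict (\<lambda>y. \<mu> (Q y)) (ou_set Y)"
    have "?\<rho> (?left \<mu>) (?right ?\<nu>) \<le> ennreal \<epsilon>"
    proof (rule mk_dist_least)
      fix z assume z: "z \<in> ?E" "lip z \<le> 1"
      then obtain x y where xy: "z = (x, y)" "x \<in> ou_set X" "y \<in> ou_set Y" by (auto simp: ou_sum_simps)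
      have "\<bar>\<mu> (x - Q y)\<bar> \<le> nX (x - Q y)" by (intro ou_state_bound[OF nX \<mu>] subX hom xy)
      also have "\<dots> \<le> \<epsilon>" using bridge_le[of z] z by (simp add: ou_sum_simps xy(1) bridge_def)
      finally show "norm (?left \<mu> z - ?right ?\<nu> z) \<le> \<epsilon>"
        using xy z(1) by (simp add: ou_state_linear[OF nX \<mu>] hom)
    qed
    moreover have "?right ?\<nu> \<in> states_right X Y"
      unfolding states_right_def by (intro imageI ou_hom_state[OF nY Q \<mu>])
    ultimately show ?thesis by (rule INF_lower2[rotated])
  qed
  have right: "(INF \<mu>\<in>states_left X Y. ?\<rho> \<mu> (?right \<nu>)) \<le> ennreal \<epsilon>" if \<nu>: "\<nu> \<in> ou_states Y" for \<nu>
  proof -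
    let ?\<mu> = "restrict (\<lambda>x. \<nu> (P x)) (ou_set X)"
    have "?\<rho> (?left ?\<mu>) (?right \<nu>) \<le> ennreal \<epsilon>"
    proof (rule mk_dist_least)
      fix z assume z: "z \<in> ?E" "lip z \<le> 1"
      then obtain x y where xy: "z = (x, y)" "x \<in> ou_set X" "y \<in> ou_set Y" by (auto simp: ou_sum_simps)
      have "\<bar>\<nu> (y - P x)\<bar> \<le> nY (y - P x)" by (intro ou_state_bound[OF nY \<nu>] subY hom xy)
      also have "\<dots> \<le> \<epsilon>" using bridge_le[of z] z by (simp add: ou_sum_simps xy(1) bridge_def)
      finally show "norm (?left ?\<mu> z - ?right \<nu> z) \<le> \<epsilon>"
        using xy z(1) by (simp add: ou_state_linear[OF nY \<nu>] hom abs_minus_commute)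
    qed
    moreover have "?left ?\<mu> \<in> states_left X Y"
      unfolding states_left_def by (intro imageI ou_hom_state[OF nX P \<nu>])
    ultimately show ?thesis by (rule INF_lower2[rotated])
  qed
  have "hausdorff_dist ?\<rho> (states_left X Y) (states_right X Y) \<le> ennreal \<epsilon>"
    unfolding hausdorff_dist_def
  proof (intro max.boundedI SUP_least)
    show "(INF \<nu>\<in>states_right X Y. ?\<rho> \<mu> \<nu>) \<le> ennreal \<epsilon>" if "\<mu> \<in> states_left X Y" for \<mu>
      using that left unfolding states_left_def by blast
    show "(INF \<mu>\<in>states_left X Y. ?\<rho> \<mu> \<nu>) \<le> ennreal \<epsilon>" if "\<nu> \<in> states_right X Y" for \<nu>
      using that right unfolding states_right_def by blast
  qed
  then show ?thesis
    unfolding ou_dist_q_def by (intro INF_lower2[of lip]) (simp_all add: admissible_lip)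
qed

end

section \<open>The semi-norms on the crossed products\<close>

text \<open>Collects what does not depend on the action; automorphisms remain variables, so two
  crossed products can be compared in one context.\<close>

locale lip_space =
  fixes V :: "'b::unital_cstar_algebra set" and L :: "'b \<Rightarrow> real" and N :: "(int \<Rightarrow> complex) \<Rightarrow> real"
  assumes V_subspace: "csubspace V"
    and V_one: "1 \<in> V"
    and V_star: "\<And>\<xi>. \<xi> \<in> V \<Longrightarrow> star \<xi> \<in> V"
    and L_seminorm: "cseminorm_on V L"
    and L_one: "L 1 = 0"
    and L_star: "\<And>\<xi>. \<xi> \<in> V \<Longrightarrow> L (star \<xi>) = L \<xi>"
    and N_norm: "order_preserving_norm N"
    and N_e0: "N (\<lambda>n. if n = 0 then 1 else 0) = 1"
    and cqms: "cstar_cqms V L"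
begin

lemma V_closed:
  "0 \<in> V" "x \<in> V \<Longrightarrow> y \<in> V \<Longrightarrow> x + y \<in> V" "x \<in> V \<Longrightarrow> c *\<^sub>C x \<in> V" "x \<in> V \<Longrightarrow> r *\<^sub>R x \<in> V"
  "(\<And>i. i \<in> I \<Longrightarrow> f i \<in> V) \<Longrightarrow> (\<Sum>i\<in>I. f i) \<in> V"
proof -
  show *: "0 \<in> V" "x \<in> V \<Longrightarrow> y \<in> V \<Longrightarrow> x + y \<in> V" "x \<in> V \<Longrightarrow> c *\<^sub>C x \<in> V" for x y c
    using V_subspace by (auto simp: csubspace_def)
  show "x \<in> V \<Longrightarrow> r *\<^sub>R x \<in> V" using *(3)[of x "complex_of_real r"] by (simp add: scaleC_of_real)
  show "(\<And>i. i \<in> I \<Longrightarrow> f i \<in> V) \<Longrightarrow> (\<Sum>i\<in>I. f i) \<in> V"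
    by (induction I rule: infinite_finite_induct) (auto simp: *)
qed

lemma L_props:
  "x \<in> V \<Longrightarrow> 0 \<le> L x" "x \<in> V \<Longrightarrow> y \<in> V \<Longrightarrow> L (x + y) \<le> L x + L y" "x \<in> V \<Longrightarrow> L (c *\<^sub>C x) = cmod c * L x"
  "x \<in> V \<Longrightarrow> L (r *\<^sub>R x) = \<bar>r\<bar> * L x" "L 0 = 0"
  "(\<And>i. i \<in> I \<Longrightarrow> f i \<in> V) \<Longrightarrow> L (\<Sum>i\<in>I. f i) \<le> (\<Sum>i\<in>I. L (f i))"
proof -
  show *: "x \<in> V \<Longrightarrow> 0 \<le> L x" "x \<in> V \<Longrightarrow> y \<in> V \<Longrightarrow> L (x + y) \<le> L x + L y"
    "x \<in> V \<Longrightarrow> L (c *\<^sub>C x) = cmod c * L x" for x y c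
    using L_seminorm by (auto simp: cseminorm_on_def)
  show "x \<in> V \<Longrightarrow> L (r *\<^sub>R x) = \<bar>r\<bar> * L x" using *(3)[of x "complex_of_real r"] by (simp add: scaleC_of_real)
  show L0: "L 0 = 0" using *(3)[OF V_closed(1), of 0] by simp
  show "(\<And>i. i \<in> I \<Longrightarrow> f i \<in> V) \<Longrightarrow> L (\<Sum>i\<in>I. f i) \<le> (\<Sum>i\<in>I. L (f i))"
  proof (induction I rule: infinite_finite_induct)
    case (insert x F)
    then show ?case using *(2)[of "f x" "\<Sum>i\<in>F. f i"] V_closed(5)[of F f] by fastforce
  qed (simp_all add: L0)
qed

definition NL :: "(int \<Rightarrow> 'b) \<Rightarrow> real" where
  "NL \<eta> = N (\<lambda>n. complex_of_real (L (\<eta> n)))"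

lemma Cc_V: "\<eta> \<in> Cc V \<Longrightarrow> \<eta> n \<in> V" "\<eta> \<in> Cc V \<Longrightarrow> finite {n. \<eta> n \<noteq> 0}" "\<eta> \<in> Cc V \<Longrightarrow> \<eta> \<in> Cc UNIV"
  by (auto simp: Cc_def)

lemma Cc_add: "\<eta> \<in> Cc V \<Longrightarrow> \<zeta> \<in> Cc V \<Longrightarrow> (\<lambda>n. \<eta> n + \<zeta> n) \<in> Cc V"
  using Cc_UNIV_add[of \<eta> \<zeta>] by (auto simp: Cc_def V_closed)

lemma Cc_scaleR: "\<eta> \<in> Cc V \<Longrightarrow> (\<lambda>n. r *\<^sub>R \<eta> n) \<in> Cc V"
  using Cc_UNIV_scaleR[of \<eta> r] by (auto simp: Cc_def V_closed)

lemma cc_one_Cc: "cc_one \<in> Cc V"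
  unfolding cc_one_def[abs_def] by (rule Cc_single) (simp_all add: V_closed V_one)

lemma L_Cc: "\<eta> \<in> Cc V \<Longrightarrow> (\<lambda>n. L (\<eta> n)) \<in> Cc UNIV"
  unfolding Cc_def by (auto intro: rev_finite_subset simp: L_props)

lemma of_real_Cc: "h \<in> Cc UNIV \<Longrightarrow> (\<lambda>n. complex_of_real (h n)) \<in> Cc UNIV"
  by (auto simp: Cc_def)

lemma N_props:
  "h \<in> Cc UNIV \<Longrightarrow> 0 \<le> N h" "h \<in> Cc UNIV \<Longrightarrow> N h = 0 \<Longrightarrow> h n = 0"
  "h \<in> Cc UNIV \<Longrightarrow> N (\<lambda>n. c * h n) = cmod c * N h"
  "h \<in> Cc UNIV \<Longrightarrow> k \<in> Cc UNIV \<Longrightarrow> N (\<lambda>n. h n + k n) \<le> N h + N k"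
  using N_norm by (auto simp: order_preserving_norm_def)

lemma N_mono:
  "f \<in> Cc UNIV \<Longrightarrow> g \<in> Cc UNIV \<Longrightarrow> (\<And>n. 0 \<le> f n) \<Longrightarrow> (\<And>n. f n \<le> g n) \<Longrightarrow>
    N (\<lambda>n. complex_of_real (f n)) \<le> N (\<lambda>n. complex_of_real (g n))"
  using N_norm by (auto simp: order_preserving_norm_def)

lemma NL_mono:
  assumes "\<eta> \<in> Cc V" "g \<in> Cc UNIV" "\<And>n. L (\<eta> n) \<le> g n"
  shows "NL \<eta> \<le> N (\<lambda>n. complex_of_real (g n))"
  unfolding NL_def using assms by (intro N_mono L_Cc L_props(1) Cc_V)

lemma NL_add:
  assumes "\<eta> \<in> Cc V" "\<zeta> \<in> Cc V" shows "NL (\<lambda>n. \<eta> n + \<zeta> n) \<le> NL \<eta> + NL \<zeta>"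
proof -
  have "(\<lambda>n. L (\<eta> n) + L (\<zeta> n)) \<in> Cc UNIV"
    using L_Cc[OF assms(1)] L_Cc[OF assms(2)] unfolding Cc_UNIV_iff Cc_def
    by (auto intro: finite_subset[of _ "{n. L (\<eta> n) \<noteq> 0} \<union> {n. L (\<zeta> n) \<noteq> 0}"])
  then have "NL (\<lambda>n. \<eta> n + \<zeta> n) \<le> N (\<lambda>n. complex_of_real (L (\<eta> n) + L (\<zeta> n)))"
    using assms by (intro NL_mono Cc_add) (auto intro: L_props Cc_V)
  also have "\<dots> \<le> NL \<eta> + NL \<zeta>"
    unfolding NL_def of_real_add by (intro N_props of_real_Cc L_Cc assms)
  finally show ?thesis .
qed

lemma NL_scaleR: "\<eta> \<in> Cc V \<Longrightarrow> NL (\<lambda>n. r *\<^sub>R \<eta> n) = \<bar>r\<bar> * NL \<eta>"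
  using N_props(3)[OF of_real_Cc[OF L_Cc], of \<eta> "complex_of_real \<bar>r\<bar>"]
  by (simp add: NL_def L_props Cc_V)

lemma NL_cc_one: "NL cc_one = 0"
proof -
  have "L (cc_one n) = 0" for n by (simp add: cc_one_def L_one L_props)
  then have "NL cc_one = N (\<lambda>n. 0 * 0)" by (simp add: NL_def)
  also have "\<dots> = 0" using N_props(3)[of "\<lambda>_. 0" 0] by (simp add: Cc_def)
  finally show ?thesis .
qed

definition N_unit :: "int \<Rightarrow> real" where
  "N_unit n = N (\<lambda>m. if m = n then 1 else 0)"

lemma N_unit_pos: "N_unit n > 0"
proof -
  have c: "(\<lambda>m. if m = n then 1 else 0 :: complex) \<in> Cc UNIV" by (rule Cc_single) simp_all
  have "N_unit n \<noteq> 0" using N_props(2)[OF c, of n] by (auto simp: N_unit_def)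
  then show ?thesis using N_props(1)[OF c] by (simp add: N_unit_def)
qed

text \<open>Order preservation compares the whole sequence with a single spike. The bound depends on
  n only, so each coefficient of a Lipschitz ball ranges over a totally bounded set of B.\<close>

lemma L_coeff_le:
  assumes "\<eta> \<in> Cc V" shows "L (\<eta> n) \<le> NL \<eta> / N_unit n"
proof -
  have nn: "0 \<le> L (\<eta> n)" for n using assms by (intro L_props Cc_V)
  have c: "(\<lambda>m. if m = n then 1 else 0 :: complex) \<in> Cc UNIV" by (rule Cc_single) simp_all
  have "N (\<lambda>m. complex_of_real (L (\<eta> n)) * (if m = n then 1 else 0)) = L (\<eta> n) * N_unit n"
    using N_props(3)[OF c, of "complex_of_real (L (\<eta> n))"] nn by (simp add: N_unit_def)
  moreover have "(\<lambda>m. complex_of_real (L (\<eta> n)) * (if m = n then 1 else 0)) = (\<lambda>m. complex_of_real (if m = n then L (\<eta> n) else 0))"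
    by auto
  moreover have "N (\<lambda>m. complex_of_real (if m = n then L (\<eta> n) else 0)) \<le> NL \<eta>"
    unfolding NL_def by (intro N_mono Cc_single L_Cc assms) (simp_all add: nn)
  ultimately show ?thesis using N_unit_pos[of n] by (simp add: field_simps)
qed

definition cc_deriv :: "(int \<Rightarrow> 'b) \<Rightarrow> int \<Rightarrow> 'b" where
  "cc_deriv \<eta> = (\<lambda>n. of_int n *\<^sub>C \<eta> n)"

lemma cc_deriv_eq: "cc_deriv \<eta> n = of_int n *\<^sub>R \<eta> n"
  by (simp add: cc_deriv_def flip: scaleC_of_real)

lemma cc_deriv_Cc: "\<eta> \<in> Cc UNIV \<Longrightarrow> cc_deriv \<eta> \<in> Cc UNIV"
  unfolding Cc_UNIV_iff by (erule rev_finite_subset) (auto simp: cc_deriv_eq)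

text \<open>The semi-norm in terms of coefficients for self-adjoint elements. There
  \<open>cc_star \<beta> \<eta> = \<eta>\<close>, so the third term of the maximum coincides with
  the second.\<close>

definition lipf :: "('b \<Rightarrow> 'b) \<Rightarrow> (int \<Rightarrow> 'b) \<Rightarrow> real" where
  "lipf \<beta> \<eta> = max (norm (cp_el \<beta> (cc_deriv \<eta>))) (NL \<eta>)"

definition aut :: "('b \<Rightarrow> 'b) \<Rightarrow> bool" where
  "aut \<beta> \<longleftrightarrow> star_automorphism \<beta> \<and> \<beta> ` V = V"

lemma aut_star: "aut \<beta> \<Longrightarrow> star_automorphism \<beta>"
  by (simp add: aut_def)

lemma aut_V: "aut \<beta> \<Longrightarrow> x \<in> V \<Longrightarrow> aut_pow \<beta> n x \<in> V"
  by (simp add: aut_def aut_pow_image star_automorphism_bij)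

definition sa :: "('b \<Rightarrow> 'b) \<Rightarrow> (int \<Rightarrow> 'b) set" where
  "sa \<beta> = {\<eta> \<in> Cc V. star (cp_el \<beta> \<eta>) = cp_el \<beta> \<eta>}"

lemma sa_Cc: "\<eta> \<in> sa \<beta> \<Longrightarrow> \<eta> \<in> Cc V" "\<eta> \<in> sa \<beta> \<Longrightarrow> \<eta> \<in> Cc UNIV"
  by (simp_all add: sa_def Cc_V)

lemma sa_star: "\<eta> \<in> sa \<beta> \<Longrightarrow> star (cp_el \<beta> \<eta>) = cp_el \<beta> \<eta>"
  by (simp add: sa_def)

lemma cc_star_Cc: "aut \<beta> \<Longrightarrow> \<eta> \<in> Cc UNIV \<Longrightarrow> cc_star \<beta> \<eta> \<in> Cc UNIV"
proof -
  assume "aut \<beta>" "\<eta> \<in> Cc UNIV"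
  then have "finite (uminus ` {n. \<eta> n \<noteq> 0})" by (simp add: Cc_UNIV_iff)
  moreover have "{n. cc_star \<beta> \<eta> n \<noteq> 0} \<subseteq> uminus ` {n. \<eta> n \<noteq> 0}"
  proof
    fix n assume "n \<in> {n. cc_star \<beta> \<eta> n \<noteq> 0}"
    then have "\<eta> (- n) \<noteq> 0" using aut_star[OF \<open>aut \<beta>\<close>] by (auto simp: cc_star_def aut_simps)
    then show "n \<in> uminus ` {n. \<eta> n \<noteq> 0}" by (intro image_eqI[of _ _ "- n"]) auto
  qed
  ultimately show ?thesis by (simp add: Cc_UNIV_iff finite_subset)
qed

lemma sa_cc_star: "aut \<beta> \<Longrightarrow> \<eta> \<in> sa \<beta> \<Longrightarrow> cc_star \<beta> \<eta> = \<eta>"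
  using cp_el_inj[OF aut_star cc_star_Cc] star_cp_el[OF aut_star] sa_star sa_Cc by metis

lemma sa_add: "aut \<beta> \<Longrightarrow> \<eta> \<in> sa \<beta> \<Longrightarrow> \<zeta> \<in> sa \<beta> \<Longrightarrow> (\<lambda>n. \<eta> n + \<zeta> n) \<in> sa \<beta>"
  by (simp add: sa_def Cc_add cp_el_add aut_star Cc_V star_add)

lemma sa_scaleR: "aut \<beta> \<Longrightarrow> \<eta> \<in> sa \<beta> \<Longrightarrow> (\<lambda>n. r *\<^sub>R \<eta> n) \<in> sa \<beta>"
  by (simp add: sa_def Cc_scaleR cp_el_scaleR aut_star Cc_V star_scaleR)

lemma sa_cc_one: "aut \<beta> \<Longrightarrow> cc_one \<in> sa \<beta>"
  by (simp add: sa_def cc_one_Cc cp_el_cc_one aut_star)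

lemma sa_diff: "aut \<beta> \<Longrightarrow> \<eta> \<in> sa \<beta> \<Longrightarrow> \<zeta> \<in> sa \<beta> \<Longrightarrow> (\<lambda>n. \<eta> n - \<zeta> n) \<in> sa \<beta>"
  using sa_add[of \<beta> \<eta> "\<lambda>n. - \<zeta> n"] sa_scaleR[of \<beta> \<zeta> "-1"] by simp

lemma cp_el_diff:
  assumes "star_automorphism \<beta>" "\<eta> \<in> Cc UNIV" "\<zeta> \<in> Cc UNIV"
  shows "cp_el \<beta> (\<lambda>n. \<eta> n - \<zeta> n) = cp_el \<beta> \<eta> - cp_el \<beta> \<zeta>"
  using cp_el_add[OF assms(1,2) Cc_UNIV_scaleR[OF assms(3)], of "-1"] cp_el_scaleR[OF assms(1,3), of "-1"] by simp

lemma lipf_seminorm: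
  assumes "aut \<beta>"
  shows "\<eta> \<in> sa \<beta> \<Longrightarrow> 0 \<le> lipf \<beta> \<eta>" "\<eta> \<in> sa \<beta> \<Longrightarrow> \<zeta> \<in> sa \<beta> \<Longrightarrow> lipf \<beta> (\<lambda>n. \<eta> n + \<zeta> n) \<le> lipf \<beta> \<eta> + lipf \<beta> \<zeta>"
    "\<eta> \<in> sa \<beta> \<Longrightarrow> lipf \<beta> (\<lambda>n. r *\<^sub>R \<eta> n) = \<bar>r\<bar> * lipf \<beta> \<eta>" "lipf \<beta> cc_one = 0"
proof -
  note [simp] = aut_star[OF assms]
  show "\<eta> \<in> sa \<beta> \<Longrightarrow> 0 \<le> lipf \<beta> \<eta>" by (simp add: lipf_def le_max_iff_disj)
  show "lipf \<beta> (\<lambda>n. \<eta> n + \<zeta> n) \<le> lipf \<beta> \<eta> + lipf \<beta> \<zeta>" if "\<eta> \<in> sa \<beta>" "\<zeta> \<in> sa \<beta>"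
  proof -
    have "cc_deriv (\<lambda>n. \<eta> n + \<zeta> n) = (\<lambda>n. cc_deriv \<eta> n + cc_deriv \<zeta> n)"
      by (simp add: cc_deriv_def scaleC_add_right)
    then have "cp_el \<beta> (cc_deriv (\<lambda>n. \<eta> n + \<zeta> n)) = cp_el \<beta> (cc_deriv \<eta>) + cp_el \<beta> (cc_deriv \<zeta>)"
      using that by (simp add: cp_el_add cc_deriv_Cc sa_Cc)
    then show ?thesis
      using norm_triangle_ineq[of "cp_el \<beta> (cc_deriv \<eta>)" "cp_el \<beta> (cc_deriv \<zeta>)"] NL_add[of \<eta> \<zeta>] that
      by (simp add: lipf_def sa_Cc) linarith
  qed
  show "lipf \<beta> (\<lambda>n. r *\<^sub>R \<eta> n) = \<bar>r\<bar> * lipf \<beta> \<eta>" if "\<eta> \<in> sa \<beta>"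
  proof -
    have "cc_deriv (\<lambda>n. r *\<^sub>R \<eta> n) = (\<lambda>n. r *\<^sub>R cc_deriv \<eta> n)" by (simp add: cc_deriv_def scaleC_scaleR)
    then show ?thesis
      using that by (simp add: lipf_def cp_el_scaleR cc_deriv_Cc sa_Cc NL_scaleR max_mult_distrib_left)
  qed
  have "cc_deriv cc_one = (\<lambda>_. 0)" by (auto simp: cc_deriv_def cc_one_def)
  then show "lipf \<beta> cc_one = 0" by (simp add: lipf_def NL_cc_one cp_el_def)
qed

section \<open>The order unit space of a crossed product\<close>

definition cp_ou :: "('b \<Rightarrow> 'b) \<Rightarrow> 'b l2_op ou_space" where
  "cp_ou \<beta> = sa_space (crossed_product \<beta>) (cp_elem \<beta> ` Cc V)"

definition cp_norm :: "'b l2_op \<Rightarrow> real" where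
  "cp_norm = l2_op_norm"

definition cp_lip :: "('b \<Rightarrow> 'b) \<Rightarrow> 'b l2_op \<Rightarrow> real" where
  "cp_lip \<beta> a = cc_lip \<beta> L N (inv_into (Cc V) (cp_elem \<beta>) a)"

lemma dist_q_eq:
  "dist_q (cp_cqms \<beta> V L N) (cp_cqms \<gamma> V L N) = ou_dist_q (cp_ou \<beta>) (cp_lip \<beta>) (cp_ou \<gamma>) (cp_lip \<gamma>)"
  by (simp add: dist_q_def cp_cqms_def cp_ou_def cp_lip_def[abs_def])

lemma inv_cp_elem:
  assumes "aut \<beta>" "\<eta> \<in> Cc V" shows "inv_into (Cc V) (cp_elem \<beta>) (op_of (cp_el \<beta> \<eta>)) = \<eta>"
proof -
  have "inj_on (cp_elem \<beta>) (Cc V)"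
    using cp_el_inj[OF aut_star[OF assms(1)]] by (intro inj_onI)
      (simp add: op_of_cp_el[OF aut_star[OF assms(1)], symmetric] op_of_inject Cc_V)
  then show ?thesis using assms by (simp add: op_of_cp_el aut_star)
qed

lemma cp_lip_eq:
  assumes "aut \<beta>" "\<eta> \<in> sa \<beta>" shows "cp_lip \<beta> (op_of (cp_el \<beta> \<eta>)) = lipf \<beta> \<eta>"
  using assms sa_Cc[OF assms(2)] sa_cc_star[OF assms]
  by (simp add: cp_lip_def inv_cp_elem cc_lip_def lipf_def NL_def cc_deriv_def l2_op_norm_op_of
      flip: op_of_cp_el[OF aut_star[OF assms(1)]])

lemma cp_ou_set: "aut \<beta> \<Longrightarrow> ou_set (cp_ou \<beta>) = (\<lambda>\<eta>. op_of (cp_el \<beta> \<eta>)) ` sa \<beta>"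
  by (auto simp: cp_ou_def sa_space_def sa_def star_op_of op_of_inject simp flip: op_of_cp_el[OF aut_star])

lemma cp_ou_unit: "ou_unit (cp_ou \<beta>) = op_of 1"
  by (simp add: cp_ou_def sa_space_def op_of_simps)

lemma cp_el_cp_alg: "\<eta> \<in> Cc UNIV \<Longrightarrow> cp_el \<beta> \<eta> \<in> cp_alg \<beta>"
  unfolding cp_alg_def by (rule subsetD[OF closure_subset]) (rule imageI)

text \<open>The order of the statement, by factorization inside the crossed product, agrees with the
  intrinsic \<open>cpos\<close>; the nontrivial direction uses that square roots stay in the crossed
  product.\<close>

lemma cp_ou_pos:
  assumes "aut \<beta>" "\<eta> \<in> sa \<beta>"
  shows "op_of (cp_el \<beta> \<eta>) \<in> ou_pos (cp_ou \<beta>) \<longleftrightarrow> cpos (cp_el \<beta> \<eta>)"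
proof
  assume "op_of (cp_el \<beta> \<eta>) \<in> ou_pos (cp_ou \<beta>)"
  then obtain c where "c \<in> cp_alg \<beta>" "op_of (cp_el \<beta> \<eta>) = star (op_of c) * op_of c"
    using assms by (auto simp: cp_ou_def sa_space_def crossed_product_eq aut_star)
  then have "cp_el \<beta> \<eta> = star c * c" by (simp add: star_op_of op_of_inject flip: op_of_simps)
  then show "cpos (cp_el \<beta> \<eta>)" by (simp add: cpos_star_mult)
next
  assume "cpos (cp_el \<beta> \<eta>)"
  then obtain d where d: "d \<in> cp_alg \<beta>" "star d * d = cp_el \<beta> \<eta>"
    using cpos_cp_alg_sqrt[OF aut_star[OF assms(1)] _ cp_el_cp_alg] sa_Cc assms(2) by metis
  then have "op_of (cp_el \<beta> \<eta>) = star (op_of d) * op_of d" by (metis star_op_of op_of_simps(7))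
  moreover have "op_of d \<in> crossed_product \<beta>" using d(1) by (simp add: crossed_product_eq aut_star assms(1))
  moreover have "op_of (cp_el \<beta> \<eta>) \<in> cp_elem \<beta> ` Cc V"
    unfolding op_of_cp_el[OF aut_star[OF assms(1)]] by (rule imageI) (rule sa_Cc(1)[OF assms(2)])
  moreover have "star (op_of (cp_el \<beta> \<eta>)) = op_of (cp_el \<beta> \<eta>)"
    by (simp add: star_op_of sa_star[OF assms(2)])
  ultimately show "op_of (cp_el \<beta> \<eta>) \<in> ou_pos (cp_ou \<beta>)"
    unfolding cp_ou_def sa_space_def by auto
qed

lemma ou_norm_cp_ou:
  assumes "aut \<beta>" shows "ou_norm (cp_ou \<beta>) cp_norm"
  unfolding ou_norm_def rseminorm_on_def cp_ou_set[OF assms] cp_norm_def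
proof (intro conjI ballI allI impI; (elim imageE; hypsubst)?)
  note [simp] = aut_star[OF assms]
  fix \<eta> assume \<eta>: "\<eta> \<in> sa \<beta>"
  show "r *\<^sub>R op_of (cp_el \<beta> \<eta>) \<in> (\<lambda>\<eta>. op_of (cp_el \<beta> \<eta>)) ` sa \<beta>" for r
    by (rule image_eqI[OF _ sa_scaleR[OF assms \<eta>, of r]]) (simp add: cp_el_scaleR sa_Cc[OF \<eta>] op_of_simps)
  show "0 \<le> l2_op_norm (op_of (cp_el \<beta> \<eta>))"
    "l2_op_norm (r *\<^sub>R op_of (cp_el \<beta> \<eta>)) = \<bar>r\<bar> * l2_op_norm (op_of (cp_el \<beta> \<eta>))" for r
    by (simp_all add: l2_op_norm_op_of flip: op_of_simps)
  show "r *\<^sub>R ou_unit (cp_ou \<beta>) - op_of (cp_el \<beta> \<eta>) \<in> ou_pos (cp_ou \<beta>)"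
    if "l2_op_norm (op_of (cp_el \<beta> \<eta>)) \<le> r" for r
  proof -
    let ?z = "\<lambda>n. r *\<^sub>R cc_one n - \<eta> n"
    have z: "?z \<in> sa \<beta>" by (intro sa_diff sa_scaleR sa_cc_one assms \<eta>)
    have eq: "cp_el \<beta> ?z = r *\<^sub>R 1 - cp_el \<beta> \<eta>"
      by (simp add: cp_el_diff cp_el_scaleR cp_el_cc_one Cc_UNIV_scaleR cc_one_Cc_UNIV sa_Cc[OF \<eta>])
    have "cpos (r *\<^sub>R 1 - cp_el \<beta> \<eta>)"
      using that by (intro cpos_norm_minus sa_star[OF \<eta>]) (simp add: l2_op_norm_op_of)
    then have "cpos (cp_el \<beta> ?z)" by (simp only: eq)
    then have "op_of (cp_el \<beta> ?z) \<in> ou_pos (cp_ou \<beta>)" by (rule iffD2[OF cp_ou_pos[OF assms z]])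
    then show ?thesis by (simp add: eq op_of_simps cp_ou_unit)
  qed
  fix \<zeta> assume \<zeta>: "\<zeta> \<in> sa \<beta>"
  show "op_of (cp_el \<beta> \<eta>) + op_of (cp_el \<beta> \<zeta>) \<in> (\<lambda>\<eta>. op_of (cp_el \<beta> \<eta>)) ` sa \<beta>"
    by (rule image_eqI[OF _ sa_add[OF assms \<eta> \<zeta>]]) (simp add: cp_el_add sa_Cc[OF \<eta>] sa_Cc[OF \<zeta>] op_of_simps)
  show "l2_op_norm (op_of (cp_el \<beta> \<eta>) + op_of (cp_el \<beta> \<zeta>)) \<le> l2_op_norm (op_of (cp_el \<beta> \<eta>)) + l2_op_norm (op_of (cp_el \<beta> \<zeta>))"
    by (simp add: l2_op_norm_op_of norm_triangle_ineq flip: op_of_simps)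
next
  show "ou_unit (cp_ou \<beta>) \<in> (\<lambda>\<eta>. op_of (cp_el \<beta> \<eta>)) ` sa \<beta>"
    by (rule image_eqI[OF _ sa_cc_one[OF assms]]) (simp add: cp_ou_unit cp_el_cc_one aut_star assms)
  show "l2_op_norm (ou_unit (cp_ou \<beta>)) = 1" by (simp add: cp_ou_unit l2_op_norm_op_of)
  show "ou_pos (cp_ou \<beta>) \<subseteq> (\<lambda>\<eta>. op_of (cp_el \<beta> \<eta>)) ` sa \<beta>"
    unfolding cp_ou_set[OF assms, symmetric] by (auto simp: cp_ou_def sa_space_def)
qed

lemma cp_lip_seminorm:
  assumes "aut \<beta>"
  shows "rseminorm_on (ou_set (cp_ou \<beta>)) (cp_lip \<beta>)" "cp_lip \<beta> (ou_unit (cp_ou \<beta>)) = 0"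
proof -
  note [simp] = aut_star[OF assms]
  have one: "ou_unit (cp_ou \<beta>) = op_of (cp_el \<beta> cc_one)" by (simp add: cp_ou_unit cp_el_cc_one)
  show "cp_lip \<beta> (ou_unit (cp_ou \<beta>)) = 0"
    unfolding one cp_lip_eq[OF assms sa_cc_one[OF assms]] by (rule lipf_seminorm[OF assms])
  show "rseminorm_on (ou_set (cp_ou \<beta>)) (cp_lip \<beta>)"
    unfolding rseminorm_on_def cp_ou_set[OF assms]
  proof (intro conjI ballI allI; elim imageE; hypsubst)
    fix \<eta> assume \<eta>: "\<eta> \<in> sa \<beta>"
    show "0 \<le> cp_lip \<beta> (op_of (cp_el \<beta> \<eta>))"
      unfolding cp_lip_eq[OF assms \<eta>] by (rule lipf_seminorm(1)[OF assms \<eta>])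
    have "r *\<^sub>R op_of (cp_el \<beta> \<eta>) = op_of (cp_el \<beta> (\<lambda>n. r *\<^sub>R \<eta> n))" for r
      by (simp add: cp_el_scaleR sa_Cc[OF \<eta>] op_of_simps)
    then show "cp_lip \<beta> (r *\<^sub>R op_of (cp_el \<beta> \<eta>)) = \<bar>r\<bar> * cp_lip \<beta> (op_of (cp_el \<beta> \<eta>))" for r
      by (simp add: cp_lip_eq[OF assms] \<eta> sa_scaleR[OF assms] lipf_seminorm(3)[OF assms])
    fix \<zeta> assume \<zeta>: "\<zeta> \<in> sa \<beta>"
    have "op_of (cp_el \<beta> \<eta>) + op_of (cp_el \<beta> \<zeta>) = op_of (cp_el \<beta> (\<lambda>n. \<eta> n + \<zeta> n))"
      by (simp add: cp_el_add sa_Cc[OF \<eta>] sa_Cc[OF \<zeta>] op_of_simps)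
    then show "cp_lip \<beta> (op_of (cp_el \<beta> \<eta>) + op_of (cp_el \<beta> \<zeta>)) \<le> cp_lip \<beta> (op_of (cp_el \<beta> \<eta>)) + cp_lip \<beta> (op_of (cp_el \<beta> \<zeta>))"
      by (simp add: cp_lip_eq[OF assms] \<eta> \<zeta> sa_add[OF assms] lipf_seminorm(2)[OF assms])
  qed
qed

lemma cp_transfer_sa:
  assumes "aut \<beta>" "aut \<gamma>" "y \<in> sa \<gamma>" "k > 0"
  shows "cp_transfer k \<beta> \<gamma> y \<in> sa \<beta>"
  unfolding sa_def Cc_def mem_Collect_eq
proof (intro conjI allI)
  show "finite {n. cp_transfer k \<beta> \<gamma> y n \<noteq> 0}" using cp_transfer_Cc_UNIV by (simp add: Cc_UNIV_iff)
  show "cp_transfer k \<beta> \<gamma> y n \<in> V" for n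
    unfolding cp_transfer_def by (intro V_closed aut_V assms Cc_V sa_Cc[OF assms(3)])
  show "star (cp_el \<beta> (cp_transfer k \<beta> \<gamma> y)) = cp_el \<beta> (cp_transfer k \<beta> \<gamma> y)"
    using assms sa_Cc sa_star by (intro cp_transfer_contractive) (auto simp: aut_star)
qed

definition cp_map :: "nat \<Rightarrow> ('b \<Rightarrow> 'b) \<Rightarrow> ('b \<Rightarrow> 'b) \<Rightarrow> 'b l2_op \<Rightarrow> 'b l2_op" where
  "cp_map k \<beta> \<gamma> a = op_of (cp_el \<beta> (cp_transfer k \<beta> \<gamma> (inv_into (Cc V) (cp_elem \<gamma>) a)))"

lemma cp_map_eq:
  "aut \<gamma> \<Longrightarrow> y \<in> sa \<gamma> \<Longrightarrow> cp_map k \<beta> \<gamma> (op_of (cp_el \<gamma> y)) = op_of (cp_el \<beta> (cp_transfer k \<beta> \<gamma> y))"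
  by (simp add: cp_map_def inv_cp_elem sa_Cc)

lemma ou_hom_cp_map:
  assumes "aut \<beta>" "aut \<gamma>" "k > 0" shows "ou_hom (cp_ou \<gamma>) (cp_ou \<beta>) (cp_map k \<beta> \<gamma>)"
  unfolding ou_hom_def cp_ou_set[OF assms(1)] cp_ou_set[OF assms(2)]
proof (intro conjI ballI allI; (elim imageE; hypsubst)?)
  note [simp] = aut_star[OF assms(1)] aut_star[OF assms(2)]
  fix \<eta> assume \<eta>: "\<eta> \<in> sa \<gamma>"
  show "cp_map k \<beta> \<gamma> (op_of (cp_el \<gamma> \<eta>)) \<in> (\<lambda>\<eta>. op_of (cp_el \<beta> \<eta>)) ` sa \<beta>"
    unfolding cp_map_eq[OF assms(2) \<eta>] by (intro imageI cp_transfer_sa assms \<eta>)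
  have "r *\<^sub>R op_of (cp_el \<gamma> \<eta>) = op_of (cp_el \<gamma> (\<lambda>n. r *\<^sub>R \<eta> n))" for r
    by (simp add: cp_el_scaleR sa_Cc[OF \<eta>] op_of_simps)
  then show "cp_map k \<beta> \<gamma> (r *\<^sub>R op_of (cp_el \<gamma> \<eta>)) = r *\<^sub>R cp_map k \<beta> \<gamma> (op_of (cp_el \<gamma> \<eta>))" for r
    by (simp add: cp_map_eq[OF assms(2)] \<eta> sa_scaleR[OF assms(2)] cp_transfer_scaleR cp_el_scaleR
        cp_transfer_Cc_UNIV op_of_simps)
  fix \<zeta> assume \<zeta>: "\<zeta> \<in> sa \<gamma>"
  have "op_of (cp_el \<gamma> \<eta>) + op_of (cp_el \<gamma> \<zeta>) = op_of (cp_el \<gamma> (\<lambda>n. \<eta> n + \<zeta> n))"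
    by (simp add: cp_el_add sa_Cc[OF \<eta>] sa_Cc[OF \<zeta>] op_of_simps)
  then show "cp_map k \<beta> \<gamma> (op_of (cp_el \<gamma> \<eta>) + op_of (cp_el \<gamma> \<zeta>)) = cp_map k \<beta> \<gamma> (op_of (cp_el \<gamma> \<eta>)) + cp_map k \<beta> \<gamma> (op_of (cp_el \<gamma> \<zeta>))"
    by (simp add: cp_map_eq[OF assms(2)] \<eta> \<zeta> sa_add[OF assms(2)] cp_transfer_add cp_el_add
        cp_transfer_Cc_UNIV op_of_simps)
next
  note [simp] = aut_star[OF assms(1)] aut_star[OF assms(2)]
  have "cp_map k \<beta> \<gamma> (op_of (cp_el \<gamma> cc_one)) = op_of (cp_el \<beta> cc_one)"
    by (subst cp_map_eq[OF assms(2) sa_cc_one[OF assms(2)]]) (simp add: cp_transfer_one assms(3))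
  then show "cp_map k \<beta> \<gamma> (ou_unit (cp_ou \<gamma>)) = ou_unit (cp_ou \<beta>)"
    by (simp add: cp_el_cc_one cp_ou_unit)
next
  fix a assume a: "a \<in> ou_pos (cp_ou \<gamma>)"
  then have "a \<in> ou_set (cp_ou \<gamma>)" by (auto simp: cp_ou_def sa_space_def)
  then obtain \<eta> where \<eta>: "\<eta> \<in> sa \<gamma>" "a = op_of (cp_el \<gamma> \<eta>)" unfolding cp_ou_set[OF assms(2)] by blast
  then have "cpos (cp_el \<gamma> \<eta>)" using a cp_ou_pos[OF assms(2)] by blast
  then obtain d where "cpos d" "d * d = cp_el \<gamma> \<eta>" by (metis cpos_sqrt)
  then have "cpos (cp_el \<beta> (cp_transfer k \<beta> \<gamma> \<eta>))"
    using cpos_cp_transfer[of \<beta> \<gamma> \<eta> d k] sa_Cc[OF \<eta>(1)] by (simp add: aut_star assms cpos_sa)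
  then show "cp_map k \<beta> \<gamma> a \<in> ou_pos (cp_ou \<beta>)"
    using cp_ou_pos[OF assms(1) cp_transfer_sa[OF assms(1,2) \<eta>(1) assms(3)]]
    by (simp add: \<eta>(2) cp_map_eq[OF assms(2) \<eta>(1)])
qed

end

section \<open>Continuity\<close>

text \<open>Telescoping, from 1/(a + 1)^2 \<le> 1/a - 1/(a + 1).\<close>

lemma sum_inverse_square_nat:
  assumes "k > 0"
  shows "(\<Sum>i\<in>{1..M}. 1 / (real i + real k)\<^sup>2) \<le> 1 / real k - 1 / (real M + real k)"
proof (induction M)
  case (Suc M)
  let ?a = "real M + real k"
  have a: "?a > 0" using assms by simp
  have "?a * (?a + 1) \<le> (?a + 1) * (?a + 1)" using a by (intro mult_right_mono) auto
  moreover have "(real (Suc M) + real k)\<^sup>2 = (?a + 1) * (?a + 1)" by (simp add: power2_eq_square ac_simps)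
  ultimately have "1 / (real (Suc M) + real k)\<^sup>2 \<le> 1 / (?a * (?a + 1))"
    using a by (intro frac_le) auto
  also have "\<dots> = 1 / ?a - 1 / (?a + 1)" using a by (simp add: field_simps)
  finally show ?case using Suc by (simp add: ac_simps)
qed simp

text \<open>Source of the constant 32: the square of 4 times at most 1/k for the positive indices,
  and the same for the negative ones.\<close>

lemma sum_inverse_square_int:
  assumes "finite F" "0 \<notin> F" "k > 0"
  shows "(\<Sum>n\<in>F. (4 / (\<bar>real_of_int n\<bar> + real k))\<^sup>2) \<le> 32 / real k"
proof -
  let ?g = "\<lambda>n. (4 / (\<bar>real_of_int n\<bar> + real k))\<^sup>2"
  have "finite ((\<lambda>n. nat \<bar>n\<bar>) ` F)" using assms(1) by simp
  then obtain M where M: "\<And>n. n \<in> F \<Longrightarrow> nat \<bar>n\<bar> \<le> M" by (metis finite_nat_set_iff_bounded_le imageI)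
  let ?A = "int ` {1..M}" and ?B = "(\<lambda>i. - int i) ` {1..M}"
  have sub: "F \<subseteq> ?A \<union> ?B"
  proof
    fix n assume n: "n \<in> F"
    then have "n \<noteq> 0" "nat \<bar>n\<bar> \<le> M" using M assms(2) by auto
    then show "n \<in> ?A \<union> ?B"
      by (cases "n \<ge> 0") (auto intro: image_eqI[of _ _ "nat \<bar>n\<bar>"])
  qed
  have one: "(\<Sum>i\<in>{1..M}. ?g (int i)) \<le> 16 / real k"
  proof -
    have "(\<Sum>i\<in>{1..M}. ?g (int i)) = 16 * (\<Sum>i\<in>{1..M}. 1 / (real i + real k)\<^sup>2)"
      by (simp add: sum_distrib_left power_divide)
    also have "\<dots> \<le> 16 * (1 / real k)"
      using sum_inverse_square_nat[OF assms(3), of M] by (intro mult_left_mono) (auto intro: order_trans)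
    finally show ?thesis by simp
  qed
  have "(\<Sum>n\<in>F. ?g n) \<le> (\<Sum>n\<in>?A \<union> ?B. ?g n)" using sub by (intro sum_mono2) auto
  also have "\<dots> \<le> (\<Sum>n\<in>?A. ?g n) + (\<Sum>n\<in>?B. ?g n)"
    by (subst sum.union_disjoint) auto
  also have "(\<Sum>n\<in>?A. ?g n) = (\<Sum>i\<in>{1..M}. ?g (int i))" by (subst sum.reindex) auto
  also have "(\<Sum>n\<in>?B. ?g n) = (\<Sum>i\<in>{1..M}. ?g (int i))"
    by (subst sum.reindex) (auto simp: inj_on_def)
  finally show ?thesis using one by simp
qed

text \<open>Divide the symbol c by n and apply the multiplier bound to the derivation. The weight
  4/(|n| + k) covers a symbol growing like 2 |n|/k for |n| < k and one bounded by 1 beyond k, so the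
  same lemma handles Fejer defects and plain cut-offs.\<close>

lemma norm_cp_el_tail_le:
  assumes \<beta>: "star_automorphism \<beta>" and \<eta>: "\<eta> \<in> Cc UNIV" and k: "k > 0"
    and c: "c 0 = 0" "\<And>n. n \<noteq> 0 \<Longrightarrow> \<bar>c n\<bar> \<le> \<bar>real_of_int n\<bar> * (4 / (\<bar>real_of_int n\<bar> + real k))"
  shows "norm (cp_el \<beta> (\<lambda>n. c n *\<^sub>R \<eta> n)) \<le> sqrt (32 / real k) * norm (cp_el \<beta> (\<lambda>n. real_of_int n *\<^sub>R \<eta> n))"
proof -
  let ?\<zeta> = "\<lambda>n. real_of_int n *\<^sub>R \<eta> n" and ?a = "\<lambda>n. c n / real_of_int n"
  let ?F = "{n. ?\<zeta> n \<noteq> 0}"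
  have \<zeta>: "?\<zeta> \<in> Cc UNIV" using \<eta> unfolding Cc_UNIV_iff by (rule rev_finite_subset) auto
  then have F: "finite ?F" by (simp add: Cc_UNIV_iff)
  have eq: "(\<lambda>n. c n *\<^sub>R \<eta> n) = (\<lambda>n. ?a n *\<^sub>R ?\<zeta> n)" using c(1) by auto
  have "(?a n)\<^sup>2 \<le> (4 / (\<bar>real_of_int n\<bar> + real k))\<^sup>2" if "n \<in> ?F" for n
  proof -
    have "n \<noteq> 0" using that by auto
    then have "\<bar>?a n\<bar> \<le> 4 / (\<bar>real_of_int n\<bar> + real k)"
      using c(2)[of n] by (simp add: abs_divide divide_le_eq mult.commute)
    from power_mono[OF this abs_ge_zero, of 2] show ?thesis by (simp only: power2_abs)
  qed
  then have "(\<Sum>n\<in>?F. (?a n)\<^sup>2) \<le> (\<Sum>n\<in>?F. (4 / (\<bar>real_of_int n\<bar> + real k))\<^sup>2)" by (rule sum_mono)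
  also have "\<dots> \<le> 32 / real k" by (rule sum_inverse_square_int[OF F _ k]) simp
  finally have "sqrt (\<Sum>n\<in>?F. (?a n)\<^sup>2) \<le> sqrt (32 / real k)" by simp
  then show ?thesis
    unfolding eq by (intro order_trans[OF norm_cp_el_multiplier_le[OF \<beta> \<zeta> F order_refl]] mult_right_mono) auto
qed

lemma ex_sqrt_inverse_le:
  assumes "(e::real) > 0" obtains k :: nat where "k > 0" "sqrt (32 / real k) \<le> e"
proof -
  obtain k :: nat where k: "32 / e\<^sup>2 \<le> real k" using real_arch_simple by blast
  have "32 / e\<^sup>2 > 0" using assms by simp
  then have "k > 0" using k by (metis not_gr_zero of_nat_0 not_le)
  have "32 / real k \<le> e\<^sup>2" using k \<open>k > 0\<close> assms by (simp add: field_simps)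
  then have "sqrt (32 / real k) \<le> e" using assms by (intro real_le_lsqrt) auto
  then show ?thesis using that \<open>k > 0\<close> by blast
qed

lemma Cc_UNIV_diff: "\<eta> \<in> Cc UNIV \<Longrightarrow> \<zeta> \<in> Cc UNIV \<Longrightarrow> (\<lambda>n. \<eta> n - \<zeta> n :: 'b::unital_cstar_algebra) \<in> Cc UNIV"
  using Cc_UNIV_add[of \<eta> "\<lambda>n. - \<zeta> n"] Cc_UNIV_scaleR[of \<zeta> "-1"] by simp

text \<open>The error splits into two parts. If the actions agreed, the n-th coefficient would be
  multiplied by the squared Fejer weight, a tail term; the mismatch of the actions lives on |n| < k
  and is bounded coefficient by coefficient.\<close>

lemma norm_cp_transfer_roundtrip:
  assumes \<beta>: "star_automorphism \<beta>" and \<gamma>: "star_automorphism \<gamma>" and k: "k > 0" and \<eta>: "\<eta> \<in> Cc UNIV"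
    and close: "\<And>n m. \<bar>n\<bar> < int k \<Longrightarrow> 0 \<le> m \<Longrightarrow> m < int k \<Longrightarrow>
      norm (aut_pow \<beta> (- m) (\<eta> n) - aut_pow \<gamma> (- m) (\<eta> n)) \<le> \<omega>"
  shows "norm (cp_el \<beta> (\<lambda>n. \<eta> n - cp_transfer k \<beta> \<gamma> (cp_transfer k \<gamma> \<beta> \<eta>) n))
    \<le> sqrt (32 / real k) * norm (cp_el \<beta> (\<lambda>n. real_of_int n *\<^sub>R \<eta> n)) + (2 * real k + 1) * (2 * \<omega>)"
proof -
  note [simp] = star_automorphism_bij[OF \<beta>] star_automorphism_bij[OF \<gamma>]
  define w where "w n = real (card (window k n)) / real k" for n
  have w: "0 \<le> w n" "w n \<le> 1" for n
    using k by (auto simp: w_def card_window)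
  let ?\<xi> = "cp_transfer k \<beta> \<gamma> (cp_transfer k \<gamma> \<beta> \<eta>)"
  let ?r = "\<lambda>n. (w n)\<^sup>2 *\<^sub>R \<eta> n - ?\<xi> n"
  \<comment> \<open>The four powers cancel when the two actions agree, so the distance of
    \<open>A m l x\<close> from x measures their difference; moving along one pair of powers and
    then the other costs \<open>\<omega>\<close> each.\<close>
  define A where "A m l x = aut_pow \<beta> m (aut_pow \<gamma> (- m) (aut_pow \<gamma> l (aut_pow \<beta> (- l) x)))" for m l x
  have r_eq: "?r n = (1 / real k)\<^sup>2 *\<^sub>R (\<Sum>m\<in>window k n. \<Sum>l\<in>window k n. \<eta> n - A m l (\<eta> n))" for n
  proof -
    have lin: "aut_pow \<alpha> m (\<Sum>i\<in>I. f i) = (\<Sum>i\<in>I. aut_pow \<alpha> m (f i))" if "star_automorphism \<alpha>" for \<alpha> m I and f :: "int \<Rightarrow> 'a"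
      using that by (induction I rule: infinite_finite_induct) (auto simp: aut_simps)
    have "?\<xi> n = (1 / real k)\<^sup>2 *\<^sub>R (\<Sum>m\<in>window k n. \<Sum>l\<in>window k n. A m l (\<eta> n))"
      by (simp add: cp_transfer_def A_def aut_simps(5)[OF \<beta>] aut_simps(5)[OF \<gamma>] lin[OF \<beta>] lin[OF \<gamma>]
          power2_eq_square flip: scaleR_sum_right)
    moreover have "(w n)\<^sup>2 *\<^sub>R \<eta> n = (1 / real k)\<^sup>2 *\<^sub>R (\<Sum>m\<in>window k n. \<Sum>l\<in>window k n. \<eta> n)"
      by (simp add: w_def sum_constant_scaleR power2_eq_square del: sum_constant)
    ultimately show ?thesis by (simp add: sum_subtractf scaleR_diff_right)
  qed
  have \<omega>: "0 \<le> \<omega>" using order_trans[OF norm_ge_zero close[of 0 0]] k by simp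
  have r_le: "norm (?r n) \<le> 2 * \<omega>" if n: "\<bar>n\<bar> < int k" for n
  proof -
    have close_A: "norm (\<eta> n - A m l (\<eta> n)) \<le> 2 * \<omega>" if "m \<in> window k n" "l \<in> window k n" for m l
    proof -
      let ?x = "\<eta> n" and ?y = "aut_pow \<gamma> l (aut_pow \<beta> (- l) (\<eta> n))"
      have "norm (?x - aut_pow \<beta> m (aut_pow \<gamma> (- m) ?x)) = norm (aut_pow \<beta> m (aut_pow \<beta> (- m) ?x - aut_pow \<gamma> (- m) ?x))"
        by (simp add: aut_simps(8)[OF \<beta>])
      also have "\<dots> \<le> \<omega>" using that close[OF n, of m] by (simp add: aut_simps(9)[OF \<beta>] window_def)
      finally have 1: "norm (?x - aut_pow \<beta> m (aut_pow \<gamma> (- m) ?x)) \<le> \<omega>" .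
      have "norm (aut_pow \<beta> m (aut_pow \<gamma> (- m) ?x) - A m l ?x) = norm (?x - ?y)"
        by (simp add: A_def aut_simps(9)[OF \<beta>] aut_simps(9)[OF \<gamma>] flip: aut_simps(8)[OF \<beta>] aut_simps(8)[OF \<gamma>])
      also have "?x - ?y = aut_pow \<gamma> l (aut_pow \<gamma> (- l) ?x - aut_pow \<beta> (- l) ?x)"
        by (simp add: aut_simps(8)[OF \<gamma>])
      also have "norm \<dots> \<le> \<omega>"
        using that close[OF n, of l] by (simp add: aut_simps(9)[OF \<gamma>] window_def norm_minus_commute)
      finally have 2: "norm (aut_pow \<beta> m (aut_pow \<gamma> (- m) ?x) - A m l ?x) \<le> \<omega>" .
      have "norm (?x - A m l ?x) \<le> norm (?x - aut_pow \<beta> m (aut_pow \<gamma> (- m) ?x)) + norm (aut_pow \<beta> m (aut_pow \<gamma> (- m) ?x) - A m l ?x)"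
        by (metis diff_add_cancel add_diff_eq norm_triangle_ineq)
      then show ?thesis using 1 2 by linarith
    qed
    have "norm (\<Sum>m\<in>window k n. \<Sum>l\<in>window k n. \<eta> n - A m l (\<eta> n)) \<le> (\<Sum>m\<in>window k n. \<Sum>l\<in>window k n. 2 * \<omega>)"
      by (intro order_trans[OF norm_sum] sum_mono order_trans[OF norm_sum] close_A)
    then have "norm (?r n) \<le> (1 / real k)\<^sup>2 * (\<Sum>m\<in>window k n. \<Sum>l\<in>window k n. 2 * \<omega>)"
      unfolding r_eq by (simp only: norm_scaleR) (simp add: mult_left_mono)
    also have "\<dots> = (w n)\<^sup>2 * (2 * \<omega>)" by (simp add: w_def power2_eq_square)
    also have "\<dots> \<le> 1 * (2 * \<omega>)" using w[of n] \<omega> by (intro mult_right_mono) (auto simp: power_le_one)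
    finally show ?thesis by simp
  qed
  have r_zero: "?r n = 0" if "\<not> \<bar>n\<bar> < int k" for n
    using that window_empty[of k n] by (simp add: r_eq)
  have rsub: "{n. ?r n \<noteq> 0} \<subseteq> {- int k..int k}"
  proof
    fix n assume "n \<in> {n. ?r n \<noteq> 0}"
    then have "\<bar>n\<bar> < int k" using r_zero by blast
    then show "n \<in> {- int k..int k}" by auto
  qed
  have "norm (cp_el \<beta> ?r) \<le> (\<Sum>n\<in>{- int k..int k}. norm (?r n))"
    by (rule norm_cp_el_le_sum[OF \<beta> _ rsub]) simp
  also have "\<dots> \<le> (\<Sum>n\<in>{- int k..int k}. 2 * \<omega>)"
    using r_le r_zero \<omega> by (intro sum_mono) (metis mult_nonneg_nonneg norm_zero zero_le_numeral)
  also have "\<dots> = (2 * real k + 1) * (2 * \<omega>)" by simp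
  finally have 1: "norm (cp_el \<beta> ?r) \<le> (2 * real k + 1) * (2 * \<omega>)" .
  let ?c = "\<lambda>n. 1 - (w n)\<^sup>2"
  have 2: "norm (cp_el \<beta> (\<lambda>n. ?c n *\<^sub>R \<eta> n)) \<le> sqrt (32 / real k) * norm (cp_el \<beta> (\<lambda>n. real_of_int n *\<^sub>R \<eta> n))"
  proof (rule norm_cp_el_tail_le[OF \<beta> \<eta> k])
    show "?c 0 = 0" using k by (simp add: w_def card_window)
    fix n :: int assume "n \<noteq> 0"
    let ?n = "\<bar>real_of_int n\<bar>"
    have n0: "?n > 0" using \<open>n \<noteq> 0\<close> by simp
    have abs: "\<bar>?c n\<bar> = ?c n" using w[of n] by (simp add: power_le_one)
    show "\<bar>?c n\<bar> \<le> ?n * (4 / (?n + real k))"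
    proof (cases "\<bar>n\<bar> < int k")
      case True
      then have nk: "?n < real k" by linarith
      have "w n = (real k - ?n) / real k" using True by (simp add: w_def card_window)
      then have "1 - w n = ?n / real k" using k by (simp add: field_simps)
      moreover have "?c n = (1 - w n) * (1 + w n)" by (simp add: power2_eq_square algebra_simps)
      moreover have "(1 - w n) * (1 + w n) \<le> (1 - w n) * 2" using w[of n] by (intro mult_left_mono) auto
      ultimately have "?c n \<le> ?n * (2 / real k)" by simp
      \<comment> \<open>Here |n| < k, so |n| + k is less than 2 k.\<close>
      also have "2 / real k \<le> 4 / (?n + real k)" using nk k n0 by (simp add: field_simps)
      finally show ?thesis using abs n0 by (simp add: mult_left_mono)
    next
      case False
      then have nk: "real k \<le> ?n" by linarith
      have "?c n \<le> 1" by simp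
      also have "1 \<le> ?n * (4 / (?n + real k))" using nk k n0 by (simp add: field_simps)
      finally show ?thesis using abs by simp
    qed
  qed
  have r_Cc: "?r \<in> Cc UNIV" using finite_subset[OF rsub] by (simp add: Cc_UNIV_iff)
  have c_Cc: "(\<lambda>n. ?c n *\<^sub>R \<eta> n) \<in> Cc UNIV" using \<eta> unfolding Cc_UNIV_iff by (rule rev_finite_subset) auto
  have "(\<lambda>n. \<eta> n - ?\<xi> n) = (\<lambda>n. ?c n *\<^sub>R \<eta> n + ?r n)" by (simp add: algebra_simps)
  then have "cp_el \<beta> (\<lambda>n. \<eta> n - ?\<xi> n) = cp_el \<beta> (\<lambda>n. ?c n *\<^sub>R \<eta> n) + cp_el \<beta> ?r"
    using cp_el_add[OF \<beta> c_Cc r_Cc] by simp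
  then have "norm (cp_el \<beta> (\<lambda>n. \<eta> n - ?\<xi> n)) \<le> norm (cp_el \<beta> (\<lambda>n. ?c n *\<^sub>R \<eta> n)) + norm (cp_el \<beta> ?r)"
    by (simp only: norm_triangle_ineq)
  then show ?thesis using add_mono[OF 2 1] by (rule order_trans)
qed

context lip_space
begin

section \<open>Uniform radius and total boundedness of the Lipschitz balls\<close>

text \<open>One radius for all automorphisms preserving V, so that it can be fixed before the
  actions to be compared. The lower bound 1 allows division by R.\<close>

definition lip_radius :: "real \<Rightarrow> bool" where
  "lip_radius R \<longleftrightarrow> 1 \<le> R \<and> (\<forall>\<beta> \<eta>. aut \<beta> \<longrightarrow> \<eta> \<in> sa \<beta> \<longrightarrow> lipf \<beta> \<eta> \<le> 1 \<longrightarrow>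
     (\<exists>r. norm (cp_el \<beta> (\<lambda>n. \<eta> n - r *\<^sub>R cc_one n)) \<le> R))"

lemma cc_deriv_fun: "cc_deriv \<eta> = (\<lambda>n. real_of_int n *\<^sub>R \<eta> n)"
  by (rule ext) (simp add: cc_deriv_eq)

text \<open>The zeroth coefficient is within D of a scalar by the corresponding fact for B; all
  others together have norm at most sqrt 32 by the tail estimate with k = 1.\<close>

lemma ex_lip_radius: obtains R where "lip_radius R"
proof -
  obtain D where D: "D \<ge> 0" "\<And>b. b \<in> V \<Longrightarrow> star b = b \<Longrightarrow> L b \<le> 1 \<Longrightarrow> \<exists>r. norm (b - r *\<^sub>R 1) \<le> D"
    using cstar_cqms_radius[OF cqms] by metis
  show ?thesis
  proof (rule that[of "D + sqrt 32 + 1"], unfold lip_radius_def, intro conjI allI impI)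
    show "1 \<le> D + sqrt 32 + 1" using D(1) by simp
    fix \<beta> \<eta> assume \<beta>: "aut \<beta>" and \<eta>: "\<eta> \<in> sa \<beta>" "lipf \<beta> \<eta> \<le> 1"
    note [simp] = aut_star[OF \<beta>]
    have "star (\<eta> 0) = \<eta> 0" using fun_cong[OF sa_cc_star[OF \<beta> \<eta>(1)], of 0] by (simp add: cc_star_def)
    \<comment> \<open>Here the normalization of the norm at e_0 enters: the coefficient bound at 0
      is exactly 1.\<close>
    moreover have "L (\<eta> 0) \<le> 1"
      using L_coeff_le[OF sa_Cc(1)[OF \<eta>(1)], of 0] \<eta>(2) N_e0 by (simp add: lipf_def N_unit_def)
    ultimately obtain r where r: "norm (\<eta> 0 - r *\<^sub>R 1) \<le> D" using D(2) Cc_V(1)[OF sa_Cc(1)[OF \<eta>(1)]] by blast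
    let ?a = "\<lambda>n::int. if n = 0 then \<eta> 0 - r *\<^sub>R 1 else 0" and ?c = "\<lambda>n::int. if n = 0 then 0 else 1 :: real"
    have a: "?a \<in> Cc UNIV" by (rule Cc_single) simp_all
    have c: "(\<lambda>n. ?c n *\<^sub>R \<eta> n) \<in> Cc UNIV"
      using sa_Cc(2)[OF \<eta>(1)] unfolding Cc_UNIV_iff by (rule rev_finite_subset) auto
    have "norm (cp_el \<beta> ?a) \<le> (\<Sum>n\<in>{0}. norm (?a n))" by (rule norm_cp_el_le_sum) auto
    then have 1: "norm (cp_el \<beta> ?a) \<le> D" using r by simp
    have "norm (cp_el \<beta> (\<lambda>n. ?c n *\<^sub>R \<eta> n)) \<le> sqrt (32 / real 1) * norm (cp_el \<beta> (\<lambda>n. real_of_int n *\<^sub>R \<eta> n))"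
    proof (rule norm_cp_el_tail_le[OF _ sa_Cc(2)[OF \<eta>(1)]])
      fix n :: int assume "n \<noteq> 0"
      then have "\<bar>real_of_int n\<bar> \<ge> 1" by linarith
      then show "\<bar>?c n\<bar> \<le> \<bar>real_of_int n\<bar> * (4 / (\<bar>real_of_int n\<bar> + real 1))"
        using \<open>n \<noteq> 0\<close> by (simp add: field_simps)
    qed auto
    also have "\<dots> \<le> sqrt 32 * 1"
      using \<eta>(2) by (intro mult_mono) (simp_all add: lipf_def cc_deriv_fun)
    finally have 2: "norm (cp_el \<beta> (\<lambda>n. ?c n *\<^sub>R \<eta> n)) \<le> sqrt 32" by simp
    have "(\<lambda>n. \<eta> n - r *\<^sub>R cc_one n) = (\<lambda>n. ?a n + ?c n *\<^sub>R \<eta> n)" by (auto simp: cc_one_def)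
    then have "cp_el \<beta> (\<lambda>n. \<eta> n - r *\<^sub>R cc_one n) = cp_el \<beta> ?a + cp_el \<beta> (\<lambda>n. ?c n *\<^sub>R \<eta> n)"
      using cp_el_add[OF _ a c, of \<beta>] by simp
    then have "norm (cp_el \<beta> (\<lambda>n. \<eta> n - r *\<^sub>R cc_one n)) \<le> D + sqrt 32 + 1"
      using norm_triangle_ineq[of "cp_el \<beta> ?a" "cp_el \<beta> (\<lambda>n. ?c n *\<^sub>R \<eta> n)"] 1 2 by simp
    then show "\<exists>r. norm (cp_el \<beta> (\<lambda>n. \<eta> n - r *\<^sub>R cc_one n)) \<le> D + sqrt 32 + 1" by blast
  qed
qed

definition lip_ball :: "('b \<Rightarrow> 'b) \<Rightarrow> real \<Rightarrow> (int \<Rightarrow> 'b) set" where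
  "lip_ball \<beta> R = {\<eta> \<in> sa \<beta>. lipf \<beta> \<eta> \<le> 1 \<and> norm (cp_el \<beta> \<eta>) \<le> R}"

lemma lip_ball_shift:
  assumes "lip_radius R" "aut \<beta>" "\<eta> \<in> sa \<beta>" "lipf \<beta> \<eta> \<le> 1"
  obtains r where "(\<lambda>n. \<eta> n - r *\<^sub>R cc_one n) \<in> lip_ball \<beta> R"
proof -
  obtain r where r: "norm (cp_el \<beta> (\<lambda>n. \<eta> n - r *\<^sub>R cc_one n)) \<le> R"
    using assms unfolding lip_radius_def by blast
  have one: "(\<lambda>n. (- r) *\<^sub>R cc_one n) \<in> sa \<beta>" by (intro sa_scaleR sa_cc_one assms)
  have "lipf \<beta> (\<lambda>n. \<eta> n + (- r) *\<^sub>R cc_one n) \<le> lipf \<beta> \<eta> + lipf \<beta> (\<lambda>n. (- r) *\<^sub>R cc_one n)"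
    by (rule lipf_seminorm(2)[OF assms(2,3) one])
  also have "lipf \<beta> (\<lambda>n. (- r) *\<^sub>R cc_one n) = 0"
    using lipf_seminorm(3)[OF assms(2) sa_cc_one[OF assms(2)], of "- r"] lipf_seminorm(4)[OF assms(2)] by simp
  finally have "lipf \<beta> (\<lambda>n. \<eta> n - r *\<^sub>R cc_one n) \<le> 1" using assms(4) by simp
  then show ?thesis
    using that[of r] r sa_diff[OF assms(2,3) sa_scaleR[OF assms(2) sa_cc_one[OF assms(2)]], of r]
    by (simp add: lip_ball_def)
qed

lemma lip_ball_coeff:
  assumes "aut \<beta>" "\<eta> \<in> lip_ball \<beta> R"
  shows "\<eta> n \<in> V" "L (\<eta> n) \<le> 1 / N_unit n" "norm (\<eta> n) \<le> R"
proof -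
  have \<eta>: "\<eta> \<in> sa \<beta>" "lipf \<beta> \<eta> \<le> 1" "norm (cp_el \<beta> \<eta>) \<le> R" using assms(2) by (auto simp: lip_ball_def)
  show "\<eta> n \<in> V" by (rule Cc_V(1)[OF sa_Cc(1)[OF \<eta>(1)]])
  have "NL \<eta> \<le> 1" using \<eta>(2) by (simp add: lipf_def)
  then show "L (\<eta> n) \<le> 1 / N_unit n"
    using L_coeff_le[OF sa_Cc(1)[OF \<eta>(1)], of n] N_unit_pos[of n]
    by (meson divide_right_mono less_imp_le order_trans)
  show "norm (\<eta> n) \<le> R"
    using norm_coeff_le_norm_cp_el[OF aut_star[OF assms(1)] sa_Cc(2)[OF \<eta>(1)]] \<eta>(3) by (rule order_trans)
qed

text \<open>Coefficients with |n| \<le> k are approximated by finite nets in B, and the remaining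
  ones are small uniformly on the ball, by the bound on the derivation.\<close>

lemma lip_ball_net:
  assumes \<beta>: "aut \<beta>" and e: "e > 0"
  shows "\<exists>F. finite F \<and> F \<subseteq> lip_ball \<beta> R \<and> (\<forall>\<eta>\<in>lip_ball \<beta> R. \<exists>f\<in>F. norm (cp_el \<beta> (\<lambda>n. \<eta> n - f n)) \<le> e)"
proof -
  note [simp] = aut_star[OF \<beta>]
  obtain k :: nat where k: "k > 0" "sqrt (32 / real k) \<le> e / 4" using ex_sqrt_inverse_le[of "e / 4"] e by auto
  let ?I = "{- int k..int k}"
  \<comment> \<open>The 2 k + 1 central coefficients together contribute at most e / 2.\<close>
  define d where "d = e / (2 * (2 * real k + 1))"
  have d: "d > 0" using e by (simp add: d_def add_nonneg_pos)
  have "\<exists>F. finite F \<and> F \<subseteq> lip_ball \<beta> R \<and> (\<forall>\<eta>\<in>lip_ball \<beta> R. \<exists>f\<in>F. \<forall>n\<in>?I. dist (\<eta> n) (f n) < d)"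
  proof (rule finite_net_multi[OF _ d, where g="\<lambda>n \<eta>. \<eta> n"])
    fix n s assume "n \<in> ?I" and s: "(s::real) > 0"
    have "1 / N_unit n > 0" using N_unit_pos by simp
    from cstar_cqms_totally_bounded[OF cqms s this, of R]
    obtain C where C: "finite C" "\<forall>b\<in>{b\<in>V. L b \<le> 1 / N_unit n \<and> norm b \<le> R}. \<exists>c\<in>C. norm (b - c) < s"
      by (elim exE conjE)
    have "\<exists>c\<in>C. dist (\<eta> n) c < s" if "\<eta> \<in> lip_ball \<beta> R" for \<eta>
      using bspec[OF C(2), of "\<eta> n"] lip_ball_coeff[OF \<beta> that, of n] by (simp add: dist_norm)
    then show "\<exists>C. finite C \<and> (\<forall>\<eta>\<in>lip_ball \<beta> R. \<exists>c\<in>C. dist (\<eta> n) c < s)" using C(1) by blast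
  qed simp
  then obtain F where F: "finite F" "F \<subseteq> lip_ball \<beta> R"
    "\<forall>\<eta>\<in>lip_ball \<beta> R. \<exists>f\<in>F. \<forall>n\<in>?I. dist (\<eta> n) (f n) < d" by (elim exE conjE)
  have "\<exists>f\<in>F. norm (cp_el \<beta> (\<lambda>n. \<eta> n - f n)) \<le> e" if \<eta>: "\<eta> \<in> lip_ball \<beta> R" for \<eta>
  proof -
    obtain f where f: "f \<in> F" "\<forall>n\<in>?I. dist (\<eta> n) (f n) < d" using bspec[OF F(3) \<eta>] by blast
    have fB: "f \<in> lip_ball \<beta> R" using f(1) F(2) by blast
    have sa: "\<eta> \<in> sa \<beta>" "f \<in> sa \<beta>" using \<eta> fB by (auto simp: lip_ball_def)
    let ?z = "\<lambda>n. \<eta> n - f n"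
    have z: "?z \<in> Cc UNIV" by (intro Cc_UNIV_diff sa_Cc(2)[OF sa(1)] sa_Cc(2)[OF sa(2)])
    let ?c = "\<lambda>n. if \<bar>n\<bar> \<le> int k then 0 else 1 :: real"
    let ?a = "\<lambda>n. if \<bar>n\<bar> \<le> int k then ?z n else 0"
    have a: "?a \<in> Cc UNIV" and c: "(\<lambda>n. ?c n *\<^sub>R ?z n) \<in> Cc UNIV"
      using z unfolding Cc_UNIV_iff by (rule rev_finite_subset; auto)+
    have "norm (cp_el \<beta> ?a) \<le> (\<Sum>n\<in>?I. norm (?a n))" by (rule norm_cp_el_le_sum) auto
    also have "\<dots> \<le> (\<Sum>n\<in>?I. d)"
      using f(2) by (intro sum_mono) (auto simp: dist_norm less_imp_le)
    also have "\<dots> = (2 * real k + 1) * d" by simp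
    also have "\<dots> = e / 2"
    proof -
      have q: "q * (e / (2 * q)) = e / 2" if "q > 0" for q using that by simp
      show ?thesis unfolding d_def by (rule q) (simp add: add_nonneg_pos)
    qed
    finally have 1: "norm (cp_el \<beta> ?a) \<le> e / 2" .
    have "norm (cp_el \<beta> (\<lambda>n. ?c n *\<^sub>R ?z n)) \<le> sqrt (32 / real k) * norm (cp_el \<beta> (\<lambda>n. real_of_int n *\<^sub>R ?z n))"
    proof (rule norm_cp_el_tail_le[OF _ z k(1)])
      fix n :: int assume "n \<noteq> 0"
      show "\<bar>?c n\<bar> \<le> \<bar>real_of_int n\<bar> * (4 / (\<bar>real_of_int n\<bar> + real k))"
      proof (cases "\<bar>n\<bar> \<le> int k")
        case False
        then have "real k \<le> \<bar>real_of_int n\<bar>" by linarith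
        then show ?thesis using k(1) False by (simp add: field_simps)
      qed simp
    qed auto
    \<comment> \<open>The derivation of a difference of two members of the ball has norm at most
      2.\<close>
    also have "\<dots> \<le> (e / 4) * 2"
    proof (rule mult_mono[OF k(2)])
      have "cp_el \<beta> (\<lambda>n. real_of_int n *\<^sub>R ?z n) = cp_el \<beta> (cc_deriv \<eta>) - cp_el \<beta> (cc_deriv f)"
        using cp_el_diff[OF _ cc_deriv_Cc[OF sa_Cc(2)[OF sa(1)]] cc_deriv_Cc[OF sa_Cc(2)[OF sa(2)]], of \<beta>]
        by (simp add: cc_deriv_fun scaleR_diff_right)
      moreover have "norm (cp_el \<beta> (cc_deriv \<eta>)) \<le> 1" "norm (cp_el \<beta> (cc_deriv f)) \<le> 1"
        using \<eta> fB by (auto simp: lip_ball_def lipf_def)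
      ultimately show "norm (cp_el \<beta> (\<lambda>n. real_of_int n *\<^sub>R ?z n)) \<le> 2"
        using norm_triangle_ineq4[of "cp_el \<beta> (cc_deriv \<eta>)" "cp_el \<beta> (cc_deriv f)"] by simp
    qed (use e in auto)
    finally have 2: "norm (cp_el \<beta> (\<lambda>n. ?c n *\<^sub>R ?z n)) \<le> e / 2" by simp
    have "?z = (\<lambda>n. ?a n + ?c n *\<^sub>R ?z n)" by auto
    then have "cp_el \<beta> ?z = cp_el \<beta> ?a + cp_el \<beta> (\<lambda>n. ?c n *\<^sub>R ?z n)"
      using cp_el_add[OF _ a c, of \<beta>] by simp
    then have "norm (cp_el \<beta> ?z) \<le> e"
      using norm_triangle_ineq[of "cp_el \<beta> ?a" "cp_el \<beta> (\<lambda>n. ?c n *\<^sub>R ?z n)"] 1 2 by simp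
    then show ?thesis using f(1) by blast
  qed
  then show ?thesis using F(1,2) by blast
qed

lemma cp_ou_totally_bounded:
  assumes \<beta>: "aut \<beta>" and e: "e > 0"
  shows "\<exists>F. finite F \<and> F \<subseteq> ou_set (cp_ou \<beta>) \<and> (\<forall>x\<in>ou_set (cp_ou \<beta>). cp_lip \<beta> x \<le> 1 \<longrightarrow>
    (\<exists>f\<in>F. \<exists>r. cp_norm (x - f - r *\<^sub>R ou_unit (cp_ou \<beta>)) \<le> e))"
proof -
  note [simp] = aut_star[OF \<beta>]
  obtain R where R: "lip_radius R" using ex_lip_radius .
  obtain F where F: "finite F" "F \<subseteq> lip_ball \<beta> R"
    "\<forall>\<eta>\<in>lip_ball \<beta> R. \<exists>f\<in>F. norm (cp_el \<beta> (\<lambda>n. \<eta> n - f n)) \<le> e" using lip_ball_net[OF assms, of R] by (elim exE conjE)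
  let ?o = "\<lambda>\<eta>. op_of (cp_el \<beta> \<eta>)"
  show ?thesis
  proof (intro exI[of _ "?o ` F"] conjI ballI impI)
    show "finite (?o ` F)" using F(1) by simp
    show "?o ` F \<subseteq> ou_set (cp_ou \<beta>)" unfolding cp_ou_set[OF \<beta>] using F(2) by (auto simp: lip_ball_def)
    fix x assume "x \<in> ou_set (cp_ou \<beta>)" "cp_lip \<beta> x \<le> 1"
    then obtain \<eta> where \<eta>: "\<eta> \<in> sa \<beta>" "x = ?o \<eta>" "lipf \<beta> \<eta> \<le> 1"
      unfolding cp_ou_set[OF \<beta>] using cp_lip_eq[OF \<beta>] by auto
    obtain r where r: "(\<lambda>n. \<eta> n - r *\<^sub>R cc_one n) \<in> lip_ball \<beta> R" using lip_ball_shift[OF R \<beta> \<eta>(1,3)] .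
    obtain f where f: "f \<in> F" "norm (cp_el \<beta> (\<lambda>n. (\<eta> n - r *\<^sub>R cc_one n) - f n)) \<le> e" using bspec[OF F(3) r] by blast
    have "f \<in> Cc UNIV" using f(1) F(2) sa_Cc(2) by (auto simp: lip_ball_def)
    then have "cp_el \<beta> (\<lambda>n. (\<eta> n - r *\<^sub>R cc_one n) - f n) = cp_el \<beta> \<eta> - r *\<^sub>R 1 - cp_el \<beta> f"
      by (simp add: cp_el_diff Cc_UNIV_diff Cc_UNIV_scaleR cc_one_Cc_UNIV sa_Cc[OF \<eta>(1)] cp_el_scaleR cp_el_cc_one)
    moreover have "cp_norm (x - ?o f - r *\<^sub>R ou_unit (cp_ou \<beta>)) = norm (cp_el \<beta> \<eta> - cp_el \<beta> f - r *\<^sub>R 1)"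
      by (simp add: \<eta>(2) cp_ou_unit cp_norm_def l2_op_norm_op_of flip: op_of_simps)
    moreover have "cp_el \<beta> \<eta> - cp_el \<beta> f - r *\<^sub>R 1 = cp_el \<beta> \<eta> - r *\<^sub>R 1 - cp_el \<beta> f" by simp
    ultimately have "cp_norm (x - ?o f - r *\<^sub>R ou_unit (cp_ou \<beta>)) \<le> e" using f(2) by (simp only:)
    then show "\<exists>f\<in>?o ` F. \<exists>r. cp_norm (x - f - r *\<^sub>R ou_unit (cp_ou \<beta>)) \<le> e" using f(1) by blast
  qed
qed

section \<open>Comparison of two actions\<close>

text \<open>The transfer acts on each coefficient linearly, so it commutes with the derivation. The
  derivation of a self-adjoint element is anti-self-adjoint; a factor i makes contractivity
  applicable.\<close>

lemma norm_cp_transfer_deriv: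
  assumes "aut \<beta>" "aut \<gamma>" "y \<in> sa \<gamma>" "k > 0"
  shows "norm (cp_el \<beta> (cc_deriv (cp_transfer k \<beta> \<gamma> y))) \<le> norm (cp_el \<gamma> (cc_deriv y))"
proof -
  note [simp] = aut_star[OF assms(1)] aut_star[OF assms(2)]
  let ?z = "\<lambda>n. \<i> *\<^sub>C cc_deriv y n"
  have d: "cc_deriv y \<in> Cc UNIV" by (intro cc_deriv_Cc sa_Cc[OF assms(3)])
  have z: "?z \<in> Cc UNIV" using d unfolding Cc_UNIV_iff by (rule rev_finite_subset) auto
  have "cc_star \<gamma> ?z = ?z"
  proof
    fix n
    have "cc_star \<gamma> y n = y n" using sa_cc_star[OF assms(2,3)] by simp
    then have "aut_pow \<gamma> n (star (y (- n))) = y n" by (simp add: cc_star_def)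
    then show "cc_star \<gamma> ?z n = ?z n"
      by (simp add: cc_star_def cc_deriv_def star_scaleC scaleC_scaleC aut_simps)
  qed
  then have "star (cp_el \<gamma> ?z) = cp_el \<gamma> ?z" using star_cp_el[OF _ z, of \<gamma>] by simp
  then have "norm (cp_el \<beta> (cp_transfer k \<beta> \<gamma> ?z)) \<le> norm (cp_el \<gamma> ?z)"
    by (intro cp_transfer_contractive z assms(4)) simp_all
  moreover have "cp_transfer k \<beta> \<gamma> ?z = (\<lambda>n. \<i> *\<^sub>C cc_deriv (cp_transfer k \<beta> \<gamma> y) n)"
    using cp_transfer_scaleC[of \<beta> \<gamma> k "\<lambda>n. \<i> * of_int n" y]
    by (simp add: cc_deriv_def scaleC_scaleC)
  ultimately show ?thesis
    using cc_deriv_Cc[OF cp_transfer_Cc_UNIV] by (simp add: cp_el_scaleC d norm_scaleC)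
qed

lemma card_window_le: "real (card (window k n)) \<le> real k"
  by (simp add: card_window)

text \<open>A window has at most k elements, so dividing by k gives a sub-convex combination and the
  bound c survives.\<close>

lemma L_cp_transfer_le:
  assumes "aut \<beta>" "aut \<gamma>" "y n \<in> V" "k > 0" "c \<ge> 0"
    and le: "\<And>m. m \<in> window k n \<Longrightarrow> L (aut_pow \<beta> m (aut_pow \<gamma> (- m) (y n))) \<le> c"
  shows "L (cp_transfer k \<beta> \<gamma> y n) \<le> c"
proof -
  have V: "aut_pow \<beta> m (aut_pow \<gamma> (- m) (y n)) \<in> V" for m by (intro aut_V assms)
  have "L (cp_transfer k \<beta> \<gamma> y n) = (1 / real k) * L (\<Sum>m\<in>window k n. aut_pow \<beta> m (aut_pow \<gamma> (- m) (y n)))"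
    unfolding cp_transfer_def by (subst L_props(4)) (auto intro: V_closed V)
  also have "\<dots> \<le> (1 / real k) * (\<Sum>m\<in>window k n. c)"
    by (intro mult_left_mono order_trans[OF L_props(6)] sum_mono le V) simp_all
  also have "\<dots> = (real (card (window k n)) / real k) * c" by simp
  also have "\<dots> \<le> 1 * c" using assms(4,5) card_window_le[of k n] by (intro mult_right_mono) simp_all
  finally show ?thesis by simp
qed

text \<open>Comparison of two actions that are close on the finitely many coefficients seen by the
  transfer maps. The Lipschitz ball for \<open>\<beta>\<close> is pushed forward as a whole; the one for \<open>\<gamma>\<close> only
  through a finite net, because only pointwise upper bounds are available there.\<close>

lemma dist_q_le:
  assumes \<beta>: "aut \<beta>" and \<gamma>: "aut \<gamma>" and k: "k > 0" and R: "lip_radius R" and e: "e > 0"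
    and \<theta>: "\<theta> > 0" "\<theta> < 1" "\<theta> * R \<le> e / 4"
    and k_e: "sqrt (32 / real k) \<le> e / 8" and \<omega>: "(2 * real k + 1) * (2 * \<omega>) \<le> e / 8"
    and close: "\<And>n m b. \<bar>n\<bar> < int k \<Longrightarrow> 0 \<le> m \<Longrightarrow> m < int k \<Longrightarrow> b \<in> V \<Longrightarrow> L b \<le> 1 / N_unit n \<Longrightarrow>
      norm b \<le> R \<Longrightarrow> norm (aut_pow \<beta> (- m) b - aut_pow \<gamma> (- m) b) \<le> \<omega>"
    and low: "\<And>m b. 0 \<le> m \<Longrightarrow> m < int k \<Longrightarrow> b \<in> V \<Longrightarrow> (1 - \<theta>) * L (aut_pow \<gamma> m b) \<le> L (aut_pow \<beta> m b)"
    and F: "F \<subseteq> lip_ball \<gamma> R" "\<And>\<eta>. \<eta> \<in> lip_ball \<gamma> R \<Longrightarrow> \<exists>f\<in>F. norm (cp_el \<gamma> (\<lambda>n. \<eta> n - f n)) \<le> e / 4"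
    and upp: "\<And>f. f \<in> F \<Longrightarrow> NL (cp_transfer k \<beta> \<gamma> f) \<le> 1 + \<theta>"
  shows "dist_q (cp_cqms \<beta> V L N) (cp_cqms \<gamma> V L N) \<le> ennreal e"
proof -
  note [simp] = aut_star[OF \<beta>] aut_star[OF \<gamma>]
  let ?P = "cp_transfer k \<gamma> \<beta>" and ?Q = "cp_transfer k \<beta> \<gamma>"
  note Cc = Cc_UNIV_add Cc_UNIV_diff Cc_UNIV_scaleR cc_one_Cc_UNIV cp_transfer_Cc_UNIV
  note lin = cp_el_add cp_el_diff cp_el_scaleR cp_el_cc_one Cc cp_transfer_add cp_transfer_scaleR
    cp_transfer_one k
  have R1: "R \<ge> 1" using R by (simp add: lip_radius_def)
  have ballD: "\<eta> \<in> sa \<alpha>" "lipf \<alpha> \<eta> \<le> 1" "norm (cp_el \<alpha> \<eta>) \<le> R" "\<eta> \<in> Cc UNIV" if "\<eta> \<in> lip_ball \<alpha> R" for \<alpha> \<eta>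
    using that sa_Cc(2) by (auto simp: lip_ball_def)
  have P_le: "norm (cp_el \<gamma> (?P \<eta>)) \<le> norm (cp_el \<beta> \<eta>)" if "\<eta> \<in> sa \<beta>" for \<eta>
    using sa_Cc[OF that] sa_star[OF that] by (intro cp_transfer_contractive k) simp_all
  have Q_le: "norm (cp_el \<beta> (?Q \<eta>)) \<le> norm (cp_el \<gamma> \<eta>)" if "\<eta> \<in> sa \<gamma>" for \<eta>
    using sa_Cc[OF that] sa_star[OF that] by (intro cp_transfer_contractive k) simp_all
  have P_sa: "?P \<eta> \<in> sa \<gamma>" if "\<eta> \<in> sa \<beta>" for \<eta> by (intro cp_transfer_sa \<beta> \<gamma> that k)
  have Q_sa: "?Q \<eta> \<in> sa \<beta>" if "\<eta> \<in> sa \<gamma>" for \<eta> by (intro cp_transfer_sa \<beta> \<gamma> that k)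
  have Q_diff: "?Q (\<lambda>n. x n - y n) = (\<lambda>n. ?Q x n - ?Q y n)" for x y
    using cp_transfer_add[of \<beta> \<gamma> k x "\<lambda>n. (- 1) *\<^sub>R y n"] cp_transfer_scaleR[of \<beta> \<gamma> k "- 1" y] by simp
  have roundtrip: "norm (cp_el \<alpha> (\<lambda>n. \<eta> n - cp_transfer k \<alpha> \<delta> (cp_transfer k \<delta> \<alpha> \<eta>) n)) \<le> e / 4"
    if "aut \<alpha>" "aut \<delta>" "\<eta> \<in> lip_ball \<alpha> R"
      and cl: "\<And>n m. \<bar>n\<bar> < int k \<Longrightarrow> 0 \<le> m \<Longrightarrow> m < int k \<Longrightarrow>
        norm (aut_pow \<alpha> (- m) (\<eta> n) - aut_pow \<delta> (- m) (\<eta> n)) \<le> \<omega>" for \<alpha> \<delta> \<eta>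
  proof -
    have "norm (cp_el \<alpha> (\<lambda>n. real_of_int n *\<^sub>R \<eta> n)) \<le> 1"
      using ballD(2)[OF that(3)] by (simp add: lipf_def cc_deriv_fun)
    then have "sqrt (32 / real k) * norm (cp_el \<alpha> (\<lambda>n. real_of_int n *\<^sub>R \<eta> n)) \<le> (e / 8) * 1"
      using e by (intro mult_mono k_e) auto
    then show ?thesis
      using norm_cp_transfer_roundtrip[OF aut_star[OF that(1)] aut_star[OF that(2)] k ballD(4)[OF that(3)] cl] \<omega>
      by simp
  qed
  have round_\<beta>: "norm (cp_el \<beta> (\<lambda>n. \<eta> n - ?Q (?P \<eta>) n)) \<le> e / 4" if "\<eta> \<in> lip_ball \<beta> R" for \<eta>
    using lip_ball_coeff[OF \<beta> that] by (intro roundtrip \<beta> \<gamma> that close)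
  have round_\<gamma>: "norm (cp_el \<gamma> (\<lambda>n. \<eta> n - ?P (?Q \<eta>) n)) \<le> e / 4" if "\<eta> \<in> lip_ball \<gamma> R" for \<eta>
  proof (rule roundtrip[OF \<gamma> \<beta> that])
    fix n m :: int assume "\<bar>n\<bar> < int k" "0 \<le> m" "m < int k"
    then have "norm (aut_pow \<beta> (- m) (\<eta> n) - aut_pow \<gamma> (- m) (\<eta> n)) \<le> \<omega>"
      using lip_ball_coeff[OF \<gamma> that] by (intro close)
    then show "norm (aut_pow \<gamma> (- m) (\<eta> n) - aut_pow \<beta> (- m) (\<eta> n)) \<le> \<omega>" by (simp add: norm_minus_commute)
  qed
  have lipf_affine: "lipf \<alpha> (\<lambda>n. c *\<^sub>R \<eta> n + r *\<^sub>R cc_one n) \<le> c * lipf \<alpha> \<eta>"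
    if "aut \<alpha>" "\<eta> \<in> sa \<alpha>" "c \<ge> 0" for \<alpha> \<eta> c r
    using lipf_seminorm(2)[OF that(1) sa_scaleR[OF that(1,2)] sa_scaleR[OF that(1) sa_cc_one[OF that(1)]], of c r]
      lipf_seminorm(3)[OF that(1,2), of c] lipf_seminorm(3)[OF that(1) sa_cc_one[OF that(1)], of r]
      lipf_seminorm(4)[OF that(1)] that(3) by simp
  have sa_affine: "(\<lambda>n. c *\<^sub>R \<eta> n + r *\<^sub>R cc_one n) \<in> sa \<alpha>" if "aut \<alpha>" "\<eta> \<in> sa \<alpha>" for \<alpha> \<eta> c r
    using that by (intro sa_add sa_scaleR sa_cc_one)
  have small: "norm (c *\<^sub>R a) \<le> e / 4" if "norm a \<le> R" "0 \<le> c" "c \<le> \<theta>" for c and a :: "'b adj"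
  proof -
    have "norm (c *\<^sub>R a) = c * norm a" using that by simp
    also have "\<dots> \<le> \<theta> * R" using that \<theta> R1 by (intro mult_mono) auto
    finally show ?thesis using \<theta>(3) by linarith
  qed
  have lift_\<beta>: "\<exists>\<zeta>\<in>sa \<gamma>. lipf \<gamma> \<zeta> \<le> 1 \<and> norm (cp_el \<beta> \<eta> - cp_el \<beta> (?Q \<zeta>)) \<le> e \<and> norm (cp_el \<gamma> \<zeta> - cp_el \<gamma> (?P \<eta>)) \<le> e"
    if \<eta>: "\<eta> \<in> sa \<beta>" "lipf \<beta> \<eta> \<le> 1" for \<eta>
  proof -
    obtain r where "(\<lambda>n. \<eta> n - r *\<^sub>R cc_one n) \<in> lip_ball \<beta> R" using lip_ball_shift[OF R \<beta> \<eta>] .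
    then obtain x where x: "x \<in> lip_ball \<beta> R" "\<eta> = (\<lambda>n. x n + r *\<^sub>R cc_one n)"
      by (intro that[of "\<lambda>n. \<eta> n - r *\<^sub>R cc_one n"]) auto
    note xB = ballD[OF x(1)]
    let ?y = "?P x"
    \<comment> \<open>The factor 1 - \<theta> absorbs the loss 1/(1 - \<theta>) in the Lipschitz
      constant; the scalar r is put back unscaled, because scalars have Lipschitz constant
      0.\<close>
    let ?\<zeta> = "\<lambda>n. (1 - \<theta>) *\<^sub>R ?y n + r *\<^sub>R cc_one n"
    have y_sa: "?y \<in> sa \<gamma>" by (rule P_sa[OF xB(1)])
    \<comment> \<open>The lower estimate, applied to \<open>aut_pow \<beta> (- m) (x n)\<close>,
      turns into an upper estimate for the terms of the transfer, with a factor that is the same for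
      all elements.\<close>
    have "NL ?y \<le> N (\<lambda>n. complex_of_real (1 / (1 - \<theta>) * L (x n)))"
    proof (rule NL_mono[OF sa_Cc(1)[OF y_sa]])
      show "(\<lambda>n. 1 / (1 - \<theta>) * L (x n)) \<in> Cc UNIV"
        using L_Cc[OF sa_Cc(1)[OF xB(1)]] unfolding Cc_UNIV_iff Cc_def by (auto intro: rev_finite_subset)
      fix n
      have xV: "x n \<in> V" by (rule Cc_V(1)[OF sa_Cc(1)[OF xB(1)]])
      show "L (?y n) \<le> 1 / (1 - \<theta>) * L (x n)"
      proof (rule L_cp_transfer_le[of \<gamma> \<beta> x n, OF \<gamma> \<beta> xV k])
        show "0 \<le> 1 / (1 - \<theta>) * L (x n)" using \<theta> L_props(1)[OF xV] by simp
        fix m assume "m \<in> window k n"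
        then have "(1 - \<theta>) * L (aut_pow \<gamma> m (aut_pow \<beta> (- m) (x n))) \<le> L (aut_pow \<beta> m (aut_pow \<beta> (- m) (x n)))"
          using aut_V[OF \<beta> xV] by (intro low) (auto simp: window_def)
        then show "L (aut_pow \<gamma> m (aut_pow \<beta> (- m) (x n))) \<le> 1 / (1 - \<theta>) * L (x n)"
          using \<theta> by (simp add: star_automorphism_bij field_simps)
      qed
    qed
    also have "\<dots> = cmod (complex_of_real (1 / (1 - \<theta>))) * NL x"
      unfolding NL_def of_real_mult by (rule N_props(3)[OF of_real_Cc[OF L_Cc[OF sa_Cc(1)[OF xB(1)]]]])
    also have "\<dots> = 1 / (1 - \<theta>) * NL x" unfolding norm_of_real using \<theta> by simp
    finally have "(1 - \<theta>) * NL ?y \<le> NL x" using \<theta> by (simp add: field_simps)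
    also have "NL x \<le> 1" using xB(2) by (simp add: lipf_def)
    finally have 1: "(1 - \<theta>) * NL ?y \<le> 1" .
    have "norm (cp_el \<gamma> (cc_deriv ?y)) \<le> 1"
      using norm_cp_transfer_deriv[OF \<gamma> \<beta> xB(1) k] xB(2) by (simp add: lipf_def)
    then have 2: "(1 - \<theta>) * norm (cp_el \<gamma> (cc_deriv ?y)) \<le> 1" using \<theta> by (intro mult_le_one) auto
    have "lipf \<gamma> ?\<zeta> \<le> (1 - \<theta>) * lipf \<gamma> ?y" using \<theta> by (intro lipf_affine \<gamma> y_sa) simp
    also have "\<dots> \<le> 1" using 1 2 by (simp add: lipf_def max_def)
    finally have lip: "lipf \<gamma> ?\<zeta> \<le> 1" .
    have yR: "norm (cp_el \<gamma> ?y) \<le> R" using P_le[OF xB(1)] xB(3) by linarith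
    have QyR: "norm (cp_el \<beta> (?Q ?y)) \<le> R" using Q_le[OF y_sa] yR by linarith
    have "cp_el \<beta> \<eta> - cp_el \<beta> (?Q ?\<zeta>) = (cp_el \<beta> x - cp_el \<beta> (?Q ?y)) + \<theta> *\<^sub>R cp_el \<beta> (?Q ?y)"
      by (simp add: x(2) lin xB(4); simp add: algebra_simps)
    moreover have "norm (cp_el \<beta> x - cp_el \<beta> (?Q ?y)) \<le> e / 4"
      using round_\<beta>[OF x(1)] by (simp add: cp_el_diff xB(4) Cc)
    moreover have "norm (\<theta> *\<^sub>R cp_el \<beta> (?Q ?y)) \<le> e / 4"
      by (rule small[OF QyR]) (use \<theta> in auto)
    ultimately have A: "norm (cp_el \<beta> \<eta> - cp_el \<beta> (?Q ?\<zeta>)) \<le> e"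
      using norm_triangle_ineq[of "cp_el \<beta> x - cp_el \<beta> (?Q ?y)" "\<theta> *\<^sub>R cp_el \<beta> (?Q ?y)"] e by simp
    have "cp_el \<gamma> ?\<zeta> - cp_el \<gamma> (?P \<eta>) = - (\<theta> *\<^sub>R cp_el \<gamma> ?y)"
      by (simp add: x(2) lin xB(4); simp add: algebra_simps)
    then have B: "norm (cp_el \<gamma> ?\<zeta> - cp_el \<gamma> (?P \<eta>)) \<le> e"
      using small[OF yR, of \<theta>] \<theta> e by simp
    show ?thesis using lip A B sa_affine[OF \<gamma> y_sa] by blast
  qed
  have lift_\<gamma>: "\<exists>\<eta>\<in>sa \<beta>. lipf \<beta> \<eta> \<le> 1 \<and> norm (cp_el \<beta> \<eta> - cp_el \<beta> (?Q \<zeta>)) \<le> e \<and> norm (cp_el \<gamma> \<zeta> - cp_el \<gamma> (?P \<eta>)) \<le> e"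
    if \<zeta>: "\<zeta> \<in> sa \<gamma>" "lipf \<gamma> \<zeta> \<le> 1" for \<zeta>
  proof -
    obtain r where "(\<lambda>n. \<zeta> n - r *\<^sub>R cc_one n) \<in> lip_ball \<gamma> R" using lip_ball_shift[OF R \<gamma> \<zeta>] .
    then obtain z where z: "z \<in> lip_ball \<gamma> R" "\<zeta> = (\<lambda>n. z n + r *\<^sub>R cc_one n)"
      by (intro that[of "\<lambda>n. \<zeta> n - r *\<^sub>R cc_one n"]) auto
    note zB = ballD[OF z(1)]
    \<comment> \<open>The upper estimate is available on F only, so z is replaced by a net element
      before it is transferred.\<close>
    obtain f where f: "f \<in> F" "norm (cp_el \<gamma> (\<lambda>n. z n - f n)) \<le> e / 4" using F(2)[OF z(1)] by blast
    have fB': "f \<in> lip_ball \<gamma> R" using f(1) F(1) by blast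
    note fB = ballD[OF fB']
    \<comment> \<open>The factor 1/(1 + \<theta>) brings the Lipschitz constant, at most 1 +
      \<theta> by the upper estimate, back to 1; it differs from 1 by at most
      \<open>\<theta>\<close>, which costs e / 4 on the ball of radius R.\<close>
    let ?x = "?Q f" and ?s = "1 / (1 + \<theta>)"
    let ?\<eta> = "\<lambda>n. ?s *\<^sub>R ?x n + r *\<^sub>R cc_one n"
    have s: "0 \<le> ?s" "1 - ?s \<le> \<theta>" "0 \<le> 1 - ?s" using \<theta> by (simp_all add: field_simps)
    have x_sa: "?x \<in> sa \<beta>" by (rule Q_sa[OF fB(1)])
    have "norm (cp_el \<beta> (cc_deriv ?x)) \<le> 1"
      using norm_cp_transfer_deriv[OF \<beta> \<gamma> fB(1) k] fB(2) by (simp add: lipf_def)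
    then have "lipf \<beta> ?x \<le> 1 + \<theta>" using upp[OF f(1)] \<theta> by (simp add: lipf_def)
    then have "?s * lipf \<beta> ?x \<le> 1" using \<theta> by (simp add: field_simps)
    then have lip: "lipf \<beta> ?\<eta> \<le> 1" using lipf_affine[OF \<beta> x_sa s(1), of r] by linarith
    have xR: "norm (cp_el \<beta> ?x) \<le> R" using Q_le[OF fB(1)] fB(3) by linarith
    have PxR: "norm (cp_el \<gamma> (?P ?x)) \<le> R" using P_le[OF x_sa] xR by linarith
    have zf: "(\<lambda>n. z n - f n) \<in> sa \<gamma>" by (rule sa_diff[OF \<gamma> zB(1) fB(1)])
    have "cp_el \<beta> ?\<eta> - cp_el \<beta> (?Q \<zeta>) = - ((1 - ?s) *\<^sub>R cp_el \<beta> ?x) - cp_el \<beta> (?Q (\<lambda>n. z n - f n))"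
      unfolding Q_diff by (simp add: z(2) lin; simp add: algebra_simps)
    moreover have "norm (cp_el \<beta> (?Q (\<lambda>n. z n - f n))) \<le> e / 4" using Q_le[OF zf] f(2) by linarith
    ultimately have A: "norm (cp_el \<beta> ?\<eta> - cp_el \<beta> (?Q \<zeta>)) \<le> e"
      using norm_triangle_ineq4[of "- ((1 - ?s) *\<^sub>R cp_el \<beta> ?x)" "cp_el \<beta> (?Q (\<lambda>n. z n - f n))"] small[OF xR s(3,2)] e
      by (simp only: norm_minus_cancel)
    have "cp_el \<gamma> \<zeta> - cp_el \<gamma> (?P ?\<eta>) = cp_el \<gamma> (\<lambda>n. z n - f n) + cp_el \<gamma> (\<lambda>n. f n - ?P ?x n) + (1 - ?s) *\<^sub>R cp_el \<gamma> (?P ?x)"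
      by (simp add: z(2) lin zB(4) fB(4); simp add: algebra_simps)
    then have "norm (cp_el \<gamma> \<zeta> - cp_el \<gamma> (?P ?\<eta>)) \<le> norm (cp_el \<gamma> (\<lambda>n. z n - f n)) + norm (cp_el \<gamma> (\<lambda>n. f n - ?P ?x n))
        + norm ((1 - ?s) *\<^sub>R cp_el \<gamma> (?P ?x))"
      by (simp only:) (intro norm_triangle_mono norm_triangle_ineq order_refl)
    then have B: "norm (cp_el \<gamma> \<zeta> - cp_el \<gamma> (?P ?\<eta>)) \<le> e" using f(2) round_\<gamma>[OF fB'] small[OF PxR s(3,2)] e by linarith
    show ?thesis using lip A B sa_affine[OF \<beta> x_sa] by blast
  qed
  have norm_eq: "cp_norm (op_of a - op_of b) = norm (a - b)" for a b :: "'b adj"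
    by (simp add: cp_norm_def l2_op_norm_op_of flip: op_of_simps)
  interpret ou_bridge "cp_ou \<beta>" "cp_ou \<gamma>" cp_norm "cp_lip \<beta>" cp_norm "cp_lip \<gamma>" "cp_map k \<gamma> \<beta>" "cp_map k \<beta> \<gamma>" e
  proof
    show "ou_norm (cp_ou \<beta>) cp_norm" "ou_norm (cp_ou \<gamma>) cp_norm" by (intro ou_norm_cp_ou \<beta> \<gamma>)+
    show "rseminorm_on (ou_set (cp_ou \<beta>)) (cp_lip \<beta>)" "cp_lip \<beta> (ou_unit (cp_ou \<beta>)) = 0"
      "rseminorm_on (ou_set (cp_ou \<gamma>)) (cp_lip \<gamma>)" "cp_lip \<gamma> (ou_unit (cp_ou \<gamma>)) = 0"
      by (intro cp_lip_seminorm \<beta> \<gamma>)+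
    show "ou_hom (cp_ou \<beta>) (cp_ou \<gamma>) (cp_map k \<gamma> \<beta>)" "ou_hom (cp_ou \<gamma>) (cp_ou \<beta>) (cp_map k \<beta> \<gamma>)"
      by (intro ou_hom_cp_map \<beta> \<gamma> k)+
    show "cp_norm (cp_map k \<beta> \<gamma> y) \<le> cp_norm y" if "y \<in> ou_set (cp_ou \<gamma>)" for y
      using that Q_le unfolding cp_ou_set[OF \<gamma>] by (auto simp: cp_map_eq[OF \<gamma>] cp_norm_def l2_op_norm_op_of)
    show "\<exists>y\<in>ou_set (cp_ou \<gamma>). cp_lip \<gamma> y \<le> 1 \<and> cp_norm (x - cp_map k \<beta> \<gamma> y) \<le> e \<and> cp_norm (y - cp_map k \<gamma> \<beta> x) \<le> e"
      if x: "x \<in> ou_set (cp_ou \<beta>)" "cp_lip \<beta> x \<le> 1" for x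
    proof -
      obtain \<eta> where \<eta>: "\<eta> \<in> sa \<beta>" "x = op_of (cp_el \<beta> \<eta>)" using x(1) unfolding cp_ou_set[OF \<beta>] by blast
      then obtain \<zeta> where "\<zeta> \<in> sa \<gamma>" "lipf \<gamma> \<zeta> \<le> 1" "norm (cp_el \<beta> \<eta> - cp_el \<beta> (?Q \<zeta>)) \<le> e" "norm (cp_el \<gamma> \<zeta> - cp_el \<gamma> (?P \<eta>)) \<le> e"
        using lift_\<beta>[of \<eta>] x(2) cp_lip_eq[OF \<beta>] by auto
      then show ?thesis unfolding cp_ou_set[OF \<gamma>] using \<eta>
        by (intro bexI[OF _ imageI[of \<zeta>]]) (simp_all add: cp_lip_eq[OF \<gamma>] cp_map_eq[OF \<gamma>] cp_map_eq[OF \<beta>] norm_eq)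
    qed
    show "\<exists>x\<in>ou_set (cp_ou \<beta>). cp_lip \<beta> x \<le> 1 \<and> cp_norm (x - cp_map k \<beta> \<gamma> y) \<le> e \<and> cp_norm (y - cp_map k \<gamma> \<beta> x) \<le> e"
      if y: "y \<in> ou_set (cp_ou \<gamma>)" "cp_lip \<gamma> y \<le> 1" for y
    proof -
      obtain \<zeta> where \<zeta>: "\<zeta> \<in> sa \<gamma>" "y = op_of (cp_el \<gamma> \<zeta>)" using y(1) unfolding cp_ou_set[OF \<gamma>] by blast
      then obtain \<eta> where "\<eta> \<in> sa \<beta>" "lipf \<beta> \<eta> \<le> 1" "norm (cp_el \<beta> \<eta> - cp_el \<beta> (?Q \<zeta>)) \<le> e" "norm (cp_el \<gamma> \<zeta> - cp_el \<gamma> (?P \<eta>)) \<le> e"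
        using lift_\<gamma>[of \<zeta>] y(2) cp_lip_eq[OF \<gamma>] by auto
      then show ?thesis unfolding cp_ou_set[OF \<beta>] using \<zeta>
        by (intro bexI[OF _ imageI[of \<eta>]]) (simp_all add: cp_lip_eq[OF \<beta>] cp_map_eq[OF \<gamma>] cp_map_eq[OF \<beta>] norm_eq)
    qed
  qed (use cp_ou_totally_bounded \<beta> \<gamma> e in auto)
  show ?thesis unfolding dist_q_eq by (rule ou_dist_q_le)
qed

end

context lip_space
begin

section \<open>Convergence of actions along a filter\<close>

text \<open>The price, in the norm on sequences, of an error that is constant on |n| \<le>
  k.\<close>

definition N_box :: "nat \<Rightarrow> real" where
  "N_box k = N (\<lambda>n. complex_of_real (if \<bar>n\<bar> \<le> int k then 1 else 0))"

lemma box_Cc: "(\<lambda>n::int. (if \<bar>n\<bar> \<le> int k then 1 else 0) :: real) \<in> Cc UNIV"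
proof -
  have "{n::int. (if \<bar>n\<bar> \<le> int k then 1 else 0 :: real) \<noteq> 0} \<subseteq> {- int k..int k}" by auto
  then show ?thesis by (simp add: Cc_def finite_subset)
qed

lemma N_box_nonneg: "0 \<le> N_box k"
  unfolding N_box_def by (intro N_props of_real_Cc box_Cc)

text \<open>The error c is additive, since upper semi-continuity only yields values below some a > L
  and L may vanish. Order preservation and the triangle inequality turn it into c times
  \<open>N_box k\<close>; outside the box the transfer is zero.\<close>

lemma NL_cp_transfer_le:
  assumes "aut \<beta>" "aut \<gamma>" "f \<in> lip_ball \<gamma> R" "k > 0" "c \<ge> 0"
    and le: "\<And>n m. n \<in> {- int k..int k} \<Longrightarrow> m \<in> {0..<int k} \<Longrightarrow>
      L (aut_pow \<beta> m (aut_pow \<gamma> (- m) (f n))) \<le> L (f n) + c"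
  shows "NL (cp_transfer k \<beta> \<gamma> f) \<le> 1 + c * N_box k"
proof -
  have f: "f \<in> sa \<gamma>" "lipf \<gamma> f \<le> 1" using assms(3) by (auto simp: lip_ball_def)
  let ?b = "\<lambda>n. (if \<bar>n\<bar> \<le> int k then 1 else 0) :: real"
  have cb: "(\<lambda>n. c * ?b n) \<in> Cc UNIV" using box_Cc[of k] unfolding Cc_def by (auto intro: rev_finite_subset)
  have Lf: "(\<lambda>n. L (f n)) \<in> Cc UNIV" by (rule L_Cc[OF sa_Cc(1)[OF f(1)]])
  have "(\<lambda>n. L (f n) + c * ?b n) \<in> Cc UNIV"
    using Lf cb unfolding Cc_UNIV_iff Cc_def
    by (auto intro: finite_subset[of _ "{n. L (f n) \<noteq> 0} \<union> {n. c * ?b n \<noteq> 0}"])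
  then have "NL (cp_transfer k \<beta> \<gamma> f) \<le> N (\<lambda>n. complex_of_real (L (f n) + c * ?b n))"
  proof (rule NL_mono[OF sa_Cc(1)[OF cp_transfer_sa[OF assms(1,2) f(1) assms(4)]]])
    fix n
    have fV: "f n \<in> V" by (rule Cc_V(1)[OF sa_Cc(1)[OF f(1)]])
    show "L (cp_transfer k \<beta> \<gamma> f n) \<le> L (f n) + c * ?b n"
    proof (cases "\<bar>n\<bar> \<le> int k")
      case True
      have "L (cp_transfer k \<beta> \<gamma> f n) \<le> L (f n) + c"
        using True assms(5) L_props(1)[OF fV]
        by (intro L_cp_transfer_le[of \<beta> \<gamma> f n, OF assms(1,2) fV assms(4)] le) (auto simp: window_def)
      then show ?thesis using True by simp
    next
      case False
      then have "cp_transfer k \<beta> \<gamma> f n = 0" using window_empty[of k n] by (simp add: cp_transfer_def)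
      then show ?thesis using False L_props(1)[OF fV] by (simp add: L_props(5))
    qed
  qed
  also have "\<dots> \<le> NL f + N (\<lambda>n. complex_of_real c * complex_of_real (?b n))"
    unfolding NL_def of_real_add using N_props(4)[OF of_real_Cc[OF Lf] of_real_Cc[OF cb]] by simp
  also have "N (\<lambda>n. complex_of_real c * complex_of_real (?b n)) = cmod (complex_of_real c) * N_box k"
    unfolding N_box_def by (rule N_props(3)[OF of_real_Cc[OF box_Cc]])
  finally show ?thesis using f(2) assms(5) by (simp add: lipf_def)
qed

text \<open>In the induction step the first summand of \<beta>(\<beta>^m b - \<gamma>^m b) +
  (\<beta> - \<gamma>)(\<gamma>^m b) is controlled because automorphisms are isometric, the second
  by pointwise convergence.\<close>

lemma tendsto_aut_pow:
  assumes \<beta>: "\<And>t. star_automorphism (\<beta> t)" and cont: "\<And>b. ((\<lambda>t. \<beta> t b) \<longlongrightarrow> \<gamma> b) G"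
  shows "((\<lambda>t. aut_pow (\<beta> t) (int m) b) \<longlongrightarrow> aut_pow \<gamma> (int m) b) G"
proof (induction m)
  case (Suc m)
  let ?c = "aut_pow \<gamma> (int m) b"
  have "((\<lambda>t. norm (aut_pow (\<beta> t) (int m) b - ?c) + norm (\<beta> t ?c - \<gamma> ?c)) \<longlongrightarrow> 0 + 0) G"
    using Suc cont[of ?c] by (intro tendsto_add tendsto_norm_zero) (simp_all add: LIM_zero_iff)
  moreover have "norm (aut_pow (\<beta> t) (int (Suc m)) b - aut_pow \<gamma> (int (Suc m)) b)
      \<le> norm (aut_pow (\<beta> t) (int m) b - ?c) + norm (\<beta> t ?c - \<gamma> ?c)" for t
  proof -
    have "aut_pow (\<beta> t) (int (Suc m)) b = \<beta> t (aut_pow (\<beta> t) (int m) b)" "aut_pow \<gamma> (int (Suc m)) b = \<gamma> ?c"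
      by (simp_all add: aut_pow_def nat_add_distrib)
    moreover have "norm (\<beta> t (aut_pow (\<beta> t) (int m) b) - \<beta> t ?c) = norm (aut_pow (\<beta> t) (int m) b - ?c)"
      by (simp add: star_automorphism_norm[OF \<beta>] flip: star_automorphism_diff[OF \<beta>])
    ultimately show ?thesis
      using norm_triangle_ineq[of "\<beta> t (aut_pow (\<beta> t) (int m) b) - \<beta> t ?c" "\<beta> t ?c - \<gamma> ?c"] by simp
  qed
  ultimately have "((\<lambda>t. aut_pow (\<beta> t) (int (Suc m)) b - aut_pow \<gamma> (int (Suc m)) b) \<longlongrightarrow> 0) G"
    by - (rule Lim_null_comparison[OF always_eventually[OF allI]], assumption, simp only: add_0_left)
  then show ?case by (simp add: LIM_zero_iff)
qed simp

text \<open>Applying the isometry \<beta>^m turns the difference of inverse powers at b into a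
  difference of positive powers at \<gamma>^-m b.\<close>

lemma tendsto_aut_pow_minus:
  assumes \<beta>: "\<And>t. star_automorphism (\<beta> t)" and \<gamma>: "star_automorphism \<gamma>" and cont: "\<And>b. ((\<lambda>t. \<beta> t b) \<longlongrightarrow> \<gamma> b) G"
  shows "((\<lambda>t. aut_pow (\<beta> t) (- int m) b) \<longlongrightarrow> aut_pow \<gamma> (- int m) b) G"
proof -
  let ?c = "aut_pow \<gamma> (- int m) b"
  have "((\<lambda>t. norm (aut_pow (\<beta> t) (int m) ?c - aut_pow \<gamma> (int m) ?c)) \<longlongrightarrow> 0) G"
    using tendsto_aut_pow[OF \<beta> cont, of m ?c] by (intro tendsto_norm_zero) (simp add: LIM_zero_iff)
  moreover have "norm (aut_pow (\<beta> t) (int m) ?c - aut_pow \<gamma> (int m) ?c) = norm (aut_pow (\<beta> t) (- int m) b - ?c)" for t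
  proof -
    have "norm (aut_pow (\<beta> t) (- int m) b - ?c) = norm (aut_pow (\<beta> t) (int m) (aut_pow (\<beta> t) (- int m) b - ?c))"
      by (simp add: aut_simps(9)[OF \<beta>])
    also have "\<dots> = norm (b - aut_pow (\<beta> t) (int m) ?c)"
      by (simp add: aut_simps(8)[OF \<beta>] star_automorphism_bij[OF \<beta>])
    finally show ?thesis by (simp add: star_automorphism_bij[OF \<gamma>] norm_minus_commute)
  qed
  ultimately have "((\<lambda>t. norm (aut_pow (\<beta> t) (- int m) b - ?c)) \<longlongrightarrow> 0) G" by simp
  then show ?thesis by (simp add: tendsto_norm_zero_iff LIM_zero_iff)
qed

text \<open>Pointwise convergence of isometries is uniform on totally bounded sets: a third of the
  error for the net and one for each of the two isometries.\<close>

lemma eventually_close_on_ball: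
  assumes \<beta>: "\<And>t. star_automorphism (\<beta> t)" and \<gamma>: "star_automorphism \<gamma>" and cont: "\<And>b. ((\<lambda>t. \<beta> t b) \<longlongrightarrow> \<gamma> b) G"
    and "\<omega> > 0" "K > 0"
  shows "\<forall>\<^sub>F t in G. \<forall>b\<in>{b\<in>V. L b \<le> K \<and> norm b \<le> R}. norm (aut_pow (\<beta> t) (- int m) b - aut_pow \<gamma> (- int m) b) \<le> \<omega>"
proof -
  have "\<omega> / 3 > 0" using assms(4) by simp
  from cstar_cqms_totally_bounded[OF cqms this assms(5), of R]
  obtain C where C: "finite C" "\<forall>b\<in>{b\<in>V. L b \<le> K \<and> norm b \<le> R}. \<exists>c\<in>C. norm (b - c) < \<omega> / 3"
    by (elim exE conjE)
  have "\<forall>\<^sub>F t in G. \<forall>c\<in>C. norm (aut_pow (\<beta> t) (- int m) c - aut_pow \<gamma> (- int m) c) < \<omega> / 3"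
    using tendstoD[OF tendsto_aut_pow_minus[OF \<beta> \<gamma> cont] \<open>\<omega> / 3 > 0\<close>]
    by (intro eventually_ball_finite C(1)) (simp add: dist_norm)
  then show ?thesis
  proof (rule eventually_mono, intro ballI)
    fix t b assume t: "\<forall>c\<in>C. norm (aut_pow (\<beta> t) (- int m) c - aut_pow \<gamma> (- int m) c) < \<omega> / 3"
      and b: "b \<in> {b\<in>V. L b \<le> K \<and> norm b \<le> R}"
    obtain c where c: "c \<in> C" "norm (b - c) < \<omega> / 3" using bspec[OF C(2) b] by blast
    let ?S = "aut_pow (\<beta> t) (- int m)" and ?T = "aut_pow \<gamma> (- int m)"
    have "?S b - ?T b = ?S (b - c) + (?S c - ?T c) - ?T (b - c)"
      by (simp add: aut_simps(8)[OF \<beta>] aut_simps(8)[OF \<gamma>])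
    then have "norm (?S b - ?T b) \<le> norm (?S (b - c)) + norm (?S c - ?T c) + norm (?T (b - c))"
      using norm_triangle_ineq4[of "?S (b - c) + (?S c - ?T c)" "?T (b - c)"]
        norm_triangle_ineq[of "?S (b - c)" "?S c - ?T c"] by simp
    then show "norm (?S b - ?T b) \<le> \<omega>"
      using c t by (force simp: aut_simps(9)[OF \<beta>] aut_simps(9)[OF \<gamma>])
  qed
qed

text \<open>All constants and the net are fixed from \<gamma>, e and the given data; the parameter
  is then restricted by a finite intersection of eventual properties.\<close>

lemma eventually_dist_q_le:
  assumes \<beta>: "\<And>t. aut (\<beta> t)" and \<gamma>: "aut \<gamma>" and cont: "\<And>b. ((\<lambda>t. \<beta> t b) \<longlongrightarrow> \<gamma> b) G"
    and upper: "\<And>n b a. b \<in> V \<Longrightarrow> L (aut_pow \<gamma> n b) < a \<Longrightarrow> \<forall>\<^sub>F t in G. L (aut_pow (\<beta> t) n b) < a"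
    and lower: "\<And>n \<theta>. \<theta> > 0 \<Longrightarrow> \<forall>\<^sub>F t in G. \<forall>b\<in>V. (1 - \<theta>) * L (aut_pow \<gamma> n b) \<le> L (aut_pow (\<beta> t) n b)"
    and e: "e > 0"
  shows "\<forall>\<^sub>F t in G. dist_q (cp_cqms (\<beta> t) V L N) (cp_cqms \<gamma> V L N) \<le> ennreal e"
proof -
  note aut_\<beta> = aut_star[OF \<beta>] and aut_\<gamma> = aut_star[OF \<gamma>]
  obtain R where R: "lip_radius R" using ex_lip_radius .
  then have R1: "R \<ge> 1" by (simp add: lip_radius_def)
  \<comment> \<open>The second bound makes the loss on a ball of radius R at most e / 4, the first
    keeps the factor 1 - \<theta> positive.\<close>
  define \<theta> where "\<theta> = min (1 / 2) (e / (4 * R))"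
  have \<theta>: "\<theta> > 0" "\<theta> < 1" using e R1 by (auto simp: \<theta>_def)
  have "\<theta> * R \<le> e / (4 * R) * R" using R1 by (intro mult_right_mono) (auto simp: \<theta>_def)
  then have \<theta>R: "\<theta> * R \<le> e / 4" using R1 by simp
  obtain k :: nat where k: "k > 0" "sqrt (32 / real k) \<le> e / 8" using ex_sqrt_inverse_le[of "e / 8"] e by auto
  \<comment> \<open>The mismatch 2 \<omega>, summed over 2 k + 1 coefficients, becomes e /
    8.\<close>
  define \<omega> where "\<omega> = e / (16 * (2 * real k + 1))"
  have \<omega>: "\<omega> > 0" using e by (simp add: \<omega>_def add_nonneg_pos)
  have "q * (2 * (e / (16 * q))) = e / 8" if "q > 0" for q using that by simp
  from this[of "2 * real k + 1"] have \<omega>e: "(2 * real k + 1) * (2 * \<omega>) \<le> e / 8"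
    unfolding \<omega>_def by (simp only: add_nonneg_pos order_refl of_nat_0_le_iff mult_nonneg_nonneg zero_le_numeral zero_less_one)
  obtain F where F: "finite F" "F \<subseteq> lip_ball \<gamma> R"
    "\<forall>\<eta>\<in>lip_ball \<gamma> R. \<exists>f\<in>F. norm (cp_el \<gamma> (\<lambda>n. \<eta> n - f n)) \<le> e / 4"
    using lip_ball_net[OF \<gamma>, of "e / 4" R] e by auto
  \<comment> \<open>Chosen so that the additive error costs at most \<open>\<theta>\<close>; the 1
    in the denominator keeps it positive.\<close>
  define c where "c = \<theta> / (N_box k + 1)"
  have c: "c > 0" using \<theta> N_box_nonneg[of k] by (simp add: c_def)
  have "c * N_box k \<le> c * (N_box k + 1)" using c by (intro mult_left_mono) auto
  also have "\<dots> = \<theta>" using N_box_nonneg[of k] by (simp add: c_def)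
  finally have c\<theta>: "c * N_box k \<le> \<theta>" .
  let ?M = "{0..<int k}" and ?I = "{- int k..int k}"
  have ev1: "\<forall>\<^sub>F t in G. \<forall>m\<in>?M. \<forall>n\<in>?I. \<forall>b\<in>{b\<in>V. L b \<le> 1 / N_unit n \<and> norm b \<le> R}.
      norm (aut_pow (\<beta> t) (- m) b - aut_pow \<gamma> (- m) b) \<le> \<omega>"
  proof (rule eventually_ball_finite[OF finite_atLeastLessThan_int], rule ballI,
      rule eventually_ball_finite[OF finite_atLeastAtMost_int], rule ballI)
    fix m n assume "m \<in> ?M"
    then show "\<forall>\<^sub>F t in G. \<forall>b\<in>{b\<in>V. L b \<le> 1 / N_unit n \<and> norm b \<le> R}.
        norm (aut_pow (\<beta> t) (- m) b - aut_pow \<gamma> (- m) b) \<le> \<omega>"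
      using eventually_close_on_ball[OF aut_\<beta> aut_\<gamma> cont \<omega>, of "1 / N_unit n" R "nat m"] N_unit_pos[of n] by simp
  qed
  have ev2: "\<forall>\<^sub>F t in G. \<forall>m\<in>?M. \<forall>b\<in>V. (1 - \<theta>) * L (aut_pow \<gamma> m b) \<le> L (aut_pow (\<beta> t) m b)"
    by (rule eventually_ball_finite[OF finite_atLeastLessThan_int]) (use lower \<theta> in blast)
  \<comment> \<open>For each of finitely many triples the vector
    \<open>aut_pow \<gamma> (- m) (f n)\<close> is fixed, and its image under the m-th power of
    \<gamma> is \<open>f n\<close>, so the pointwise upper estimate applies.\<close>
  have ev3: "\<forall>\<^sub>F t in G. \<forall>f\<in>F. \<forall>n\<in>?I. \<forall>m\<in>?M. L (aut_pow (\<beta> t) m (aut_pow \<gamma> (- m) (f n))) < L (f n) + c"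
  proof (rule eventually_ball_finite[OF F(1)], rule ballI, rule eventually_ball_finite[OF finite_atLeastAtMost_int],
      rule ballI, rule eventually_ball_finite[OF finite_atLeastLessThan_int], rule ballI)
    fix f n m assume "f \<in> F"
    then have "f n \<in> V" using F(2) lip_ball_coeff(1)[OF \<gamma>] by blast
    then show "\<forall>\<^sub>F t in G. L (aut_pow (\<beta> t) m (aut_pow \<gamma> (- m) (f n))) < L (f n) + c"
      using c aut_V[OF \<gamma>] star_automorphism_bij[OF aut_\<gamma>] by (intro upper) auto
  qed
  show ?thesis
    using eventually_conj[OF ev1 eventually_conj[OF ev2 ev3]]
  proof (rule eventually_mono, elim conjE)
    fix t
    assume 1: "\<forall>m\<in>?M. \<forall>n\<in>?I. \<forall>b\<in>{b\<in>V. L b \<le> 1 / N_unit n \<and> norm b \<le> R}.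
        norm (aut_pow (\<beta> t) (- m) b - aut_pow \<gamma> (- m) b) \<le> \<omega>"
      and 2: "\<forall>m\<in>?M. \<forall>b\<in>V. (1 - \<theta>) * L (aut_pow \<gamma> m b) \<le> L (aut_pow (\<beta> t) m b)"
      and 3: "\<forall>f\<in>F. \<forall>n\<in>?I. \<forall>m\<in>?M. L (aut_pow (\<beta> t) m (aut_pow \<gamma> (- m) (f n))) < L (f n) + c"
    show "dist_q (cp_cqms (\<beta> t) V L N) (cp_cqms \<gamma> V L N) \<le> ennreal e"
    proof (rule dist_q_le[OF \<beta> \<gamma> k(1) R e \<theta> \<theta>R k(2) \<omega>e _ _ F(2)])
      show "norm (aut_pow (\<beta> t) (- m) b - aut_pow \<gamma> (- m) b) \<le> \<omega>"
        if "\<bar>n\<bar> < int k" "0 \<le> m" "m < int k" "b \<in> V" "L b \<le> 1 / N_unit n" "norm b \<le> R" for n m b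
      proof -
        have "m \<in> ?M" "n \<in> ?I" "b \<in> {b \<in> V. L b \<le> 1 / N_unit n \<and> norm b \<le> R}" using that by auto
        with 1 show ?thesis by blast
      qed
      show "(1 - \<theta>) * L (aut_pow \<gamma> m b) \<le> L (aut_pow (\<beta> t) m b)" if "0 \<le> m" "m < int k" "b \<in> V" for m b
        using 2 that by auto
      show "\<exists>f\<in>F. norm (cp_el \<gamma> (\<lambda>n. \<eta> n - f n)) \<le> e / 4" if "\<eta> \<in> lip_ball \<gamma> R" for \<eta>
        using bspec[OF F(3) that] .
      show "NL (cp_transfer k (\<beta> t) \<gamma> f) \<le> 1 + \<theta>" if f: "f \<in> F" for f
      proof -
        have "NL (cp_transfer k (\<beta> t) \<gamma> f) \<le> 1 + c * N_box k"
          using 3 f F(2) c by (intro NL_cp_transfer_le[OF \<beta> \<gamma> _ k(1)]) (auto intro: less_imp_le)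
        then show ?thesis using c\<theta> by linarith
      qed
    qed
  qed
qed

end

theorem theorem7p2:
  fixes V :: "'b::unital_cstar_algebra set"
    and L :: "'b \<Rightarrow> real"
    and N :: "(int \<Rightarrow> complex) \<Rightarrow> real"
    and \<beta> :: "'t::t2_space \<Rightarrow> 'b \<Rightarrow> 'b"
  assumes V_subspace: "csubspace V"
    and V_dense: "closure V = UNIV"
    and V_one: "1 \<in> V"
    and V_star: "\<And>\<xi>. \<xi> \<in> V \<Longrightarrow> star \<xi> \<in> V"
    and L_seminorm: "cseminorm_on V L"
    and L_one: "L 1 = 0"
    and L_star: "\<And>\<xi>. \<xi> \<in> V \<Longrightarrow> L (star \<xi>) = L \<xi>"
    and N_norm: "order_preserving_norm N"
    and N_e0: "N (\<lambda>n. if n = 0 then 1 else 0) = 1"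
    and T_compact: "compact (UNIV :: 't set)"
    and \<beta>_aut: "\<And>t. star_automorphism (\<beta> t)"
    and \<beta>_V: "\<And>t. \<beta> t ` V = V \<and> \<beta> t -` V = V"
    and \<beta>_cont: "\<And>b. continuous_on UNIV (\<lambda>t. \<beta> t b)"
    and cond1: "lower_semicontinuous_on V L \<and> cstar_cqms V L"
    and cond2: "\<And>n \<eta>. \<eta> \<in> V \<Longrightarrow> upper_semicontinuous_on UNIV (\<lambda>t. L (aut_pow (\<beta> t) n \<eta>))"
    and cond3: "\<And>n \<epsilon> t0. \<epsilon> > 0 \<Longrightarrow> \<exists>W. open W \<and> t0 \<in> W \<and>
        (\<forall>t\<in>W. \<forall>\<eta>\<in>V. (1 - \<epsilon>) * L (aut_pow (\<beta> t0) n \<eta>) \<le> L (aut_pow (\<beta> t) n \<eta>))"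
  shows "\<And>t0. ((\<lambda>t. dist_q (cp_cqms (\<beta> t) V L N) (cp_cqms (\<beta> t0) V L N)) \<longlongrightarrow> 0) (at t0)"
proof -
  fix t0
  interpret lip_space V L N
    by unfold_locales (use V_subspace V_one V_star L_seminorm L_one L_star N_norm N_e0 cond1 in auto)
  have aut: "aut (\<beta> t)" for t using \<beta>_aut \<beta>_V by (simp add: aut_def)
  have ev: "\<forall>\<^sub>F t in at t0. dist_q (cp_cqms (\<beta> t) V L N) (cp_cqms (\<beta> t0) V L N) \<le> ennreal e" if "e > 0" for e
  proof (rule eventually_dist_q_le[OF aut aut _ _ _ that])
    show "((\<lambda>t. \<beta> t b) \<longlongrightarrow> \<beta> t0 b) (at t0)" for b
      using \<beta>_cont[of b] by (simp add: continuous_on_def)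
    show "\<forall>\<^sub>F t in at t0. L (aut_pow (\<beta> t) n b) < a" if "b \<in> V" "L (aut_pow (\<beta> t0) n b) < a" for n b a
    proof -
      have "open {t. L (aut_pow (\<beta> t) n b) < a}"
        using cond2[OF that(1), of n] by (simp add: upper_semicontinuous_on_def)
      then show ?thesis
        using that(2) eventually_nhds_in_open[of "{t. L (aut_pow (\<beta> t) n b) < a}" t0]
        by (auto simp: eventually_at_filter elim: eventually_mono)
    qed
    show "\<forall>\<^sub>F t in at t0. \<forall>b\<in>V. (1 - \<theta>) * L (aut_pow (\<beta> t0) n b) \<le> L (aut_pow (\<beta> t) n b)"
      if "\<theta> > 0" for n \<theta>
      using cond3[OF that, of t0 n] by (auto simp: eventually_at_topological)
  qed
  show "((\<lambda>t. dist_q (cp_cqms (\<beta> t) V L N) (cp_cqms (\<beta> t0) V L N)) \<longlongrightarrow> 0) (at t0)"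
  proof (rule order_tendstoI)
    fix a :: ennreal assume "0 < a"
    \<comment> \<open>The bound a may be infinite; a finite value strictly below it can be written
      as a real e.\<close>
    then obtain b where b: "0 < b" "b < a" using dense by blast
    then have fin: "b < top" using less_top_ennreal order_less_le_trans top_greatest by blast
    define e where "e = enn2real b"
    have eb: "ennreal e = b" using fin by (simp add: e_def)
    have "e > 0" using b(1) fin by (simp add: e_def enn2real_positive_iff)
    from ev[OF this] show "\<forall>\<^sub>F t in at t0. dist_q (cp_cqms (\<beta> t) V L N) (cp_cqms (\<beta> t0) V L N) < a"
      by (rule eventually_mono) (use b(2) eb in auto)
  qed simp
qed

end
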